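(* Let $W$ be the generator of $H^1\left(\overline{CD}_2(S^1),\mathbb{Z}_2\right)\cong\mathbb{Z}_2$. Then in the cohomology ring $H^*\left(\overline{CD}_2(S^1),\mathbb{Z}_2\right)$ one has $W^2\neq 0$ and $W^3=0$.
   Context: Let $S^1=\mathbb{R}/2\pi\mathbb{Z}$. For $k\ge 1$ let $F(S^1,2k)\subset (S^1)^{2k}$ be the set of sequences $(x_1,\tilde x_1;\dots;x_k,\tilde x_k)$ of $2k$ pairwise distinct points; such a sequence defines the subalgebra $\{f\in C^\infty(S^1,\mathbb{R}): f(x_i)=f(\tilde x_i)\ \forall i\}$. Given an algebraic parametric curve germ $\nu:[0,\varepsilon)\to (S^1)^{2k}$ with $\nu(t)\in F(S^1,2k)$ for $t\in(0,\varepsilon)$, let $\mathcal{F}_t$ be the subalgebra defined by $\nu(t)$, and let $\mathcal{F}_0$ be the set of all $f$ for which there exists a family $f_t$, $t\in[0,\varepsilon)$, continuous in the $C^{2k}$ topology, with $f_0=f$ and $f_t\in\mathcal{F}_t$ for $t>0$. Such $\mathcal{F}_0$ are the equilevel algebras of codimension $k$; their set is $\overline{CD}_k(S^1)$. Topology: for a finite-dimensional subspace $\mathcal{L}\subset C^\infty(S^1,\mathbb{R})$ such that any $(2k-1)$-jets at any $2k$ distinct points are realized by some $f\in\mathcal{L}$, the map $\mathcal{F}\mapsto\mathcal{F}\cap\mathcal{L}$ embeds $\overline{CD}_k(S^1)$ into the Grassmannian $G_{\dim\mathcal{L}-k}(\mathcal{L})$; $\overline{CD}_k(S^1)$ carries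 the induced (compact) topology, independent of $\mathcal{L}$. It is known that $H^1(\overline{CD}_2(S^1),\mathbb{Z}_2)\cong\mathbb{Z}_2$. *)

theory Defs
  imports "HOL-Analysis.Analysis" "HOL-Homology.Homology"
          "HOL-Computational_Algebra.Polynomial"
begin

definition smooth_circ :: "(real \<Rightarrow> real) \<Rightarrow> bool" where
  "smooth_circ f \<longleftrightarrow> (\<forall>x. f (x + 2 * pi) = f x) \<and>
     (\<forall>n x. ((deriv ^^ n) f) differentiable (at x))"

text \<open>Points of S^1 are represented by real lifts; a sequence of 2k points is a
  function nat => real (only indices < 2k matter); x_i = xs (2i), x~_i = xs (2i+1).\<close>

definition config :: "nat \<Rightarrow> (nat \<Rightarrow> real) \<Rightarrow> bool" where
  "config k xs \<longleftrightarrow> (\<forall>i<2*k. \<forall>j<2*k. i \<noteq> j \<longrightarrow>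
      (\<forall>m::int. xs i - xs j \<noteq> 2 * pi * of_int m))"

definition pt_alg :: "nat \<Rightarrow> (nat \<Rightarrow> real) \<Rightarrow> (real \<Rightarrow> real) set" where
  "pt_alg k xs = {f. smooth_circ f \<and> (\<forall>i<k. f (xs (2*i)) = f (xs (2*i+1)))}"

definition alg_germ :: "real \<Rightarrow> (real \<Rightarrow> real) \<Rightarrow> bool" where
  "alg_germ \<epsilon> y \<longleftrightarrow> (\<exists>P :: real poly poly. P \<noteq> 0 \<and>
      (\<forall>t\<in>{0..<\<epsilon>}. poly (map_poly (\<lambda>a. poly a t) P) (y t) = 0))"

text \<open>Algebraic parametric curve germ nu : [0,eps) -> (S^1)^{2k} (given by continuous
  lifts), whose points (cos, sin) of each coordinate are algebraic in t, with
  nu(t) in F(S^1,2k) for 0 < t < eps.\<close>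

definition curve_germ :: "nat \<Rightarrow> real \<Rightarrow> (real \<Rightarrow> nat \<Rightarrow> real) \<Rightarrow> bool" where
  "curve_germ k \<epsilon> \<nu> \<longleftrightarrow> \<epsilon> > 0 \<and>
     (\<forall>i<2*k. continuous_on {0..<\<epsilon>} (\<lambda>t. \<nu> t i) \<and>
              alg_germ \<epsilon> (\<lambda>t. cos (\<nu> t i)) \<and> alg_germ \<epsilon> (\<lambda>t. sin (\<nu> t i))) \<and>
     (\<forall>t\<in>{0<..<\<epsilon>}. config k (\<nu> t))"

definition Cr_continuous :: "nat \<Rightarrow> real \<Rightarrow> (real \<Rightarrow> real \<Rightarrow> real) \<Rightarrow> bool" where
  "Cr_continuous r \<epsilon> fam \<longleftrightarrow> (\<forall>j\<le>r. \<forall>t0\<in>{0..<\<epsilon>}. \<forall>e>0. \<exists>\<delta>>0.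
      \<forall>t\<in>{0..<\<epsilon>}. \<bar>t - t0\<bar> < \<delta> \<longrightarrow>
        (\<forall>x. \<bar>(deriv ^^ j) (fam t) x - (deriv ^^ j) (fam t0) x\<bar> \<le> e))"

definition limit_alg :: "nat \<Rightarrow> real \<Rightarrow> (real \<Rightarrow> nat \<Rightarrow> real) \<Rightarrow> (real \<Rightarrow> real) set" where
  "limit_alg k \<epsilon> \<nu> = {f. smooth_circ f \<and> (\<exists>fam. fam 0 = f \<and> Cr_continuous (2*k) \<epsilon> fam \<and>
        (\<forall>t\<in>{0<..<\<epsilon>}. fam t \<in> pt_alg k (\<nu> t)))}"

definition CDbar :: "nat \<Rightarrow> (real \<Rightarrow> real) set set" where
  "CDbar k = {limit_alg k \<epsilon> \<nu> | \<epsilon> \<nu>. curve_germ k \<epsilon> \<nu>}"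

text \<open>Test space L: trigonometric polynomials of degree <= N. For N >= 2k^2 any
  (2k-1)-jets at 2k distinct points are realized in L (trigonometric Hermite
  interpolation).\<close>

definition trigL :: "nat \<Rightarrow> (real \<Rightarrow> real) set" where
  "trigL N = {f. \<exists>a b. \<forall>x. f x = a 0 + (\<Sum>j\<in>{1..N}. a j * cos (real j * x) + b j * sin (real j * x))}"

definition sup_dist :: "(real \<Rightarrow> real) \<Rightarrow> (real \<Rightarrow> real) \<Rightarrow> real" where
  "sup_dist f g = (SUP x. \<bar>f x - g x\<bar>)"

definition unit_ball_L :: "nat \<Rightarrow> (real \<Rightarrow> real) set \<Rightarrow> (real \<Rightarrow> real) set" where
  "unit_ball_L N F = {f \<in> F \<inter> trigL N. \<forall>x. \<bar>f x\<bar> \<le> 1}"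

text \<open>Metric on subspaces of L (Hausdorff distance of unit balls w.r.t. the sup norm);
  it induces the standard topology of the Grassmannian of L.\<close>

definition grass_dist :: "nat \<Rightarrow> (real \<Rightarrow> real) set \<Rightarrow> (real \<Rightarrow> real) set \<Rightarrow> real" where
  "grass_dist N F G = max
     (SUP f\<in>unit_ball_L N F. INF g\<in>unit_ball_L N G. sup_dist f g)
     (SUP g\<in>unit_ball_L N G. INF f\<in>unit_ball_L N F. sup_dist f g)"

text \<open>Topology on CDbar k induced by F |-> F \<inter> L, L = trigL (2*k^2).\<close>

definition CD_top :: "nat \<Rightarrow> (real \<Rightarrow> real) set topology" where
  "CD_top k = topology (\<lambda>U. U \<subseteq> CDbar k \<and>
     (\<forall>F\<in>U. \<exists>e>0. \<forall>G\<in>CDbar k. grass_dist (2*k^2) F G < e \<longrightarrow> G \<in> U))"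

text \<open>A p-cochain with Z_2 coefficients: a function from singular p-simplices to bool
  (True = 1).\<close>

definition cobdry :: "nat \<Rightarrow> (((nat \<Rightarrow> real) \<Rightarrow> 'a) \<Rightarrow> bool) \<Rightarrow> ((nat \<Rightarrow> real) \<Rightarrow> 'a) \<Rightarrow> bool" where
  "cobdry p c \<sigma> = odd (card {k \<in> {0..Suc p}. c (singular_face (Suc p) k \<sigma>)})"

definition is_cocycle :: "nat \<Rightarrow> 'a topology \<Rightarrow> (((nat \<Rightarrow> real) \<Rightarrow> 'a) \<Rightarrow> bool) \<Rightarrow> bool" where
  "is_cocycle p X c \<longleftrightarrow> (\<forall>\<sigma>. singular_simplex (Suc p) X \<sigma> \<longrightarrow> \<not> cobdry p c \<sigma>)"

text \<open>Coboundary in degree Suc p.\<close>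
definition is_coboundary :: "nat \<Rightarrow> 'a topology \<Rightarrow> (((nat \<Rightarrow> real) \<Rightarrow> 'a) \<Rightarrow> bool) \<Rightarrow> bool" where
  "is_coboundary p X c \<longleftrightarrow> (\<exists>b. \<forall>\<sigma>. singular_simplex (Suc p) X \<sigma> \<longrightarrow> c \<sigma> = cobdry p b \<sigma>)"

definition front_face :: "nat \<Rightarrow> ((nat \<Rightarrow> real) \<Rightarrow> 'a) \<Rightarrow> (nat \<Rightarrow> real) \<Rightarrow> 'a" where
  "front_face p \<sigma> = restrict \<sigma> (standard_simplex p)"

definition back_face :: "nat \<Rightarrow> nat \<Rightarrow> ((nat \<Rightarrow> real) \<Rightarrow> 'a) \<Rightarrow> (nat \<Rightarrow> real) \<Rightarrow> 'a" where
  "back_face p q \<sigma> = restrict (\<sigma> \<circ> (\<lambda>y i. if i < p then 0 else y (i - p))) (standard_simplex q)"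

definition cup :: "nat \<Rightarrow> nat \<Rightarrow> (((nat \<Rightarrow> real) \<Rightarrow> 'a) \<Rightarrow> bool) \<Rightarrow> (((nat \<Rightarrow> real) \<Rightarrow> 'a) \<Rightarrow> bool)
                   \<Rightarrow> ((nat \<Rightarrow> real) \<Rightarrow> 'a) \<Rightarrow> bool" where
  "cup p q \<phi> \<psi> \<sigma> = (\<phi> (front_face p \<sigma>) \<and> \<psi> (back_face p q \<sigma>))"

end

theory Submission
  imports Defs
begin

text \<open>The form \<open>(f, g) \<mapsto> (f a - f b) (g c - g d) - (f c - f d) (g a - g b)\<close> of two chords, suitably normalized, has a
  limit along every algebraic germ. Up to sign the limit form determines the limit algebra and depends
  continuously on it; the two signs form a double cover of the space of equilevel algebras.
  For a point th of the circle let \<open>U th\<close> be the open set of algebras supported away from th whose limit form does not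
  vanish on the pair \<open>(ct, ct\<^sup>2)\<close>, where ct is the cotangent of half the distance to th. Dilations of the
  coordinate ct contract \<open>U th\<close>, so a cocycle has a potential there. Comparing the potentials
  on generic pairs of chords leaves a single invariant in \<open>Z\<^sub>2\<close>, which is nonzero exactly for the class of the double cover.
  Three sections of the double cover without common zero give \<open>W\<^sup>3 = 0\<close> by the Lusternik--Schnirelmann argument. The
  loop which exchanges the two chords of a pair lifts to a nonclosed path of the double cover, and it is a fibre of a Klein bottle
  of pairs of chords glued by reversing this loop. The cup square of a one-dimensional class on a Klein bottle glued in this
  way equals its value on the reversed loop, hence \<open>W\<^sup>2 \<noteq> 0\<close>.\<close>

text \<open>A family of pairs of chords can degenerate in several ways at once: the ends of a chord
  collide, the chords collide, or both. No coordinates are chosen for the resulting limits; the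
  estimates are uniform over all nondegenerate quadruples instead. A chord enters through the sum
  and the product of its ends on the unit circle, and division by \<open>nrm\<close> keeps the form
  on the monomials \<open>E i\<close> bounded under every collision. Two quadruples that are
  compared have at most eight points together. A function that can be interpolated at any eight
  points of the circle by a polynomial of degree 7 with uniformly bounded coefficients may therefore
  replace a monomial. So the table of values on \<open>E 0\<close>, ..., \<open>E 7\<close>, up to
  sign, serves as the coordinate of an algebra: the limits along germs, the Grassmannian topology,
  the nearness of supports and the continuity of dilations are all read off from it. Algebraicity
  enters through the fact that a bounded algebraic germ of a function has a limit. Potentials are
  compared along explicit convex families of chords, on which the difference of two of them is
  constant.\<close>

type_synonym alg = "(real => real) set"
type_synonym germ = "real => nat => real"
type_synonym conf = "nat => real"

abbreviation tendsto0 (infixr "~~>" 55) where "f ~~> l == (f \<longlongrightarrow> l) (at_right (0::real))"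

abbreviation ev0 (binder "EV " 10) where "ev0 P == eventually P (at_right (0::real))"

abbreviation CD_cont where "CD_cont S == continuous_map (top_of_set S) (CD_top 2)"

declare One_nat_def [simp del]

section \<open>Mod 2 counts of faces, and singular simplices reindexed along vertex maps\<close>

lemma odd_card_Suc:
 "odd (card {k \<in> {0..Suc n}. Q k}) \<longleftrightarrow> odd (card {k \<in> {0..n}. Q k}) ~= Q (Suc n)"
proof -
 have "{k \<in> {0..Suc n}. Q k} = (if Q (Suc n) then insert (Suc n) {k \<in> {0..n}. Q k} else {k \<in> {0..n}. Q k})"
  by (auto simp: le_Suc_eq)
 thus ?thesis by simp
qed

lemma odd_card_0: "odd (card {k \<in> {0..0::nat}. Q k}) \<longleftrightarrow> Q 0"
proof -
 have "{k \<in> {0..0::nat}. Q k} = (if Q 0 then {0} else {})" by auto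
 thus ?thesis by simp
qed

lemmas odd_card_simps = odd_card_Suc odd_card_0

text \<open>The composite of \<open>\<sigma>\<close> with the affine map of standard simplices that
  sends vertex \<open>i\<close> to vertex \<open>f i\<close>. Since \<open>f\<close> may repeat or
  permute vertices, one construction covers faces, front and back faces, edges in either direction
  and constant edges.\<close>

definition sub_simplex :: "(conf => 'a) => (nat => nat) => nat => conf => 'a" where
 "sub_simplex \<sigma> f q = restrict (%x. \<sigma> (%l. \<Sum>i\<le>q. if f i = l then x i else 0)) (standard_simplex q)"

lemma sub_simplex_point:
 assumes "!!i. i <= q ==> f i <= p" "x \<in> standard_simplex q"
 shows "(%l. \<Sum>i\<le>q. if f i = l then x i else 0) \<in> standard_simplex p"
proof -
 have x: "!!i. 0 <= x i" "sum x {..q} = 1" using assms(2) by (auto simp: standard_simplex_def)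
 have nn: "0 <= (\<Sum>i\<le>q. if f i = l then x i else 0)" for l by (intro sum_nonneg) (auto simp: x)
 have "(\<Sum>i\<le>q. if f i = l then x i else 0) <= (\<Sum>i\<le>q. x i)" for l by (intro sum_mono) (auto simp: x)
 moreover have "(\<Sum>i\<le>q. if f i = l then x i else 0) = 0" if "l > p" for l
  using that assms(1) by (intro sum.neutral) fastforce
 moreover have "(\<Sum>l\<le>p. \<Sum>i\<le>q. if f i = l then x i else 0) = 1"
 proof -
  have "(\<Sum>l\<le>p. \<Sum>i\<le>q. if f i = l then x i else 0) = (\<Sum>i\<le>q. \<Sum>l\<le>p. if f i = l then x i else 0)"
   by (rule sum.swap)
  also have "... = (\<Sum>i\<le>q. x i)" by (intro sum.cong refl) (use assms(1) in \<open>auto simp: sum.delta'\<close>)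
  finally show ?thesis using x by simp
 qed
 ultimately show ?thesis using nn x by (auto simp: standard_simplex_def)
qed

lemma singular_simplex_sub_simplex:
 assumes "singular_simplex p X \<sigma>" "!!i. i <= q ==> f i <= p"
 shows "singular_simplex q X (sub_simplex \<sigma> f q)"
proof -
 let ?PT = "powertop_real UNIV"
 let ?g = "%x l. \<Sum>i\<le>q. if f i = l then x i else (0::real)"
 have "continuous_map ?PT euclideanreal (%x. \<Sum>i\<le>q. if f i = l then x i else 0)" for l
  by (intro continuous_map_sum) (auto intro: continuous_map_product_projection)
 hence "continuous_map (subtopology ?PT (standard_simplex q)) (subtopology ?PT (standard_simplex p)) ?g"
  by (auto simp: continuous_map_in_subtopology continuous_map_componentwise sub_simplex_point assms(2)
    intro: continuous_map_from_subtopology)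
 from continuous_map_compose[OF this] assms(1)
 have "continuous_map (subtopology ?PT (standard_simplex q)) X (\<sigma> \<circ> ?g)" by (auto simp: singular_simplex_def)
 thus ?thesis
  unfolding singular_simplex_def sub_simplex_def by (auto intro: continuous_map_eq)
qed

lemma sub_simplex_sub_simplex:
 assumes "!!i. i <= r ==> g i <= q"
 shows "sub_simplex (sub_simplex \<sigma> f q) g r = sub_simplex \<sigma> (f \<circ> g) r"
proof -
 have "(\<Sum>i\<le>q. if f i = l then \<Sum>j\<le>r. if g j = i then x j else 0 else 0) =
    (\<Sum>j\<le>r. if f (g j) = l then x j else (0::real))" for x l
 proof -
  have "(\<Sum>i\<le>q. if f i = l then \<Sum>j\<le>r. if g j = i then x j else 0 else 0) =
     (\<Sum>i\<le>q. \<Sum>j\<le>r. if g j = i then (if f i = l then x j else 0) else 0)"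
   by (intro sum.cong refl) (simp add: sum.neutral cong: if_cong)
  also have "... = (\<Sum>j\<le>r. \<Sum>i\<le>q. if g j = i then (if f i = l then x j else 0) else 0)" by (rule sum.swap)
  also have "... = (\<Sum>j\<le>r. if f (g j) = l then x j else 0)"
   by (intro sum.cong refl) (use assms in \<open>auto simp: sum.delta'\<close>)
  finally show ?thesis .
 qed
 thus ?thesis
  unfolding sub_simplex_def using sub_simplex_point[OF assms] by (auto simp: fun_eq_iff restrict_def)
qed

lemma simplex_above: "x \<in> standard_simplex p ==> i > p ==> x i = 0" by (auto simp: standard_simplex_def)

lemma singular_face_eq_sub_simplex:
 "singular_face (Suc p) k \<sigma> = sub_simplex \<sigma> (%i. if i < k then i else Suc i) p"
proof -
 have "simplical_face k x = (%l. \<Sum>i\<le>p. if (if i < k then i else Suc i) = l then x i else 0)"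
  if x: "x \<in> standard_simplex p" for x
 proof
  fix l
  have *: "((if i < k then i else Suc i) = l) = (l ~= k & i = (if l < k then l else l - 1))" for i by auto
  have "(\<Sum>i\<le>p. if (if i < k then i else Suc i) = l then x i else 0) =
   (\<Sum>i\<le>p. if i = (if l < k then l else l - 1) then (if l ~= k then x i else 0) else 0)"
   by (intro sum.cong refl) (simp add: *)
  also have "... = simplical_face k x l"
   using x by (auto simp: simplical_face_def sum.delta simplex_above)
  finally show "simplical_face k x l = (\<Sum>i\<le>p. if (if i < k then i else Suc i) = l then x i else 0)" by simp
 qed
 thus ?thesis unfolding singular_face_def sub_simplex_def o_def diff_Suc_Suc diff_zero by (intro restrict_ext) simp
qed

lemma front_face_eq_sub_simplex: "front_face p \<sigma> = sub_simplex \<sigma> (%i. i) p"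
proof -
 have "x = (%l. \<Sum>i\<le>p. if i = l then x i else 0)" if "x \<in> standard_simplex p" for x
  using that by (auto simp: fun_eq_iff sum.delta simplex_above)
 thus ?thesis by (auto simp: front_face_def sub_simplex_def fun_eq_iff restrict_def)
qed

lemma back_face_eq_sub_simplex: "back_face p q \<sigma> = sub_simplex \<sigma> (%i. i + p) q"
proof -
 have "(%l. if l < p then 0 else x (l - p)) = (%l. \<Sum>i\<le>q. if i + p = l then x i else 0)"
  if x: "x \<in> standard_simplex q" for x
 proof
  fix l
  have "(\<Sum>i\<le>q. if i + p = l then x i else 0) = (\<Sum>i\<le>q. if i = l - p then (if l < p then 0 else x i) else 0)"
   by (intro sum.cong refl) auto
  thus "(if l < p then 0 else x (l - p)) = (\<Sum>i\<le>q. if i + p = l then x i else 0)"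
   using x by (auto simp: sum.delta simplex_above)
 qed
 thus ?thesis by (auto simp: back_face_def sub_simplex_def fun_eq_iff restrict_def)
qed

definition vertex :: "(conf => 'a) => nat => 'a" where
 "vertex \<sigma> i = \<sigma> (%j. if j = i then 1 else 0)"

definition edge :: "(conf => 'a) => nat => nat => conf => 'a" where
 "edge \<sigma> i j = sub_simplex \<sigma> (%k. if k = 0 then i else j) 1"

lemma vertex_sub_simplex: "i <= q ==> vertex (sub_simplex \<sigma> f q) i = vertex \<sigma> (f i)"
proof -
 assume "i <= q"
 hence "(\<Sum>k\<le>q. if f k = l then if k = i then 1 else 0 else 0) = (if l = f i then 1 else (0::real))" for l
  by (subst sum.cong[OF refl, of _ _ "%k. if k = i then if f i = l then 1 else 0 else 0"]) (auto simp: sum.delta)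
 thus ?thesis using \<open>i <= q\<close> by (simp add: vertex_def sub_simplex_def)
qed

lemma edge_sub_simplex: "i <= q ==> j <= q ==> edge (sub_simplex \<sigma> f q) i j = edge \<sigma> (f i) (f j)"
 by (simp add: edge_def sub_simplex_sub_simplex o_def if_distrib)

lemma vertex_edge: "vertex (edge \<sigma> i j) 0 = vertex \<sigma> i" "vertex (edge \<sigma> i j) 1 = vertex \<sigma> j"
 by (simp_all add: edge_def vertex_sub_simplex)

lemma singular_simplex_edge:
 "singular_simplex p X \<sigma> ==> i <= p ==> j <= p ==> singular_simplex 1 X (edge \<sigma> i j)"
 unfolding edge_def by (rule singular_simplex_sub_simplex) auto

lemma sub_simplex_1: "sub_simplex \<sigma> f 1 = edge \<sigma> (f 0) (f 1)"
proof -
 have "sub_simplex \<sigma> f 1 = sub_simplex \<sigma> (%k. if k = 0 then f 0 else f 1) 1"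
  unfolding sub_simplex_def by (intro restrict_ext arg_cong[of _ _ \<sigma>] ext sum.cong refl) (auto simp: le_Suc_eq One_nat_def)
 thus ?thesis by (simp add: edge_def)
qed

definition point_simplex :: "'a => conf => 'a" where
 "point_simplex x = restrict (%_. x) (standard_simplex 0)"

lemma sub_simplex_0: "sub_simplex \<sigma> f 0 = point_simplex (vertex \<sigma> (f 0))"
proof -
 have "(%l. \<Sum>i\<le>0. if f i = l then x i else 0) = (%j. if j = f 0 then 1 else (0::real))"
  if "x \<in> standard_simplex 0" for x
  using that by (auto simp: standard_simplex_0)
 thus ?thesis unfolding sub_simplex_def point_simplex_def vertex_def by (intro restrict_ext) simp
qed

lemma cobdry_0: "cobdry 0 b \<sigma> \<longleftrightarrow> b (point_simplex (vertex \<sigma> 0)) ~= b (point_simplex (vertex \<sigma> 1))"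
proof -
 have "cobdry 0 b \<sigma> \<longleftrightarrow> odd (card {k \<in> {0..Suc 0}. b (singular_face (Suc 0) k \<sigma>)})"
  by (simp add: cobdry_def)
 thus ?thesis unfolding odd_card_simps singular_face_eq_sub_simplex sub_simplex_0 by (auto simp: One_nat_def)
qed

lemma cobdry_1: "cobdry 1 b \<sigma> \<longleftrightarrow> (b (edge \<sigma> 1 2) ~= b (edge \<sigma> 0 2)) ~= b (edge \<sigma> 0 1)"
proof -
 have "cobdry 1 b \<sigma> \<longleftrightarrow> odd (card {k \<in> {0..Suc (Suc 0)}. b (singular_face (Suc 1) k \<sigma>)})"
  by (simp add: cobdry_def One_nat_def)
 thus ?thesis unfolding odd_card_simps singular_face_eq_sub_simplex sub_simplex_1 by (auto simp: numeral_2_eq_2 One_nat_def)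
qed

text \<open>A 0-simplex is determined by its point, so 0-cochains are functions on points. All
  potentials are handled in this form.\<close>

lemma is_coboundary_0_iff:
 "is_coboundary 0 X W \<longleftrightarrow> (\<exists>\<beta> :: 'a => bool. \<forall>\<sigma>. singular_simplex 1 X \<sigma> --> W \<sigma> = (\<beta> (vertex \<sigma> 0) ~= \<beta> (vertex \<sigma> 1)))"
 for X :: "'a topology"
proof
 assume "is_coboundary 0 X W"
 then obtain b where b: "\<forall>\<sigma>. singular_simplex 1 X \<sigma> --> W \<sigma> = cobdry 0 b \<sigma>"
  unfolding is_coboundary_def One_nat_def by blast
 define \<beta> where "\<beta> = (%x. b (point_simplex x))"
 have "\<forall>\<sigma>. singular_simplex 1 X \<sigma> --> W \<sigma> = (\<beta> (vertex \<sigma> 0) ~= \<beta> (vertex \<sigma> 1))"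
  using b by (simp add: cobdry_0 \<beta>_def)
 thus "\<exists>\<beta> :: 'a => bool. \<forall>\<sigma>. singular_simplex 1 X \<sigma> --> W \<sigma> = (\<beta> (vertex \<sigma> 0) ~= \<beta> (vertex \<sigma> 1))"
  by - (rule exI[of _ \<beta>])
next
 assume "\<exists>\<beta> :: 'a => bool. \<forall>\<sigma>. singular_simplex 1 X \<sigma> --> W \<sigma> = (\<beta> (vertex \<sigma> 0) ~= \<beta> (vertex \<sigma> 1))"
 then obtain \<beta> :: "'a => bool" where \<beta>: "\<forall>\<sigma>. singular_simplex 1 X \<sigma> --> W \<sigma> = (\<beta> (vertex \<sigma> 0) ~= \<beta> (vertex \<sigma> 1))" by blast
 have "point_simplex x (%j. if j = 0 then 1 else 0) = x" for x :: 'a by (simp add: point_simplex_def)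
 hence "\<forall>\<sigma>. singular_simplex 1 X \<sigma> --> W \<sigma> = cobdry 0 (%\<tau>. \<beta> (\<tau> (%j. if j = 0 then 1 else 0))) \<sigma>"
  using \<beta> by (simp add: cobdry_0)
 thus "is_coboundary 0 X W" unfolding is_coboundary_def One_nat_def[symmetric] by blast
qed

text \<open>The reindexed 2-simplex on the vertices \<open>i\<close>, \<open>j\<close>,
  \<open>k\<close> exists for any choice of indices, repeated or unordered; the cocycle condition on
  it makes \<open>W\<close> additive along every chain of edges.\<close>

lemma cocycle_triangle:
 assumes "is_cocycle 1 X W" "singular_simplex p X \<sigma>" "i <= p" "j <= p" "k <= p"
 shows "W (edge \<sigma> i k) \<longleftrightarrow> W (edge \<sigma> i j) ~= W (edge \<sigma> j k)"
proof -
 let ?f = "%n. if n = 0 then i else if n = 1 then j else k"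
 have "singular_simplex (Suc 1) X (sub_simplex \<sigma> ?f 2)"
  using singular_simplex_sub_simplex[OF assms(2), of 2 ?f] assms by (simp add: numeral_2_eq_2)
 hence "\<not> cobdry 1 W (sub_simplex \<sigma> ?f 2)" using assms(1) by (auto simp: is_cocycle_def)
 moreover have "edge (sub_simplex \<sigma> ?f 2) 0 1 = edge \<sigma> i j" "edge (sub_simplex \<sigma> ?f 2) 1 2 = edge \<sigma> j k"
   "edge (sub_simplex \<sigma> ?f 2) 0 2 = edge \<sigma> i k" by (simp_all add: edge_sub_simplex)
 ultimately show ?thesis by (auto simp: cobdry_1)
qed

subsection \<open>Cocycles vanishing on small simplices\<close>

lemma add_telescope:
 fixes a b c d s t u :: "'a::ab_group_add"
 assumes "b + d = u - t" "a + c = t - s"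
 shows "(a + b) + (c + d) = u - s"
proof -
 have "(a + b) + (c + d) = (a + c) + (b + d)" by (simp add: ac_simps)
 thus ?thesis using assms by simp
qed

text \<open>Iterated barycentric subdivision is chain homotopic to the identity, and after enough
  subdivisions every simplex of a chain lies in a member of the cover, where \<open>C\<close>
  vanishes. The parity of \<open>C\<close> on the homotopy applied to a simplex is then the required
  cochain.\<close>

lemma small_cocycle_coboundary:
 assumes coc: "is_cocycle (Suc p) X C"
  and opn: "!!U. U \<in> \<U> ==> openin X U" and cov: "topspace X \<subseteq> \<Union>\<U>"
  and small: "!!\<sigma> V. singular_simplex (Suc p) X \<sigma> ==> V \<in> \<U> ==> \<sigma> \<in> standard_simplex (Suc p) \<rightarrow> V ==> \<not> C \<sigma>"
 shows "is_coboundary p X C"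
proof -
 \<comment> \<open>\<open>E\<close> counts with multiplicity the simplices of an integral chain on
   which \<open>C\<close> holds; its parity is the linear extension of \<open>C\<close>.\<close>
 define E :: "'a chain => int" where
  "E c = Poly_Mapping.lookup (frag_extend (%\<sigma>. if C \<sigma> then frag_of () else 0) c) ()" for c
 have E0[simp]: "E 0 = 0" by (simp add: E_def)
 have Eadd: "E (c + d) = E c + E d" for c d by (simp add: E_def frag_extend_add lookup_add)
 have Ediff: "E (c - d) = E c - E d" for c d by (simp add: E_def frag_extend_diff lookup_minus)
 have Ecmul: "E (frag_cmul n c) = n * E c" for n c by (simp add: E_def frag_extend_cmul)
 have Esum: "E (sum f I) = (\<Sum>i\<in>I. E (f i))" if "finite I" for f :: "nat => 'a chain" and I
  using that by (induction I rule: finite_induct) (simp_all add: Eadd)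
 have Eof: "E (frag_of \<sigma>) = of_bool (C \<sigma>)" for \<sigma> by (simp add: E_def)
 have Evan: "E c = 0" if "!!f. f \<in> Poly_Mapping.keys c ==> \<not> C f" for c
 proof -
  have "frag_extend (%\<sigma>. if C \<sigma> then frag_of () else 0) c = 0"
   unfolding frag_extend_def using that by (intro sum.neutral) auto
  thus ?thesis by (simp add: E_def)
 qed
 have odd_alt: "odd (\<Sum>k\<le>n. (-1) ^ k * e k) \<longleftrightarrow> odd (card {k \<in> {0..n}. odd (e k)})" for n and e :: "nat => int"
  proof (induction n)
  case (Suc n)
  thus ?case unfolding odd_card_Suc sum.atMost_Suc by simp
 qed (unfold odd_card_0, simp)
 have face: "singular_simplex n X (singular_face (Suc n) k \<sigma>)"
  if "singular_simplex (Suc n) X \<sigma>" "k <= Suc n" for n k \<sigma>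
  using singular_simplex_singular_face[OF that(1) _ that(2)] by simp
 have Ebd: "even (E (chain_boundary (Suc (Suc p)) c))" if "singular_chain (Suc (Suc p)) X c" for c
  using that[unfolded singular_chain_def]
 proof (induction c rule: frag_induction)
  case (one \<sigma>)
  hence "\<not> cobdry (Suc p) C \<sigma>" using coc by (auto simp: is_cocycle_def)
  hence "\<not> odd (\<Sum>k\<le>Suc (Suc p). (-1) ^ k * E (frag_of (singular_face (Suc (Suc p)) k \<sigma>)))"
   unfolding odd_alt by (simp add: Eof cobdry_def)
  thus ?case unfolding chain_boundary_of by (simp add: Esum Ecmul del: sum.atMost_Suc)
 qed (auto simp: chain_boundary_diff Ediff)
 obtain h where h0: "!!p. h p 0 = (0 :: 'a chain)"
  and hd: "!!p c1 c2. h p (c1 - c2) = h p c1 - h p c2"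
  and hs: "!!p X c. singular_chain p X c ==> singular_chain (Suc p) X (h p c)"
  and hb: "!!p X c. singular_chain p X c
   ==> chain_boundary (Suc p) (h p c) + h (p - Suc 0) (chain_boundary p c) = singular_subdivision p c - c"
  using chain_homotopic_singular_subdivision by blast
 let ?sd = "%q i. (singular_subdivision q ^^ i)"
 define D where "D q n c = (\<Sum>i<n. h q (?sd q i c))" for q n and c :: "'a chain"
 have hadd: "h q (c1 + c2) = h q c1 + h q c2" for q c1 c2
  using hd[of q "c1" "0 - c2"] hd[of q 0 c2] by (simp add: h0)
 have sdc: "singular_chain q Y (?sd q i c)" if "singular_chain q Y c" for q i c and Y :: "'a topology"
  by (induction i) (auto simp: singular_chain_singular_subdivision that)
 have sdb: "chain_boundary (Suc q) (?sd (Suc q) i c) = ?sd q i (chain_boundary (Suc q) c)"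
  if "singular_chain (Suc q) X c" for q i c
 proof (induction i)
  case (Suc i)
  have "chain_boundary (Suc q) (?sd (Suc q) (Suc i) c) =
     chain_boundary (Suc q) (singular_subdivision (Suc q) (?sd (Suc q) i c))" by simp
  also have "... = singular_subdivision q (chain_boundary (Suc q) (?sd (Suc q) i c))"
   using chain_boundary_singular_subdivision[OF sdc[OF that]] by simp
  finally show ?case using Suc by simp
 qed simp
 have Dbd: "chain_boundary (Suc (Suc q)) (D (Suc q) n c) + D q n (chain_boundary (Suc q) c) = ?sd (Suc q) n c - c"
  if "singular_chain (Suc q) X c" for q n c
 proof (induction n)
  case (Suc n)
  have "chain_boundary (Suc (Suc q)) (h (Suc q) (?sd (Suc q) n c)) + h q (?sd q n (chain_boundary (Suc q) c))
    = ?sd (Suc q) (Suc n) c - ?sd (Suc q) n c"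
   using hb[OF sdc[OF that, of n]] sdb[OF that, of n] by simp
  moreover have "D q' (Suc n) d = D q' n d + h q' (?sd q' n d)" for q' d by (simp add: D_def)
  moreover have "chain_boundary (Suc (Suc q)) (D (Suc q) n c + h (Suc q) (?sd (Suc q) n c)) =
   chain_boundary (Suc (Suc q)) (D (Suc q) n c) + chain_boundary (Suc (Suc q)) (h (Suc q) (?sd (Suc q) n c))"
   by (rule chain_boundary_add)
  ultimately show ?case using Suc by (simp only: funpow.simps(2) o_apply add_telescope)
 qed (simp add: D_def)
 have Ddiff: "D q n (c - d) = D q n c - D q n d" for q n c d by (simp add: D_def singular_subdivision_power_diff hd sum_subtractf)
 have D0: "D q n 0 = 0" for q n by (simp add: D_def h0)
 have Dadd: "D q n (c + d) = D q n c + D q n d" for q n c d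
  using Ddiff[of q n c "0 - d"] Ddiff[of q n 0 d] by (simp add: D0)
 have Dsum: "D q n (sum f I) = (\<Sum>i\<in>I. D q n (f i))" if "finite I" for q n and f :: "nat => 'a chain" and I
  using that by (induction I rule: finite_induct) (simp_all add: Dadd D0)
 have Dsg: "D q n (frag_cmul ((-1) ^ k) c) = frag_cmul ((-1) ^ k) (D q n c)" for q n k c
  using Ddiff[of q n 0 c] by (cases "even k") (simp_all add: D0)
 define sm where "sm q = {\<tau>. singular_simplex q X \<tau> & (\<exists>V\<in>\<U>. \<tau> \<in> standard_simplex q \<rightarrow> V)}" for q
 \<comment> \<open>The homotopy \<open>h\<close> is natural in the space: applied to a simplex in
   \<open>V\<close> it gives a chain in \<open>V\<close>, so small simplices contribute
   nothing.\<close>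
 have Ehsm: "E (h p c) = 0" if "Poly_Mapping.keys c \<subseteq> sm p" for c
  using that
 proof (induction c rule: frag_induction)
  case (one \<tau>)
  then obtain V where V: "V \<in> \<U>" "singular_simplex p (subtopology X V) \<tau>"
   by (auto simp: sm_def singular_simplex_subtopology)
  hence "singular_chain (Suc p) (subtopology X V) (h p (frag_of \<tau>))" by (intro hs) (simp add: singular_chain_of)
  thus ?case using small[OF _ V(1)] by (intro Evan) (auto simp: singular_chain_def singular_simplex_subtopology image_subset_iff)
 qed (auto simp: hd Ediff h0)
 have "\<exists>n. \<forall>m\<ge>n. Poly_Mapping.keys (?sd q m c) \<subseteq> sm q" if qc: "singular_chain q X c" for q c
 proof -
  obtain n where "!!m f. n <= m ==> f \<in> Poly_Mapping.keys (?sd q m c) ==> \<exists>V \<in> \<U>. f \<in> (standard_simplex q) \<rightarrow> V"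
   using sufficient_iterated_singular_subdivision_exists[of \<U>, OF opn cov qc] by blast
  thus ?thesis using sdc[OF qc] unfolding sm_def singular_chain_def by blast
 qed
 then obtain m where m: "!!q c n. singular_chain q X c ==> n \<ge> m q c ==> Poly_Mapping.keys (?sd q n c) \<subseteq> sm q"
  by metis
 \<comment> \<open>The number of subdivisions differs from simplex to simplex. Further subdivisions
   do not change the value, so the faces of one simplex can be compared at a common
   \<open>N\<close>.\<close>
 define b where "b \<tau> = odd (E (D p (m p (frag_of \<tau>)) (frag_of \<tau>)))" for \<tau>
 have stab: "E (D p n (frag_of \<tau>)) = E (D p (m p (frag_of \<tau>)) (frag_of \<tau>))"
  if "singular_simplex p X \<tau>" "n \<ge> m p (frag_of \<tau>)" for n \<tau>
  using that(2)
 proof (induction n rule: dec_induct)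
  case (step n)
  have "E (h p (?sd p n (frag_of \<tau>))) = 0"
   using m[of p "frag_of \<tau>" n] that(1) step by (intro Ehsm) (auto simp: singular_chain_of)
  thus ?case using step by (simp add: D_def Eadd)
 qed simp
 have "C \<sigma> = cobdry p b \<sigma>" if \<sigma>: "singular_simplex (Suc p) X \<sigma>" for \<sigma>
 proof -
  let ?F = "%k. frag_of (singular_face (Suc p) k \<sigma>)"
  define N where "N = m (Suc p) (frag_of \<sigma>) + (\<Sum>k\<le>Suc p. m p (?F k))"
  have N: "N \<ge> m (Suc p) (frag_of \<sigma>)" "!!k. k <= Suc p ==> N \<ge> m p (?F k)"
   unfolding N_def by (auto intro!: trans_le_add2 member_le_sum[of _ "{..Suc p}" "%k. m p (?F k)"] simp del: sum.atMost_Suc)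
  have sc: "singular_chain (Suc p) X (frag_of \<sigma>)" using \<sigma> by (simp add: singular_chain_of)
  have "singular_chain (Suc (Suc q)) X (D (Suc q) n c)" if "singular_chain (Suc q) X c" for q n c
   unfolding D_def using that by (intro singular_chain_sum hs sdc)
  hence ev: "even (E (chain_boundary (Suc (Suc p)) (D (Suc p) N (frag_of \<sigma>))))"
   using Ebd sc by blast
  have "E (?sd (Suc p) N (frag_of \<sigma>)) = 0"
   using m[OF sc N(1)] small by (intro Evan) (auto simp: sm_def)
  hence "odd (E (frag_of \<sigma>)) \<longleftrightarrow> odd (E (D p N (chain_boundary (Suc p) (frag_of \<sigma>))))"
   using arg_cong[OF Dbd[OF sc, of N], of E] ev by (simp add: Eadd Ediff) presburger
  also have "D p N (chain_boundary (Suc p) (frag_of \<sigma>)) = (\<Sum>k\<le>Suc p. frag_cmul ((-1) ^ k) (D p N (?F k)))"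
   by (simp add: chain_boundary_of Dsum Dsg del: sum.atMost_Suc)
  also have "E ... = (\<Sum>k\<le>Suc p. (-1) ^ k * E (D p N (?F k)))" by (simp add: Esum Ecmul del: sum.atMost_Suc)
  also have "... = (\<Sum>k\<le>Suc p. (-1) ^ k * E (D p (m p (?F k)) (?F k)))"
   by (intro sum.cong refl arg_cong2[of _ _ _ _ "(*)"] stab face[OF \<sigma>] N(2)) auto
  also have "odd ... \<longleftrightarrow> cobdry p b \<sigma>" unfolding odd_alt by (simp add: cobdry_def b_def)
  finally show ?thesis by (simp add: Eof)
 qed
 thus ?thesis by (auto simp: is_coboundary_def)
qed

section \<open>The cube of a class that splits over three open sets\<close>

lemma xor_triangle: "(w::bool) = (u ~= v) ==> (w ~= ((a::bool) ~= c)) = ((u ~= (a ~= b)) ~= (v ~= (b ~= c)))"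
 by (cases a; cases b; cases c; auto)

lemma xor_interchange: "((a ~= b) ~= (c ~= (d::bool))) = ((a ~= c) ~= (b ~= d))" by (cases a; cases b; cases c; simp)

lemma xor_interchange4:
 fixes s0 s1 s2 s3 r0 r1 r2 r3 :: bool
 shows "((((s0 ~= r0) ~= (s1 ~= r1)) ~= (s2 ~= r2)) ~= (s3 ~= (r3::bool))) =
 ((((s0 ~= s1) ~= s2) ~= s3) ~= (((r0 ~= r1) ~= r2) ~= r3))"
 by (simp only: xor_interchange[of s0 r0 s1 r1] xor_interchange[of "s0 ~= s1" "r0 ~= r1" s2 r2]
   xor_interchange[of "(s0 ~= s1) ~= s2" "(r0 ~= r1) ~= r2" s3 r3])

text \<open>The Leibniz rule in Z_2. The factors of the product of \<open>w01\<close>,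
  \<open>w12\<close>, \<open>w23\<close> are exchanged for \<open>v0\<close>, \<open>v1\<close>,
  \<open>v2\<close> one after another, and each exchange costs the coboundary of a product that
  contains one of the functions \<open>a\<close>, \<open>b\<close>, \<open>d\<close>.\<close>

lemma cup_cube_bool:
 fixes w01 w12 w23 :: bool
 assumes "(((c0 ~= c1) ~= c2) ~= c3) = (v0 & v1 & v2)"
  and "w02 = (w01 ~= w12)" "w13 = (w12 ~= w23)" "x02 = (x01 ~= v1)" "y13 = (y12 ~= v2)"
  and "v0 = (w01 ~= (a0 ~= a1))" "v1 = (w12 ~= (b1 ~= b2))" "v2 = (w23 ~= (d2 ~= d3))"
 shows "(w01 & w12 & w23) =
  (((((((c0 ~= (a1 & v1 & v2)) ~= (w12 & b2 & v2)) ~= (w12 & w23 & d3)) ~=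
  (((c1 ~= (a0 & x02 & v2)) ~= (w02 & b2 & v2)) ~= (w02 & w23 & d3)))) ~=
  (((c2 ~= (a0 & x01 & y13)) ~= (w01 & b1 & y13)) ~= (w01 & w13 & d3))) ~=
  (((c3 ~= (a0 & x01 & y12)) ~= (w01 & b1 & y12)) ~= (w01 & w12 & d2)))"
proof -
 have P: "((((a1 & v1 & v2) ~= (a0 & x02 & v2)) ~= (a0 & x01 & y13)) ~= (a0 & x01 & y12)) = ((a0 ~= a1) & v1 & v2)"
  unfolding assms(4,5) by (cases a0; cases a1; cases x01; cases v1; cases v2; simp)
 have Q: "((((w12 & b2 & v2) ~= (w02 & b2 & v2)) ~= (w01 & b1 & y13)) ~= (w01 & b1 & y12)) = (w01 & (b1 ~= b2) & v2)"
  unfolding assms(2,5) by (cases w01; cases w12; cases b1; cases b2; cases v2; simp)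
 have R: "((((w12 & w23 & d3) ~= (w02 & w23 & d3)) ~= (w01 & w13 & d3)) ~= (w01 & w12 & d2)) = (w01 & w12 & (d2 ~= d3))"
  unfolding assms(2,3) by (cases w01; cases w12; cases w23; cases d2; cases d3; simp)
 have D: "a = (b ~= c) ==> c = (a ~= b)" for a b c :: bool by auto
 show ?thesis unfolding xor_interchange4 assms(1) P Q R D[OF assms(6)] D[OF assms(7)] D[OF assms(8)]
  by (cases w01; cases w12; cases w23; cases v0; cases v1; cases v2; simp)
qed

text \<open>The cocycle \<open>V i\<close>, which is \<open>W\<close> plus the coboundary of
  \<open>\<beta> i\<close>, is cohomologous to \<open>W\<close> and vanishes on simplices inside
  \<open>U i\<close>. The product of the three vanishes on every simplex inside one of the sets,
  hence is a coboundary by subdivision.\<close>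

theorem cup_cube_coboundary:
 assumes W: "is_cocycle 1 X W"
  and U: "!!i. i < (3::nat) ==> openin X (U i)" "topspace X \<subseteq> U 0 \<union> U 1 \<union> U 2"
  and \<beta>: "!!i \<sigma>. i < (3::nat) ==> singular_simplex 1 X \<sigma> ==> \<sigma> \<in> standard_simplex 1 \<rightarrow> U i
    ==> W \<sigma> \<longleftrightarrow> (\<beta> i (vertex \<sigma> 0) :: bool) ~= \<beta> i (vertex \<sigma> 1)"
 shows "is_coboundary 2 X (cup 2 1 (cup 1 1 W W) W)"
proof -
 define V where "V i \<sigma> = (W \<sigma> ~= (\<beta> i (vertex \<sigma> 0) ~= \<beta> i (vertex \<sigma> 1)))" for i \<sigma>
 have tri: "V i (edge \<sigma> a c) = (V i (edge \<sigma> a b) ~= V i (edge \<sigma> b c))"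
  if "singular_simplex p X \<sigma>" "a <= p" "b <= p" "c <= p" for i p \<sigma> a b c
  using cocycle_triangle[OF W that] unfolding V_def vertex_edge by (rule xor_triangle)
 define C where "C \<sigma> = (V 0 (edge \<sigma> 0 1) & V 1 (edge \<sigma> 1 2) & V 2 (edge \<sigma> 2 3))" for \<sigma>
 have "is_cocycle (Suc 2) X C"
  unfolding is_cocycle_def
 proof (intro allI impI)
  fix \<sigma> assume s: "singular_simplex (Suc (Suc 2)) X \<sigma>"
  note t = tri[OF s]
  have "V 0 (edge \<sigma> 0 2) = (V 0 (edge \<sigma> 0 1) ~= V 0 (edge \<sigma> 1 2))"
    "V 1 (edge \<sigma> 1 3) = (V 1 (edge \<sigma> 1 2) ~= V 1 (edge \<sigma> 2 3))"
    "V 2 (edge \<sigma> 2 4) = (V 2 (edge \<sigma> 2 3) ~= V 2 (edge \<sigma> 3 4))" by (rule t; simp)+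
  hence "\<not> odd (card {k \<in> {0..Suc (Suc (Suc (Suc 0)))}. C (singular_face (Suc 3) k \<sigma>)})"
   unfolding odd_card_simps singular_face_eq_sub_simplex C_def
   apply (simp add: edge_sub_simplex)
   apply (simp only: One_nat_def[symmetric])
   by (cases "V 0 (edge \<sigma> 0 1)"; cases "V 0 (edge \<sigma> 1 2)"; cases "V 1 (edge \<sigma> 1 2)"; cases "V 1 (edge \<sigma> 2 3)";
     cases "V 2 (edge \<sigma> 2 3)"; simp)
  thus "\<not> cobdry (Suc 2) C \<sigma>" by (simp add: cobdry_def numeral_eq_Suc)
 qed
 moreover have "\<not> C \<sigma>" if s: "singular_simplex (Suc 2) X \<sigma>" and i: "i < 3" and im: "\<sigma> \<in> standard_simplex (Suc 2) \<rightarrow> U i" for \<sigma> i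
 proof -
  have "\<not> V i (edge \<sigma> a b)" if "a <= 3" "b <= 3" for a b
  proof -
   have "edge \<sigma> a b \<in> standard_simplex 1 \<rightarrow> U i"
    unfolding edge_def sub_simplex_def
    using im sub_simplex_point[of 1 "%k. if k = 0 then a else b" "Suc 2"] that by (auto simp: Pi_iff)
   moreover have "singular_simplex 1 X (edge \<sigma> a b)"
    using singular_simplex_edge[OF s] that by simp
   ultimately show ?thesis using \<beta>[OF i] by (auto simp: V_def)
  qed
  moreover have "i = 0 \<or> i = 1 \<or> i = 2" using i by auto
  ultimately show ?thesis by (auto simp: C_def)
 qed
 ultimately have "is_coboundary 2 X C"
  using U by (intro small_cocycle_coboundary[where \<U> = "U ` {..<3}"])
   (auto simp: lessThan_Suc numeral_eq_Suc One_nat_def)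
 then obtain c where c: "!!\<sigma>. singular_simplex (Suc 2) X \<sigma> ==> C \<sigma> = cobdry 2 c \<sigma>"
  by (auto simp: is_coboundary_def)
 \<comment> \<open>\<open>c\<close> bounds the product of the \<open>V i\<close>; the other three
   terms are primitives of the differences that arise when its factors are changed back to
   \<open>W\<close> one by one.\<close>
 define B where "B \<tau> = (((c \<tau>
  ~= (\<beta> 0 (vertex \<tau> 0) & V 1 (edge \<tau> 0 1) & V 2 (edge \<tau> 1 2)))
  ~= (W (edge \<tau> 0 1) & \<beta> 1 (vertex \<tau> 1) & V 2 (edge \<tau> 1 2)))
  ~= (W (edge \<tau> 0 1) & W (edge \<tau> 1 2) & \<beta> 2 (vertex \<tau> 2)))" for \<tau>
 have "cup 2 1 (cup 1 1 W W) W \<sigma> = cobdry 2 B \<sigma>" if s: "singular_simplex (Suc 2) X \<sigma>" for \<sigma>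
 proof -
  have cb: "cobdry 2 b \<sigma> \<longleftrightarrow> odd (card {k \<in> {0..Suc (Suc (Suc 0))}. b (singular_face (Suc 2) k \<sigma>)})" for b
   by (simp add: cobdry_def numeral_eq_Suc)
  have e: "cup 2 1 (cup 1 1 W W) W \<sigma> \<longleftrightarrow> W (edge \<sigma> 0 1) & W (edge \<sigma> 1 2) & W (edge \<sigma> 2 3)"
   by (simp add: cup_def front_face_eq_sub_simplex back_face_eq_sub_simplex sub_simplex_sub_simplex
     sub_simplex_1 edge_sub_simplex o_def numeral_2_eq_2 numeral_3_eq_3)
  have w: "W (edge \<sigma> 0 2) = (W (edge \<sigma> 0 1) ~= W (edge \<sigma> 1 2))"
    "W (edge \<sigma> 1 3) = (W (edge \<sigma> 1 2) ~= W (edge \<sigma> 2 3))" by (rule cocycle_triangle[OF W s]; simp)+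
  have v: "V 1 (edge \<sigma> 0 2) = (V 1 (edge \<sigma> 0 1) ~= V 1 (edge \<sigma> 1 2))"
    "V 2 (edge \<sigma> 1 3) = (V 2 (edge \<sigma> 1 2) ~= V 2 (edge \<sigma> 2 3))" by (rule tri[OF s]; simp)+
  have vd: "V i (edge \<sigma> a b) = (W (edge \<sigma> a b) ~= (\<beta> i (vertex \<sigma> a) ~= \<beta> i (vertex \<sigma> b)))" for i a b
   by (simp add: V_def vertex_edge)
  have "(V 0 (edge \<sigma> 0 1) & V 1 (edge \<sigma> 1 2) & V 2 (edge \<sigma> 2 3)) =
   odd (card {k \<in> {0..Suc (Suc (Suc 0))}. c (singular_face (Suc 2) k \<sigma>)})"
   using c[OF s] by (simp add: C_def cb)
  hence cx: "(((c (singular_face (Suc 2) 0 \<sigma>) ~= c (singular_face (Suc 2) 1 \<sigma>)) ~= c (singular_face (Suc 2) 2 \<sigma>)) ~=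
   c (singular_face (Suc 2) 3 \<sigma>)) = (V 0 (edge \<sigma> 0 1) & V 1 (edge \<sigma> 1 2) & V 2 (edge \<sigma> 2 3))"
   unfolding odd_card_simps by (simp add: numeral_2_eq_2 numeral_3_eq_3 One_nat_def)
  have B: "cobdry 2 B \<sigma> \<longleftrightarrow> (((B (singular_face (Suc 2) 0 \<sigma>) ~= B (singular_face (Suc 2) 1 \<sigma>)) ~= B (singular_face (Suc 2) 2 \<sigma>)) ~=
   B (singular_face (Suc 2) 3 \<sigma>))"
   unfolding cb odd_card_simps by (simp add: numeral_2_eq_2 numeral_3_eq_3 One_nat_def)
  have f: "edge (singular_face (Suc 2) k \<sigma>) i j = edge \<sigma> (if i < k then i else Suc i) (if j < k then j else Suc j)"
   if "i <= 2" "j <= 2" for k i j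
   unfolding singular_face_eq_sub_simplex using that by (simp add: edge_sub_simplex)
  have f': "vertex (singular_face (Suc 2) k \<sigma>) i = vertex \<sigma> (if i < k then i else Suc i)" if "i <= 2" for k i
   unfolding singular_face_eq_sub_simplex using that by (simp add: vertex_sub_simplex)
  have n: "Suc 0 = 1" "Suc 1 = 2" "Suc 2 = 3" by simp_all
  have Bf:
   "B (singular_face (Suc 2) 0 \<sigma>) = (((c (singular_face (Suc 2) 0 \<sigma>) ~= (\<beta> 0 (vertex \<sigma> 1) & V 1 (edge \<sigma> 1 2) & V 2 (edge \<sigma> 2 3)))
    ~= (W (edge \<sigma> 1 2) & \<beta> 1 (vertex \<sigma> 2) & V 2 (edge \<sigma> 2 3))) ~= (W (edge \<sigma> 1 2) & W (edge \<sigma> 2 3) & \<beta> 2 (vertex \<sigma> 3)))"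
   "B (singular_face (Suc 2) 1 \<sigma>) = (((c (singular_face (Suc 2) 1 \<sigma>) ~= (\<beta> 0 (vertex \<sigma> 0) & V 1 (edge \<sigma> 0 2) & V 2 (edge \<sigma> 2 3)))
    ~= (W (edge \<sigma> 0 2) & \<beta> 1 (vertex \<sigma> 2) & V 2 (edge \<sigma> 2 3))) ~= (W (edge \<sigma> 0 2) & W (edge \<sigma> 2 3) & \<beta> 2 (vertex \<sigma> 3)))"
   "B (singular_face (Suc 2) 2 \<sigma>) = (((c (singular_face (Suc 2) 2 \<sigma>) ~= (\<beta> 0 (vertex \<sigma> 0) & V 1 (edge \<sigma> 0 1) & V 2 (edge \<sigma> 1 3)))
    ~= (W (edge \<sigma> 0 1) & \<beta> 1 (vertex \<sigma> 1) & V 2 (edge \<sigma> 1 3))) ~= (W (edge \<sigma> 0 1) & W (edge \<sigma> 1 3) & \<beta> 2 (vertex \<sigma> 3)))"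
   "B (singular_face (Suc 2) 3 \<sigma>) = (((c (singular_face (Suc 2) 3 \<sigma>) ~= (\<beta> 0 (vertex \<sigma> 0) & V 1 (edge \<sigma> 0 1) & V 2 (edge \<sigma> 1 2)))
    ~= (W (edge \<sigma> 0 1) & \<beta> 1 (vertex \<sigma> 1) & V 2 (edge \<sigma> 1 2))) ~= (W (edge \<sigma> 0 1) & W (edge \<sigma> 1 2) & \<beta> 2 (vertex \<sigma> 2)))"
   by (simp_all add: B_def f[unfolded n] f'[unfolded n] n)
  show ?thesis
   unfolding e B Bf by (rule cup_cube_bool[OF cx w v vd vd vd])
 qed
 thus ?thesis by (auto simp: is_coboundary_def)
qed

subsection \<open>Algebraic function germs\<close>

definition eval2 :: "real poly poly => real => real => real" where
 "eval2 P t y = poly (map_poly (%a. poly a t) P) y"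

lemma eval2_sum:
 assumes "degree P <= n"
 shows "eval2 P t y = (\<Sum>i\<le>n. poly (poly.coeff P i) t * y ^ i)"
proof -
 let ?q = "map_poly (%a. poly a t) P"
 have "degree ?q <= n" using assms by (intro degree_le) (simp add: coeff_map_poly coeff_eq_0)
 have "eval2 P t y = (\<Sum>i\<le>degree ?q. poly.coeff ?q i * y ^ i)" by (simp add: eval2_def poly_altdef)
 also have "... = (\<Sum>i\<le>n. poly.coeff ?q i * y ^ i)"
  using \<open>degree ?q <= n\<close> by (intro sum.mono_neutral_left) (auto simp: coeff_eq_0)
 finally show ?thesis by (simp add: coeff_map_poly)
qed

definition alg_fun :: "(real => real) => bool" where
 "alg_fun y \<longleftrightarrow> (\<exists>P. P ~= 0 & (EV t. eval2 P t (y t) = 0))"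

lemma eventually_poly_nonzero:
 fixes p :: "real poly" assumes "p ~= 0"
 shows "EV t. poly p t ~= 0"
proof -
 have "EV t. \<forall>a\<in>{x. poly p x = 0}. t ~= a"
  using poly_roots_finite[OF assms] by (intro eventually_ball_finite) (simp_all add: eventually_neq_at_within)
 thus ?thesis by eventually_elim auto
qed

text \<open>Elimination without division: with the pivot \<open>f k0 b\<close> every other unknown
  is scaled by the pivot, so that the coefficients may lie in a polynomial ring.\<close>

lemma homogeneous_system:
 fixes f :: "'k => 'b => 'a::idom"
 assumes "finite B" "finite K" "card B < card K"
 shows "\<exists>x. (\<exists>k\<in>K. x k ~= 0) & (\<forall>b\<in>B. (\<Sum>k\<in>K. x k * f k b) = 0)"
 using assms
proof (induction B arbitrary: K f rule: finite_induct)
 case empty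
 then obtain k where "k \<in> K" by fastforce
 thus ?case by (intro exI[of _ "%_. 1"]) auto
next
 case (insert b B)
 show ?case
 proof (cases "\<forall>k\<in>K. f k b = 0")
  case True
  have "card B < card K" using insert by simp
  then obtain x where "\<exists>k\<in>K. x k ~= 0" "\<forall>b\<in>B. (\<Sum>k\<in>K. x k * f k b) = 0"
   using insert.IH[OF insert.prems(1)] by blast
  with True show ?thesis by (intro exI[of _ x]) auto
 next
  case False
  then obtain k0 where k0: "k0 \<in> K" "f k0 b ~= 0" by blast
  let ?K = "K - {k0}"
  have "card B < card ?K" using insert k0 by simp
  then obtain y where y: "\<exists>k\<in>?K. y k ~= 0"
   "!!b'. b' \<in> B ==> (\<Sum>k\<in>?K. y k * (f k0 b * f k b' - f k b * f k0 b')) = 0"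
   using insert.IH[of ?K "%k b'. f k0 b * f k b' - f k b * f k0 b'"] insert.prems by auto
  define x where "x k = (if k = k0 then - (\<Sum>k\<in>?K. y k * f k b) else f k0 b * y k)" for k
  have s: "(\<Sum>k\<in>K. x k * f k b') = (\<Sum>k\<in>?K. y k * (f k0 b * f k b' - f k b * f k0 b'))" for b'
  proof -
   have "(\<Sum>k\<in>K. x k * f k b') = x k0 * f k0 b' + (\<Sum>k\<in>?K. x k * f k b')"
    using k0 insert.prems by (simp add: sum.remove)
   also have "(\<Sum>k\<in>?K. x k * f k b') = (\<Sum>k\<in>?K. f k0 b * y k * f k b')" by (intro sum.cong) (auto simp: x_def)
   finally show ?thesis by (simp add: x_def sum_distrib_right sum_distrib_left sum_negf sum_subtractf algebra_simps)
  qed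
  have "(\<Sum>k\<in>?K. y k * (f k0 b * f k b - f k b * f k0 b)) = 0" by (intro sum.neutral) (simp add: mult.commute)
  hence "\<forall>b'\<in>insert b B. (\<Sum>k\<in>K. x k * f k b') = 0" using y(2) by (simp add: s)
  moreover have "\<exists>k\<in>K. x k ~= 0" using y(1) k0 by (auto simp: x_def)
  ultimately show ?thesis by blast
 qed
qed

text \<open>The span over the field of rational functions in \<open>t\<close>, as germs at 0 from
  the right; \<open>a\<close> is a common denominator.\<close>

definition alg_span :: "'i set => ('i => real => real) => (real => real) => bool" where
 "alg_span I v y \<longleftrightarrow> (\<exists>a c. a ~= 0 & (EV t. poly a t * y t = (\<Sum>i\<in>I. poly (c i) t * v i t)))"

lemma alg_span_add:
 assumes "alg_span I v y" "alg_span I v u" shows "alg_span I v (%t. y t + u t)"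
proof -
 obtain a c where a: "a ~= 0" "EV t. poly a t * y t = (\<Sum>i\<in>I. poly (c i) t * v i t)"
  using assms(1) by (auto simp: alg_span_def)
 obtain b d where b: "b ~= 0" "EV t. poly b t * u t = (\<Sum>i\<in>I. poly (d i) t * v i t)"
  using assms(2) by (auto simp: alg_span_def)
 have "EV t. poly (a * b) t * (y t + u t) = (\<Sum>i\<in>I. poly (b * c i + a * d i) t * v i t)"
  using a(2) b(2)
 proof eventually_elim
  case (elim t)
  have "poly (a * b) t * (y t + u t) = poly b t * (poly a t * y t) + poly a t * (poly b t * u t)" by (simp add: algebra_simps)
  also have "... = (\<Sum>i\<in>I. poly (b * c i + a * d i) t * v i t)"
   unfolding elim sum_distrib_left sum.distrib[symmetric] by (intro sum.cong refl) (simp add: algebra_simps)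
  finally show ?case .
 qed
 thus ?thesis unfolding alg_span_def using a(1) b(1) by (intro exI[of _ "a * b"] exI[of _ "%i. b * c i + a * d i"]) simp
qed

lemma alg_span_cmul:
 assumes "alg_span I v y" shows "alg_span I v (%t. poly p t * y t)"
proof -
 obtain a c where a: "a ~= 0" "EV t. poly a t * y t = (\<Sum>i\<in>I. poly (c i) t * v i t)"
  using assms(1) by (auto simp: alg_span_def)
 have "EV t. poly a t * (poly p t * y t) = (\<Sum>i\<in>I. poly (p * c i) t * v i t)"
  using a(2)
 proof eventually_elim
  case (elim t)
  have "poly a t * (poly p t * y t) = poly p t * (poly a t * y t)" by simp
  thus ?case by (simp only: elim) (simp add: sum_distrib_left algebra_simps)
 qed
 thus ?thesis unfolding alg_span_def using a(1) by (intro exI[of _ a] exI[of _ "%i. p * c i"]) simp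
qed

lemma alg_span_zero: "alg_span I v (%t. 0)"
 unfolding alg_span_def by (intro exI[of _ 1] exI[of _ "%_. 0"]) auto

lemma alg_span_sum:
 "(!!j. j \<in> J ==> alg_span I v (y j)) ==> alg_span I v (%t. \<Sum>j\<in>J. y j t)"
 by (induction J rule: infinite_finite_induct) (auto intro: alg_span_add alg_span_zero)

lemma alg_span_generator: "finite I ==> i \<in> I ==> alg_span I v (v i)"
 unfolding alg_span_def
 by (intro exI[of _ 1] exI[of _ "%j. if j = i then 1 else 0"]) (auto simp: sum.delta if_distrib if_distribR cong: if_cong)

lemma alg_span_divide:
 assumes "alg_span I v (%t. poly p t * y t)" "p ~= 0" shows "alg_span I v y"
proof -
 obtain a c where a: "a ~= 0" "EV t. poly a t * (poly p t * y t) = (\<Sum>i\<in>I. poly (c i) t * v i t)"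
  using assms(1) by (auto simp: alg_span_def)
 thus ?thesis unfolding alg_span_def using assms(2) by (intro exI[of _ "a * p"] exI[of _ c]) (auto simp: mult.assoc)
qed

lemma alg_span_cong:
 assumes "alg_span I v y" "EV t. y t = u t" shows "alg_span I v u"
proof -
 obtain a c where a: "a ~= 0" "EV t. poly a t * y t = (\<Sum>i\<in>I. poly (c i) t * v i t)"
  using assms(1) by (auto simp: alg_span_def)
 have "EV t. poly a t * u t = (\<Sum>i\<in>I. poly (c i) t * v i t)"
  using a(2) assms(2) by eventually_elim simp
 thus ?thesis unfolding alg_span_def using a(1) by (intro exI[of _ a] exI[of _ c]) simp
qed

lemma alg_span_trans:
 assumes "alg_span I v y" "!!i. i \<in> I ==> alg_span J w (v i)" shows "alg_span J w y"
proof -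
 obtain a c where a: "a ~= 0" "EV t. poly a t * y t = (\<Sum>i\<in>I. poly (c i) t * v i t)"
  using assms(1) by (auto simp: alg_span_def)
 have "alg_span J w (%t. \<Sum>i\<in>I. poly (c i) t * v i t)"
  using assms(2) by (intro alg_span_sum alg_span_cmul)
 hence "alg_span J w (%t. poly a t * y t)" by (rule alg_span_cong) (use a(2) in \<open>auto elim: eventually_mono\<close>)
 thus ?thesis by (rule alg_span_divide) fact
qed

lemma alg_span_mult:
 assumes "alg_span I v y" "alg_span J w u" "finite I" "finite J"
 shows "alg_span (I \<times> J) (%p t. v (fst p) t * w (snd p) t) (%t. y t * u t)"
proof -
 obtain a c where a: "a ~= 0" "EV t. poly a t * y t = (\<Sum>i\<in>I. poly (c i) t * v i t)"
  using assms(1) by (auto simp: alg_span_def)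
 obtain b d where b: "b ~= 0" "EV t. poly b t * u t = (\<Sum>i\<in>J. poly (d i) t * w i t)"
  using assms(2) by (auto simp: alg_span_def)
 have "EV t. poly (a * b) t * (y t * u t) =
   (\<Sum>p\<in>I \<times> J. poly (c (fst p) * d (snd p)) t * (v (fst p) t * w (snd p) t))"
  using a(2) b(2)
 proof eventually_elim
  case (elim t)
  have "poly (a * b) t * (y t * u t) = (poly a t * y t) * (poly b t * u t)" by (simp add: algebra_simps)
  also have "... = (\<Sum>i\<in>I. \<Sum>j\<in>J. poly (c i * d j) t * (v i t * w j t))"
   unfolding elim sum_product by (intro sum.cong refl) (simp add: algebra_simps)
  also have "... = (\<Sum>p\<in>I \<times> J. poly (c (fst p) * d (snd p)) t * (v (fst p) t * w (snd p) t))"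
   by (simp add: sum.cartesian_product case_prod_beta)
  finally show ?case .
 qed
 thus ?thesis unfolding alg_span_def using a(1) b(1) by (intro exI[of _ "a * b"] exI[of _ "%p. c (fst p) * d (snd p)"]) simp
qed

text \<open>Multiplication by \<open>y\<close> maps the span of the powers below the degree of the
  equation into itself. Together with the converse \<open>alg_fun_if_powers\<close> this gives sums
  and products of algebraic germs without resultants.\<close>

lemma alg_fun_powers:
 assumes "alg_fun y"
 obtains m where "!!k. alg_span {..<m} (%i t. y t ^ i) (%t. y t ^ k)"
proof -
 obtain P where P: "P ~= 0" "EV t. eval2 P t (y t) = 0"
  using assms by (auto simp: alg_fun_def)
 define m where "m = degree P"
 have "EV t. poly (poly.coeff P m) t * y t ^ m = (\<Sum>i<m. poly (- poly.coeff P i) t * y t ^ i)"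
  using P(2) by eventually_elim
   (simp add: eval2_sum[of P m] m_def lessThan_Suc_atMost[symmetric] sum_negf)
 hence m: "alg_span {..<m} (%i t. y t ^ i) (%t. y t ^ m)"
  unfolding alg_span_def using P(1) by (intro exI[of _ "poly.coeff P m"] exI[of _ "%i. - poly.coeff P i"]) (auto simp: m_def)
 have "alg_span {..<m} (%i t. y t ^ i) (%t. y t ^ k)" for k
 proof (induction k)
  case 0
  show ?case
  proof (cases "m = 0")
   case True
   thus ?thesis using m by simp
  qed (auto intro!: alg_span_generator[of "{..<m}" 0 "%i t. y t ^ i", simplified])
 next
  case (Suc k)
  then obtain a c where a: "a ~= 0" "EV t. poly a t * y t ^ k = (\<Sum>i<m. poly (c i) t * y t ^ i)" by (auto simp: alg_span_def)
  have "EV t. poly a t * y t ^ Suc k = (\<Sum>i<m. poly (c i) t * y t ^ Suc i)"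
   using a(2)
  proof eventually_elim
   case (elim t)
   have "poly a t * y t ^ Suc k = y t * (poly a t * y t ^ k)" by simp
   thus ?case by (simp only: elim) (simp add: sum_distrib_left algebra_simps)
  qed
  hence "alg_span {..<m} (%i t. y t ^ Suc i) (%t. y t ^ Suc k)"
   unfolding alg_span_def using a(1) by (intro exI[of _ a] exI[of _ c]) simp
  thus ?case
  proof (rule alg_span_trans)
   fix i assume "i \<in> {..<m}"
   then consider "Suc i < m" | "Suc i = m" by fastforce
   thus "alg_span {..<m} (%i t. y t ^ i) (%t. y t ^ Suc i)"
    by cases (use m alg_span_generator[of "{..<m}" "Suc i" "%i t. y t ^ i"] in auto)
  qed
 qed
 thus ?thesis using that by blast
qed

text \<open>One more power than there are generators must be linearly dependent over the rational
  functions; the dependence is the polynomial equation.\<close>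

lemma alg_fun_if_powers:
 assumes "finite I" "!!k. alg_span I v (%t. y t ^ k)"
 shows "alg_fun y"
proof -
 define N where "N = card I"
 define G where "G k ac \<longleftrightarrow> fst ac ~= 0 & (EV t. poly (fst ac) t * y t ^ k = (\<Sum>i\<in>I. poly (snd ac i) t * v i t))"
  for k and ac :: "real poly \<times> ('a => real poly)"
 have "\<exists>ac. G k ac" for k
 proof -
  obtain a c where "a ~= 0" "EV t. poly a t * y t ^ k = (\<Sum>i\<in>I. poly (c i) t * v i t)"
   using assms(2)[of k] by (auto simp: alg_span_def)
  thus ?thesis by (intro exI[of _ "(a, c)"]) (simp add: G_def)
 qed
 then obtain ac where ac: "!!k. G k (ac k)" by metis
 define a c where "a k = fst (ac k)" and "c k = snd (ac k)" for k
 have a: "a k ~= 0" "EV t. poly (a k) t * y t ^ k = (\<Sum>i\<in>I. poly (c k i) t * v i t)" for k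
  using ac[of k] by (simp_all add: G_def a_def c_def)
 obtain x where x: "\<exists>k\<in>{..N}. x k ~= 0" "!!i. i \<in> I ==> (\<Sum>k\<le>N. x k * c k i) = 0"
  using homogeneous_system[OF assms(1), of "{..N}" c] by (auto simp: N_def)
 define P where "P = (\<Sum>k\<le>N. Polynomial.monom (x k * a k) k)"
 have co: "poly.coeff P i = (if i <= N then x i * a i else 0)" for i by (simp add: P_def coeff_sum)
 have "P ~= 0" using x(1) a(1) co by (metis atMost_iff coeff_0 mult_eq_0_iff)
 moreover have "degree P <= N" by (rule degree_le) (simp add: co)
 have "EV t. \<forall>k\<in>{..N}. poly (a k) t * y t ^ k = (\<Sum>i\<in>I. poly (c k i) t * v i t)"
  using a(2) by (intro eventually_ball_finite) auto
 hence "EV t. eval2 P t (y t) = 0"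
 proof eventually_elim
  case (elim t)
  have "eval2 P t (y t) = (\<Sum>k\<le>N. poly (x k) t * (poly (a k) t * y t ^ k))"
   using eval2_sum[OF \<open>degree P <= N\<close>] by (simp add: co mult.assoc)
  also have "... = (\<Sum>k\<le>N. poly (x k) t * (\<Sum>i\<in>I. poly (c k i) t * v i t))"
   using elim by (intro sum.cong) auto
  also have "... = (\<Sum>i\<in>I. \<Sum>k\<le>N. poly (x k * c k i) t * v i t)"
   unfolding sum_distrib_left by (subst sum.swap) (simp add: mult.assoc)
  also have "... = (\<Sum>i\<in>I. poly (\<Sum>k\<le>N. x k * c k i) t * v i t)" by (simp add: sum_distrib_right poly_sum)
  finally show ?case by (simp add: x(2))
 qed
 ultimately show ?thesis by (auto simp: alg_fun_def)
qed

lemma alg_fun_mult: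
 assumes "alg_fun y" "alg_fun u" shows "alg_fun (%t. y t * u t)"
proof -
 obtain m where m: "!!k. alg_span {..<m} (%i t. y t ^ i) (%t. y t ^ k)" using alg_fun_powers[OF assms(1)] by blast
 obtain n where n: "!!k. alg_span {..<n} (%i t. u t ^ i) (%t. u t ^ k)" using alg_fun_powers[OF assms(2)] by blast
 show ?thesis
  using alg_span_mult[OF m n] by (intro alg_fun_if_powers[of "{..<m} \<times> {..<n}"]) (auto simp: power_mult_distrib)
qed

lemma alg_fun_add:
 assumes "alg_fun y" "alg_fun u" shows "alg_fun (%t. y t + u t)"
proof -
 obtain m where m: "!!k. alg_span {..<m} (%i t. y t ^ i) (%t. y t ^ k)" using alg_fun_powers[OF assms(1)] by blast
 obtain n where n: "!!k. alg_span {..<n} (%i t. u t ^ i) (%t. u t ^ k)" using alg_fun_powers[OF assms(2)] by blast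
 have "alg_span ({..<m} \<times> {..<n}) (%p t. y t ^ fst p * u t ^ snd p) (%t. (y t + u t) ^ k)" for k
 proof -
  have "alg_span ({..<m} \<times> {..<n}) (%p t. y t ^ fst p * u t ^ snd p)
   (%t. \<Sum>j\<le>k. poly [:of_nat (k choose j):] t * (y t ^ j * u t ^ (k - j)))"
   by (intro alg_span_sum alg_span_cmul alg_span_mult m n) auto
  thus ?thesis by (simp add: binomial_ring mult.assoc)
 qed
 thus ?thesis by (intro alg_fun_if_powers[of "{..<m} \<times> {..<n}"]) auto
qed

lemma alg_fun_poly: "alg_fun (%t. poly p t)"
proof -
 have "eval2 [:- p, 1:] t (poly p t) = 0" for t
  using eval2_sum[of "[:- p, 1:]" 1] by (simp add: One_nat_def)
 thus ?thesis unfolding alg_fun_def by (intro exI[of _ "[:- p, 1:]"]) auto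
qed

lemma alg_fun_inverse:
 assumes "alg_fun y" "EV t. y t ~= 0" shows "alg_fun (%t. inverse (y t))"
proof -
 obtain P where P: "P ~= 0" "EV t. eval2 P t (y t) = 0"
  using assms by (auto simp: alg_fun_def)
 define m where "m = degree P"
 \<comment> \<open>The coefficients of \<open>P\<close> in reverse order: the equation of the
   inverse.\<close>
 define Q where "Q = (\<Sum>i\<le>m. Polynomial.monom (poly.coeff P (m - i)) i)"
 have co: "poly.coeff Q i = (if i <= m then poly.coeff P (m - i) else 0)" for i by (simp add: Q_def coeff_sum)
 have "Q ~= 0" using co[of 0] P(1) by (auto simp: m_def)
 have dQ: "degree Q <= m" by (rule degree_le) (simp add: co)
 have "EV t. eval2 Q t (inverse (y t)) = 0"
  using P(2) assms(2)
 proof eventually_elim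
  case (elim t)
  have "eval2 Q t (inverse (y t)) = (\<Sum>i\<le>m. poly (poly.coeff P (m - i)) t * inverse (y t) ^ i)"
   by (simp add: eval2_sum[OF dQ] co)
  also have "... = (\<Sum>i\<le>m. poly (poly.coeff P i) t * inverse (y t) ^ (m - i))"
   by (rule sum.reindex_bij_witness[of _ "%i. m - i" "%i. m - i"]) auto
  also have "... = (\<Sum>i\<le>m. inverse (y t) ^ m * (poly (poly.coeff P i) t * y t ^ i))"
   using elim by (intro sum.cong refl) (simp add: power_diff field_simps)
  also have "... = inverse (y t) ^ m * eval2 P t (y t)" by (simp add: eval2_sum[of P m] m_def sum_distrib_left)
  finally show ?case using elim by simp
 qed
 thus ?thesis using \<open>Q ~= 0\<close> by (auto simp: alg_fun_def)
qed

text \<open>Algebraicity alone allows a germ to jump between the branches of its equation;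
  continuity on a punctured neighbourhood excludes this and forces a constant sign near 0.\<close>

definition tame :: "(real => real) => bool" where
 "tame y \<longleftrightarrow> alg_fun y & (\<exists>e>0. continuous_on {0<..<e} y)"

lemma tame_add: "tame y ==> tame u ==> tame (%t. y t + u t)"
 unfolding tame_def
proof (elim conjE exE, intro conjI)
 fix e d :: real assume "e > 0" "d > 0" "continuous_on {0<..<e} y" "continuous_on {0<..<d} u"
 thus "\<exists>e>0. continuous_on {0<..<e} (%t. y t + u t)"
  by (intro exI[of _ "min e d"]) (auto intro!: continuous_on_add elim: continuous_on_subset)
qed (rule alg_fun_add)

lemma tame_mult: "tame y ==> tame u ==> tame (%t. y t * u t)"
 unfolding tame_def
proof (elim conjE exE, intro conjI)
 fix e d :: real assume "e > 0" "d > 0" "continuous_on {0<..<e} y" "continuous_on {0<..<d} u"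
 thus "\<exists>e>0. continuous_on {0<..<e} (%t. y t * u t)"
  by (intro exI[of _ "min e d"]) (auto intro!: continuous_on_mult elim: continuous_on_subset)
qed (rule alg_fun_mult)

lemma tame_poly: "tame (%t. poly p t)"
 unfolding tame_def by (auto intro!: alg_fun_poly exI[of _ 1] continuous_intros)

lemma tame_const: "tame (%t. c)" using tame_poly[of "[:c:]"] by simp
lemma tame_ident: "tame (%t. t)" using tame_poly[of "[:0,1:]"] by simp
lemma tame_uminus: "tame y ==> tame (%t. - y t)" using tame_mult[OF tame_const[of "-1"]] by simp
lemma tame_diff: "tame y ==> tame u ==> tame (%t. y t - u t)"
 using tame_add[of y "%t. - u t"] tame_uminus[of u] by simp
lemma tame_power: "tame y ==> tame (%t. y t ^ n)" by (induction n) (auto intro: tame_const tame_mult)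

lemma tame_inverse:
 assumes "tame y" "EV t. y t ~= 0" shows "tame (%t. inverse (y t))"
proof -
 obtain e where e: "e > 0" "continuous_on {0<..<e} y" using assms by (auto simp: tame_def)
 obtain d where d: "d > 0" "!!t. 0 < t ==> t < d ==> y t ~= 0"
  using assms(2) by (auto simp: eventually_at_right_field)
 have "continuous_on {0<..<min e d} (%t. inverse (y t))"
  using e d by (intro continuous_on_inverse continuous_on_subset[OF e(2)]) auto
 thus ?thesis using assms e(1) d(1) alg_fun_inverse[of y] unfolding tame_def by (metis min_less_iff_conj)
qed

lemma continuous_nonzero_sign:
 fixes h :: "real => real"
 assumes "continuous_on {a<..<b} h" "!!t. t \<in> {a<..<b} ==> h t ~= 0"
 shows "(\<forall>t\<in>{a<..<b}. h t > 0) \<or> (\<forall>t\<in>{a<..<b}. h t < 0)"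
proof (rule ccontr)
 assume "\<not> ?thesis"
 then obtain s t where st: "s \<in> {a<..<b}" "t \<in> {a<..<b}" "h s < 0" "h t > 0"
  using assms(2) by (meson linorder_neqE_linordered_idom)
 have "connected (h ` {a<..<b})" using assms(1) by (intro connected_continuous_image) auto
 hence "0 \<in> h ` {a<..<b}" using st unfolding connected_iff_interval by (meson imageI less_imp_le)
 thus False using assms(2) by auto
qed

text \<open>After extraction of the power \<open>y ^ j\<close> the remaining factor \<open>R\<close>
  is nonzero at \<open>y = 0\<close>. So at each \<open>t\<close> exactly one of \<open>y\<close>
  and \<open>R\<close> vanishes, the difference \<open>h\<close> of their squares has no zero, and
  its constant sign tells which of the two vanishes throughout.\<close>

lemma tame_zero_or_nonzero:
 assumes "tame y"
 shows "(EV t. y t = 0) \<or> (EV t. y t ~= 0)"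
proof -
 obtain e where e: "e > 0" "continuous_on {0<..<e} y" using assms by (auto simp: tame_def)
 obtain P where P: "P ~= 0" "EV t. eval2 P t (y t) = 0"
  using assms by (auto simp: alg_fun_def tame_def)
 define m where "m = degree P"
 define j where "j = (LEAST i. poly.coeff P i ~= 0)"
 have "\<exists>i. poly.coeff P i ~= 0" using P(1) by (intro exI[of _ m]) (auto simp: m_def)
 hence j: "poly.coeff P j ~= 0" and jl: "!!i. i < j ==> poly.coeff P i = 0"
  unfolding j_def by (rule LeastI_ex, blast dest: not_less_Least)
 have jm: "j <= m" using j unfolding m_def by (rule le_degree)
 define R where "R t x = (\<Sum>i\<le>m - j. poly (poly.coeff P (i + j)) t * x ^ i)" for t x
 have ev: "eval2 P t x = x ^ j * R t x" for t x
 proof -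
  have "eval2 P t x = (\<Sum>i\<in>{j..m}. poly (poly.coeff P i) t * x ^ i)"
   unfolding eval2_sum[of P m, OF eq_refl[OF m_def[symmetric]]] by (rule sum.mono_neutral_right) (auto simp: jl)
  also have "... = (\<Sum>i\<le>m - j. poly (poly.coeff P (i + j)) t * x ^ (i + j))"
   by (rule sum.reindex_bij_witness[of _ "%i. i + j" "%i. i - j"]) (use jm in auto)
  finally show ?thesis by (simp add: R_def sum_distrib_left power_add algebra_simps)
 qed
 have R0: "R t 0 = poly (poly.coeff P j) t" for t
  unfolding R_def by (subst sum.atMost_shift) simp
 have "EV t. y t ^ j * R t (y t) = 0 & poly (poly.coeff P j) t ~= 0"
  using P(2) eventually_poly_nonzero[OF j] by eventually_elim (simp add: ev)
 then obtain d where d: "d > 0" "!!t. 0 < t ==> t < d ==> y t ^ j * R t (y t) = 0 & poly (poly.coeff P j) t ~= 0"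
  by (auto simp: eventually_at_right_field)
 define r where "r = min e d"
 have r: "r > 0" using e d by (simp add: r_def)
 have yc: "continuous_on {0<..<r} y" by (rule continuous_on_subset[OF e(2)]) (auto simp: r_def)
 have Rc: "continuous_on {0<..<r} (%t. R t (y t))"
  unfolding R_def by (intro continuous_intros yc)
 define h where "h t = (y t)\<^sup>2 - (R t (y t))\<^sup>2" for t
 have "(\<forall>t\<in>{0<..<r}. h t > 0) \<or> (\<forall>t\<in>{0<..<r}. h t < 0)"
 proof (rule continuous_nonzero_sign)
  show "continuous_on {0<..<r} h" unfolding h_def by (intro continuous_intros yc Rc)
  fix t assume "t \<in> {0<..<r}"
  thus "h t ~= 0" using d(2)[of t] R0[of t] by (auto simp: h_def r_def)
 qed
 thus ?thesis
 proof
  assume *: "\<forall>t\<in>{0<..<r}. h t > 0"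
  have "y t ~= 0" if "0 < t" "t < r" for t using * that by (force simp: h_def)
  thus ?thesis using r by (auto simp: eventually_at_right_field)
 next
  assume *: "\<forall>t\<in>{0<..<r}. h t < 0"
  have "y t = 0" if "0 < t" "t < r" for t using * that d(2)[of t] by (force simp: h_def r_def)
  thus ?thesis using r by (auto simp: eventually_at_right_field)
 qed
qed

lemma tame_sign:
 assumes "tame y"
 shows "(EV t. y t = 0) \<or> (EV t. y t > 0) \<or> (EV t. y t < 0)"
proof (cases "EV t. y t = 0")
 case False
 then obtain d where d: "d > 0" "!!t. 0 < t ==> t < d ==> y t ~= 0"
  using tame_zero_or_nonzero[OF assms] by (auto simp: eventually_at_right_field)
 obtain e where e: "e > 0" "continuous_on {0<..<e} y" using assms by (auto simp: tame_def)
 have "(\<forall>t\<in>{0<..<min d e}. y t > 0) \<or> (\<forall>t\<in>{0<..<min d e}. y t < 0)"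
  using d e by (intro continuous_nonzero_sign continuous_on_subset[OF e(2)]) auto
 moreover have "min d e > 0" using d e by simp
 ultimately show ?thesis unfolding eventually_at_right_field by (metis greaterThanLessThan_iff)
qed auto

text \<open>The limit is the supremum of the eventual lower bounds of \<open>y\<close>; the
  trichotomy \<open>tame_sign\<close> for \<open>y\<close> minus a slightly larger constant gives
  the bound from above.\<close>

lemma tame_tendsto:
 assumes "tame y" "EV t. \<bar>y t\<bar> <= B"
 shows "\<exists>L. (y ~~> L)"
proof -
 let ?S = "{a. EV t. y t \<ge> a}"
 have bB: "a <= B" if "a \<in> ?S" for a
 proof -
  have "\<forall>\<^sub>F t in at_right (0::real). a <= B" using that[simplified] assms(2) by eventually_elim auto
  thus ?thesis by simp
 qed
 have mB: "- B \<in> ?S" using assms(2) by (auto elim: eventually_mono)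
 have bdd: "bdd_above ?S" using bB by (auto simp: bdd_above_def)
 show ?thesis
 proof (intro exI[of _ "Sup ?S"] tendstoI)
  fix \<epsilon> :: real assume \<epsilon>: "\<epsilon> > 0"
  have "Sup ?S - \<epsilon> < Sup ?S" using \<epsilon> by simp
  then obtain a where a: "a \<in> ?S" "Sup ?S - \<epsilon> < a"
   using less_cSup_iff[of ?S "Sup ?S - \<epsilon>"] mB bdd by blast
  have "Sup ?S + \<epsilon> / 2 \<notin> ?S" using cSup_upper[OF _ bdd, of "Sup ?S + \<epsilon> / 2"] \<epsilon> by fastforce
  hence nn: "\<not> (EV t. y t - (Sup ?S + \<epsilon> / 2) \<ge> 0)" by simp
  have "tame (%t. y t - (Sup ?S + \<epsilon> / 2))" by (intro tame_diff assms(1) tame_const)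
  have ev: "\<not> (EV t. P t)" if "!!t. P t ==> y t - (Sup ?S + \<epsilon> / 2) \<ge> 0" for P
   using nn that by (meson eventually_mono)
  from tame_sign[OF \<open>tame (%t. y t - (Sup ?S + \<epsilon> / 2))\<close>]
  have "EV t. y t - (Sup ?S + \<epsilon> / 2) < 0"
   by (elim disjE) (use ev[of "%t. y t - (Sup ?S + \<epsilon> / 2) = 0"] ev[of "%t. y t - (Sup ?S + \<epsilon> / 2) > 0"] in auto)
  thus "EV t. dist (y t) (Sup ?S) < \<epsilon>"
   using a(1)[simplified] by eventually_elim (use a(2) \<epsilon> in \<open>auto simp: dist_real_def\<close>)
 qed
qed

text \<open>The square of the quotient is tame and bounded, hence convergent. The square root loses
  only the sign, and the sign of \<open>A\<close> is eventually constant.\<close>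

lemma tame_quotient_sqrt_tendsto:
 assumes "tame A" "tame Q" "EV t. Q t > 0 & \<bar>A t\<bar> <= B * sqrt (Q t)"
 shows "\<exists>L. ((%t. A t / sqrt (Q t)) ~~> L)"
proof -
 have "tame (%t. A t ^ 2 * inverse (Q t))"
  using assms by (intro tame_mult tame_power tame_inverse) (auto elim: eventually_mono)
 moreover have "EV t. \<bar>A t ^ 2 * inverse (Q t)\<bar> <= B ^ 2"
  using assms(3)
 proof eventually_elim
  case (elim t)
  hence "\<bar>A t\<bar> ^ 2 <= (B * sqrt (Q t)) ^ 2" by (intro power_mono) auto
  thus ?case using elim by (simp add: power_mult_distrib field_simps)
 qed
 ultimately obtain L where L: "((%t. A t ^ 2 * inverse (Q t)) ~~> L)"
  using tame_tendsto by blast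
 have s: "((%t. sqrt (A t ^ 2 * inverse (Q t))) ~~> sqrt L)" by (intro tendsto_real_sqrt L)
 have eq: "EV t. sqrt (A t ^ 2 * inverse (Q t)) = \<bar>A t\<bar> / sqrt (Q t)"
  using assms(3) by eventually_elim (simp add: real_sqrt_mult real_sqrt_inverse divide_inverse)
 have s': "((%t. \<bar>A t\<bar> / sqrt (Q t)) ~~> sqrt L)"
  using s eq by (rule Lim_transform_eventually)
 have cases: "(EV t. A t \<ge> 0) \<or> (EV t. A t <= 0)"
 proof -
  have "EV t. A t = 0 ==> EV t. A t \<ge> 0"
   "EV t. A t > 0 ==> EV t. A t \<ge> 0"
   "EV t. A t < 0 ==> EV t. A t <= 0" by (erule eventually_mono, simp)+
  thus ?thesis using tame_sign[OF assms(1)] by blast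
 qed
 thus ?thesis
 proof
  assume "EV t. A t \<ge> 0"
  hence "EV t. \<bar>A t\<bar> / sqrt (Q t) = A t / sqrt (Q t)" by eventually_elim simp
  thus ?thesis by - (rule exI, rule Lim_transform_eventually[OF s'])
 next
  assume "EV t. A t <= 0"
  hence "EV t. - (\<bar>A t\<bar> / sqrt (Q t)) = A t / sqrt (Q t)" by eventually_elim simp
  thus ?thesis by - (rule exI, rule Lim_transform_eventually[OF tendsto_minus[OF s']])
 qed
qed

lemma alg_germ_imp_tame:
 assumes "e > 0" "alg_germ e y" "continuous_on {0..<e} y" shows "tame y"
proof -
 obtain P where "P ~= 0" "\<forall>t\<in>{0..<e}. eval2 P t (y t) = 0"
  using assms(2) by (auto simp: alg_germ_def eval2_def)
 hence "alg_fun y" using assms(1)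
  unfolding alg_fun_def by (intro exI[of _ P]) (auto simp: eventually_at_right_field intro!: exI[of _ e])
 moreover have "continuous_on {0<..<e} y" by (rule continuous_on_subset[OF assms(3)]) auto
 ultimately show ?thesis using assms(1) by (auto simp: tame_def)
qed

lemma tame_imp_alg_germ:
 assumes "tame y" shows "\<exists>e>0. \<forall>e'\<le>e. alg_germ e' y"
proof -
 obtain P where P: "P ~= 0" "EV t. eval2 P t (y t) = 0"
  using assms by (auto simp: alg_fun_def tame_def)
 then obtain e where e: "e > 0" "!!t. 0 < t ==> t < e ==> eval2 P t (y t) = 0" by (auto simp: eventually_at_right_field)
 \<comment> \<open>The factor \<open>t\<close> makes the equation hold at \<open>t = 0\<close> too,
   where nothing is known about \<open>y\<close>.\<close>
 let ?Q = "Polynomial.smult [:0, 1:] P"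
 have "eval2 ?Q t (y t) = 0" if "0 <= t" "t < e" for t
 proof -
  have "eval2 ?Q t (y t) = t * eval2 P t (y t)"
   using eval2_sum[of ?Q "degree P"] eval2_sum[of P "degree P"] by (simp add: degree_smult_le sum_distrib_left mult.assoc)
  thus ?thesis using that e(2)[of t] by (cases "t = 0") auto
 qed
 moreover have "?Q ~= 0" using P(1) by simp
 ultimately have "alg_germ e' y" if "e' <= e" for e'
  using that unfolding alg_germ_def eval2_def[symmetric] by (intro exI[of _ ?Q]) auto
 thus ?thesis using e(1) by blast
qed

subsection \<open>The alternating form of a pair of chords\<close>

definition E :: "nat => real => complex" where "E k x = cis x ^ k"

definition nform :: "conf => (real => complex) => (real => complex) => complex" where
 "nform xs \<phi> \<psi> = (\<phi> (xs 0) - \<phi> (xs 1)) * (\<psi> (xs 2) - \<psi> (xs 3)) - (\<phi> (xs 2) - \<phi> (xs 3)) * (\<psi> (xs 0) - \<psi> (xs 1))"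

text \<open>Up to the chord lengths, these two values determine the differences of the sums and of
  the products of the chord ends, and so they bound the form on all other monomials.\<close>

definition nrm :: "conf => real" where
 "nrm xs = sqrt ((cmod (nform xs (E 1) (E 2)))\<^sup>2 + (cmod (nform xs (E 1) (E 3)))\<^sup>2)"

text \<open>For a degenerate quadruple the quotient is 0, so bounds on \<open>zform\<close> hold for
  every quadruple.\<close>

definition zform :: "conf => (real => complex) => (real => complex) => complex" where
 "zform xs \<phi> \<psi> = nform xs \<phi> \<psi> / of_real (nrm xs)"

lemma nform_bilinear:
 "nform xs (%x. \<phi> x + \<phi>' x) \<psi> = nform xs \<phi> \<psi> + nform xs \<phi>' \<psi>"
 "nform xs (%x. \<phi> x - \<phi>' x) \<psi> = nform xs \<phi> \<psi> - nform xs \<phi>' \<psi>"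
 "nform xs \<phi> (%x. \<psi> x + \<psi>' x) = nform xs \<phi> \<psi> + nform xs \<phi> \<psi>'"
 "nform xs \<phi> (%x. \<psi> x - \<psi>' x) = nform xs \<phi> \<psi> - nform xs \<phi> \<psi>'"
 "nform xs (%x. c * \<phi> x) \<psi> = c * nform xs \<phi> \<psi>"
 "nform xs \<phi> (%x. c * \<psi> x) = c * nform xs \<phi> \<psi>" by (simp_all add: nform_def algebra_simps)

lemma nform_const: "nform xs (%x. c) \<psi> = 0" "nform xs \<phi> (%x. c) = 0" by (simp_all add: nform_def)

lemma nform_swap: "nform xs \<psi> \<phi> = - nform xs \<phi> \<psi>" by (simp add: nform_def algebra_simps)

lemma nform_sum:
 "nform xs (%x. \<Sum>i\<in>I. \<phi> i x) \<psi> = (\<Sum>i\<in>I. nform xs (\<phi> i) \<psi>)"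
 "nform xs \<psi> (%x. \<Sum>i\<in>I. \<phi> i x) = (\<Sum>i\<in>I. nform xs \<psi> (\<phi> i))"
 by (induction I rule: infinite_finite_induct) (simp_all add: nform_bilinear nform_const)

lemma nform_plucker:
 "nform xs \<phi> \<psi> * nform xs u v = nform xs \<phi> u * nform xs \<psi> v - nform xs \<phi> v * nform xs \<psi> u"
proof -
 have "(p1 * q2 - p2 * q1) * (u1 * v2 - u2 * v1) =
  (p1 * u2 - p2 * u1) * (q1 * v2 - q2 * v1) - (p1 * v2 - p2 * v1) * (q1 * u2 - q2 * u1)"
  for p1 p2 q1 q2 u1 u2 v1 v2 :: complex by (simp add: algebra_simps)
 thus ?thesis unfolding nform_def .
qed

lemma nform_cong:
 assumes "!!i. i < 4 ==> \<phi> (xs i) = \<phi>' (xs i)" "!!i. i < 4 ==> \<psi> (xs i) = \<psi>' (xs i)"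
 shows "nform xs \<phi> \<psi> = nform xs \<phi>' \<psi>'"
 using assms[of 0] assms[of 1] assms[of 2] assms[of 3] by (simp add: nform_def)

lemma nrm_nonneg: "nrm xs \<ge> 0" by (simp add: nrm_def)

text \<open>The quotient \<open>(a^n - b^n) / (a - b)\<close> as a polynomial in the sum
  \<open>S\<close> and the product \<open>P\<close> of \<open>a\<close> and \<open>b\<close>; it
  remains meaningful when the ends of a chord collide.\<close>

fun hsym :: "complex => complex => nat => complex" where
 "hsym S P 0 = 0"
| "hsym S P (Suc 0) = 1"
| "hsym S P (Suc (Suc n)) = S * hsym S P (Suc n) - P * hsym S P n"

lemma power_diff_hsym: "a ^ n - b ^ n = (a - b) * hsym (a + b) (a * b) n"
proof (induction "a + b" "a * b" n rule: hsym.induct)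
 case (3 n)
 have "a ^ Suc (Suc n) - b ^ Suc (Suc n) = (a + b) * (a ^ Suc n - b ^ Suc n) - a * b * (a ^ n - b ^ n)"
  by (simp add: algebra_simps)
 also have "... = (a - b) * hsym (a + b) (a * b) (Suc (Suc n))"
  unfolding 3 by (simp add: algebra_simps)
 finally show ?case .
qed auto

lemma norm_hsym_le:
 assumes "cmod S <= 2" "cmod P <= 1" shows "cmod (hsym S P n) <= 3 ^ n"
 using assms
proof (induction S P n rule: hsym.induct)
 case (3 S P n)
 have "cmod (hsym S P (Suc (Suc n))) <= cmod S * cmod (hsym S P (Suc n)) + cmod P * cmod (hsym S P n)"
  by (simp add: norm_mult[symmetric] norm_triangle_ineq4)
 also have "... <= 2 * 3 ^ Suc n + 1 * 3 ^ n"
  using 3 by (intro add_mono mult_mono) auto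
 also have "... <= 3 ^ Suc (Suc n)" by simp
 finally show ?case .
qed auto

lemma norm_hsym_diff_le:
 assumes "cmod S <= 2" "cmod P <= 1" "cmod S' <= 2" "cmod P' <= 1"
 shows "cmod (hsym S P n - hsym S' P' n) <= 6 ^ n * (cmod (S - S') + cmod (P - P'))"
proof (induction n rule: less_induct)
 case (less n)
 let ?e = "cmod (S - S') + cmod (P - P')"
 consider "n = 0" | "n = Suc 0" | m where "n = Suc (Suc m)" by (metis not0_implies_Suc)
 thus ?case
 proof cases
  case 3
  let ?h = "hsym S P" and ?h' = "hsym S' P'"
  have eq: "?h n - ?h' n = S * (?h (Suc m) - ?h' (Suc m)) + (S - S') * ?h' (Suc m) - P * (?h m - ?h' m) - (P - P') * ?h' m"
   by (simp add: 3 algebra_simps)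
  have e0: "?e \<ge> 0" by simp
  have 1: "cmod (S * (?h (Suc m) - ?h' (Suc m))) <= 2 * (6 ^ Suc m * ?e)"
   unfolding norm_mult using assms less[of "Suc m"] 3 by (intro mult_mono) auto
  have 2: "cmod ((S - S') * ?h' (Suc m)) <= ?e * 3 ^ Suc m"
   unfolding norm_mult by (intro mult_mono norm_hsym_le[OF assms(3,4)]) auto
  have 4: "cmod (P * (?h m - ?h' m)) <= 1 * (6 ^ m * ?e)"
   unfolding norm_mult using assms less[of "m"] 3 by (intro mult_mono) auto
  have 5: "cmod ((P - P') * ?h' m) <= ?e * 3 ^ m"
   unfolding norm_mult using norm_hsym_le[OF assms(3,4)] by (intro mult_mono) auto
  have "cmod (?h n - ?h' n) <= 2 * (6 ^ Suc m * ?e) + ?e * 3 ^ Suc m + 1 * (6 ^ m * ?e) + ?e * 3 ^ m"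
   unfolding eq by (intro order_trans[OF norm_triangle_ineq4] order_trans[OF norm_triangle_ineq] add_mono 1 2 4 5)
  also have "... <= ?e * (13 * 6 ^ m + 4 * 3 ^ m)" by (simp add: algebra_simps)
  also have "... <= ?e * (36 * 6 ^ m)"
  proof (intro mult_left_mono e0)
   have "(3::real) ^ m <= 6 ^ m" by (rule power_mono) auto
   thus "13 * 6 ^ m + 4 * 3 ^ m <= 36 * (6::real) ^ m"
    using zero_le_power[of "6::real" m] by linarith
  qed
  finally show ?thesis by (simp add: 3 mult.commute mult.left_commute)
 qed auto
qed

section \<open>The size of the form in terms of sums and products of chord ends\<close>

definition chord_sum :: "real => real => complex" where "chord_sum x y = cis x + cis y"
definition chord_prod :: "real => real => complex" where "chord_prod x y = cis x * cis y"

text \<open>Chord lengths times the distance of the chords as unordered pairs, measured by sum and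
  product. Near every degeneration it has the same order of magnitude as \<open>nrm\<close>.\<close>

definition mdist :: "conf => real" where
 "mdist xs = cmod (cis (xs 0) - cis (xs 1)) * cmod (cis (xs 2) - cis (xs 3)) *
  (cmod (chord_sum (xs 0) (xs 1) - chord_sum (xs 2) (xs 3)) + cmod (chord_prod (xs 0) (xs 1) - chord_prod (xs 2) (xs 3)))"

lemma chord_bounds: "cmod (chord_sum x y) <= 2" "cmod (chord_prod x y) <= 1"
 using norm_triangle_ineq[of "cis x" "cis y"] by (simp_all add: chord_sum_def chord_prod_def norm_mult)

lemma nform_E:
 "nform xs (E i) (E j) = (cis (xs 0) - cis (xs 1)) * (cis (xs 2) - cis (xs 3)) *
  (hsym (chord_sum (xs 0) (xs 1)) (chord_prod (xs 0) (xs 1)) i * hsym (chord_sum (xs 2) (xs 3)) (chord_prod (xs 2) (xs 3)) j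
  - hsym (chord_sum (xs 2) (xs 3)) (chord_prod (xs 2) (xs 3)) i * hsym (chord_sum (xs 0) (xs 1)) (chord_prod (xs 0) (xs 1)) j)"
 unfolding nform_def E_def power_diff_hsym chord_sum_def chord_prod_def by (simp add: algebra_simps)

text \<open>Both chord lengths factor out of the form. What is left is antisymmetric under exchange
  of the chords, hence bounded by a multiple of the difference of their sums and products.\<close>

lemma norm_nform_E_le: "cmod (nform xs (E i) (E j)) <= 2 * 6 ^ (i + j) * mdist xs"
proof -
 define S P S' P' where "S = chord_sum (xs 0) (xs 1)" "P = chord_prod (xs 0) (xs 1)"
  "S' = chord_sum (xs 2) (xs 3)" "P' = chord_prod (xs 2) (xs 3)"
 note b = chord_bounds[of "xs 0" "xs 1"] chord_bounds[of "xs 2" "xs 3"]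
 let ?e = "cmod (S - S') + cmod (P - P')"
 have b36: "(3::real) ^ k <= 6 ^ k" for k by (rule power_mono) auto
 have "hsym S P i * hsym S' P' j - hsym S' P' i * hsym S P j =
  (hsym S P i - hsym S' P' i) * hsym S' P' j - hsym S' P' i * (hsym S P j - hsym S' P' j)" by (simp add: algebra_simps)
 also have "cmod ... <= (6 ^ i * ?e) * 6 ^ j + 6 ^ i * (6 ^ j * ?e)"
  using b by (intro order_trans[OF norm_triangle_ineq4] add_mono; unfold norm_mult; intro mult_mono norm_hsym_diff_le
   order_trans[OF norm_hsym_le b36]) (auto simp: S_P_S'_P'_def)
 also have "... = 2 * 6 ^ (i + j) * ?e" by (simp add: power_add algebra_simps)
 finally have *: "cmod (hsym S P i * hsym S' P' j - hsym S' P' i * hsym S P j) <= 2 * 6 ^ (i + j) * ?e" .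
 have "cmod (nform xs (E i) (E j)) = cmod (cis (xs 0) - cis (xs 1)) * cmod (cis (xs 2) - cis (xs 3)) *
   cmod (hsym S P i * hsym S' P' j - hsym S' P' i * hsym S P j)"
  unfolding nform_E norm_mult S_P_S'_P'_def by simp
 also have "... <= cmod (cis (xs 0) - cis (xs 1)) * cmod (cis (xs 2) - cis (xs 3)) * (2 * 6 ^ (i + j) * ?e)"
  by (intro mult_left_mono *) auto
 finally show ?thesis by (simp add: mdist_def S_P_S'_P'_def algebra_simps)
qed

lemma nform_E12: "nform xs (E 1) (E 2) = (cis (xs 0) - cis (xs 1)) * (cis (xs 2) - cis (xs 3)) *
  (chord_sum (xs 2) (xs 3) - chord_sum (xs 0) (xs 1))"
 unfolding nform_def E_def chord_sum_def by (simp add: power2_eq_square algebra_simps)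

lemma nform_E13: "nform xs (E 1) (E 3) = (cis (xs 0) - cis (xs 1)) * (cis (xs 2) - cis (xs 3)) *
  (chord_sum (xs 2) (xs 3) ^ 2 - chord_prod (xs 2) (xs 3) - (chord_sum (xs 0) (xs 1) ^ 2 - chord_prod (xs 0) (xs 1)))"
 unfolding nform_def E_def chord_sum_def chord_prod_def by (simp add: power2_eq_square power3_eq_cube algebra_simps)

text \<open>The value on \<open>(E 1, E 2)\<close> gives the difference of the sums. The value on
  \<open>(E 1, E 3)\<close> gives the difference of the products after subtraction of
  \<open>(S' - S) * (S' + S)\<close>, whose second factor is at most 4 in modulus; this makes 5 + 1
  = 6.\<close>

lemma mdist_le_nrm: "mdist xs <= 6 * nrm xs"
proof -
 define S P S' P' where "S = chord_sum (xs 0) (xs 1)" "P = chord_prod (xs 0) (xs 1)"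
  "S' = chord_sum (xs 2) (xs 3)" "P' = chord_prod (xs 2) (xs 3)"
 define k where "k = cmod (cis (xs 0) - cis (xs 1)) * cmod (cis (xs 2) - cis (xs 3))"
 have k0: "k \<ge> 0" by (simp add: k_def)
 define X where "X = S' ^ 2 - P' - (S ^ 2 - P)"
 have "P - P' = X - (S' - S) * (S' + S)" by (simp add: X_def power2_eq_square algebra_simps)
 hence "cmod (P - P') <= cmod X + cmod (S' - S) * cmod (S' + S)"
  using norm_triangle_ineq4[of X "(S' - S) * (S' + S)"] by (simp add: norm_mult)
 also have "... <= cmod X + cmod (S' - S) * 4"
  using chord_bounds[of "xs 0" "xs 1"] chord_bounds[of "xs 2" "xs 3"] norm_triangle_ineq[of S' S]
  by (intro add_left_mono mult_left_mono) (auto simp: S_P_S'_P'_def)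
 finally have "k * (cmod (S - S') + cmod (P - P')) <= k * (5 * cmod (S' - S) + cmod X)"
  using k0 by (intro mult_left_mono) (auto simp: norm_minus_commute)
 also have "... = 5 * cmod (nform xs (E 1) (E 2)) + cmod (nform xs (E 1) (E 3))"
  unfolding nform_E12 nform_E13 norm_mult by (simp add: k_def X_def S_P_S'_P'_def algebra_simps)
 also have "... <= 5 * nrm xs + nrm xs"
  unfolding nrm_def by (intro add_mono mult_left_mono real_sqrt_sum_squares_ge1 real_sqrt_sum_squares_ge2) auto
 finally show ?thesis by (simp add: mdist_def k_def S_P_S'_P'_def)
qed

text \<open>The bound \<open>2 * 6 ^ (i + j)\<close> at i = j = 7 times the constant 6 of
  \<open>mdist_le_nrm\<close>.\<close>

definition CC :: real where "CC = 12 * 6 ^ 14"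

lemma CC_pos: "CC > 0" by (simp add: CC_def)

lemma norm_zform_E_le:
 assumes "i <= 7" "j <= 7" shows "cmod (zform xs (E i) (E j)) <= CC"
proof (cases "nrm xs = 0")
 case False
 hence n: "nrm xs > 0" using nrm_nonneg[of xs] by simp
 have "cmod (nform xs (E i) (E j)) <= 2 * 6 ^ (i + j) * (6 * nrm xs)"
  using norm_nform_E_le[of xs i j] mdist_le_nrm[of xs]
  by (meson mult_left_mono order_trans zero_le_mult_iff zero_le_numeral zero_le_power)
 also have "... <= 2 * 6 ^ 14 * (6 * nrm xs)"
  using n assms by (intro mult_right_mono mult_left_mono power_increasing) auto
 finally show ?thesis using n by (simp add: zform_def norm_divide CC_def field_simps)
qed (simp add: zform_def CC_def)

lemma mdist_eq_0_iff:
 "mdist xs = 0 \<longleftrightarrow> cis (xs 0) = cis (xs 1) \<or> cis (xs 2) = cis (xs 3) \<or>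
  chord_sum (xs 0) (xs 1) = chord_sum (xs 2) (xs 3) & chord_prod (xs 0) (xs 1) = chord_prod (xs 2) (xs 3)"
 by (auto simp: mdist_def add_nonneg_eq_0_iff)

lemma nrm_eq_0_iff: "nrm xs = 0 \<longleftrightarrow> mdist xs = 0"
proof
 assume "nrm xs = 0"
 moreover have "mdist xs \<ge> 0" by (simp add: mdist_def)
 ultimately show "mdist xs = 0" using mdist_le_nrm[of xs] by simp
next
 assume "mdist xs = 0"
 hence "nform xs (E i) (E j) = 0" for i j using norm_nform_E_le[of xs i j] by simp
 thus "nrm xs = 0" by (simp add: nrm_def)
qed

lemma chord_eq_iff:
 "chord_sum x y = chord_sum x' y' & chord_prod x y = chord_prod x' y' \<longleftrightarrow>
  cis x = cis x' & cis y = cis y' \<or> cis x = cis y' & cis y = cis x'"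
proof
 assume *: "chord_sum x y = chord_sum x' y' & chord_prod x y = chord_prod x' y'"
 have "(cis x - cis x') * (cis x - cis y') = cis x * cis x - chord_sum x' y' * cis x + chord_prod x' y'"
  by (simp add: chord_sum_def chord_prod_def algebra_simps)
 also have "... = 0" unfolding *[THEN conjunct1, symmetric] *[THEN conjunct2, symmetric]
  by (simp add: chord_sum_def chord_prod_def algebra_simps)
 finally show "cis x = cis x' & cis y = cis y' \<or> cis x = cis y' & cis y = cis x'"
  using * by (auto simp: chord_sum_def)
qed (auto simp: chord_sum_def chord_prod_def)

lemma nrm_pos_iff:
 "nrm xs > 0 \<longleftrightarrow> cis (xs 0) ~= cis (xs 1) & cis (xs 2) ~= cis (xs 3) \<and>
  \<not> (cis (xs 0) = cis (xs 2) & cis (xs 1) = cis (xs 3)) & \<not> (cis (xs 0) = cis (xs 3) & cis (xs 1) = cis (xs 2))"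
proof -
 have "nrm xs > 0 \<longleftrightarrow> mdist xs ~= 0" using nrm_eq_0_iff[of xs] nrm_nonneg[of xs] by linarith
 thus ?thesis unfolding mdist_eq_0_iff chord_eq_iff by blast
qed

subsection \<open>Bounded interpolation\<close>

definition pnorm :: "complex poly => real" where "pnorm p = (\<Sum>i\<le>degree p. cmod (poly.coeff p i))"

lemma pnorm_eq: "degree p <= n ==> pnorm p = (\<Sum>i\<le>n. cmod (poly.coeff p i))"
 unfolding pnorm_def by (rule sum.mono_neutral_left) (auto simp: coeff_eq_0)

lemma pnorm_nonneg: "pnorm p \<ge> 0" by (simp add: pnorm_def sum_nonneg)

lemma pnorm_0: "pnorm 0 = 0" by (simp add: pnorm_def)

lemma pnorm_pCons: "pnorm (pCons a p) = cmod a + pnorm p"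
proof -
 have "pnorm (pCons a p) = (\<Sum>i\<le>Suc (degree p). cmod (poly.coeff (pCons a p) i))"
  by (rule pnorm_eq) (simp add: degree_pCons_le)
 also have "... = cmod a + (\<Sum>i\<le>degree p. cmod (poly.coeff p i))" by (subst sum.atMost_Suc_shift) simp
 finally show ?thesis by (simp only: pnorm_def)
qed

lemma pnorm_monom: "pnorm (Polynomial.monom c n) = cmod c" by (induction n) (simp_all add: monom_Suc monom_0 pnorm_pCons pnorm_0)

lemma pnorm_add: "pnorm (p + q) <= pnorm p + pnorm q"
proof -
 let ?n = "max (degree p) (degree q)"
 have "pnorm (p + q) = (\<Sum>i\<le>?n. cmod (poly.coeff p i + poly.coeff q i))"
  using pnorm_eq[of "p + q" ?n] degree_add_le_max[of p q] by simp
 also have "... <= (\<Sum>i\<le>?n. cmod (poly.coeff p i) + cmod (poly.coeff q i))" by (intro sum_mono norm_triangle_ineq)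
 finally show ?thesis using pnorm_eq[of p ?n] pnorm_eq[of q ?n] by (simp add: sum.distrib)
qed

lemma pnorm_smult: "pnorm (Polynomial.smult c p) = cmod c * pnorm p"
 by (induction p) (simp_all add: pnorm_0 pnorm_pCons norm_mult algebra_simps)

lemma pnorm_diff: "pnorm (p - q) <= pnorm p + pnorm q"
 using pnorm_add[of p "- q"] pnorm_smult[of "-1" q] by simp

lemma pnorm_mult: "pnorm (p * q) <= pnorm p * pnorm q"
proof (induction p)
 case (pCons a p)
 have "pnorm (pCons a p * q) <= pnorm (Polynomial.smult a q) + pnorm (pCons 0 (p * q))"
  unfolding mult_pCons_left by (rule pnorm_add)
 also have "... <= cmod a * pnorm q + pnorm p * pnorm q" using pCons by (simp add: pnorm_smult pnorm_pCons)
 finally show ?case by (simp add: pnorm_pCons algebra_simps)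
qed (simp add: pnorm_0)

lemma pnorm_coeff: "cmod (poly.coeff p i) <= pnorm p"
proof (cases "i <= degree p")
 case True
 thus ?thesis unfolding pnorm_def by (intro member_le_sum[of i _ "%i. cmod (poly.coeff p i)"]) auto
qed (simp add: coeff_eq_0 pnorm_nonneg)

lemma node_poly:
 assumes "finite Z" "!!z. z \<in> Z ==> cmod z = 1"
 obtains \<Omega> where "degree \<Omega> = card Z" "poly.coeff \<Omega> (card Z) = 1" "pnorm \<Omega> <= 2 ^ card Z" "!!z. z \<in> Z ==> poly \<Omega> z = 0"
proof -
 have "\<exists>\<Omega>. degree \<Omega> = card Z & poly.coeff \<Omega> (card Z) = 1 & pnorm \<Omega> <= 2 ^ card Z & (\<forall>z\<in>Z. poly \<Omega> z = 0)"
  using assms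
 proof (induction Z rule: finite_induct)
  case empty
  show ?case by (intro exI[of _ 1]) (simp add: pnorm_def)
 next
  case (insert z Z)
  then obtain \<Omega> where \<Omega>: "degree \<Omega> = card Z" "poly.coeff \<Omega> (card Z) = 1" "pnorm \<Omega> <= 2 ^ card Z" "\<forall>z\<in>Z. poly \<Omega> z = 0"
   by auto
  have nz: "\<Omega> ~= 0" using \<Omega>(2) by auto
  have "degree ([:- z, 1:] * \<Omega>) = Suc (card Z)" using \<Omega>(1) nz by (subst degree_mult_eq) auto
  moreover have "poly.coeff ([:- z, 1:] * \<Omega>) (Suc (card Z)) = 1"
   using \<Omega>(1,2) by (simp add: coeff_eq_0)
  moreover have "pnorm ([:- z, 1:] * \<Omega>) <= 2 ^ Suc (card Z)"
  proof -
   have "pnorm [:- z, 1:] = 2" using insert.prems by (simp add: pnorm_pCons pnorm_0)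
   thus ?thesis using pnorm_mult[of "[:- z, 1:]" \<Omega>] \<Omega>(3) by simp
  qed
  ultimately show ?case using \<Omega>(4) insert by (intro exI[of _ "[:- z, 1:] * \<Omega>"]) auto
 qed
 thus ?thesis using that by blast
qed

text \<open>Subtraction of a multiple of the monic polynomial that vanishes on \<open>Z\<close>
  lowers the degree without changing the values on \<open>Z\<close>. Its norm is at most 2^8, so
  each step costs a factor 1 + 2^8 = 257.\<close>

lemma reduce_degree:
 assumes Z: "finite Z" "!!z. z \<in> Z ==> cmod z = 1" "card Z <= 8"
 shows "degree q <= 7 + k ==> \<exists>r. degree r <= 7 & pnorm r <= 257 ^ k * pnorm q & (\<forall>z\<in>Z. poly r z = poly q z)"
proof (induction k arbitrary: q)
 case 0
 thus ?case by (intro exI[of _ q]) simp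
next
 case (Suc k)
 show ?case
 proof (cases "degree q <= 7 + k")
  case True
  then obtain r where r: "degree r <= 7" "pnorm r <= 257 ^ k * pnorm q" "\<forall>z\<in>Z. poly r z = poly q z"
   using Suc.IH by blast
  have "257 ^ k * pnorm q <= 257 ^ Suc k * pnorm q" by (intro mult_right_mono pnorm_nonneg) simp
  with r(2) have "pnorm r <= 257 ^ Suc k * pnorm q" by (rule order_trans)
  thus ?thesis using r by (intro exI[of _ r]) auto
 next
  case False
  define d where "d = degree q"
  have d: "d = 8 + k" using False Suc.prems by (simp add: d_def)
  obtain \<Omega> where \<Omega>: "degree \<Omega> = card Z" "poly.coeff \<Omega> (card Z) = 1" "pnorm \<Omega> <= 2 ^ card Z" "!!z. z \<in> Z ==> poly \<Omega> z = 0"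
   using node_poly[OF Z(1,2)] by blast
  define c where "c = poly.coeff q d"
  define m where "m = Polynomial.monom c (d - card Z) * \<Omega>"
  have "poly.coeff (q - m) i = 0" if "i > 7 + k" for i
  proof (cases "i = d")
   case True
   thus ?thesis using \<Omega>(2) d Z(3) by (simp add: m_def coeff_monom_mult c_def)
  next
   case False
   hence "i > d" using that d by simp
   thus ?thesis using \<Omega>(1) Z(3) d by (auto simp: m_def coeff_monom_mult d_def[symmetric] coeff_eq_0)
  qed
  hence "degree (q - m) <= 7 + k" by (intro degree_le) auto
  then obtain r where r: "degree r <= 7" "pnorm r <= 257 ^ k * pnorm (q - m)" "\<forall>z\<in>Z. poly r z = poly (q - m) z"
   using Suc.IH by blast
  have "pnorm (Polynomial.monom c (d - card Z)) = cmod c" by (rule pnorm_monom)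
  hence "pnorm m <= cmod c * pnorm \<Omega>" using pnorm_mult[of "Polynomial.monom c (d - card Z)" \<Omega>] by (simp add: m_def)
  also have "... <= pnorm q * 2 ^ 8"
   using \<Omega>(3) Z(3) pnorm_coeff[of q d] power_increasing[OF Z(3), of "2::real"]
   by (intro mult_mono pnorm_nonneg) (auto simp: c_def)
  finally have "pnorm (q - m) <= 257 * pnorm q" using pnorm_diff[of q m] by simp
  hence "257 ^ k * pnorm (q - m) <= 257 ^ k * (257 * pnorm q)" by (intro mult_left_mono) auto
  also have "... = 257 ^ Suc k * pnorm q" by (simp only: power_Suc mult_ac)
  finally have "pnorm r <= 257 ^ Suc k * pnorm q" by (rule order_trans[OF r(2)])
  moreover have "poly (q - m) z = poly q z" if "z \<in> Z" for z using \<Omega>(4)[OF that] by (simp add: m_def)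
  hence "\<forall>z\<in>Z. poly r z = poly q z" using r(3) by simp
  ultimately show ?thesis using r(1) by (intro exI[of _ r] conjI)
 qed
qed

text \<open>A uniform interpolation property: the bound \<open>B\<close> does not depend on the
  position of the nodes, which may be arbitrarily close. Eight is the number of points of two
  quadruples that are compared with each other.\<close>

definition good :: "real set => real => (real => complex) => bool" where
 "good K B \<phi> \<longleftrightarrow> (\<forall>S. finite S & S \<subseteq> K & card (cis ` S) <= 8 -->
  (\<exists>r. degree r <= 7 & pnorm r <= B & (\<forall>x\<in>S. poly r (cis x) = \<phi> x)))"

lemma goodD:
 assumes "good K B \<phi>" "finite S" "S \<subseteq> K" "card (cis ` S) <= 8"
 obtains r where "degree r <= 7" "pnorm r <= B" "!!x. x \<in> S ==> poly r (cis x) = \<phi> x"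
proof -
 have "\<exists>r. degree r <= 7 & pnorm r <= B & (\<forall>x\<in>S. poly r (cis x) = \<phi> x)"
  using assms(1)[unfolded good_def, rule_format, of S] assms(2-4) by simp
 thus ?thesis using that by blast
qed

lemma good_nonneg: "good K B \<phi> ==> B \<ge> 0" by (rule goodD[of K B \<phi> "{}"]) (auto intro: order_trans[OF pnorm_nonneg])

lemma good_mono: "good K B \<phi> ==> B <= B' ==> L \<subseteq> K ==> good L B' \<phi>"
 unfolding good_def by (elim all_forward) force

lemma good_const: "good K (cmod c) (%x. c)"
 unfolding good_def by (intro allI impI exI[of _ "[:c:]"]) (simp add: pnorm_pCons pnorm_0)

lemma good_cis: "good K 1 cis"
 unfolding good_def by (intro allI impI exI[of _ "[:0, 1:]"]) (simp add: pnorm_pCons pnorm_0)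

lemma good_add: "good K B \<phi> ==> good K B' \<psi> ==> good K (B + B') (%x. \<phi> x + \<psi> x)"
 unfolding good_def[of _ "B + B'"]
proof (intro allI impI)
 fix S
 assume *: "good K B \<phi>" "good K B' \<psi>" and S: "finite S & S \<subseteq> K & card (cis ` S) <= 8"
 obtain r where r: "degree r <= 7" "pnorm r <= B" "!!x. x \<in> S ==> poly r (cis x) = \<phi> x" using goodD[OF *(1), of S] S by blast
 obtain r' where r': "degree r' <= 7" "pnorm r' <= B'" "!!x. x \<in> S ==> poly r' (cis x) = \<psi> x" using goodD[OF *(2), of S] S by blast
 show "\<exists>r. degree r <= 7 & pnorm r <= B + B' & (\<forall>x\<in>S. poly r (cis x) = \<phi> x + \<psi> x)"
  using pnorm_add[of r r'] r r' by (intro exI[of _ "r + r'"]) (auto intro: degree_add_le)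
qed

lemma good_mult: "good K B \<phi> ==> good K B' \<psi> ==> good K (257 ^ 7 * (B * B')) (%x. \<phi> x * \<psi> x)"
 unfolding good_def[of _ "257 ^ 7 * (B * B')"]
proof (intro allI impI)
 fix S
 assume *: "good K B \<phi>" "good K B' \<psi>" and S: "finite S & S \<subseteq> K & card (cis ` S) <= 8"
 obtain r where r: "degree r <= 7" "pnorm r <= B" "!!x. x \<in> S ==> poly r (cis x) = \<phi> x" using goodD[OF *(1), of S] S by blast
 obtain r' where r': "degree r' <= 7" "pnorm r' <= B'" "!!x. x \<in> S ==> poly r' (cis x) = \<psi> x" using goodD[OF *(2), of S] S by blast
 have "degree (r * r') <= 7 + 7" using degree_mult_le[of r r'] r(1) r'(1) by linarith
 then obtain q where q: "degree q <= 7" "pnorm q <= 257 ^ 7 * pnorm (r * r')" "\<forall>z\<in>cis ` S. poly q z = poly (r * r') z"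
  using reduce_degree[of "cis ` S" "r * r'" 7] S by fastforce
 have "pnorm (r * r') <= B * B'"
  using pnorm_mult[of r r'] mult_mono[OF r(2) r'(2) good_nonneg[OF *(1)] pnorm_nonneg] by linarith
 thus "\<exists>q. degree q <= 7 & pnorm q <= 257 ^ 7 * (B * B') & (\<forall>x\<in>S. poly q (cis x) = \<phi> x * \<psi> x)"
  using q r(3) r'(3) by (intro exI[of _ q]) auto
qed

fun inv_bound :: "real => real => nat => real" where
 "inv_bound M k 0 = 0"
| "inv_bound M k (Suc n) = inv_bound M k n + (1 + 2 * M * inv_bound M k n) / k"

lemma inv_bound_mono:
 assumes "M \<ge> 0" "k > 0" shows "inv_bound M k n \<ge> 0" "m <= n ==> inv_bound M k m <= inv_bound M k n"
proof -
 have *: "inv_bound M k n \<ge> 0" for n using assms by (induction n) auto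
 show "inv_bound M k n \<ge> 0" by (rule *)
 show "m <= n ==> inv_bound M k m <= inv_bound M k n" by (rule lift_Suc_mono_le[of "inv_bound M k"]) (use * assms in auto)
qed

text \<open>Newton interpolation of the inverse, one node at a time. The correction divides by the
  value \<open>c\<close> of the linear function at the new node and never by a difference of nodes,
  so the bound depends on \<open>k\<close> and \<open>M\<close> alone.\<close>

lemma good_inverse:
 assumes M: "cmod \<alpha> <= M" "cmod \<beta> <= M" and k: "k > 0" "!!x. x \<in> K ==> cmod (\<alpha> + \<beta> * cis x) \<ge> k"
 shows "good K (inv_bound M k 8) (%x. inverse (\<alpha> + \<beta> * cis x))"
 unfolding good_def
proof (intro allI impI)
 fix S assume S: "finite S & S \<subseteq> K & card (cis ` S) <= 8"
 have M0: "M \<ge> 0" using M(1) norm_ge_zero order_trans by blast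
 have "\<exists>r. degree r <= card Z - 1 & (Z = {} --> r = 0) & pnorm r <= inv_bound M k (card Z) & (\<forall>z\<in>Z. (\<alpha> + \<beta> * z) * poly r z = 1)"
  if "finite Z" "\<forall>z\<in>Z. cmod (\<alpha> + \<beta> * z) \<ge> k" for Z
  using that
 proof (induction Z rule: finite_induct)
  case empty
  show ?case by (intro exI[of _ 0]) (simp add: pnorm_0)
 next
  case (insert z Z)
  then obtain r where r: "degree r <= card Z - 1" "Z = {} --> r = 0" "pnorm r <= inv_bound M k (card Z)"
   "\<forall>z\<in>Z. (\<alpha> + \<beta> * z) * poly r z = 1" by auto
  \<comment> \<open>The residual vanishes at the old nodes; adding \<open>e / c\<close> to
    \<open>r\<close> keeps the values there and makes the residual vanish at the new node.\<close>
  define e where "e = 1 - [:\<alpha>, \<beta>:] * r"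
  define c where "c = \<alpha> + \<beta> * z"
  have c: "cmod c \<ge> k" using insert.prems by (simp add: c_def)
  hence c0: "c ~= 0" using k(1) by auto
  let ?r = "r + Polynomial.smult (1 / c) e"
  have "degree ([:\<alpha>, \<beta>:] * r) <= card Z"
  proof (cases "Z = {}")
   case False
   hence "card Z > 0" using insert by (simp add: card_gt_0_iff)
   have "degree ([:\<alpha>, \<beta>:] * r) <= degree [:\<alpha>, \<beta>:] + degree r" by (rule degree_mult_le)
   also have "... <= 1 + (card Z - 1)" using r(1) by (intro add_mono) auto
   finally show ?thesis using \<open>card Z > 0\<close> by simp
  qed (use r in simp)
  hence "degree e <= card Z" unfolding e_def by (intro degree_diff_le) auto
  hence "degree ?r <= card Z" using r(1) by (intro degree_add_le) (auto intro: order_trans[OF degree_smult_le])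
  moreover have "pnorm e <= 1 + 2 * M * inv_bound M k (card Z)"
  proof -
   have "pnorm ([:\<alpha>, \<beta>:] * r) <= pnorm [:\<alpha>, \<beta>:] * pnorm r" by (rule pnorm_mult)
   also have "... <= (2 * M) * inv_bound M k (card Z)"
    using r(3) M M0 by (intro mult_mono pnorm_nonneg) (auto simp: pnorm_pCons pnorm_0)
   finally show ?thesis using pnorm_diff[of 1 "[:\<alpha>, \<beta>:] * r"] by (simp add: e_def one_pCons pnorm_pCons pnorm_0)
  qed
  hence "pnorm (Polynomial.smult (1 / c) e) <= (1 + 2 * M * inv_bound M k (card Z)) / k"
   using c k(1) pnorm_nonneg[of e] by (simp add: pnorm_smult norm_divide) (meson frac_le order_trans pnorm_nonneg)
  hence "pnorm ?r <= inv_bound M k (card (insert z Z))"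
   using pnorm_add[of r "Polynomial.smult (1 / c) e"] r(3) insert by simp
  moreover have "(\<alpha> + \<beta> * y) * poly ?r y = 1" if "y \<in> insert z Z" for y
  proof (cases "y = z")
   case True
   have "poly ?r z = 1 / c" using c0 by (simp add: e_def c_def[symmetric] field_simps) (simp add: c_def algebra_simps)
   thus ?thesis using True c0 by (simp add: c_def)
  next
   case False
   hence "y \<in> Z" using that by simp
   hence "poly e y = 1 - (\<alpha> + \<beta> * y) * poly r y" by (simp add: e_def algebra_simps)
   hence "poly e y = 0" using r(4) \<open>y \<in> Z\<close> by simp
   thus ?thesis using r(4) \<open>y \<in> Z\<close> by simp
  qed
  ultimately show ?case using insert by (intro exI[of _ ?r]) auto
 qed
 from this[of "cis ` S"] obtain r where r: "degree r <= card (cis ` S) - 1" "pnorm r <= inv_bound M k (card (cis ` S))"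
  "\<forall>x\<in>S. (\<alpha> + \<beta> * cis x) * poly r (cis x) = 1" using S k(2) by auto
 have "poly r (cis x) = inverse (\<alpha> + \<beta> * cis x)" if "x \<in> S" for x
  using r(3) that by (metis inverse_unique)
 moreover have "pnorm r <= inv_bound M k 8"
  using r(2) inv_bound_mono(2)[OF M0 k(1)] S by (meson order_trans)
 ultimately show "\<exists>r. degree r <= 7 & pnorm r <= inv_bound M k 8 & (\<forall>x\<in>S. poly r (cis x) = inverse (\<alpha> + \<beta> * cis x))"
  using r(1) S by (intro exI[of _ r]) auto
qed

subsection \<open>Transfer of closeness from monomials to interpolable functions\<close>

definition nodes :: "conf => real set" where "nodes xs = xs ` {..<4}"

lemma nodes_simps: "finite (nodes xs)" "card (cis ` nodes xs) <= 4"
 unfolding nodes_def by (auto simp: image_image intro: order_trans[OF card_image_le])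

lemma zform_poly:
 assumes "degree r <= n" "degree s <= n" "!!x. x \<in> nodes xs ==> poly r (cis x) = \<phi> x" "!!x. x \<in> nodes xs ==> poly s (cis x) = \<psi> x"
 shows "zform xs \<phi> \<psi> = (\<Sum>i\<le>n. \<Sum>j\<le>n. poly.coeff r i * poly.coeff s j * zform xs (E i) (E j))"
proof -
 have p: "poly r (cis x) = (\<Sum>i\<le>n. poly.coeff r i * E i x)" if "degree r <= n" for r x
  unfolding poly_altdef E_def by (rule sum.mono_neutral_left) (use that in \<open>auto simp: coeff_eq_0\<close>)
 have "nform xs \<phi> \<psi> = nform xs (%x. \<Sum>i\<le>n. poly.coeff r i * E i x) (%x. \<Sum>i\<le>n. poly.coeff s i * E i x)"
  by (intro nform_cong) (use assms in \<open>simp_all add: p[symmetric] nodes_def\<close>)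
 also have "... = (\<Sum>i\<le>n. \<Sum>j\<le>n. poly.coeff r i * poly.coeff s j * nform xs (E i) (E j))"
  unfolding nform_sum nform_bilinear sum_distrib_left by (simp add: mult.assoc)
 finally show ?thesis by (simp add: zform_def sum_divide_distrib)
qed

lemma norm_double_sum_le:
 assumes "!!i j. i <= n ==> j <= n ==> cmod (B i j) <= c" "degree r <= n" "degree s <= n"
 shows "cmod (\<Sum>i\<le>n. \<Sum>j\<le>n. poly.coeff r i * poly.coeff s j * B i j) <= pnorm r * pnorm s * c"
proof -
 have "cmod (\<Sum>i\<le>n. \<Sum>j\<le>n. poly.coeff r i * poly.coeff s j * B i j) \<le>
  (\<Sum>i\<le>n. \<Sum>j\<le>n. cmod (poly.coeff r i) * cmod (poly.coeff s j) * c)"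
  using assms(1) by (intro sum_norm_le) (auto simp: norm_mult intro!: mult_left_mono)
 also have "... = pnorm r * pnorm s * c"
  unfolding pnorm_eq[OF assms(2)] pnorm_eq[OF assms(3)] by (subst sum_product) (simp only: sum_distrib_right)
 finally show ?thesis .
qed

lemma norm_zform_le:
 assumes "good K B \<phi>" "good K B' \<psi>" "nodes xs \<subseteq> K" shows "cmod (zform xs \<phi> \<psi>) <= B * B' * CC"
proof -
 have c: "card (cis ` nodes xs) <= 8" using nodes_simps(2)[of xs] by simp
 obtain r where r: "degree r <= 7" "pnorm r <= B" "!!x. x \<in> nodes xs ==> poly r (cis x) = \<phi> x"
  using goodD[OF assms(1) nodes_simps(1) assms(3) c] by blast
 obtain s where s: "degree s <= 7" "pnorm s <= B'" "!!x. x \<in> nodes xs ==> poly s (cis x) = \<psi> x"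
  using goodD[OF assms(2) nodes_simps(1) assms(3) c] by blast
 have "cmod (zform xs \<phi> \<psi>) <= pnorm r * pnorm s * CC"
  using norm_double_sum_le[OF norm_zform_E_le r(1) s(1)] zform_poly[OF r(1) s(1) r(3) s(3)] by simp
 also have "... <= B * B' * CC"
  using r(2) s(2) good_nonneg[OF assms(1)] CC_pos by (intro mult_right_mono mult_mono) (auto simp: pnorm_nonneg)
 finally show ?thesis .
qed

text \<open>The nodes of both quadruples are interpolated by the same two polynomials of degree 7.
  The comparison then involves monomials only, and it survives any collision because the
  coefficients are bounded.\<close>

lemma zform_transfer:
 assumes "good K B \<phi>" "good K B' \<psi>" "nodes xs \<subseteq> K" "nodes ys \<subseteq> K"
  "!!i j. i <= 7 ==> j <= 7 ==> cmod (zform xs (E i) (E j) - \<sigma> * zform ys (E i) (E j)) <= e"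
 shows "cmod (zform xs \<phi> \<psi> - \<sigma> * zform ys \<phi> \<psi>) <= B * B' * e"
proof -
 let ?S = "nodes xs \<union> nodes ys"
 have c: "card (cis ` ?S) <= 8" using nodes_simps(2)[of xs] nodes_simps(2)[of ys]
  unfolding image_Un by (intro order_trans[OF card_Un_le]) simp
 have f: "finite ?S" "?S \<subseteq> K" using assms by (auto simp: nodes_simps)
 obtain r where r: "degree r <= 7" "pnorm r <= B" "!!x. x \<in> ?S ==> poly r (cis x) = \<phi> x"
  using goodD[OF assms(1) f c] by blast
 obtain s where s: "degree s <= 7" "pnorm s <= B'" "!!x. x \<in> ?S ==> poly s (cis x) = \<psi> x"
  using goodD[OF assms(2) f c] by blast
 have "e \<ge> 0" using assms(5)[of 0 0] norm_ge_zero order_trans by blast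
 have "zform xs \<phi> \<psi> - \<sigma> * zform ys \<phi> \<psi> = (\<Sum>i\<le>7. \<Sum>j\<le>7. poly.coeff r i * poly.coeff s j * (zform xs (E i) (E j) - \<sigma> * zform ys (E i) (E j)))"
  using zform_poly[OF r(1) s(1), of xs \<phi> \<psi>] zform_poly[OF r(1) s(1), of ys \<phi> \<psi>] r(3) s(3)
  by (simp add: sum_distrib_left sum_subtractf algebra_simps)
 also have "cmod ... <= pnorm r * pnorm s * e" by (intro norm_double_sum_le assms(5) r s)
 also have "... <= B * B' * e"
  using r(2) s(2) good_nonneg[OF assms(1)] \<open>e \<ge> 0\<close> by (intro mult_right_mono mult_mono) (auto simp: pnorm_nonneg)
 finally show ?thesis .
qed

subsection \<open>The form evaluated on a smooth function\<close>

text \<open>Jordan's inequality, by concavity of the sine on the first quadrant.\<close>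

lemma abs_le_half_pi_sin:
 fixes u :: real assumes "\<bar>u\<bar> <= pi / 2" shows "\<bar>u\<bar> <= pi / 2 * \<bar>sin u\<bar>"
proof -
 have *: "u <= pi / 2 * sin u" if "0 <= u" "u <= pi / 2" for u :: real
 proof -
  have "concave_on {0..pi/2} (sin :: real => real)"
  proof (rule f''_le0_imp_concave)
   show "(sin has_real_derivative cos x) (at x)" "(cos has_real_derivative - sin x) (at x)" for x :: real
    by (auto intro!: derivative_eq_intros)
   show "- sin x <= 0" if "x \<in> {0..pi/2}" for x :: real
    using that by (auto intro!: sin_ge_zero)
  qed auto
  from concave_onD[OF this, of "2 * u / pi" 0 "pi/2"] that
  have "2 * u / pi <= sin u" by (auto simp: field_simps)
  thus ?thesis by (simp add: field_simps)
 qed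
 show ?thesis using *[of "\<bar>u\<bar>"] assms sin_ge_zero[of "\<bar>u\<bar>"] by (cases "u \<ge> 0") auto
qed

lemma periodic_int:
 fixes f :: "real => 'a" and m :: int
 assumes "!!x. f (x + 2 * pi) = f x" shows "f (x + 2 * pi * of_int m) = f x"
proof -
 have n: "f (x + 2 * pi * of_nat n) = f x" for n :: nat and x
 proof (induction n)
  case (Suc n)
  have "f (x + 2 * pi * of_nat (Suc n)) = f ((x + 2 * pi * of_nat n) + 2 * pi)" by (simp add: algebra_simps)
  thus ?case using Suc assms by simp
 qed simp
 show ?thesis
 proof (cases "m \<ge> 0")
  case True
  thus ?thesis using n[of x "nat m"] by simp
 next
  case False
  thus ?thesis using n[of "x + 2 * pi * of_int m" "nat (- m)"] by simp
 qed
qed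

lemma nearest_multiple_pi:
 fixes s :: real obtains m :: int where "\<bar>s - of_int m * pi\<bar> <= pi / 2"
proof -
 have "\<bar>of_int (round (s / pi)) - s / pi\<bar> <= 1 / 2" by (rule of_int_round_abs_le)
 hence "\<bar>of_int (round (s / pi)) - s / pi\<bar> * pi <= 1 / 2 * pi" by (intro mult_right_mono) auto
 moreover have "\<bar>of_int (round (s / pi)) - s / pi\<bar> * pi = \<bar>s - of_int (round (s / pi)) * pi\<bar>"
  by (subst abs_minus_commute, subst (2) abs_of_pos[OF pi_gt_zero, symmetric], subst abs_mult[symmetric])
   (simp add: algebra_simps)
 ultimately show ?thesis using that[of "round (s / pi)"] by simp
qed

lemma mvt_bound:
 fixes F :: "real => real"
 assumes "!!x. (F has_real_derivative F' x) (at x)" "!!x. \<bar>F' x\<bar> <= e"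
 shows "\<bar>F x - F y\<bar> <= e * \<bar>x - y\<bar>"
proof -
 have "norm (F x - F y) <= e * norm (x - y)" by (rule field_differentiable_bound[of UNIV F F']) (use assms in auto)
 thus ?thesis by simp
qed

lemma sin_int_times_pi: "sin (of_int m * pi) = 0"
 using sin_zero_iff_int2 by blast

lemma cis_periodic: "cis (x + 2 * pi) = cis x" by (simp add: complex_eq_iff)

text \<open>Shifting one end by a multiple of the period brings the half difference into the
  interval from \<open>- pi / 2\<close> to \<open>pi / 2\<close>, where its size is comparable to
  its sine.\<close>

lemma periodic_chord_bound:
 fixes F :: "real => real"
 assumes "!!x. (F has_real_derivative F' x) (at x)" "!!x. \<bar>F' x\<bar> <= e" "!!x. F (x + 2 * pi) = F x"
 shows "\<bar>F (c + s) - F (c - s)\<bar> <= pi * e * \<bar>sin s\<bar>"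
proof -
 obtain m :: int where m: "\<bar>s - of_int m * pi\<bar> <= pi / 2" by (rule nearest_multiple_pi)
 have e: "e \<ge> 0" using assms(2)[of 0] by linarith
 have "F (c - s) = F (c - s + 2 * pi * of_int m)" using periodic_int[of F, OF assms(3)] by simp
 hence "\<bar>F (c + s) - F (c - s)\<bar> <= e * \<bar>(c + s) - (c - s + 2 * pi * of_int m)\<bar>"
  using mvt_bound[OF assms(1,2)] by presburger
 also have "(c + s) - (c - s + 2 * pi * of_int m) = 2 * (s - of_int m * pi)" by (simp add: algebra_simps)
 also have "e * \<bar>2 * (s - of_int m * pi)\<bar> = e * (2 * \<bar>s - of_int m * pi\<bar>)" by (simp only: abs_mult abs_numeral)
 also have "... <= e * (2 * (pi / 2 * \<bar>sin (s - of_int m * pi)\<bar>))"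
  using abs_le_half_pi_sin[OF m] e by (intro mult_left_mono) auto
 also have "\<bar>sin (s - of_int m * pi)\<bar> = \<bar>sin s\<bar>"
 proof -
  have "sin (of_int m * pi) = 0" by (rule sin_int_times_pi)
  moreover have "\<bar>cos (of_int m * pi)\<bar> = 1" using sin_cos_squared_add[of "of_int m * pi"] calculation
   by (simp add: abs_square_eq_1)
  ultimately show ?thesis by (simp add: sin_diff abs_mult)
 qed
 finally show ?thesis by (simp add: mult_ac)
qed

text \<open>For smooth functions the part of \<open>hsym\<close> is taken by the difference quotient
  of a chord. Bounds on three derivatives make it Lipschitz in the sum and the product of the ends,
  uniformly up to collisions.\<close>

locale periodic_C3 =
 fixes f0 f1 f2 f3 :: "real => real" and e :: real
 assumes der: "!!x. (f0 has_real_derivative f1 x) (at x)" "!!x. (f1 has_real_derivative f2 x) (at x)"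
   "!!x. (f2 has_real_derivative f3 x) (at x)"
  and bnd: "!!x. \<bar>f1 x\<bar> <= e" "!!x. \<bar>f2 x\<bar> <= e" "!!x. \<bar>f3 x\<bar> <= e"
  and per: "!!x. f0 (x + 2 * pi) = f0 x" "!!x. f1 (x + 2 * pi) = f1 x" "!!x. f2 (x + 2 * pi) = f2 x"
begin

lemma e_nonneg: "e \<ge> 0" using bnd(1)[of 0] by linarith

text \<open>The difference quotient in terms of midpoint and half length. It is even and periodic in
  \<open>s\<close>, hence a function of \<open>cos s\<close>, and \<open>cos s\<close> together with
  \<open>c\<close> describes the unordered chord.\<close>

definition k :: "real => real => real" where "k c s = (f0 (c + s) - f0 (c - s)) / sin s"

lemma k_bound: "\<bar>k c s\<bar> <= pi * e"
proof (cases "sin s = 0")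
 case False
 thus ?thesis using periodic_chord_bound[OF der(1) bnd(1) per(1), of c s] by (simp add: k_def field_simps)
qed (simp add: k_def e_nonneg)

lemma k_cos_eq: "\<exists>t. 0 <= t & t <= pi & cos t = cos s & k c t = k c s"
proof -
 let ?t = "arccos (cos s)"
 have t: "0 <= ?t" "?t <= pi" "cos ?t = cos s" by (auto simp: arccos_lbound arccos_ubound)
 then obtain x where x: "x \<in> \<int>" "?t = s + 2 * x * pi \<or> ?t = - s + 2 * x * pi"
  using cos_eq[of ?t s] by (auto simp: Ints_def)
 then obtain m :: int where m: "x = of_int m" by (auto simp: Ints_def)
 have "k c (s + 2 * pi * of_int m) = k c s" for s
 proof -
  have "f0 (c + (s + 2 * pi * of_int m)) = f0 (c + s)"
   using periodic_int[of f0 "c + s" m, OF per(1)] by (simp add: add.assoc)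
  moreover have "f0 (c - (s + 2 * pi * of_int m)) = f0 (c - s)"
   using periodic_int[of f0 "c - s" "- m", OF per(1)] by (simp add: algebra_simps)
  moreover have "sin (s + 2 * pi * of_int m) = sin s"
   using periodic_int[of sin s m] by simp
  ultimately show ?thesis by (simp add: k_def)
 qed
 moreover have "k c (- s) = k c s" by (simp add: k_def divide_simps)
 note per' = calculation this calculation[of "- s"]
 have "?t = s + 2 * pi * of_int m \<or> ?t = - s + 2 * pi * of_int m" using x(2) m by (simp add: mult_ac)
 hence "k c ?t = k c s" using per' by auto
 thus ?thesis using t by blast
qed

lemma k_lipschitz_first: "\<bar>k c s - k c' s\<bar> <= pi * e * \<bar>c - c'\<bar>"
proof (cases "sin s = 0")
 case False
 have "\<bar>(f0 (c + s) - f0 (c - s)) - (f0 (c' + s) - f0 (c' - s))\<bar> <= (pi * e * \<bar>sin s\<bar>) * \<bar>c - c'\<bar>"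
 proof (rule mvt_bound)
  show "((%c. f0 (c + s) - f0 (c - s)) has_real_derivative f1 (x + s) - f1 (x - s)) (at x)" for x
   by (intro DERIV_diff DERIV_shift[THEN iffD1] DERIV_at_within_shift[THEN iffD1])
    (use der(1) DERIV_shift[of f0 "f1 (x + s)" x s] DERIV_shift[of f0 "f1 (x - s)" x "- s"] in auto)
  show "\<bar>f1 (x + s) - f1 (x - s)\<bar> <= pi * e * \<bar>sin s\<bar>" for x
   using periodic_chord_bound[OF der(2) bnd(2) per(2)] .
 qed
 thus ?thesis using False by (simp add: k_def diff_divide_distrib[symmetric] field_simps)
qed (simp add: k_def e_nonneg)

text \<open>The derivative of the quotient in \<open>s\<close> is \<open>n\<close> divided by the
  squared sine. Here \<open>n\<close> vanishes at 0 and at \<open>pi\<close>, and its derivative is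
  of the order of the squared sine because the chord bound applies to both \<open>H\<close> and
  \<open>H2\<close>. So \<open>n\<close> is of the order of the cubed sine, and the quotient changes
  no faster than a multiple of the cosine.\<close>

lemma k_lipschitz_second_aux:
 assumes "0 < s" "s < t" "t < pi"
 shows "\<bar>k c s - k c t\<bar> <= pi\<^sup>2 * e * \<bar>cos s - cos t\<bar>"
proof -
 define H where "H s = f0 (c + s) - f0 (c - s)" for s
 define H1 where "H1 s = f1 (c + s) + f1 (c - s)" for s
 define H2 where "H2 s = f2 (c + s) - f2 (c - s)" for s
 define n where "n s = H1 s * sin s - H s * cos s" for s
 have sh: "((%s. g (c + s)) has_real_derivative g' (c + x)) (at x)" "((%s. g (c - s)) has_real_derivative - g' (c - x)) (at x)"
  if "!!x. (g has_real_derivative g' x) (at x)" for g g' x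
 proof -
  have a: "((%s. c + s) has_real_derivative 1) (at x)" "((%s. c - s) has_real_derivative -1) (at x)"
   by (auto intro!: derivative_eq_intros)
  show "((%s. g (c + s)) has_real_derivative g' (c + x)) (at x)" "((%s. g (c - s)) has_real_derivative - g' (c - x)) (at x)"
   using DERIV_chain2[OF that a(1)] DERIV_chain2[OF that a(2)] by simp_all
 qed
 have dH: "(H has_real_derivative H1 x) (at x)" for x
  unfolding H_def H1_def using DERIV_diff[OF sh(1)[OF der(1), of x] sh(2)[OF der(1), of x]] by simp
 have dH1: "(H1 has_real_derivative H2 x) (at x)" for x
  unfolding H1_def H2_def using DERIV_add[OF sh(1)[OF der(2), of x] sh(2)[OF der(2), of x]] by simp
 have dn: "(n has_real_derivative (H2 x + H x) * sin x) (at x)" for x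
  unfolding n_def by (auto intro!: derivative_eq_intros dH dH1 simp: algebra_simps)
 have bn: "\<bar>(H2 x + H x) * sin x\<bar> <= 2 * pi * e * (sin x)\<^sup>2" for x
 proof -
  have "\<bar>H2 x + H x\<bar> <= 2 * pi * e * \<bar>sin x\<bar>"
   using periodic_chord_bound[OF der(3) bnd(3) per(3), of c x] periodic_chord_bound[OF der(1) bnd(1) per(1), of c x]
   unfolding H2_def H_def by linarith
  hence "\<bar>H2 x + H x\<bar> * \<bar>sin x\<bar> <= 2 * pi * e * \<bar>sin x\<bar> * \<bar>sin x\<bar>" by (rule mult_right_mono) simp
  thus ?thesis by (simp add: abs_mult power2_eq_square)
 qed
 have n3: "\<bar>n x\<bar> <= pi\<^sup>2 * e * sin x ^ 3" if x: "0 < x" "x < pi" for x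
 proof -
  have sx: "sin x > 0" using x by (rule sin_gt_zero)
  have gen: "\<bar>n x\<bar> <= pi\<^sup>2 * e * sin x ^ 3" if "\<bar>n x\<bar> = \<bar>d\<bar> * \<bar>(H2 y + H y) * sin y\<bar>" "\<bar>d\<bar> <= pi / 2 * sin x" "0 <= sin y" "sin y <= sin x" for d y
  proof -
   have "\<bar>n x\<bar> <= (pi / 2 * sin x) * (2 * pi * e * (sin x)\<^sup>2)"
    unfolding that(1) using that sx e_nonneg by (intro mult_mono order_trans[OF bn] mult_left_mono power_mono) auto
   thus ?thesis by (simp add: power2_eq_square power3_eq_cube mult_ac)
  qed
  show ?thesis
  proof (cases "x <= pi / 2")
   case True
   obtain y where y: "0 < y" "y < x" "n x - n 0 = (x - 0) * ((H2 y + H y) * sin y)"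
    using MVT2[OF x(1), of n "%x. (H2 x + H x) * sin x"] dn by blast
   have "sin y <= sin x" using y True by (intro sin_monotone_2pi_le) auto
   moreover have "sin y \<ge> 0" using y x by (intro sin_ge_zero) auto
   moreover have "\<bar>x\<bar> <= pi / 2 * sin x" using abs_le_half_pi_sin[of x] True x sx by auto
   moreover have "n 0 = 0" by (simp add: n_def H_def)
   ultimately show ?thesis using y(3) by (intro gen[of x y]) (auto simp: abs_mult)
  next
   case False
   obtain y where y: "x < y" "y < pi" "n pi - n x = (pi - x) * ((H2 y + H y) * sin y)"
    using MVT2[OF x(2), of n "%x. (H2 x + H x) * sin x"] dn by blast
   have "sin (pi - y) <= sin (pi - x)" using y False by (intro sin_monotone_2pi_le) auto
   hence "sin y <= sin x" by simp
   moreover have "sin y \<ge> 0" using y x by (intro sin_ge_zero) auto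
   moreover have "\<bar>pi - x\<bar> <= pi / 2 * sin x" using abs_le_half_pi_sin[of "pi - x"] False x sx by auto
   moreover have "n pi = 0" using per(1)[of "c - pi"] by (simp add: n_def H_def add.commute)
   moreover have "\<bar>n x\<bar> = \<bar>pi - x\<bar> * \<bar>(H2 y + H y) * sin y\<bar>"
    using arg_cong[OF y(3), of abs] \<open>n pi = 0\<close> by (simp add: abs_mult)
   ultimately show ?thesis by (intro gen[of "pi - x" y]) auto
  qed
 qed
 have dk: "(k c has_real_derivative n x / (sin x)\<^sup>2) (at x)" if "0 < x" "x < pi" for x
 proof -
  have "sin x ~= 0" using sin_gt_zero[OF that] by simp
  hence "((%x. H x / sin x) has_real_derivative n x / (sin x)\<^sup>2) (at x)"
   by (auto intro!: derivative_eq_intros dH simp: n_def power2_eq_square)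
  thus ?thesis by (simp add: k_def[abs_def] H_def)
 qed
 have bk: "\<bar>n x / (sin x)\<^sup>2\<bar> <= pi\<^sup>2 * e * sin x" if "0 < x" "x < pi" for x
  using n3[OF that] sin_gt_zero[OF that] by (simp add: field_simps power2_eq_square power3_eq_cube)
 let ?C = "pi\<^sup>2 * e"
 \<comment> \<open>Monotonicity of \<open>k c\<close> plus and minus a multiple of the cosine is the
   Lipschitz bound relative to the cosine, without a change of variable.\<close>
 have 1: "k c t + ?C * cos t <= k c s + ?C * cos s"
 proof (rule DERIV_nonpos_imp_nonincreasing[of s t "%x. k c x + ?C * cos x"])
  fix x assume "s <= x" "x <= t"
  hence "0 < x" "x < pi" using assms by auto
  thus "\<exists>y. ((%x. k c x + ?C * cos x) has_real_derivative y) (at x) & y <= 0"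
   using abs_le_D1[OF bk[of x]] by (intro exI[of _ "n x / (sin x)\<^sup>2 + ?C * (- sin x)"] conjI DERIV_add DERIV_cmult dk DERIV_cos) auto
 qed (use assms in simp)
 have 2: "k c s - ?C * cos s <= k c t - ?C * cos t"
 proof (rule DERIV_nonneg_imp_nondecreasing[of s t "%x. k c x - ?C * cos x"])
  fix x assume "s <= x" "x <= t"
  hence "0 < x" "x < pi" using assms by auto
  thus "\<exists>y. ((%x. k c x - ?C * cos x) has_real_derivative y) (at x) & 0 <= y"
   using abs_le_D2[OF bk[of x]] by (intro exI[of _ "n x / (sin x)\<^sup>2 - ?C * (- sin x)"] conjI DERIV_diff DERIV_cmult dk DERIV_cos) auto
 qed (use assms in simp)
 have "cos t <= cos s" using assms by (intro cos_monotone_0_pi_le) auto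
 hence "\<bar>cos s - cos t\<bar> = cos s - cos t" by simp
 thus ?thesis using 1 2 by (simp add: algebra_simps abs_le_iff)
qed

lemma k_lipschitz_second:
 assumes "sin s ~= 0" "sin t ~= 0"
 shows "\<bar>k c s - k c t\<bar> <= pi\<^sup>2 * e * \<bar>cos s - cos t\<bar>"
proof -
 obtain s' where s': "0 <= s'" "s' <= pi" "cos s' = cos s" "k c s' = k c s" using k_cos_eq by blast
 obtain t' where t': "0 <= t'" "t' <= pi" "cos t' = cos t" "k c t' = k c t" using k_cos_eq by blast
 have sq: "sin y ~= 0" if "sin x ~= 0" "cos y = cos x" for x y :: real
 proof -
  have "(sin y)\<^sup>2 = (sin x)\<^sup>2" using sin_squared_eq[of x] sin_squared_eq[of y] that(2) by simp
  thus ?thesis using that(1) by auto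
 qed
 have "s' ~= 0" "s' ~= pi" "t' ~= 0" "t' ~= pi" using sq[OF assms(1) s'(3)] sq[OF assms(2) t'(3)] by auto
 hence r: "0 < s'" "s' < pi" "0 < t'" "t' < pi" using s' t' by auto
 consider "s' < t'" | "s' = t'" | "t' < s'" by linarith
 thus ?thesis
 proof cases
  case 1
  thus ?thesis using k_lipschitz_second_aux[of s' t' c] r s' t' by simp
 next
  case 2
  thus ?thesis using s' t' e_nonneg by simp
 next
  case 3
  thus ?thesis using k_lipschitz_second_aux[of t' s' c] r s' t' by (simp add: abs_minus_commute)
 qed
qed

definition quot :: "real => real => complex" where
 "quot x y = (complex_of_real (f0 x) - complex_of_real (f0 y)) / (cis x - cis y)"

lemma quot_eq: "quot (c + s) (c - s) = of_real (k c s) * cis (- c) / (2 * \<i>)"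
proof -
 have "cis (c + s) - cis (c - s) = 2 * \<i> * of_real (sin s) * cis c"
  by (simp add: complex_eq_iff cos_add sin_add cos_diff sin_diff)
 moreover have inv: "D / (2 * \<i> * u * z) = (D / u) * inverse z / (2 * \<i>)" for D u z :: complex
  unfolding divide_inverse inverse_mult_distrib by (simp only: mult_ac)
 ultimately show ?thesis unfolding quot_def k_def by (simp only: inv cis_inverse of_real_divide of_real_diff)
qed

lemma norm_quot_le: "cmod (quot x y) <= 2 * e"
proof -
 have "quot x y = quot ((x + y) / 2 + (x - y) / 2) ((x + y) / 2 - (x - y) / 2)" by (simp add: field_simps)
 hence "cmod (quot x y) = \<bar>k ((x + y) / 2) ((x - y) / 2)\<bar> / 2"
  unfolding quot_eq by (simp add: norm_mult norm_divide)
 also have "... <= (4 * e) / 2"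
  using k_bound[of "(x + y) / 2" "(x - y) / 2"] mult_right_mono[OF less_imp_le[OF pi_less_4] e_nonneg] by simp
 finally show ?thesis by simp
qed

lemma norm_quot_diff_le:
 assumes "cis x ~= cis y" "cis x' ~= cis y'"
 shows "cmod (quot x y - quot x' y') <= 30 * e * (cmod (chord_sum x y - chord_sum x' y') + cmod (chord_prod x y - chord_prod x' y'))"
proof -
 define c s where "c = (x + y) / 2" "s = (x - y) / 2"
 define c0 s0 where "c0 = (x' + y') / 2" "s0 = (x' - y') / 2"
 obtain m :: int where m: "\<bar>(c - c0) - of_int m * pi\<bar> <= pi / 2" by (rule nearest_multiple_pi)
 \<comment> \<open>Midpoint and half length are changed by the same multiple of \<open>pi\<close>:
   the ends stay the same on the circle, and the midpoints come within \<open>pi / 2\<close>, where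
   the difference of the products bounds their distance.\<close>
 define c' s' where "c' = c0 + of_int m * pi" "s' = s0 + of_int m * pi"
 have xy: "x = c + s" "y = c - s" by (simp_all add: c_s_def field_simps)
 have xy': "x' + 2 * pi * of_int m = c' + s'" "y' = c' - s'" by (simp_all add: c'_s'_def c0_s0_def field_simps)
 have cisx': "cis x' = cis (c' + s')" using periodic_int[of cis x' m, OF cis_periodic] xy'(1) by simp
 have fx': "f0 x' = f0 (c' + s')" using periodic_int[of f0 x' m, OF per(1)] xy'(1) by simp
 have q': "quot x' y' = quot (c' + s') (c' - s')" using cisx' fx' xy'(2) by (simp add: quot_def)
 have cd: "\<bar>c - c'\<bar> <= pi / 2" using m by (simp add: c'_s'_def algebra_simps)
 have dif: "cis (u + v) - cis (u - v) = 2 * \<i> * of_real (sin v) * cis u" for u v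
  by (simp add: complex_eq_iff cos_add sin_add cos_diff sin_diff)
 have sm: "cis (u + v) + cis (u - v) = 2 * of_real (cos v) * cis u" for u v
  by (simp add: complex_eq_iff cos_add sin_add cos_diff sin_diff)
 have sn: "sin s ~= 0" "sin s' ~= 0" using assms dif[of c s] dif[of c' s'] cisx' xy xy'(2) by auto
 define dS dP where "dS = cmod (chord_sum x y - chord_sum x' y')" "dP = cmod (chord_prod x y - chord_prod x' y')"
 have d0: "dS \<ge> 0" "dP \<ge> 0" by (simp_all add: dS_dP_def)
 have P: "chord_prod x y = cis (2 * c)" "chord_prod x' y' = cis (2 * c')"
  unfolding chord_prod_def cisx' xy xy'(2) by (simp_all add: cis_mult)
 have S: "chord_sum x y = 2 * of_real (cos s) * cis c" "chord_sum x' y' = 2 * of_real (cos s') * cis c'"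
  unfolding chord_sum_def cisx' using sm[of c s] sm[of c' s'] xy xy'(2) by simp_all
 have "cis (2 * c) - cis (2 * c') = 2 * \<i> * of_real (sin (c - c')) * cis (c + c')"
  using dif[of "c + c'" "c - c'"] by (simp add: algebra_simps)
 hence "dP = 2 * \<bar>sin (c - c')\<bar>" unfolding dS_dP_def P by (simp add: norm_mult)
 hence cc: "\<bar>c - c'\<bar> <= dP"
  using abs_le_half_pi_sin[OF cd] mult_right_mono[OF less_imp_le[OF pi_less_4], of "\<bar>sin (c - c')\<bar>"] by simp
 have cis_le: "cmod (cis u - cis v) <= \<bar>u - v\<bar>" for u v
 proof -
  have "cis u - cis v = 2 * \<i> * of_real (sin ((u - v) / 2)) * cis ((u + v) / 2)"
   using dif[of "(u + v) / 2" "(u - v) / 2"] by (simp add: field_simps)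
  hence "cmod (cis u - cis v) = 2 * \<bar>sin ((u - v) / 2)\<bar>" by (simp add: norm_mult)
  thus ?thesis using abs_sin_x_le_abs_x[of "(u - v) / 2"] by simp
 qed
 have cosd: "\<bar>cos s - cos s'\<bar> <= dS + dP"
 proof -
  have "2 * of_real (cos s - cos s') * cis c = (chord_sum x y - chord_sum x' y') + 2 * of_real (cos s') * (cis c' - cis c)"
   unfolding S by (simp add: algebra_simps)
  hence "cmod (2 * of_real (cos s - cos s') * cis c) <= dS + cmod (2 * of_real (cos s') * (cis c' - cis c))"
   unfolding dS_dP_def by (metis norm_triangle_ineq)
  also have "... <= dS + 2 * 1 * \<bar>c' - c\<bar>"
   unfolding norm_mult by (intro add_left_mono mult_mono cis_le) auto
  also have "cmod (2 * of_real (cos s - cos s') * cis c) = 2 * \<bar>cos s - cos s'\<bar>"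
   by (simp add: norm_mult del: of_real_diff)
  finally have "2 * \<bar>cos s - cos s'\<bar> <= dS + 2 * \<bar>c - c'\<bar>" by (simp add: abs_minus_commute)
  thus ?thesis using cc d0 by simp
 qed
 have pi2: "pi\<^sup>2 <= 16" using power_mono[OF less_imp_le[OF pi_less_4], of 2] by simp
 have kk: "\<bar>k c s - k c' s'\<bar> <= 20 * e * (dS + dP)"
 proof -
  have "\<bar>k c s - k c' s'\<bar> <= pi * e * \<bar>c - c'\<bar> + pi\<^sup>2 * e * \<bar>cos s - cos s'\<bar>"
   using k_lipschitz_first[of c s c'] k_lipschitz_second[OF sn, of c'] by linarith
  also have "... <= 4 * e * (dS + dP) + 16 * e * (dS + dP)"
   using cc cosd d0 e_nonneg pi2 pi_less_4 by (intro add_mono mult_mono) (auto simp: less_imp_le)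
  finally show ?thesis by simp
 qed
 have "quot x y - quot x' y' = (of_real (k c s - k c' s') * cis (- c) + of_real (k c' s') * (cis (- c) - cis (- c'))) / (2 * \<i>)"
  unfolding q' xy(1) xy(2) quot_eq by (simp add: diff_divide_distrib algebra_simps)
 also have "cmod ... <= (\<bar>k c s - k c' s'\<bar> + \<bar>k c' s'\<bar> * \<bar>c - c'\<bar>) / 2"
  unfolding norm_divide using cis_le[of "- c" "- c'"] by (simp add: norm_mult abs_minus_commute del: of_real_diff)
   (intro order_trans[OF norm_triangle_ineq] add_mono; auto intro!: mult_left_mono simp: norm_mult abs_minus_commute simp del: of_real_diff)
 also have "... <= (20 * e * (dS + dP) + (4 * e) * (dS + dP)) / 2"
  using kk k_bound[of c' s'] cc d0 e_nonneg mult_right_mono[OF less_imp_le[OF pi_less_4] e_nonneg]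
  by (intro divide_right_mono add_mono mult_mono) auto
 also have "... <= 30 * e * (dS + dP)" using d0 e_nonneg by (simp add: algebra_simps)
 finally show ?thesis by (simp add: dS_dP_def)
qed

text \<open>Same splitting as in \<open>norm_nform_E_le\<close>, with the difference quotient in
  place of one \<open>hsym\<close>. The factor \<open>e\<close> is what forces the limit form to
  vanish on limits of functions from the algebras.\<close>

lemma norm_nform_smooth_le:
 "cmod (nform xs (%x. of_real (f0 x)) (E j)) <= 32 * 6 ^ j * e * mdist xs"
proof (cases "cis (xs 0) = cis (xs 1) \<or> cis (xs 2) = cis (xs 3)")
 case True
 have eq: "f0 x = f0 y" if "cis x = cis y" for x y
 proof -
  have "sin y = sin x & cos y = cos x" using that by (auto simp: complex_eq_iff)
  then obtain n :: int where "y = x + 2 * pi * n" using sin_cos_eq_iff[of y x] by auto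
  thus ?thesis using periodic_int[of f0 x n, OF per(1)] by simp
 qed
 from True have "nform xs (%x. of_real (f0 x)) (E j) = 0"
 proof
  assume c: "cis (xs 0) = cis (xs 1)"
  show ?thesis unfolding nform_def E_def c eq[OF c] by simp
 next
  assume c: "cis (xs 2) = cis (xs 3)"
  show ?thesis unfolding nform_def E_def c eq[OF c] by simp
 qed
 thus ?thesis using e_nonneg by (simp add: mdist_def)
next
 case False
 hence ne: "cis (xs 0) ~= cis (xs 1)" "cis (xs 2) ~= cis (xs 3)" by auto
 define S P S' P' where "S = chord_sum (xs 0) (xs 1)" "P = chord_prod (xs 0) (xs 1)"
  "S' = chord_sum (xs 2) (xs 3)" "P' = chord_prod (xs 2) (xs 3)"
 define \<delta> where "\<delta> = cmod (S - S') + cmod (P - P')"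
 have \<delta>0: "\<delta> \<ge> 0" by (simp add: \<delta>_def)
 note b = chord_bounds[of "xs 0" "xs 1"] chord_bounds[of "xs 2" "xs 3"]
 let ?q = "quot (xs 0) (xs 1)" and ?q' = "quot (xs 2) (xs 3)"
 have fq: "of_real (f0 (xs 0)) - of_real (f0 (xs 1)) = ?q * (cis (xs 0) - cis (xs 1))"
     "of_real (f0 (xs 2)) - of_real (f0 (xs 3)) = ?q' * (cis (xs 2) - cis (xs 3))"
  using ne by (simp_all add: quot_def)
 have "nform xs (%x. of_real (f0 x)) (E j) = (cis (xs 0) - cis (xs 1)) * (cis (xs 2) - cis (xs 3)) *
  ((?q - ?q') * hsym S' P' j + ?q' * (hsym S' P' j - hsym S P j))"
  unfolding nform_def E_def power_diff_hsym fq S_P_S'_P'_def chord_sum_def chord_prod_def by (simp add: algebra_simps)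
 also have "cmod ... <= cmod (cis (xs 0) - cis (xs 1)) * cmod (cis (xs 2) - cis (xs 3)) * (32 * 6 ^ j * e * \<delta>)"
  unfolding norm_mult
 proof (intro mult_left_mono)
  have b36: "(3::real) ^ k <= 6 ^ k" for k by (rule power_mono) auto
  have "cmod ((?q - ?q') * hsym S' P' j + ?q' * (hsym S' P' j - hsym S P j)) <= (30 * e * \<delta>) * 6 ^ j + (2 * e) * (6 ^ j * \<delta>)"
   using norm_quot_diff_le[OF ne] norm_quot_le[of "xs 2" "xs 3"] b norm_hsym_diff_le[of S' P' S P j] \<delta>0 e_nonneg
   by (intro order_trans[OF norm_triangle_ineq] add_mono; unfold norm_mult; intro mult_mono order_trans[OF norm_hsym_le b36])
    (auto simp: S_P_S'_P'_def \<delta>_def norm_minus_commute)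
  thus "cmod ((?q - ?q') * hsym S' P' j + ?q' * (hsym S' P' j - hsym S P j)) <= 32 * 6 ^ j * e * \<delta>"
   by (simp add: algebra_simps)
 qed auto
 finally show ?thesis by (simp add: mdist_def S_P_S'_P'_def \<delta>_def mult_ac)
qed

end

subsection \<open>Trigonometric polynomials\<close>

lemma trigL_iff: "f \<in> trigL N \<longleftrightarrow> (\<exists>a b. \<forall>x. f x = a 0 + (\<Sum>j\<in>{1..N}. a j * cos (real j * x) + b j * sin (real j * x)))"
 by (simp add: trigL_def)

lemma trigL_lincomb:
 assumes "f \<in> trigL N" "g \<in> trigL N" shows "(%x. c * f x + d * g x) \<in> trigL N"
proof -
 obtain a b where ab: "!!x. f x = a 0 + (\<Sum>j\<in>{1..N}. a j * cos (real j * x) + b j * sin (real j * x))"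
  using assms(1) by (auto simp: trigL_iff)
 obtain a' b' where ab': "!!x. g x = a' 0 + (\<Sum>j\<in>{1..N}. a' j * cos (real j * x) + b' j * sin (real j * x))"
  using assms(2) by (auto simp: trigL_iff)
 show ?thesis unfolding trigL_iff by (intro exI[of _ "%j. c * a j + d * a' j"] exI[of _ "%j. c * b j + d * b' j"])
   (simp add: ab ab' sum.distrib sum_distrib_left algebra_simps)
qed

lemma trigL_cmul: "f \<in> trigL N ==> (%x. c * f x) \<in> trigL N"
 using trigL_lincomb[of f N f c 0] by simp

lemma trigL_cos: "k <= N ==> (%x. cos (real k * x)) \<in> trigL N"
proof -
 assume k: "k <= N"
 have "(\<Sum>j\<in>{1..N}. (if j = k then 1 else 0) * cos (real j * x) + 0 * sin (real j * x)) =
   (\<Sum>j\<in>{1..N}. if j = k then cos (real k * x) else 0)" for x by (intro sum.cong) auto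
 thus ?thesis unfolding trigL_iff using k
  by (intro exI[of _ "%j. if j = k then 1 else 0"] exI[of _ "%_. 0"]) (cases "k = 0"; simp add: sum.delta)
qed

lemma trigL_sin: "k <= N ==> (%x. sin (real k * x)) \<in> trigL N"
proof -
 assume k: "k <= N"
 have "(\<Sum>j\<in>{1..N}. 0 * cos (real j * x) + (if j = k then 1 else 0) * sin (real j * x)) =
   (\<Sum>j\<in>{1..N}. if j = k then sin (real k * x) else 0)" for x by (intro sum.cong) auto
 thus ?thesis unfolding trigL_iff using k
  by (intro exI[of _ "%_. 0"] exI[of _ "%j. if j = k then 1 else 0"]) (cases "k = 0"; simp add: sum.delta)
qed

lemma trigL_deriv:
 assumes "f \<in> trigL N"
 shows "deriv f \<in> trigL N" "(f has_real_derivative deriv f x) (at x)"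
proof -
 obtain a b where ab: "!!x. f x = a 0 + (\<Sum>j\<in>{1..N}. a j * cos (real j * x) + b j * sin (real j * x))"
  using assms(1) by (auto simp: trigL_iff)
 have d: "(f has_real_derivative (\<Sum>j\<in>{1..N}. real j * b j * cos (real j * x) + (- real j * a j) * sin (real j * x))) (at x)" for x
 proof -
  have "((%x. a 0 + (\<Sum>j\<in>{1..N}. a j * cos (real j * x) + b j * sin (real j * x))) has_real_derivative
   (\<Sum>j\<in>{1..N}. real j * b j * cos (real j * x) + (- real j * a j) * sin (real j * x))) (at x)"
   by (auto intro!: derivative_eq_intros sum.cong simp: algebra_simps)
  thus ?thesis using ab by presburger
 qed
 have eq: "deriv f = (%x. \<Sum>j\<in>{1..N}. real j * b j * cos (real j * x) + (- real j * a j) * sin (real j * x))"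
  using DERIV_imp_deriv[OF d] by (intro ext)
 show "deriv f \<in> trigL N" unfolding trigL_iff eq by (intro exI[of _ "%j. real j * b j"] exI[of _ "%j. - real j * a j"]) simp
 show "(f has_real_derivative deriv f x) (at x)" using d[of x] by (simp add: eq)
qed

lemma trigL_funpow_deriv: "f \<in> trigL N ==> (deriv ^^ n) f \<in> trigL N" by (induction n) (simp_all add: trigL_deriv)

lemma trigL_smooth_circ: "f \<in> trigL N ==> smooth_circ f"
proof -
 assume f: "f \<in> trigL N"
 then obtain a b where ab: "!!x. f x = a 0 + (\<Sum>j\<in>{1..N}. a j * cos (real j * x) + b j * sin (real j * x))"
  by (auto simp: trigL_iff)
 have c: "cos (real j * (x + 2 * pi)) = cos (real j * x)" "sin (real j * (x + 2 * pi)) = sin (real j * x)" for j x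
  using periodic_int[of cos "real j * x" "int j", OF cos_periodic] periodic_int[of sin "real j * x" "int j", OF sin_periodic]
  by (simp_all add: algebra_simps)
 show ?thesis unfolding smooth_circ_def
  using trigL_deriv(2)[OF trigL_funpow_deriv[OF f]] by (auto simp: ab c real_differentiable_def)
qed

lemma trigL_bounded: "f \<in> trigL N ==> \<exists>B. \<forall>x. \<bar>f x\<bar> <= B"
proof -
 assume f: "f \<in> trigL N"
 then obtain a b where ab: "!!x. f x = a 0 + (\<Sum>j\<in>{1..N}. a j * cos (real j * x) + b j * sin (real j * x))"
  by (auto simp: trigL_iff)
 have "\<bar>f x\<bar> <= \<bar>a 0\<bar> + (\<Sum>j\<in>{1..N}. \<bar>a j\<bar> * 1 + \<bar>b j\<bar> * 1)" for x
  unfolding ab by (intro order_trans[OF abs_triangle_ineq] add_mono order_refl order_trans[OF sum_abs] sum_mono)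
   (auto intro!: order_trans[OF abs_triangle_ineq] add_mono mult_left_le simp: abs_mult)
 thus ?thesis by blast
qed

lemma trigL_deriv_lincomb:
 assumes "f \<in> trigL N" "g \<in> trigL N"
 shows "(deriv ^^ n) (%x. c * f x + d * g x) = (%x. c * (deriv ^^ n) f x + d * (deriv ^^ n) g x)"
proof (induction n)
 case (Suc n)
 have "deriv (%x. c * (deriv ^^ n) f x + d * (deriv ^^ n) g x) = (%x. c * deriv ((deriv ^^ n) f) x + d * deriv ((deriv ^^ n) g) x)"
  by (intro ext DERIV_imp_deriv DERIV_add DERIV_cmult trigL_deriv(2)[of _ N] trigL_funpow_deriv assms)
 thus ?case using Suc by simp
qed simp

definition cx :: "(real => real) => real => complex" where "cx f x = complex_of_real (f x)"

lemma trigL_poly: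
 assumes "f \<in> trigL 8"
 obtains q where "degree q <= 16" "!!x. cx f x = poly q (cis x) * inverse (cis x) ^ 8"
proof -
 obtain a b where ab: "!!x. f x = a 0 + (\<Sum>j\<in>{1..8}. a j * cos (real j * x) + b j * sin (real j * x))"
  using assms(1) by (auto simp: trigL_iff)
 define q where "q = Polynomial.monom (of_real (a 0)) 8 +
  (\<Sum>j\<in>{1..8}. Polynomial.monom (Complex (a j) (- b j) / 2) (8 + j) + Polynomial.monom (Complex (a j) (b j) / 2) (8 - j))"
 have "degree q <= 16" unfolding q_def
  by (intro degree_add_le degree_sum_le) (auto intro!: degree_add_le order_trans[OF degree_monom_le])
 moreover have "cx f x = poly q (cis x) * inverse (cis x) ^ 8" for x
 proof -
  have t: "(Complex (a j) (- b j) / 2 * cis x ^ (8 + j) + Complex (a j) (b j) / 2 * cis x ^ (8 - j)) * inverse (cis x) ^ 8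
   = of_real (a j * cos (real j * x) + b j * sin (real j * x))" if "j \<in> {1..8}" for j
  proof -
   have "cis x ^ (8 + j) * inverse (cis x) ^ 8 = cis (real j * x)"
    by (simp only: cis_inverse Complex.DeMoivre cis_mult) (simp add: algebra_simps)
   moreover have "cis x ^ (8 - j) * inverse (cis x) ^ 8 = cis (- (real j * x))"
    using that by (simp only: cis_inverse Complex.DeMoivre cis_mult) (simp add: of_nat_diff algebra_simps)
   ultimately have "(Complex (a j) (- b j) / 2 * cis x ^ (8 + j) + Complex (a j) (b j) / 2 * cis x ^ (8 - j)) * inverse (cis x) ^ 8
    = Complex (a j) (- b j) / 2 * cis (real j * x) + Complex (a j) (b j) / 2 * cis (- (real j * x))"
    by (metis (no_types, lifting) distrib_right mult.assoc)
   thus ?thesis by (simp add: complex_eq_iff field_simps)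
  qed
  have "poly q (cis x) * inverse (cis x) ^ 8 = of_real (a 0) * (cis x ^ 8 * inverse (cis x) ^ 8) +
   (\<Sum>j\<in>{1..8}. (Complex (a j) (- b j) / 2 * cis x ^ (8 + j) + Complex (a j) (b j) / 2 * cis x ^ (8 - j)) * inverse (cis x) ^ 8)"
   unfolding q_def poly_add poly_sum poly_monom distrib_right sum_distrib_right mult.assoc ..
  also have "... = of_real (a 0) + (\<Sum>j\<in>{1..8}. of_real (a j * cos (real j * x) + b j * sin (real j * x)))"
  proof -
   have one: "cis x ^ 8 * inverse (cis x) ^ 8 = 1" by (simp only: power_mult_distrib[symmetric]) (simp del: cis_inverse)
   show ?thesis by (simp only: one mult_1_right sum.cong[OF refl t])
  qed
  finally show ?thesis by (simp add: cx_def ab)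
 qed
 ultimately show ?thesis using that by blast
qed

text \<open>Fourier inversion on the 17th roots of unity; degree 16 leaves no aliasing.\<close>

lemma coeff_bound_circle:
 assumes "degree q <= 16" "!!x. cmod (poly q (cis x)) <= M"
 shows "cmod (poly.coeff q k) <= M"
proof (cases "k <= 16")
 case True
 define w where "w j = cis (2 * pi * j / 17)" for j :: real
 have orth: "(\<Sum>t<17. w (real t) ^ n * inverse (w (real t)) ^ k) = (if n = k then 17 else 0)" if "n <= 16" for n
 proof -
  define z where "z = cis (2 * pi * (real n - real k) / 17)"
  have zt: "w (real t) ^ n * inverse (w (real t)) ^ k = z ^ t" for t
   unfolding w_def z_def cis_inverse Complex.DeMoivre cis_mult by (rule arg_cong[of _ _ cis]) (simp add: field_simps)
  show ?thesis
  proof (cases "n = k")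
   case False
   have "z ~= 1"
   proof
    assume "z = 1"
    hence "cos (2 * pi * (real n - real k) / 17) = 1" by (simp add: z_def complex_eq_iff)
    then obtain m :: int where m: "2 * pi * (real n - real k) / 17 = of_int m * 2 * pi"
     using cos_one_2pi_int by blast
    hence "2 * pi * (real n - real k) = 2 * pi * (17 * of_int m)" by (simp add: field_simps)
    hence "real n - real k = 17 * of_int m" by simp
    hence "real_of_int (int n - int k) = real_of_int (17 * m)" by simp
    hence "int n - int k = 17 * m" by linarith
    thus False using that True False by presburger
   qed
   moreover have "z ^ 17 = 1"
   proof -
    have "z ^ 17 = cis (0 + 2 * pi * of_int (int n - int k))"
     unfolding z_def Complex.DeMoivre by (rule arg_cong[of _ _ cis]) simp
    also have "... = cis 0" by (rule periodic_int[of cis, OF cis_periodic])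
    finally show ?thesis by simp
   qed
   ultimately show ?thesis using geometric_sum[of z 17] False by (simp add: zt)
  qed (unfold zt, simp add: z_def)
 qed
 have "(\<Sum>t<17. poly q (w (real t)) * inverse (w (real t)) ^ k) =
   (\<Sum>t<17. \<Sum>n\<le>16. poly.coeff q n * (w (real t) ^ n * inverse (w (real t)) ^ k))"
 proof (intro sum.cong refl)
  fix t
  have "poly q (w (real t)) = (\<Sum>n\<le>16. poly.coeff q n * w (real t) ^ n)"
   unfolding poly_altdef by (rule sum.mono_neutral_left) (use assms(1) in \<open>auto simp: coeff_eq_0\<close>)
  thus "poly q (w (real t)) * inverse (w (real t)) ^ k = (\<Sum>n\<le>16. poly.coeff q n * (w (real t) ^ n * inverse (w (real t)) ^ k))"
   by (simp only: sum_distrib_right mult.assoc)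
 qed
 also have "... = (\<Sum>n\<le>16. poly.coeff q n * (\<Sum>t<17. w (real t) ^ n * inverse (w (real t)) ^ k))"
  by (subst sum.swap) (simp only: sum_distrib_left)
 also have "... = (\<Sum>n\<le>16. if n = k then poly.coeff q n * 17 else 0)" by (intro sum.cong refl) (simp add: orth)
 also have "... = poly.coeff q k * 17" using True by (simp add: sum.delta)
 finally have "cmod (poly.coeff q k) * 17 = cmod (\<Sum>t<17. poly q (w (real t)) * inverse (w (real t)) ^ k)"
  by (metis norm_mult norm_numeral)
 also have "... <= (\<Sum>t<(17::nat). M)"
  by (intro sum_norm_le) (use assms(2) in \<open>auto simp: norm_mult norm_power norm_inverse w_def\<close>)
 finally show ?thesis by simp
next
 case False
 hence "poly.coeff q k = 0" using assms(1) by (intro coeff_eq_0) simp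
 thus ?thesis using order_trans[OF norm_ge_zero assms(2)[of 0]] by simp
qed

lemma good_inverse_cis: "good K (inv_bound 1 1 8) (%x. inverse (cis x))"
 using good_inverse[of 0 1 1 1 K] by simp

lemma good_poly16:
 assumes "degree q <= 16" shows "good K (257 ^ 9 * pnorm q) (%x. poly q (cis x))"
 unfolding good_def
proof (intro allI impI)
 fix S assume S: "finite S & S \<subseteq> K & card (cis ` S) <= 8"
 have "degree q <= 7 + 9" using assms by simp
 then obtain r where "degree r <= 7" "pnorm r <= 257 ^ 9 * pnorm q" "\<forall>z\<in>cis ` S. poly r z = poly q z"
  using reduce_degree[of "cis ` S" q 9] S by fastforce
 thus "\<exists>r. degree r <= 7 & pnorm r <= 257 ^ 9 * pnorm q & (\<forall>x\<in>S. poly r (cis x) = poly q (cis x))"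
  by (intro exI[of _ r]) auto
qed

lemma good_power_ex: "good K B \<phi> ==> \<exists>B'. good K B' (%x. \<phi> x ^ n)"
proof (induction n)
 case 0
 show ?case using good_const[of K 1] by auto
next
 case (Suc n)
 then obtain B' where "good K B' (%x. \<phi> x ^ n)" by blast
 from good_mult[OF Suc.prems this] show ?case by auto
qed

text \<open>Coefficients are bounded by the maximum on the circle, so the interpolation bound is
  proportional to the sup norm with a constant common to all functions. The sup norm is the one in
  which the unit balls of the Grassmannian distance are compared.\<close>

lemma trigL_good_uniform:
 obtains C where "C > 0" "!!f M. f \<in> trigL 8 ==> (!!x. \<bar>f x\<bar> <= M) ==> good UNIV (C * M) (cx f)"
proof -
 obtain B where B: "good UNIV B (%x. inverse (cis x) ^ 8)" using good_power_ex[OF good_inverse_cis] by blast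
 have B0: "B \<ge> 0" using good_nonneg[OF B] .
 let ?C = "257 ^ 7 * (257 ^ 9 * 17 * (B + 1))"
 have "good UNIV (?C * M) (cx f)" if f: "f \<in> trigL 8" and M: "!!x. \<bar>f x\<bar> <= M" for f M
 proof -
  have M0: "M \<ge> 0" using M[of 0] by linarith
  obtain q where q: "degree q <= 16" "!!x. cx f x = poly q (cis x) * inverse (cis x) ^ 8" using trigL_poly[OF f] by blast
  have "cmod (poly q (cis x)) <= M" for x
  proof -
   have "inverse (cis x) ^ 8 * cis x ^ 8 = 1" by (simp only: power_mult_distrib[symmetric]) (simp del: cis_inverse)
   hence "poly q (cis x) = cx f x * cis x ^ 8" by (simp only: q(2) mult.assoc mult_1_right)
   thus ?thesis using M[of x] by (simp add: norm_mult norm_power cx_def)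
  qed
  from coeff_bound_circle[OF q(1) this] have "pnorm q <= (\<Sum>i\<le>(16::nat). M)"
   unfolding pnorm_eq[OF q(1)] by (intro sum_mono)
  hence p: "pnorm q <= 17 * M" by simp
  have "good UNIV (257 ^ 7 * (257 ^ 9 * pnorm q * B)) (%x. poly q (cis x) * inverse (cis x) ^ 8)"
   by (rule good_mult[OF good_poly16[OF q(1)] B])
  moreover have "257 ^ 7 * (257 ^ 9 * pnorm q * B) <= 257 ^ 7 * (257 ^ 9 * (17 * M) * (B + 1))"
   using p B0 M0 by (intro mult_left_mono mult_mono) (auto simp: pnorm_nonneg)
  ultimately have "good UNIV (?C * M) (%x. poly q (cis x) * inverse (cis x) ^ 8)"
   by (rule good_mono[OF _ order_trans]) (auto simp: algebra_simps)
  moreover have "cx f = (%x. poly q (cis x) * inverse (cis x) ^ 8)" using q(2) by auto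
  ultimately show ?thesis by simp
 qed
 moreover have "?C > 0" using B0 by simp
 ultimately show ?thesis using that by blast
qed

lemma trigL_good: "f \<in> trigL 8 ==> \<exists>B. good UNIV B (cx f)"
proof -
 assume f: "f \<in> trigL 8"
 obtain C where C: "!!f M. f \<in> trigL 8 ==> (!!x. \<bar>f x\<bar> <= M) ==> good UNIV (C * M) (cx f)"
  using trigL_good_uniform by blast
 obtain M where "\<forall>x. \<bar>f x\<bar> <= M" using trigL_bounded[OF f] by blast
 thus ?thesis using C[OF f] by blast
qed

subsection \<open>Limits of the form along algebraic germs\<close>

definition ctame :: "(real => complex) => bool" where
 "ctame g \<longleftrightarrow> tame (%t. Re (g t)) & tame (%t. Im (g t))"

lemma ctame_add: "ctame f ==> ctame g ==> ctame (%t. f t + g t)" by (simp add: ctame_def tame_add)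
lemma ctame_diff: "ctame f ==> ctame g ==> ctame (%t. f t - g t)" by (simp add: ctame_def tame_diff)
lemma ctame_mult: "ctame f ==> ctame g ==> ctame (%t. f t * g t)" by (simp add: ctame_def tame_add tame_diff tame_mult)
lemma ctame_const: "ctame (%t. c)" by (simp add: ctame_def tame_const)
lemma ctame_power: "ctame f ==> ctame (%t. f t ^ n)" by (induction n) (simp_all add: ctame_const ctame_mult)

text \<open>Weaker than \<open>curve_germ\<close>: points may coincide as long as the quadruple is
  nondegenerate, so constant germs at two chords with a common end qualify.\<close>

definition tgerm :: "germ => bool" where
 "tgerm nu \<longleftrightarrow> (\<forall>i<4. ctame (%t. cis (nu t i))) & (EV t. nrm (nu t) > 0)"

lemma cis_eq_iff: "cis x = cis y \<longleftrightarrow> (\<exists>m::int. x - y = 2 * pi * of_int m)"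
proof
 assume "cis x = cis y"
 hence "sin x = sin y & cos x = cos y" by (auto simp: complex_eq_iff)
 then obtain n :: int where "x = y + 2 * pi * n" using sin_cos_eq_iff[of x y] by auto
 thus "\<exists>m::int. x - y = 2 * pi * of_int m" by (intro exI[of _ n]) simp
next
 assume "\<exists>m::int. x - y = 2 * pi * of_int m"
 then obtain m :: int where "x = y + 2 * pi * of_int m" by (auto simp: algebra_simps)
 thus "cis x = cis y" using periodic_int[of cis y m, OF cis_periodic] by simp
qed

lemma config_cis: "config 2 xs ==> i < 4 ==> j < 4 ==> i ~= j ==> cis (xs i) ~= cis (xs j)"
 unfolding cis_eq_iff by (auto simp: config_def)

lemma config_nrm_pos: "config 2 xs ==> nrm xs > 0"
 unfolding nrm_pos_iff using config_cis[of xs] by simp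

lemma curve_germ_tgerm:
 assumes "curve_germ 2 \<epsilon> nu" shows "tgerm nu"
 unfolding tgerm_def
proof (intro conjI allI impI)
 fix i :: nat assume i: "i < 4"
 have c: "continuous_on {0..<\<epsilon>} (%t. nu t i)" and a: "alg_germ \<epsilon> (%t. cos (nu t i))" "alg_germ \<epsilon> (%t. sin (nu t i))" and e: "\<epsilon> > 0"
  using assms i by (auto simp: curve_germ_def)
 show "ctame (%t. cis (nu t i))"
  using alg_germ_imp_tame[OF e a(1)] alg_germ_imp_tame[OF e a(2)] c by (simp add: ctame_def continuous_on_cos continuous_on_sin)
next
 have "\<epsilon> > 0" "!!t. 0 < t ==> t < \<epsilon> ==> config 2 (nu t)" using assms by (auto simp: curve_germ_def)
 thus "EV t. nrm (nu t) > 0"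
  using config_nrm_pos by (auto simp: eventually_at_right_field)
qed

lemma tgerm_ctame_nform:
 assumes "tgerm nu" shows "ctame (%t. nform (nu t) (E i) (E j))"
 unfolding nform_def E_def using assms by (intro ctame_diff ctame_mult ctame_power) (auto simp: tgerm_def)

text \<open>Real and imaginary part are bounded quotients of a tame germ by the square root of a
  positive tame germ.\<close>

lemma tgerm_E_convergent:
 assumes "tgerm nu" "i <= 7" "j <= 7" shows "\<exists>z. ((%t. zform (nu t) (E i) (E j)) ~~> z)"
proof -
 define Q where "Q t = (cmod (nform (nu t) (E 1) (E 2)))\<^sup>2 + (cmod (nform (nu t) (E 1) (E 3)))\<^sup>2" for t
 have n: "nrm (nu t) = sqrt (Q t)" for t by (simp add: nrm_def Q_def)
 have tQ: "tame Q" unfolding Q_def cmod_power2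
  using tgerm_ctame_nform[OF assms(1), of 1 2] tgerm_ctame_nform[OF assms(1), of 1 3]
  by (intro tame_add tame_power) (auto simp: ctame_def)
 have pos: "EV t. Q t > 0" using assms(1) by (auto simp: tgerm_def n)
 have b: "EV t. Q t > 0 & \<bar>p (nform (nu t) (E i) (E j))\<bar> <= CC * sqrt (Q t)"
  if p: "!!z. \<bar>p z\<bar> <= cmod z" for p
  using pos
 proof eventually_elim
  case (elim t)
  have "cmod (nform (nu t) (E i) (E j)) <= CC * sqrt (Q t)"
   using norm_zform_E_le[OF assms(2,3), of "nu t"] elim by (simp add: zform_def norm_divide n pos_divide_le_eq)
  thus ?case using elim p[of "nform (nu t) (E i) (E j)"] by linarith
 qed
 note t = tgerm_ctame_nform[OF assms(1), of i j, unfolded ctame_def]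
 obtain x where x: "((%t. Re (nform (nu t) (E i) (E j)) / sqrt (Q t)) ~~> x)"
  using tame_quotient_sqrt_tendsto[OF conjunct1[OF t] tQ b[of Re]] abs_Re_le_cmod by blast
 obtain y where y: "((%t. Im (nform (nu t) (E i) (E j)) / sqrt (Q t)) ~~> y)"
  using tame_quotient_sqrt_tendsto[OF conjunct2[OF t] tQ b[of Im]] abs_Im_le_cmod by blast
 have "((%t. zform (nu t) (E i) (E j)) ~~> Complex x y)"
  using x y by (simp add: tendsto_complex_iff zform_def n Re_divide_of_real Im_divide_of_real)
 thus ?thesis by blast
qed

lemma cauchy_at_right:
 fixes g :: "real => complex"
 assumes "!!e. e > 0 ==> \<exists>d>0. \<forall>s t. 0 < s & s < d & 0 < t & t < d --> cmod (g s - g t) <= e"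
 shows "\<exists>L. (g ~~> L)"
proof -
 define X where "X n = g (1 / real (Suc n))" for n
 have "Cauchy X"
 proof (rule metric_CauchyI)
  fix e :: real assume e: "e > 0"
  then obtain d where d: "d > 0" "!!s t. 0 < s ==> s < d ==> 0 < t ==> t < d ==> cmod (g s - g t) <= e / 2"
   using assms[of "e / 2"] by auto
  obtain N where N: "1 / real (Suc N) < d" using nat_approx_posE[OF d(1)] by blast
  have "1 / real (Suc n) < d" if "n \<ge> N" for n
  proof -
   have "1 / real (Suc n) <= 1 / real (Suc N)" using that by (intro divide_left_mono) auto
   thus ?thesis using N by linarith
  qed
  hence "dist (X m) (X n) < e" if "m \<ge> N" "n \<ge> N" for m n
   using d(2)[of "1 / real (Suc m)" "1 / real (Suc n)"] that e by (fastforce simp: X_def dist_norm)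
  thus "\<exists>M. \<forall>m\<ge>M. \<forall>n\<ge>M. dist (X m) (X n) < e" by blast
 qed
 then obtain L where L: "X \<longlonglongrightarrow> L" using Cauchy_convergent convergent_def by blast
 have "(g ~~> L)"
 proof (rule tendstoI)
  fix e :: real assume e: "e > 0"
  then obtain d where d: "d > 0" "!!s t. 0 < s ==> s < d ==> 0 < t ==> t < d ==> cmod (g s - g t) <= e / 2"
   using assms[of "e / 2"] by auto
  have "\<forall>\<^sub>F n in sequentially. 1 / real (Suc n) < d & dist (X n) L < e / 2"
   using order_tendstoD(2)[OF LIMSEQ_inverse_real_of_nat d(1)] tendstoD[OF L, of "e / 2"] e
   by (intro eventually_conj) (auto simp: inverse_eq_divide)
  then obtain n where n: "1 / real (Suc n) < d" "dist (X n) L < e / 2"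
   using eventually_happens' sequentially_bot by blast
  have "dist (g t) L < e" if "0 < t" "t < d" for t
   using d(2)[of t "1 / real (Suc n)"] that n dist_triangle[of "g t" L "X n"] by (simp add: X_def dist_norm)
  thus "EV t. dist (g t) L < e" using d(1) by (auto simp: eventually_at_right_field)
 qed
 thus ?thesis by blast
qed

definition zlim :: "germ => (real => complex) => (real => complex) => complex" where
 "zlim nu \<phi> \<psi> = Lim (at_right 0) (%t. zform (nu t) \<phi> \<psi>)"

lemma zlimI: "((%t. zform (nu t) \<phi> \<psi>) ~~> z) ==> zlim nu \<phi> \<psi> = z"
 unfolding zlim_def by (rule tendsto_Lim) (simp_all add: trivial_limit_at_right_real)

text \<open>Two moments of the same germ are compared through \<open>zform_transfer\<close>, so the
  Cauchy property passes from the monomials to all interpolable functions, also to those that are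
  interpolable only away from a point.\<close>

lemma tendsto_zlim:
 assumes "tgerm nu" "good K B \<phi>" "good K B' \<psi>" "EV t. nodes (nu t) \<subseteq> K"
 shows "((%t. zform (nu t) \<phi> \<psi>) ~~> zlim nu \<phi> \<psi>)"
proof -
 have "\<forall>i j. \<exists>z. i <= 7 --> j <= 7 --> ((%t. zform (nu t) (E i) (E j)) ~~> z)"
  using tgerm_E_convergent[OF assms(1)] by blast
 then obtain z where z: "!!i j. i <= 7 ==> j <= 7 ==> ((%t. zform (nu t) (E i) (E j)) ~~> z i j)" by metis
 have BB: "B * B' \<ge> 0" using good_nonneg[OF assms(2)] good_nonneg[OF assms(3)] by simp
 have "\<exists>L. ((%t. zform (nu t) \<phi> \<psi>) ~~> L)"
 proof (rule cauchy_at_right)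
  fix e :: real assume e: "e > 0"
  define e' where "e' = e / (B * B' + 1)"
  have e': "e' > 0" using e BB by (simp add: e'_def)
  have "EV t. \<forall>i\<in>{..7}. \<forall>j\<in>{..7}. dist (zform (nu t) (E i) (E j)) (z i j) < e' / 2"
   using e' by (intro eventually_ball_finite finite_atMost ballI tendstoD[OF z]) auto
  hence "EV t. nodes (nu t) \<subseteq> K & (\<forall>i\<in>{..7}. \<forall>j\<in>{..7}. dist (zform (nu t) (E i) (E j)) (z i j) < e' / 2)"
   using assms(4) by eventually_elim auto
  then obtain d where d: "d > 0" "!!t. 0 < t ==> t < d ==> nodes (nu t) \<subseteq> K"
   "!!t i j. 0 < t ==> t < d ==> i <= 7 ==> j <= 7 ==> dist (zform (nu t) (E i) (E j)) (z i j) < e' / 2"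
   by (auto simp: eventually_at_right_field)
  have "cmod (zform (nu s) \<phi> \<psi> - zform (nu t) \<phi> \<psi>) <= e" if st: "0 < s" "s < d" "0 < t" "t < d" for s t
  proof -
   have "cmod (zform (nu s) \<phi> \<psi> - 1 * zform (nu t) \<phi> \<psi>) <= B * B' * e'"
   proof (rule zform_transfer[OF assms(2,3)])
    fix i j :: nat assume "i <= 7" "j <= 7"
    hence "dist (zform (nu s) (E i) (E j)) (zform (nu t) (E i) (E j)) <= e'"
     using d(3)[of s i j] d(3)[of t i j] st dist_triangle_half_l by (meson less_imp_le)
    thus "cmod (zform (nu s) (E i) (E j) - 1 * zform (nu t) (E i) (E j)) <= e'" by (simp add: dist_norm)
   qed (use d(2) st in auto)
   also have "... <= (B * B' + 1) * e'" using e' by simp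
   also have "... = e" using BB by (simp add: e'_def)
   finally show ?thesis by simp
  qed
  thus "\<exists>d>0. \<forall>s t. 0 < s & s < d & 0 < t & t < d --> cmod (zform (nu s) \<phi> \<psi> - zform (nu t) \<phi> \<psi>) <= e"
   using d(1) by blast
 qed
 thus ?thesis using zlimI by blast
qed

lemma tendsto_zlim_UNIV:
 assumes "tgerm nu" "good UNIV B \<phi>" "good UNIV B' \<psi>"
 shows "((%t. zform (nu t) \<phi> \<psi>) ~~> zlim nu \<phi> \<psi>)"
 using tendsto_zlim[OF assms] by simp

lemma good_E: "\<exists>B. good K B (E k)"
 unfolding E_def[abs_def] by (rule good_power_ex[OF good_cis])

lemma zlim_normalized:
 assumes "tgerm nu" shows "(cmod (zlim nu (E 1) (E 2)))\<^sup>2 + (cmod (zlim nu (E 1) (E 3)))\<^sup>2 = 1"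
proof -
 obtain B1 B2 B3 where B: "good UNIV B1 (E 1)" "good UNIV B2 (E 2)" "good UNIV B3 (E 3)" using good_E by metis
 have l: "((%t. (cmod (zform (nu t) (E 1) (E 2)))\<^sup>2 + (cmod (zform (nu t) (E 1) (E 3)))\<^sup>2) ~~>
  (cmod (zlim nu (E 1) (E 2)))\<^sup>2 + (cmod (zlim nu (E 1) (E 3)))\<^sup>2)"
  by (intro tendsto_intros tendsto_zlim_UNIV[OF assms B(1) B(2)] tendsto_zlim_UNIV[OF assms B(1) B(3)])
 have "EV t. (cmod (zform (nu t) (E 1) (E 2)))\<^sup>2 + (cmod (zform (nu t) (E 1) (E 3)))\<^sup>2 = 1"
  using assms[unfolded tgerm_def, THEN conjunct2]
 proof eventually_elim
  case (elim t)
  have q: "(cmod (nform (nu t) (E 1) (E 2)))\<^sup>2 + (cmod (nform (nu t) (E 1) (E 3)))\<^sup>2 = (nrm (nu t))\<^sup>2" by (simp add: nrm_def)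
  have "(cmod (zform (nu t) (E 1) (E 2)))\<^sup>2 + (cmod (zform (nu t) (E 1) (E 3)))\<^sup>2 =
   ((cmod (nform (nu t) (E 1) (E 2)))\<^sup>2 + (cmod (nform (nu t) (E 1) (E 3)))\<^sup>2) / (nrm (nu t))\<^sup>2"
   by (simp add: zform_def norm_divide power_divide add_divide_distrib)
  also have "... = (nrm (nu t))\<^sup>2 / (nrm (nu t))\<^sup>2" by (simp only: q)
  also have "... = 1" using elim by simp
  finally show ?case .
 qed
 hence "((%t. (cmod (zform (nu t) (E 1) (E 2)))\<^sup>2 + (cmod (zform (nu t) (E 1) (E 3)))\<^sup>2) ~~> 1)"
  by (rule tendsto_eventually)
 from tendsto_unique[OF _ l this] show ?thesis by (simp add: trivial_limit_at_right_real)
qed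

lemma zlim_plucker:
 assumes "tgerm nu" "good UNIV B1 \<phi>" "good UNIV B2 \<psi>" "good UNIV B3 u" "good UNIV B4 v"
 shows "zlim nu \<phi> \<psi> * zlim nu u v = zlim nu \<phi> u * zlim nu \<psi> v - zlim nu \<phi> v * zlim nu \<psi> u"
proof -
 note t = tendsto_zlim_UNIV[OF assms(1)]
 have "((%t. zform (nu t) \<phi> \<psi> * zform (nu t) u v) ~~> zlim nu \<phi> \<psi> * zlim nu u v)"
  by (intro tendsto_mult t[OF assms(2,3)] t[OF assms(4,5)])
 moreover have "((%t. zform (nu t) \<phi> u * zform (nu t) \<psi> v - zform (nu t) \<phi> v * zform (nu t) \<psi> u) ~~>
  zlim nu \<phi> u * zlim nu \<psi> v - zlim nu \<phi> v * zlim nu \<psi> u)"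
  by (intro tendsto_mult tendsto_diff t[OF assms(2,4)] t[OF assms(3,5)] t[OF assms(2,5)] t[OF assms(3,4)])
 moreover have "zform xs \<phi> \<psi> * zform xs u v = zform xs \<phi> u * zform xs \<psi> v - zform xs \<phi> v * zform xs \<psi> u" for xs
  using nform_plucker[of xs \<phi> \<psi> u v] by (simp add: zform_def diff_divide_distrib[symmetric])
 ultimately show ?thesis by (intro tendsto_unique[of "at_right (0::real)"]) (auto simp: trivial_limit_at_right_real)
qed

lemma zlim_bilinear:
 assumes "tgerm nu" "good UNIV B \<phi>" "good UNIV B' \<phi>'" "good UNIV C \<psi>"
 shows "zlim nu (%x. a * \<phi> x + b * \<phi>' x) \<psi> = a * zlim nu \<phi> \<psi> + b * zlim nu \<phi>' \<psi>"
  and "zlim nu \<psi> (%x. a * \<phi> x + b * \<phi>' x) = a * zlim nu \<psi> \<phi> + b * zlim nu \<psi> \<phi>'"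
proof -
 note t = tendsto_zlim_UNIV[OF assms(1)]
 have eq: "zform xs (%x. a * \<phi> x + b * \<phi>' x) \<psi> = a * zform xs \<phi> \<psi> + b * zform xs \<phi>' \<psi>"
  "zform xs \<psi> (%x. a * \<phi> x + b * \<phi>' x) = a * zform xs \<psi> \<phi> + b * zform xs \<psi> \<phi>'" for xs
  by (simp_all add: zform_def nform_bilinear add_divide_distrib)
 show "zlim nu (%x. a * \<phi> x + b * \<phi>' x) \<psi> = a * zlim nu \<phi> \<psi> + b * zlim nu \<phi>' \<psi>"
  by (rule zlimI, unfold eq, intro tendsto_intros t[OF assms(2,4)] t[OF assms(3,4)])
 show "zlim nu \<psi> (%x. a * \<phi> x + b * \<phi>' x) = a * zlim nu \<psi> \<phi> + b * zlim nu \<psi> \<phi>'"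
  by (rule zlimI, unfold eq, intro tendsto_intros t[OF assms(4,2)] t[OF assms(4,3)])
qed

lemma zlim_swap:
 assumes "tgerm nu" "good UNIV B \<phi>" "good UNIV C \<psi>"
 shows "zlim nu \<psi> \<phi> = - zlim nu \<phi> \<psi>"
proof -
 have eq: "zform xs \<psi> \<phi> = - zform xs \<phi> \<psi>" for xs using nform_swap[of xs \<psi> \<phi>] by (simp add: zform_def)
 show ?thesis by (rule zlimI, unfold eq, intro tendsto_intros tendsto_zlim_UNIV[OF assms])
qed

lemma norm_zlim_le:
 assumes "tgerm nu" "good K B \<phi>" "good K B' \<psi>" "EV t. nodes (nu t) \<subseteq> K"
 shows "cmod (zlim nu \<phi> \<psi>) <= B * B' * CC"
proof (rule tendsto_upperbound[OF tendsto_norm[OF tendsto_zlim[OF assms]]])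
 show "EV t. cmod (zform (nu t) \<phi> \<psi>) <= B * B' * CC"
  using assms(4) by eventually_elim (rule norm_zform_le[OF assms(2,3)])
qed (simp add: trivial_limit_at_right_real)

definition RB :: "alg" where
 "RB = (%k x. cos (real k * x)) ` {1..3} \<union> (%k x. sin (real k * x)) ` {1..3}"

lemma RB_trigL: "u \<in> RB ==> u \<in> trigL 8" by (auto simp: RB_def trigL_cos trigL_sin)

lemma E_eq: "E k = (%x. 1 * cx (%x. cos (real k * x)) x + \<i> * cx (%x. sin (real k * x)) x)"
 by (rule ext) (simp add: E_def cx_def Complex.DeMoivre complex_eq_iff)

text \<open>If all values were below 1/16, the four terms of the expansion of \<open>E 1\<close> and
  \<open>E k\<close> into cosines and sines would add up to at most 1/4, against the normalization
  of the limit form.\<close>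

lemma RB_pair:
 assumes "tgerm nu" obtains u v where "u \<in> RB" "v \<in> RB" "cmod (zlim nu (cx u) (cx v)) \<ge> 1 / 16"
proof -
 have "\<exists>u\<in>RB. \<exists>v\<in>RB. cmod (zlim nu (cx u) (cx v)) \<ge> 1 / 16"
 proof (rule ccontr)
  assume "\<not> ?thesis"
  hence small: "!!u v. u \<in> RB ==> v \<in> RB ==> cmod (zlim nu (cx u) (cx v)) < 1 / 16" by force
  have g: "\<exists>B. good UNIV B (cx (%x. cos (real k * x)))" "\<exists>B. good UNIV B (cx (%x. sin (real k * x)))" if "k \<in> {1..3}" for k
   using that by (auto intro!: trigL_good trigL_cos trigL_sin)
  have "cmod (zlim nu (E 1) (E k)) <= 1 / 4" if k: "k \<in> {1..3}" for k
  proof -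
   obtain A1 A2 C1 C2 where G: "good UNIV A1 (cx (%x. cos (real 1 * x)))" "good UNIV A2 (cx (%x. sin (real 1 * x)))"
    "good UNIV C1 (cx (%x. cos (real k * x)))" "good UNIV C2 (cx (%x. sin (real k * x)))"
    using g[of 1] g[OF k] by auto
   obtain D where D: "good UNIV D (E k)" using good_E by blast
   have in1: "(%x. cos (real j * x)) \<in> RB" "(%x. sin (real j * x)) \<in> RB" if "j \<in> {1..3}" for j
    using that by (auto simp: RB_def)
   have "zlim nu (E 1) (E k) = 1 * zlim nu (cx (%x. cos (real 1 * x))) (E k) + \<i> * zlim nu (cx (%x. sin (real 1 * x))) (E k)"
    by (subst E_eq[of 1]) (rule zlim_bilinear(1)[OF assms G(1) G(2) D])
   also have "... = 1 * (1 * zlim nu (cx (%x. cos (real 1 * x))) (cx (%x. cos (real k * x))) + \<i> * zlim nu (cx (%x. cos (real 1 * x))) (cx (%x. sin (real k * x))))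
    + \<i> * (1 * zlim nu (cx (%x. sin (real 1 * x))) (cx (%x. cos (real k * x))) + \<i> * zlim nu (cx (%x. sin (real 1 * x))) (cx (%x. sin (real k * x))))"
    unfolding E_eq[of k] by (simp only: zlim_bilinear(2)[OF assms G(3) G(4) G(1)] zlim_bilinear(2)[OF assms G(3) G(4) G(2)])
   also have "cmod ... <= (1/16 + 1/16) + (1/16 + 1/16)"
    using in1[of 1] in1[OF k] small
    by (intro order_trans[OF norm_triangle_ineq] add_mono; (simp only: norm_mult norm_one norm_ii mult_1)?;
      intro order_trans[OF norm_triangle_ineq] add_mono; simp add: norm_mult less_imp_le)
   finally show ?thesis by simp
  qed
  from this[of 2] this[of 3] have "(cmod (zlim nu (E 1) (E 2)))\<^sup>2 <= (1/4)\<^sup>2" "(cmod (zlim nu (E 1) (E 3)))\<^sup>2 <= (1/4)\<^sup>2"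
   by (auto intro!: power_mono)
  thus False using zlim_normalized[OF assms] by (simp add: power2_eq_square)
 qed
 thus ?thesis using that by blast
qed

subsection \<open>The limit algebra of a germ inside the test space\<close>

definition rform :: "conf => (real => real) => (real => real) => real" where
 "rform xs f g = (f (xs 0) - f (xs 1)) * (g (xs 2) - g (xs 3)) - (f (xs 2) - f (xs 3)) * (g (xs 0) - g (xs 1))"

lemma nform_cx: "nform xs (cx f) (cx g) = of_real (rform xs f g)" by (simp add: nform_def rform_def cx_def)

lemma Cr_continuous_lincomb:
 assumes "continuous_on {0..<\<epsilon>} p" "continuous_on {0..<\<epsilon>} q" "continuous_on {0..<\<epsilon>} r"
  and f: "f \<in> trigL N" "u \<in> trigL N" "v \<in> trigL N"
 shows "Cr_continuous n \<epsilon> (%t x. p t * f x + q t * u x + r t * v x)"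
 unfolding Cr_continuous_def
proof (intro allI impI ballI)
 fix j t0 and e :: real assume t0: "t0 \<in> {0..<\<epsilon>}" and e: "e > 0"
 have eq: "(deriv ^^ j) (%x. p t * f x + q t * u x + r t * v x) =
  (%x. p t * (deriv ^^ j) f x + q t * (deriv ^^ j) u x + r t * (deriv ^^ j) v x)" for t
  using trigL_deriv_lincomb[OF trigL_lincomb[OF f(1,2), of "p t" "q t"] f(3), of j 1 "r t"]
   trigL_deriv_lincomb[OF f(1,2), of j "p t" "q t"] by simp
 obtain A B C where B: "!!x. \<bar>(deriv ^^ j) f x\<bar> <= A" "!!x. \<bar>(deriv ^^ j) u x\<bar> <= B" "!!x. \<bar>(deriv ^^ j) v x\<bar> <= C"
  using trigL_bounded[OF trigL_funpow_deriv] f by metis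
 define M where "M = A + B + C + 1"
 have ABC: "A \<ge> 0" "B \<ge> 0" "C \<ge> 0"
  using order_trans[OF abs_ge_zero B(1)[of 0]] order_trans[OF abs_ge_zero B(2)[of 0]] order_trans[OF abs_ge_zero B(3)[of 0]] by auto
 have M: "M > 0" "\<bar>(deriv ^^ j) f x\<bar> <= M" "\<bar>(deriv ^^ j) u x\<bar> <= M" "\<bar>(deriv ^^ j) v x\<bar> <= M" for x
  using ABC B(1)[of x] B(2)[of x] B(3)[of x] by (auto simp: M_def)
 have e': "e / (3 * M) > 0" using e M by simp
 have c: "\<exists>d>0. \<forall>t\<in>{0..<\<epsilon>}. \<bar>t - t0\<bar> < d --> \<bar>g t - g t0\<bar> <= e / (3 * M)" if "continuous_on {0..<\<epsilon>} g" for g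
  using that[unfolded continuous_on_iff, rule_format, OF t0 e'] by (fastforce simp: dist_real_def)
 obtain d1 where d1: "d1 > 0" "!!t. t\<in>{0..<\<epsilon>} ==> \<bar>t - t0\<bar> < d1 ==> \<bar>p t - p t0\<bar> <= e / (3 * M)" using c[OF assms(1)] by blast
 obtain d2 where d2: "d2 > 0" "!!t. t\<in>{0..<\<epsilon>} ==> \<bar>t - t0\<bar> < d2 ==> \<bar>q t - q t0\<bar> <= e / (3 * M)" using c[OF assms(2)] by blast
 obtain d3 where d3: "d3 > 0" "!!t. t\<in>{0..<\<epsilon>} ==> \<bar>t - t0\<bar> < d3 ==> \<bar>r t - r t0\<bar> <= e / (3 * M)" using c[OF assms(3)] by blast
 have "\<bar>(p t * (deriv ^^ j) f x + q t * (deriv ^^ j) u x + r t * (deriv ^^ j) v x) -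
   (p t0 * (deriv ^^ j) f x + q t0 * (deriv ^^ j) u x + r t0 * (deriv ^^ j) v x)\<bar> <= e"
  if t: "t\<in>{0..<\<epsilon>}" "\<bar>t - t0\<bar> < min d1 (min d2 d3)" for t x
 proof -
  have "(p t * (deriv ^^ j) f x + q t * (deriv ^^ j) u x + r t * (deriv ^^ j) v x) -
   (p t0 * (deriv ^^ j) f x + q t0 * (deriv ^^ j) u x + r t0 * (deriv ^^ j) v x)
   = (p t - p t0) * (deriv ^^ j) f x + (q t - q t0) * (deriv ^^ j) u x + (r t - r t0) * (deriv ^^ j) v x"
   by (simp add: algebra_simps)
  also have "\<bar>...\<bar> <= e / (3 * M) * M + e / (3 * M) * M + e / (3 * M) * M"
   using d1(2)[of t] d2(2)[of t] d3(2)[of t] t M e'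
   by (intro order_trans[OF abs_triangle_ineq] add_mono; simp only: abs_mult; intro mult_mono) auto
  also have "... = e" using M by simp
  finally show ?thesis .
 qed
 thus "\<exists>\<delta>>0. \<forall>t\<in>{0..<\<epsilon>}. \<bar>t - t0\<bar> < \<delta> --> (\<forall>x. \<bar>(deriv ^^ j) (%x. p t * f x + q t * u x + r t * v x) x -
  (deriv ^^ j) (%x. p t0 * f x + q t0 * u x + r t0 * v x) x\<bar> <= e)"
  unfolding eq using d1(1) d2(1) d3(1) by (intro exI[of _ "min d1 (min d2 d3)"]) auto
qed

lemma smooth_circ_periodic: "smooth_circ f ==> (deriv ^^ n) f (x + 2 * pi) = (deriv ^^ n) f x"
proof (induction n arbitrary: x)
 case (Suc n)
 have d: "(((deriv ^^ n) f) has_real_derivative deriv ((deriv ^^ n) f) y) (at y)" for y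
  using Suc.prems by (auto simp: smooth_circ_def DERIV_deriv_iff_real_differentiable)
 have "((%x. (deriv ^^ n) f (x + 2 * pi)) has_real_derivative deriv ((deriv ^^ n) f) (x + 2 * pi)) (at x)"
  using d[of "x + 2 * pi"] DERIV_shift by blast
 moreover have "(%x. (deriv ^^ n) f (x + 2 * pi)) = (deriv ^^ n) f" using Suc by auto
 ultimately have "deriv ((deriv ^^ n) f) x = deriv ((deriv ^^ n) f) (x + 2 * pi)" by (simp add: DERIV_imp_deriv)
 thus ?case by simp
qed (simp add: smooth_circ_def)

lemma pt_alg_2: "f \<in> pt_alg 2 xs \<longleftrightarrow> smooth_circ f & f (xs 0) = f (xs 1) & f (xs 2) = f (xs 3)"
proof -
 have "(\<forall>i<2. P i) \<longleftrightarrow> P 0 & P (1::nat)" for P by (auto simp: less_2_cases_iff One_nat_def)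
 thus ?thesis by (simp add: pt_alg_def)
qed

text \<open>A function of the limit algebra is C^3 close to functions of the algebras along the
  germ, on which the form vanishes; the bound for smooth functions, divided by \<open>nrm\<close>,
  tends to 0.\<close>

lemma limit_alg_imp_zlim:
 assumes g: "curve_germ 2 \<epsilon> nu" and f: "f \<in> trigL 8" "f \<in> limit_alg 2 \<epsilon> nu"
 shows "zlim nu (cx f) (E j) = 0"
proof -
 have \<epsilon>: "\<epsilon> > 0" using g by (simp add: curve_germ_def)
 obtain fam where fam: "fam 0 = f" "Cr_continuous 4 \<epsilon> fam" "!!t. 0 < t ==> t < \<epsilon> ==> fam t \<in> pt_alg 2 (nu t)"
  using f(2) by (auto simp: limit_alg_def)
 have sm: "smooth_circ f" by (rule trigL_smooth_circ[OF f(1)])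
 have "((%t. zform (nu t) (cx f) (E j)) ~~> 0)"
 proof (rule tendstoI)
  fix e :: real assume e: "e > 0"
  \<comment> \<open>\<open>32 * 6 ^ j\<close> comes from the smooth bound, 6 from
    \<open>mdist_le_nrm\<close>, and 2 makes the final inequality strict.\<close>
  define \<eta> where "\<eta> = e / (32 * 6 ^ j * 6 * 2)"
  have \<eta>: "\<eta> > 0" using e by (simp add: \<eta>_def)
  have "\<forall>i\<in>{..3::nat}. \<exists>d>0. \<forall>t\<in>{0..<\<epsilon>}. \<bar>t\<bar> < d --> (\<forall>x. \<bar>(deriv ^^ i) (fam t) x - (deriv ^^ i) (fam 0) x\<bar> <= \<eta>)"
  proof
   fix i :: nat assume "i \<in> {..3}"
   hence "i <= 4" by simp
   from fam(2)[unfolded Cr_continuous_def, rule_format, OF this, of 0 \<eta>]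
   show "\<exists>d>0. \<forall>t\<in>{0..<\<epsilon>}. \<bar>t\<bar> < d --> (\<forall>x. \<bar>(deriv ^^ i) (fam t) x - (deriv ^^ i) (fam 0) x\<bar> <= \<eta>)"
    using \<epsilon> \<eta> by simp
  qed
  then obtain d where d: "!!i. i <= 3 ==> d i > 0"
   "!!i t x. i <= 3 ==> t\<in>{0..<\<epsilon>} ==> \<bar>t\<bar> < d i ==> \<bar>(deriv ^^ i) (fam t) x - (deriv ^^ i) (fam 0) x\<bar> <= \<eta>"
   by (metis atMost_iff)
  define D where "D = Min (insert \<epsilon> (d ` {..3}))"
  have D: "D > 0" "D <= \<epsilon>" "!!i. i <= 3 ==> D <= d i" using d(1) \<epsilon> by (auto simp: D_def simp del: Min_insert)
  have "cmod (zform (nu t) (cx f) (E j)) < e" if t: "0 < t" "t < D" for t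
  proof -
   have te: "0 < t" "t < \<epsilon>" using t D by auto
   have pt: "smooth_circ (fam t)" "fam t (nu t 0) = fam t (nu t 1)" "fam t (nu t 2) = fam t (nu t 3)"
    using fam(3)[OF te] by (simp_all add: pt_alg_2)
   define h where "h i x = (deriv ^^ i) (fam t) x - (deriv ^^ i) f x" for i x
   have dh: "(h i has_real_derivative h (Suc i) x) (at x)" for i x
    unfolding h_def[abs_def] using pt(1) sm by (auto simp: smooth_circ_def DERIV_deriv_iff_real_differentiable intro!: DERIV_diff)
   have bh: "\<bar>h i x\<bar> <= \<eta>" if "i <= 3" for i x
    using d(2)[OF that, of t x] te t D(3)[OF that] by (simp add: h_def fam(1))
   have ph: "h i (x + 2 * pi) = h i x" for i x
    using smooth_circ_periodic[OF pt(1)] smooth_circ_periodic[OF sm] by (simp add: h_def)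
   interpret periodic_C3 "h 0" "h (Suc 0)" "h (Suc (Suc 0))" "h (Suc (Suc (Suc 0)))" \<eta>
    by unfold_locales (use dh bh ph in auto)
   have eq: "cx f = (%x. cx (fam t) x - of_real (h 0 x))" by (auto simp: cx_def h_def)
   have "nform (nu t) (cx (fam t)) (E j) = 0" using pt by (simp add: nform_def cx_def)
   hence "cmod (nform (nu t) (cx f) (E j)) = cmod (nform (nu t) (%x. of_real (h 0 x)) (E j))"
    unfolding eq nform_bilinear by simp
   also have "... <= 32 * 6 ^ j * \<eta> * mdist (nu t)" by (rule norm_nform_smooth_le)
   also have "... <= 32 * 6 ^ j * \<eta> * (6 * nrm (nu t))"
    using \<eta> by (intro mult_left_mono mdist_le_nrm) auto
   finally have "cmod (nform (nu t) (cx f) (E j)) <= e / 2 * nrm (nu t)" by (simp add: \<eta>_def)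
   moreover have "nrm (nu t) > 0" using g te by (intro config_nrm_pos) (auto simp: curve_germ_def)
   ultimately have "cmod (zform (nu t) (cx f) (E j)) <= e / 2" by (simp add: zform_def norm_divide pos_divide_le_eq)
   thus ?thesis using e by simp
  qed
  thus "EV t. dist (zform (nu t) (cx f) (E j)) 0 < e"
   using D(1) by (auto simp: eventually_at_right_field)
 qed
 thus ?thesis by (rule zlimI)
qed

lemma zlim_zero_good:
 assumes "tgerm nu" "good UNIV B \<phi>" "!!j. j <= 7 ==> zlim nu \<phi> (E j) = 0" "good UNIV B' \<psi>"
 shows "zlim nu \<phi> \<psi> = 0"
proof -
 have l: "((%t. \<Sum>j\<le>7. B' * cmod (zform (nu t) \<phi> (E j))) ~~> (\<Sum>j\<le>(7::nat). B' * cmod 0))"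
 proof (intro tendsto_intros)
  fix j :: nat assume "j \<in> {..7}"
  obtain D where "good UNIV D (E j)" using good_E by blast
  from tendsto_zlim_UNIV[OF assms(1,2) this] show "((%t. zform (nu t) \<phi> (E j)) ~~> 0)"
   using assms(3) \<open>j \<in> {..7}\<close> by simp
 qed
 have b: "cmod (zform xs \<phi> \<psi>) <= (\<Sum>j\<le>7. B' * cmod (zform xs \<phi> (E j)))" for xs
 proof -
  have c: "card (cis ` nodes xs) <= 8" using nodes_simps(2)[of xs] by simp
  obtain s where s: "degree s <= 7" "pnorm s <= B'" "!!x. x \<in> nodes xs ==> poly s (cis x) = \<psi> x"
   using goodD[OF assms(4) nodes_simps(1) subset_UNIV c] by blast
  have "poly s (cis x) = (\<Sum>i\<le>7. poly.coeff s i * E i x)" for x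
   unfolding poly_altdef E_def by (rule sum.mono_neutral_left) (use s(1) in \<open>auto simp: coeff_eq_0\<close>)
  hence "nform xs \<phi> \<psi> = nform xs \<phi> (%x. \<Sum>i\<le>7. poly.coeff s i * E i x)"
   using s(3) by (intro nform_cong) (auto simp: nodes_def)
  hence "zform xs \<phi> \<psi> = (\<Sum>i\<le>7. poly.coeff s i * zform xs \<phi> (E i))"
   unfolding nform_sum nform_bilinear zform_def by (simp add: sum_divide_distrib)
  also have "cmod ... <= (\<Sum>j\<le>7. B' * cmod (zform xs \<phi> (E j)))"
   using pnorm_coeff[of s] s(2) by (intro sum_norm_le) (auto simp: norm_mult intro!: mult_right_mono intro: order_trans)
  finally show ?thesis .
 qed
 have "((%t. zform (nu t) \<phi> \<psi>) ~~> 0)" by (rule Lim_null_comparison[OF _ l[simplified]]) (use b in auto)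
 thus ?thesis by (rule zlimI)
qed

lemma zlim_cx_real:
 assumes "tgerm nu" "f \<in> trigL 8" "g \<in> trigL 8"
 shows "Im (zlim nu (cx f) (cx g)) = 0"
proof -
 obtain B C where "good UNIV B (cx f)" "good UNIV C (cx g)" using trigL_good assms by blast
 from tendsto_zlim_UNIV[OF assms(1) this] have "((%t. Im (zform (nu t) (cx f) (cx g))) ~~> Im (zlim nu (cx f) (cx g)))"
  by (rule tendsto_Im)
 moreover have "Im (zform xs (cx f) (cx g)) = 0" for xs by (simp add: zform_def nform_cx)
 ultimately show ?thesis using tendsto_unique[of "at_right (0::real)" "%t. 0"] by (simp add: trivial_limit_at_right_real tendsto_const_iff)
qed

definition corr :: "real => real => (real => real) => (real => real) => (real => real) => real => real" where
 "corr x y f u v = (%s. 1 * (1 * f s + (- x) * u s) + (- y) * v s)"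

lemma corr_trigL: "f \<in> trigL N ==> u \<in> trigL N ==> v \<in> trigL N ==> corr x y f u v \<in> trigL N"
 unfolding corr_def by (intro trigL_lincomb)

text \<open>By the Plucker relation the limit form has rank two. If it does not vanish on
  \<open>u\<close> and \<open>v\<close>, then subtracting the multiples of \<open>u\<close> and
  \<open>v\<close> given by Cramer's rule projects \<open>f\<close> into its kernel.\<close>

lemma zlim_correction:
 assumes t: "tgerm nu" and f: "f \<in> trigL 8" "u \<in> trigL 8" "v \<in> trigL 8" and nz: "zlim nu (cx u) (cx v) ~= 0"
  and x: "x = Re (zlim nu (cx f) (cx v) / zlim nu (cx u) (cx v))" and y: "y = - Re (zlim nu (cx f) (cx u) / zlim nu (cx u) (cx v))"
  and g: "good UNIV B \<psi>"
 shows "zlim nu (cx (corr x y f u v)) \<psi> = 0"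
proof -
 obtain Bf Bu Bv where G: "good UNIV Bf (cx f)" "good UNIV Bu (cx u)" "good UNIV Bv (cx v)"
  using trigL_good f by metis
 let ?z = "zlim nu"
 have X: "of_real x = ?z (cx f) (cx v) / ?z (cx u) (cx v)" "of_real y = - (?z (cx f) (cx u) / ?z (cx u) (cx v))"
  using zlim_cx_real[OF t] f by (auto simp: x y complex_eq_iff Im_divide)
 have eq: "cx (corr x y f u v) = (%s. 1 * (1 * cx f s + of_real (- x) * cx u s) + of_real (- y) * cx v s)"
  by (auto simp: cx_def corr_def)
 have G1: "\<exists>B. good UNIV B (%s. 1 * cx f s + of_real (- x) * cx u s)"
  using good_add[OF good_mult[OF good_const[of UNIV 1] G(1)] good_mult[OF good_const[of UNIV "of_real (- x)"] G(2)]] by blast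
 then obtain B1 where B1: "good UNIV B1 (%s. 1 * cx f s + of_real (- x) * cx u s)" by blast
 have "?z (cx (corr x y f u v)) \<psi> = ?z (cx f) \<psi> - of_real x * ?z (cx u) \<psi> - of_real y * ?z (cx v) \<psi>"
  unfolding eq zlim_bilinear(1)[OF t B1 G(3) g] zlim_bilinear(1)[OF t G(1) G(2) g] by simp
 hence "?z (cx (corr x y f u v)) \<psi> * ?z (cx u) (cx v) =
  ?z (cx f) \<psi> * ?z (cx u) (cx v) - ?z (cx f) (cx v) * ?z (cx u) \<psi> + ?z (cx f) (cx u) * ?z (cx v) \<psi>"
  using nz by (simp add: X field_simps)
 also have "... = 0"
  using zlim_plucker[OF t G(1) g G(2) G(3)] zlim_swap[OF t G(2) g] zlim_swap[OF t G(3) g] by (simp add: algebra_simps)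
 finally show ?thesis using nz by simp
qed

lemma rform_corr_zero:
 assumes "rform xs u v ~= 0" "x = rform xs f v / rform xs u v" "y = - rform xs f u / rform xs u v"
 shows "corr x y f u v (xs 0) = corr x y f u v (xs 1)" "corr x y f u v (xs 2) = corr x y f u v (xs 3)"
proof -
 define a1 a2 b1 b2 c1 c2 where "a1 = f (xs 0) - f (xs 1)" "a2 = f (xs 2) - f (xs 3)"
  "b1 = u (xs 0) - u (xs 1)" "b2 = u (xs 2) - u (xs 3)" "c1 = v (xs 0) - v (xs 1)" "c2 = v (xs 2) - v (xs 3)"
 have d: "b1 * c2 - b2 * c1 ~= 0" and x: "x = (a1 * c2 - a2 * c1) / (b1 * c2 - b2 * c1)" and y: "y = - (a1 * b2 - a2 * b1) / (b1 * c2 - b2 * c1)"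
  using assms by (simp_all add: rform_def a1_a2_b1_b2_c1_c2_def)
 have "a1 - x * b1 - y * c1 = 0" "a2 - x * b2 - y * c2 = 0"
  unfolding x y using d by (simp_all add: field_simps)
 thus "corr x y f u v (xs 0) = corr x y f u v (xs 1)" "corr x y f u v (xs 2) = corr x y f u v (xs 3)"
  by (simp_all add: corr_def a1_a2_b1_b2_c1_c2_def algebra_simps)
qed

text \<open>Near 0, Cramer's rule with \<open>u\<close> and \<open>v\<close> corrects
  \<open>f\<close> to an element of each algebra along the germ, and the corrections tend to 0
  because the limit form kills \<open>f\<close>. Away from 0 the determinant may vanish, so the
  family has to be cut off.\<close>

lemma zlim_imp_limit_alg:
 assumes g: "curve_germ 2 \<epsilon> nu" and f: "f \<in> trigL 8" and z: "!!j. j <= 7 ==> zlim nu (cx f) (E j) = 0"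
 shows "f \<in> limit_alg 2 \<epsilon> nu"
proof -
 have \<epsilon>: "\<epsilon> > 0" using g by (simp add: curve_germ_def)
 have t: "tgerm nu" by (rule curve_germ_tgerm[OF g])
 obtain u v where uv: "u \<in> RB" "v \<in> RB" "cmod (zlim nu (cx u) (cx v)) \<ge> 1 / 16" using RB_pair[OF t] by blast
 note uL = RB_trigL[OF uv(1)] and vL = RB_trigL[OF uv(2)]
 obtain Bf Bu Bv where G: "good UNIV Bf (cx f)" "good UNIV Bu (cx u)" "good UNIV Bv (cx v)"
  using trigL_good f uL vL by metis
 have zr: "zform xs (cx a) (cx b) = of_real (rform xs a b / nrm xs)" for xs a b by (simp add: zform_def nform_cx)
 define X where "X t = rform (nu t) f v / rform (nu t) u v" for t
 define Y where "Y t = - rform (nu t) f u / rform (nu t) u v" for t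
 note T = tendsto_zlim_UNIV[OF t]
 have nz: "zlim nu (cx u) (cx v) ~= 0" using uv(3) by auto
 have ev: "EV s. rform (nu s) u v ~= 0 & nrm (nu s) > 0"
 proof -
  have "EV s. zform (nu s) (cx u) (cx v) ~= 0" by (rule tendsto_imp_eventually_ne[OF T[OF G(2) G(3)] nz])
  thus ?thesis using t[unfolded tgerm_def, THEN conjunct2] by eventually_elim (auto simp: zr)
 qed
 then obtain t2 where t2: "t2 > 0" "!!s. 0 < s ==> s < t2 ==> rform (nu s) u v ~= 0 & nrm (nu s) > 0"
  by (auto simp: eventually_at_right_field)
 have lim0: "((%s. rform (nu s) f w / rform (nu s) u v) ~~> 0)" if w: "good UNIV Bw (cx w)" for w Bw
 proof -
  have "((%s. zform (nu s) (cx f) (cx w) / zform (nu s) (cx u) (cx v)) ~~> zlim nu (cx f) (cx w) / zlim nu (cx u) (cx v))"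
   by (intro tendsto_divide T[OF G(1) w] T[OF G(2) G(3)] nz)
  hence "((%s. zform (nu s) (cx f) (cx w) / zform (nu s) (cx u) (cx v)) ~~> of_real 0)"
   using zlim_zero_good[OF t G(1) z w] by simp
  moreover have "EV s. zform (nu s) (cx f) (cx w) / zform (nu s) (cx u) (cx v) = of_real (rform (nu s) f w / rform (nu s) u v)"
   using ev by eventually_elim (simp add: zr)
  ultimately have "((%s. complex_of_real (rform (nu s) f w / rform (nu s) u v)) ~~> of_real 0)" by (rule Lim_transform_eventually)
  thus ?thesis by (simp only: tendsto_of_real_iff)
 qed
 have X0: "(X ~~> 0)" unfolding X_def by (rule lim0[OF G(3)])
 have Y0: "(Y ~~> 0)" unfolding Y_def using tendsto_minus[OF lim0[OF G(2)]] by simp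
 have nuc: "continuous_on {0..<\<epsilon>} (%t. nu t i)" if "i < 4" for i using g that by (auto simp: curve_germ_def)
 have wc: "continuous_on UNIV w" if "w \<in> trigL 8" for w
  using trigL_deriv(2)[OF that] by (auto intro!: continuous_at_imp_continuous_on DERIV_isCont)
 have rc: "continuous_on {0..<\<epsilon>} (%s. rform (nu s) a b)" if "a \<in> trigL 8" "b \<in> trigL 8" for a b
  unfolding rform_def
  by (intro continuous_intros continuous_on_compose2[OF wc[OF that(1)]] continuous_on_compose2[OF wc[OF that(2)]] nuc) auto
 define t1 where "t1 = min t2 \<epsilon> / 2"
 have t1: "0 < t1" "t1 < t2" "t1 < \<epsilon>" using t2(1) \<epsilon> by (auto simp: t1_def)
 \<comment> \<open>From \<open>t1\<close> on the family is 0, which belongs to every algebra; the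
   cutoff ends before the determinant of \<open>u\<close> and \<open>v\<close> can vanish.\<close>
 define cut where "cut s = max 0 (1 - s / t1)" for s
 define q where "q Z s = (if s = 0 then 0 else - cut s * Z s)" for Z :: "real => real" and s
 have qc: "continuous_on {0..<\<epsilon>} (q Z)" if Zc: "continuous_on ({0<..<t2} \<inter> {0..<\<epsilon>}) Z" and Z0: "(Z ~~> 0)" for Z
  unfolding continuous_on_eq_continuous_within
 proof
  fix s assume s: "s \<in> {0..<\<epsilon>}"
  consider "s = 0" | "0 < s" "s < t2" | "t1 < s" using t1 s by force
  thus "continuous (at s within {0..<\<epsilon>}) (q Z)"
  proof cases
   case 1
   have "((%s. - cut s * Z s) ~~> - max 0 (1 - 0 / t1) * 0)"
    unfolding cut_def by (intro tendsto_intros Z0) (use t1 in auto)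
   hence "(q Z ~~> 0)" by (simp, elim Lim_transform_eventually) (auto simp: q_def eventually_at_filter)
   moreover have "at 0 within {0..<\<epsilon>} <= at_right (0::real)"
    unfolding at_within_def by (intro inf_mono order_refl) auto
   ultimately show ?thesis using 1 by (simp add: continuous_within q_def tendsto_mono)
  next
   case 2
   have "continuous_on ({0<..<t2} \<inter> {0..<\<epsilon>}) (%s. - cut s * Z s)"
    unfolding cut_def by (intro continuous_intros Zc) (use t1 in auto)
   hence "continuous_on ({0<..<t2} \<inter> {0..<\<epsilon>}) (q Z)" by (rule continuous_on_eq) (auto simp: q_def)
   moreover have "{0<..<t2} \<inter> {0..<\<epsilon>} = {0<..<min t2 \<epsilon>}" using \<epsilon> by auto
   ultimately have "isCont (q Z) s" using 2 s by (simp add: continuous_on_eq_continuous_at)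
   thus ?thesis by (rule continuous_at_imp_continuous_within)
  next
   case 3
   have "\<forall>\<^sub>F x in nhds s. x \<in> {t1<..}" using 3 by (intro eventually_nhds_in_open) auto
   hence "\<forall>\<^sub>F x in nhds s. q Z x = 0" by eventually_elim (use t1 in \<open>auto simp: q_def cut_def field_simps max_def\<close>)
   hence "isCont (q Z) s = isCont (%_. 0::real) s" by (rule isCont_cong)
   thus ?thesis by (simp add: continuous_at_imp_continuous_within)
  qed
 qed
 have sub: "{0<..<t2} \<inter> {0..<\<epsilon>} \<subseteq> {0..<\<epsilon>}" by auto
 have "continuous_on ({0<..<t2} \<inter> {0..<\<epsilon>}) X" "continuous_on ({0<..<t2} \<inter> {0..<\<epsilon>}) Y"
  unfolding X_def Y_def using t2(2) by (intro continuous_intros continuous_on_subset[OF rc sub] f uL vL; auto)+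
 hence c: "continuous_on {0..<\<epsilon>} (q X)" "continuous_on {0..<\<epsilon>} (q Y)" using qc X0 Y0 by blast+
 define fam where "fam s x = cut s * f x + q X s * u x + q Y s * v x" for s x
 have famc: "fam s = (%x. cut s * corr (X s) (Y s) f u v x)" if "s ~= 0" for s
  using that by (auto simp: fam_def q_def corr_def algebra_simps)
 have chi: "continuous_on {0..<\<epsilon>} cut" unfolding cut_def by (intro continuous_intros) (use t1 in auto)
 have "fam s \<in> pt_alg 2 (nu s)" if s: "0 < s" "s < \<epsilon>" for s
 proof -
  have L: "fam s \<in> trigL 8" using s by (simp add: famc trigL_cmul corr_trigL f uL vL)
  have "fam s (nu s 0) = fam s (nu s 1) & fam s (nu s 2) = fam s (nu s 3)"
  proof (cases "s < t2")
   case True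
   have r: "rform (nu s) u v ~= 0" using t2(2) s True by blast
   show ?thesis using rform_corr_zero[OF r, of "X s" f "Y s"] s by (simp add: famc X_def Y_def)
  next
   case False
   hence "cut s = 0" using t1 by (auto simp: cut_def field_simps max_def)
   thus ?thesis using s by (simp add: famc)
  qed
  thus ?thesis using trigL_smooth_circ[OF L] by (simp add: pt_alg_2)
 qed
 moreover have "fam 0 = f" by (auto simp: fam_def q_def cut_def)
 moreover have "Cr_continuous (2 * 2) \<epsilon> fam" unfolding fam_def[abs_def] by (rule Cr_continuous_lincomb[OF chi c f uL vL])
 ultimately show ?thesis unfolding limit_alg_def using trigL_smooth_circ[OF f] by auto
qed

subsection \<open>The topology of the space of equilevel algebras\<close>

definition zdat :: "germ => nat => nat => complex" where
 "zdat nu i j = zlim nu (E i) (E j)"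

definition sclose :: "complex => real => (nat => nat => complex) => (nat => nat => complex) => bool" where
 "sclose \<sigma> e A B \<longleftrightarrow> (\<forall>i\<le>7. \<forall>j\<le>7. cmod (A i j - \<sigma> * B i j) <= e)"

text \<open>The sign of the form depends on the order of the points, so an algebra determines its
  table only up to sign.\<close>

definition close :: "real => (nat => nat => complex) => (nat => nat => complex) => bool" where
 "close e A B \<longleftrightarrow> sclose 1 e A B \<or> sclose (- 1) e A B"

lemma close_iff: "close e A B \<longleftrightarrow> (\<exists>\<sigma>\<in>{1, -1}. sclose \<sigma> e A B)"
 by (auto simp: close_def)

lemma sclose_sym: "\<sigma> \<in> {1, -1} ==> sclose \<sigma> e A B ==> sclose \<sigma> e B A"
 unfolding sclose_def by (auto simp: norm_minus_commute add.commute)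

lemma close_sym: "close e A B ==> close e B A"
 unfolding close_iff using sclose_sym by blast

lemma sclose_trans: "\<sigma> \<in> {1, -1} ==> sclose \<sigma> e A B ==> sclose \<tau> d B C ==> sclose (\<sigma> * \<tau>) (e + d) A C"
 unfolding sclose_def
proof (intro allI impI)
 fix i j :: nat
 assume s: "\<sigma> \<in> {1, -1}" and 1: "\<forall>i\<le>7. \<forall>j\<le>7. cmod (A i j - \<sigma> * B i j) <= e" "\<forall>i\<le>7. \<forall>j\<le>7. cmod (B i j - \<tau> * C i j) <= d" "i <= 7" "j <= 7"
 have "A i j - \<sigma> * \<tau> * C i j = (A i j - \<sigma> * B i j) + \<sigma> * (B i j - \<tau> * C i j)" by (simp add: algebra_simps)
 hence "cmod (A i j - \<sigma> * \<tau> * C i j) <= cmod (A i j - \<sigma> * B i j) + cmod (\<sigma> * (B i j - \<tau> * C i j))"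
  by (metis norm_triangle_ineq)
 also have "cmod (\<sigma> * (B i j - \<tau> * C i j)) = cmod (B i j - \<tau> * C i j)" using s by (auto simp: norm_mult)
 finally show "cmod (A i j - \<sigma> * \<tau> * C i j) <= e + d" using 1 by fastforce
qed

lemma close_trans: "close e A B ==> close d B C ==> close (e + d) A C"
 unfolding close_iff
proof (elim bexE)
 fix \<sigma> \<tau> :: complex assume s: "\<sigma> \<in> {1, -1}" "\<tau> \<in> {1, -1}" and c: "sclose \<sigma> e A B" "sclose \<tau> d B C"
 have "\<sigma> * \<tau> \<in> {1, -1}" using s by auto
 thus "\<exists>\<sigma>\<in>{1, -1}. sclose \<sigma> (e + d) A C" using sclose_trans[OF s(1) c] by blast
qed

lemma close_mono: "close e A B ==> e <= d ==> close d A B"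
 unfolding close_def sclose_def by (meson order_trans)

lemma close_refl: "e \<ge> 0 ==> close e A A" by (auto simp: close_def sclose_def)

lemma eventually_sclose:
 assumes t: "tgerm nu" "tgerm nu'" and c: "sclose \<sigma> e (zdat nu) (zdat nu')" "e < e'"
 shows "EV s. \<forall>i\<le>7. \<forall>j\<le>7. cmod (zform (nu s) (E i) (E j) - \<sigma> * zform (nu' s) (E i) (E j)) <= e'"
proof -
 have "EV s. cmod (zform (nu s) (E i) (E j) - \<sigma> * zform (nu' s) (E i) (E j)) < e'" if "i <= 7" "j <= 7" for i j
 proof -
  obtain C D where "good UNIV C (E i)" "good UNIV D (E j)" using good_E by metis
  from tendsto_zlim_UNIV[OF t(1) this] tendsto_zlim_UNIV[OF t(2) this]
  have "((%s. cmod (zform (nu s) (E i) (E j) - \<sigma> * zform (nu' s) (E i) (E j))) ~~> cmod (zdat nu i j - \<sigma> * zdat nu' i j))"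
   unfolding zdat_def by (intro tendsto_intros)
  moreover have "cmod (zdat nu i j - \<sigma> * zdat nu' i j) < e'" using c that by (fastforce simp: sclose_def)
  ultimately show ?thesis by (rule order_tendstoD(2))
 qed
 hence "EV s. \<forall>i\<in>{..7}. \<forall>j\<in>{..7}. cmod (zform (nu s) (E i) (E j) - \<sigma> * zform (nu' s) (E i) (E j)) < e'"
  by (intro eventually_ball_finite finite_atMost ballI) auto
 thus ?thesis by eventually_elim (auto intro: less_imp_le)
qed

lemma zlim_transfer:
 assumes t: "tgerm nu" "tgerm nu'" and g: "good K B \<phi>" "good K B' \<psi>"
  and K: "EV t. nodes (nu t) \<subseteq> K" "EV t. nodes (nu' t) \<subseteq> K"
  and c: "sclose \<sigma> e (zdat nu) (zdat nu')" and e: "e < e'"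
 shows "cmod (zlim nu \<phi> \<psi> - \<sigma> * zlim nu' \<phi> \<psi>) <= B * B' * e'"
proof -
 have ev: "EV s. cmod (zform (nu s) \<phi> \<psi> - \<sigma> * zform (nu' s) \<phi> \<psi>) <= B * B' * e'"
  using eventually_sclose[OF t c e] K by eventually_elim (rule zform_transfer[OF g], auto)
 show ?thesis by (rule tendsto_upperbound[OF _ ev])
   (intro tendsto_intros tendsto_zlim[OF t(1) g K(1)] tendsto_zlim[OF t(2) g K(2)], simp add: trivial_limit_at_right_real)
qed

lemma zlim_transfer_UNIV:
 assumes "tgerm nu" "tgerm nu'" "good UNIV B \<phi>" "good UNIV B' \<psi>" "sclose \<sigma> e (zdat nu) (zdat nu')" "e < e'"
 shows "cmod (zlim nu \<phi> \<psi> - \<sigma> * zlim nu' \<phi> \<psi>) <= B * B' * e'"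
 using zlim_transfer[OF assms(1-4) _ _ assms(5,6)] by simp

definition repr :: "alg => germ => bool" where
 "repr F nu \<longleftrightarrow> (\<exists>\<epsilon>. curve_germ 2 \<epsilon> nu & F = limit_alg 2 \<epsilon> nu)"

text \<open>An arbitrary choice; by \<open>repr_close\<close> it affects the table only up to
  sign.\<close>

definition germ_of :: "alg => real => nat => real" where
 "germ_of F = (SOME nu. repr F nu)"

lemma repr_germ_of: "F \<in> CDbar 2 ==> repr F (germ_of F)"
proof -
 assume "F \<in> CDbar 2"
 hence "\<exists>nu. repr F nu" unfolding CDbar_def repr_def by blast
 from someI_ex[OF this] show ?thesis unfolding germ_of_def .
qed

lemma repr_CDbar: "repr F nu ==> F \<in> CDbar 2"
 unfolding repr_def CDbar_def by blast

lemma repr_tgerm: "repr F nu ==> tgerm nu"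
 unfolding repr_def using curve_germ_tgerm by blast

lemmas tgerm_germ_of = repr_tgerm[OF repr_germ_of]

definition zd :: "alg => nat => nat => complex" where "zd F = zdat (germ_of F)"

lemma repr_mem_iff:
 assumes "repr F nu" "f \<in> trigL 8"
 shows "f \<in> F \<longleftrightarrow> (\<forall>j\<le>7. zlim nu (cx f) (E j) = 0)"
proof -
 obtain \<epsilon> where "curve_germ 2 \<epsilon> nu" "F = limit_alg 2 \<epsilon> nu" using assms(1) unfolding repr_def by blast
 thus ?thesis using limit_alg_imp_zlim[OF _ assms(2)] zlim_imp_limit_alg[OF _ assms(2)] by metis
qed

lemma repr_zlim_zero:
 assumes "repr F nu" "f \<in> trigL 8" "f \<in> F" "good UNIV B \<psi>" shows "zlim nu (cx f) \<psi> = 0"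
proof -
 obtain C where "good UNIV C (cx f)" using trigL_good assms(2) by blast
 thus ?thesis using zlim_zero_good[OF repr_tgerm[OF assms(1)] _ _ assms(4)] repr_mem_iff[OF assms(1,2)] assms(3) by blast
qed

lemmas CDbar_mem_iff = repr_mem_iff[OF repr_germ_of]
lemmas CDbar_zlim_zero = repr_zlim_zero[OF repr_germ_of]

lemma sup_dist_le: "(!!x. \<bar>f x - g x\<bar> <= e) ==> sup_dist f g <= e"
 unfolding sup_dist_def by (rule cSUP_least) auto

lemma sup_dist_ge:
 assumes "!!x. \<bar>f x\<bar> <= 1" "!!x. \<bar>g x\<bar> <= 1" shows "\<bar>f x - g x\<bar> <= sup_dist f g" "sup_dist f g \<ge> 0"
proof -
 have b: "bdd_above (range (%x. \<bar>f x - g x\<bar>))"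
 proof (rule bdd_aboveI2)
  show "\<bar>f x - g x\<bar> <= 2" for x using assms(1)[of x] assms(2)[of x] by linarith
 qed
 show *: "\<bar>f x - g x\<bar> <= sup_dist f g" for x unfolding sup_dist_def by (rule cSUP_upper[OF _ b]) simp
 show "sup_dist f g \<ge> 0" using *[of 0] by linarith
qed

lemma unit_ball_L_iff: "f \<in> unit_ball_L N F \<longleftrightarrow> f \<in> F & f \<in> trigL N & (\<forall>x. \<bar>f x\<bar> <= 1)"
 by (auto simp: unit_ball_L_def)

lemma zero_in_unit_ball: assumes "F \<in> CDbar 2" shows "(%x. 0) \<in> unit_ball_L 8 F"
proof -
 have "(%x. 0) \<in> trigL 8" using trigL_cmul[OF trigL_cos[of 0 8], of 0] by simp
 moreover have "zlim nu (cx (%x. 0)) (E j) = 0" for nu j by (rule zlimI) (simp add: zform_def nform_def cx_def)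
 ultimately show ?thesis using CDbar_mem_iff[OF assms] by (simp add: unit_ball_L_iff)
qed

lemma inf_sup_dist_le:
 assumes "f \<in> unit_ball_L 8 F" "g \<in> unit_ball_L 8 G" "!!x. \<bar>f x - g x\<bar> <= e"
 shows "(INF g\<in>unit_ball_L 8 G. sup_dist f g) <= e"
proof -
 have "(INF g\<in>unit_ball_L 8 G. sup_dist f g) <= sup_dist f g"
  by (rule cINF_lower[OF _ assms(2)]) (use assms(1) sup_dist_ge(2) in \<open>auto simp: bdd_below_def unit_ball_L_iff intro!: exI[of _ 0]\<close>)
 also have "... <= e" by (rule sup_dist_le[OF assms(3)])
 finally show ?thesis .
qed

text \<open>An element of one unit ball is corrected by two functions from \<open>RB\<close> to an
  element of the other algebra, with coefficients of order \<open>e\<close>, and then shrunk back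
  into the unit ball. The 16 is the inverse of the bound in \<open>RB_pair\<close>.\<close>

lemma grass_dist_le_close:
 obtains C where "C > 0" "!!F G e. F \<in> CDbar 2 ==> G \<in> CDbar 2 ==> e > 0 ==> close e (zd F) (zd G) ==> grass_dist 8 F G <= C * e"
proof -
 obtain C0 where C0: "C0 > 0" "!!f M. f \<in> trigL 8 ==> (!!x. \<bar>f x\<bar> <= M) ==> good UNIV (C0 * M) (cx f)"
  using trigL_good_uniform by blast
 have RB1: "\<bar>u x\<bar> <= 1" if "u \<in> RB" for u x using that by (auto simp: RB_def)
 let ?k = "16 * (C0 * C0 * 2)"
 have one: "(INF g\<in>unit_ball_L 8 G. sup_dist f g) <= 4 * ?k * e"
  if FG: "F \<in> CDbar 2" "G \<in> CDbar 2" and e: "e > 0" and c: "close e (zd F) (zd G)" and f: "f \<in> unit_ball_L 8 F" for F G e f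
 proof -
  note t = tgerm_germ_of[OF FG(1)] tgerm_germ_of[OF FG(2)]
  have fL: "f \<in> trigL 8" "f \<in> F" "!!x. \<bar>f x\<bar> <= 1" using f by (auto simp: unit_ball_L_iff)
  obtain u v where uv: "u \<in> RB" "v \<in> RB" "cmod (zlim (germ_of G) (cx u) (cx v)) \<ge> 1 / 16" using RB_pair[OF t(2)] by blast
  note L = RB_trigL[OF uv(1)] RB_trigL[OF uv(2)]
  have G: "good UNIV C0 (cx f)" using C0(2)[of f 1] fL by simp
  obtain \<sigma> where \<sigma>: "\<sigma> \<in> {1, -1}" "sclose \<sigma> e (zdat (germ_of G)) (zdat (germ_of F))"
   using close_sym[OF c] by (auto simp: close_iff zd_def)
  have small: "cmod (zlim (germ_of G) (cx f) (cx w) / zlim (germ_of G) (cx u) (cx v)) <= ?k * e" if w: "w \<in> RB" for w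
  proof -
   have Gw: "good UNIV C0 (cx w)" using C0(2)[OF RB_trigL[OF w], of 1] RB1[OF w] by simp
   have "zlim (germ_of F) (cx f) (cx w) = 0" by (rule CDbar_zlim_zero[OF FG(1) fL(1,2) Gw])
   hence "cmod (zlim (germ_of G) (cx f) (cx w)) <= C0 * C0 * (2 * e)"
    using zlim_transfer_UNIV[OF t(2,1) G Gw \<sigma>(2), of "2 * e"] e by simp
   moreover have "cmod (zlim (germ_of G) (cx u) (cx v)) > 0" using uv(3) by linarith
   ultimately have "cmod (zlim (germ_of G) (cx f) (cx w) / zlim (germ_of G) (cx u) (cx v)) <= (C0 * C0 * (2 * e)) / (1 / 16)"
    unfolding norm_divide using uv(3) e C0(1) by (intro frac_le) auto
   thus ?thesis by (simp add: mult_ac)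
  qed
  define x y where "x = Re (zlim (germ_of G) (cx f) (cx v) / zlim (germ_of G) (cx u) (cx v))"
   "y = - Re (zlim (germ_of G) (cx f) (cx u) / zlim (germ_of G) (cx u) (cx v))"
  have xy: "\<bar>x\<bar> <= ?k * e" "\<bar>y\<bar> <= ?k * e"
   unfolding x_y_def abs_minus_cancel
   by (rule order_trans[OF abs_Re_le_cmod small[OF uv(2)]], rule order_trans[OF abs_Re_le_cmod small[OF uv(1)]])
  define g where "g = corr x y f u v"
  have gL: "g \<in> trigL 8" unfolding g_def by (intro corr_trigL fL L)
  have nz: "zlim (germ_of G) (cx u) (cx v) ~= 0" using uv(3) by auto
  have gz: "zlim (germ_of G) (cx g) (E j) = 0" for j
  proof -
   obtain D where "good UNIV D (E j)" using good_E by blast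
   thus ?thesis unfolding g_def by (rule zlim_correction[OF t(2) fL(1) L nz x_y_def])
  qed
  \<comment> \<open>\<open>g\<close> exceeds the unit ball by at most \<open>K\<close>; division by
    \<open>1 + K\<close> repairs this at the cost of another \<open>K\<close>.\<close>
  define K where "K = 2 * ?k * e"
  have K: "K > 0" using e C0 by (simp add: K_def)
  have fg: "\<bar>f s - g s\<bar> <= K" for s
  proof -
   have "f s - g s = x * u s + y * v s" by (simp add: g_def corr_def)
   also have "\<bar>...\<bar> <= \<bar>x\<bar> * \<bar>u s\<bar> + \<bar>y\<bar> * \<bar>v s\<bar>" by (metis abs_mult abs_triangle_ineq)
   also have "... <= (?k * e) * 1 + (?k * e) * 1" using xy RB1[OF uv(1)] RB1[OF uv(2)] by (intro add_mono mult_mono) auto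
   finally show ?thesis by (simp add: K_def)
  qed
  have gb: "\<bar>g s\<bar> <= 1 + K" for s using fg[of s] fL(3)[of s] by linarith
  define h where "h = (%s. (1 / (1 + K)) * g s)"
  have hL: "h \<in> trigL 8" unfolding h_def by (rule trigL_cmul[OF gL])
  have "zlim (germ_of G) (cx h) (E j) = 0" for j
  proof -
   obtain D D' where D: "good UNIV D (E j)" "good UNIV D' (cx g)" using good_E trigL_good[OF gL] by metis
   have "cx h = (%s. of_real (1 / (1 + K)) * cx g s + 0 * cx g s)" by (auto simp: h_def cx_def)
   thus ?thesis using zlim_bilinear(1)[OF t(2) D(2) D(2) D(1), of "of_real (1 / (1 + K))" 0] gz by simp
  qed
  hence "h \<in> G" using CDbar_mem_iff[OF FG(2) hL] by blast
  moreover have "\<bar>h s\<bar> <= 1" for s using gb[of s] K by (simp add: h_def abs_mult field_simps)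
  ultimately have hb: "h \<in> unit_ball_L 8 G" using hL by (simp add: unit_ball_L_iff)
  have "\<bar>f s - h s\<bar> <= 4 * ?k * e" for s
  proof -
   have "g s - h s = g s / (1 + K) * K" using K by (simp add: h_def field_simps)
   hence "\<bar>g s - h s\<bar> = \<bar>g s\<bar> / (1 + K) * K" using K by (simp add: abs_mult)
   also have "... <= 1 * K" using gb[of s] K by (intro mult_right_mono) auto
   finally show ?thesis using fg[of s] by (simp add: K_def)
  qed
  thus ?thesis by (rule inf_sup_dist_le[OF f hb])
 qed
 have swap: "sup_dist f g = sup_dist g f" for f g by (simp add: sup_dist_def abs_minus_commute)
 have "grass_dist 8 F G <= 4 * ?k * e"
  if FG: "F \<in> CDbar 2" "G \<in> CDbar 2" and e: "e > 0" and c: "close e (zd F) (zd G)" for F G e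
 proof -
  have "(SUP f\<in>unit_ball_L 8 F. INF g\<in>unit_ball_L 8 G. sup_dist f g) <= 4 * ?k * e"
   using zero_in_unit_ball[OF FG(1)] one[OF FG e c] by (intro cSUP_least) auto
  moreover have "(SUP g\<in>unit_ball_L 8 G. INF f\<in>unit_ball_L 8 F. sup_dist f g) <= 4 * ?k * e"
   using zero_in_unit_ball[OF FG(2)] one[OF FG(2,1) e close_sym[OF c]] by (subst swap, intro cSUP_least) auto
  ultimately show ?thesis by (simp add: grass_dist_def)
 qed
 moreover have "4 * ?k > 0" using C0(1) by simp
 ultimately show ?thesis using that by blast
qed

lemma grass_dist_obtain:
 assumes FG: "F \<in> CDbar 2" "G \<in> CDbar 2" and d: "grass_dist 8 F G < e" and f: "f \<in> unit_ball_L 8 F"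
 obtains g where "g \<in> unit_ball_L 8 G" "!!x. \<bar>f x - g x\<bar> <= e"
proof -
 have "(INF g\<in>unit_ball_L 8 G. sup_dist f g) <= 1" if "f \<in> unit_ball_L 8 F" for f
  using inf_sup_dist_le[OF that zero_in_unit_ball[OF FG(2)], of 1] that by (simp add: unit_ball_L_iff)
 hence "bdd_above ((%f. INF g\<in>unit_ball_L 8 G. sup_dist f g) ` unit_ball_L 8 F)" by (auto simp: bdd_above_def)
 from cSUP_upper[OF f this] have "(INF g\<in>unit_ball_L 8 G. sup_dist f g) < e" using d by (auto simp: grass_dist_def)
 moreover have "bdd_below (sup_dist f ` unit_ball_L 8 G)"
  using f sup_dist_ge(2) by (auto simp: bdd_below_def unit_ball_L_iff intro!: exI[of _ 0])
 ultimately obtain g where g: "g \<in> unit_ball_L 8 G" "sup_dist f g < e"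
  using cINF_less_iff[of "unit_ball_L 8 G" "sup_dist f" e] zero_in_unit_ball[OF FG(2)] by blast
 have "\<bar>f x - g x\<bar> <= e" for x using sup_dist_ge(1)[of f g x] g f by (auto simp: unit_ball_L_iff intro: order_trans less_imp_le)
 thus ?thesis using that g(1) by blast
qed

text \<open>Each test function splits into an element of \<open>F\<close> and a combination of
  \<open>u\<close> and \<open>v\<close>. The form of \<open>G\<close> is small on the first part,
  because \<open>G\<close> contains a nearby function, so the two forms are proportional up to a
  small error. The normalization then forces the factor \<open>c\<close> near 1 or -1.\<close>

lemma close_le_grass_dist:
 obtains C where "C > 0" "!!F G e nu nu'. repr F nu ==> repr G nu' ==> e > 0 ==> grass_dist 8 F G < e ==> close (C * e) (zdat nu) (zdat nu')"
proof -
 obtain C0 where C0: "C0 > 0" "!!f M. f \<in> trigL 8 ==> (!!x. \<bar>f x\<bar> <= M) ==> good UNIV (C0 * M) (cx f)"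
  using trigL_good_uniform by blast
 define T where "T = (%k x. cos (real k * x)) ` {..7} \<union> (%k x. sin (real k * x)) ` {..7}"
 have RBT: "RB \<subseteq> T" unfolding RB_def T_def by (intro Un_mono image_mono) auto
 have T: "f \<in> trigL 8" "\<bar>f x\<bar> <= 1" if "f \<in> T" for f x
  using that by (auto simp: T_def intro!: trigL_cos trigL_sin)
 have gT: "good UNIV C0 (cx f)" if "f \<in> T" for f using C0(2)[OF T(1)[OF that], of 1] T(2)[OF that] by simp
 define b where "b = 16 * (C0 * C0 * CC)"
 have b0: "b \<ge> 0" using CC_pos by (simp add: b_def)
 define M where "M = 1 + 2 * b"
 define k1 where "k1 = C0 * M * C0 * CC"
 define k where "k = k1 + 2 * b * k1"
 have M0: "M > 0" "k1 \<ge> 0" "k \<ge> 0" using b0 C0 CC_pos by (auto simp: M_def k1_def k_def)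
 define C where "C = 4 * k + 8 * k * CC + 1"
 have "close (C * e) (zdat nu) (zdat nu')" if FG: "repr F nu" "repr G nu'" and e: "e > 0" and d: "grass_dist 8 F G < e" for F G e nu nu'
 proof -
  note t = repr_tgerm[OF FG(1)] repr_tgerm[OF FG(2)]
  note FGC = repr_CDbar[OF FG(1)] repr_CDbar[OF FG(2)]
  let ?F = "zlim nu" and ?G = "zlim nu'"
  obtain u v where uv: "u \<in> RB" "v \<in> RB" "cmod (?F (cx u) (cx v)) \<ge> 1 / 16" using RB_pair[OF t(1)] by blast
  have uvT: "u \<in> T" "v \<in> T" using uv RBT by auto
  have nz: "?F (cx u) (cx v) ~= 0" using uv(3) by auto
  define X where "X f = Re (?F (cx f) (cx v) / ?F (cx u) (cx v))" for f
  define Y where "Y f = - Re (?F (cx f) (cx u) / ?F (cx u) (cx v))" for f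
  have q: "cmod (?F (cx f) (cx w) / ?F (cx u) (cx v)) <= b" if "f \<in> T" "w \<in> T" for f w
  proof -
   have "cmod (?F (cx f) (cx w)) <= C0 * C0 * CC" using norm_zlim_le[OF t(1) gT[OF that(1)] gT[OF that(2)]] by simp
   hence "cmod (?F (cx f) (cx w) / ?F (cx u) (cx v)) <= (C0 * C0 * CC) / (1 / 16)"
    unfolding norm_divide using uv(3) C0(1) CC_pos by (intro frac_le) auto
   thus ?thesis by (simp add: b_def)
  qed
  have XY: "\<bar>X f\<bar> <= b" "\<bar>Y f\<bar> <= b" if "f \<in> T" for f
   unfolding X_def Y_def abs_minus_cancel
   by (rule order_trans[OF abs_Re_le_cmod q[OF that uvT(2)]], rule order_trans[OF abs_Re_le_cmod q[OF that uvT(1)]])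
  define f' where "f' f = corr (X f) (Y f) f u v" for f
  have f'L: "f' f \<in> trigL 8" if "f \<in> T" for f unfolding f'_def by (intro corr_trigL T(1) that uvT)
  have f'b: "\<bar>f' f x\<bar> <= M" if "f \<in> T" for f x
  proof -
   have "f' f x = f x + (- X f * u x + - Y f * v x)" by (simp add: f'_def corr_def)
   also have "\<bar>...\<bar> <= \<bar>f x\<bar> + (\<bar>X f\<bar> * \<bar>u x\<bar> + \<bar>Y f\<bar> * \<bar>v x\<bar>)"
    by (intro order_trans[OF abs_triangle_ineq] add_mono order_refl order_trans[OF abs_triangle_ineq]) (auto simp: abs_mult)
   also have "... <= 1 + (b * 1 + b * 1)" using XY[OF that] T(2)[OF that] T(2)[OF uvT(1)] T(2)[OF uvT(2)] b0
    by (intro add_mono mult_mono) auto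
   finally show ?thesis by (simp add: M_def)
  qed
  have f'F: "f' f \<in> F" and f'z: "!!D \<psi>. good UNIV D \<psi> ==> ?F (cx (f' f)) \<psi> = 0" if "f \<in> T" for f
  proof -
   show z: "?F (cx (f' f)) \<psi> = 0" if "good UNIV D \<psi>" for D \<psi>
    unfolding f'_def by (rule zlim_correction[OF t(1) T(1)[OF \<open>f \<in> T\<close>] T(1)[OF uvT(1)] T(1)[OF uvT(2)] nz X_def Y_def that])
   show "f' f \<in> F" using repr_mem_iff[OF FG(1) f'L[OF that]] z good_E by metis
  qed
  have small: "cmod (?G (cx (f' f)) \<psi>) <= C0 * M * D * CC * e" if f: "f \<in> T" and \<psi>: "good UNIV D \<psi>" for f \<psi> D
  proof -
   define h where "h = (%x. (1 / M) * f' f x)"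
   have hL: "h \<in> trigL 8" unfolding h_def by (rule trigL_cmul[OF f'L[OF f]])
   have hF: "h \<in> F"
   proof -
    have "?F (cx h) (E j) = 0" for j
    proof -
     obtain D D' where D: "good UNIV D (E j)" "good UNIV D' (cx (f' f))" using good_E trigL_good[OF f'L[OF f]] by metis
     have "cx h = (%s. of_real (1 / M) * cx (f' f) s + 0 * cx (f' f) s)" by (auto simp: h_def cx_def)
     thus ?thesis using zlim_bilinear(1)[OF t(1) D(2) D(2) D(1), of "of_real (1 / M)" 0] f'z[OF f D(1)] by simp
    qed
    thus ?thesis using repr_mem_iff[OF FG(1) hL] by blast
   qed
   have "\<bar>h x\<bar> <= 1" for x using f'b[OF f, of x] M0 by (simp add: h_def abs_mult field_simps)
   hence "h \<in> unit_ball_L 8 F" using hL hF by (simp add: unit_ball_L_iff)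
   then obtain g where g: "g \<in> unit_ball_L 8 G" "!!x. \<bar>h x - g x\<bar> <= e" using grass_dist_obtain[OF FGC d] by blast
   have gL: "g \<in> trigL 8" "g \<in> G" using g(1) by (auto simp: unit_ball_L_iff)
   define r where "r = (%x. 1 * h x + (-1) * g x)"
   have rL: "r \<in> trigL 8" unfolding r_def by (rule trigL_lincomb[OF hL gL(1)])
   have rg: "good UNIV (C0 * e) (cx r)" using C0(2)[OF rL, of e] g(2) by (simp add: r_def)
   obtain Dg where Dg: "good UNIV Dg (cx g)" using trigL_good[OF gL(1)] by blast
   have "cx (f' f) = (%x. of_real M * cx r x + of_real M * cx g x)"
    using M0 by (auto simp: h_def r_def cx_def field_simps)
   hence "?G (cx (f' f)) \<psi> = of_real M * ?G (cx r) \<psi> + of_real M * ?G (cx g) \<psi>"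
    using zlim_bilinear(1)[OF t(2) rg Dg \<psi>, of "of_real M" "of_real M"] by simp
   also have "?G (cx g) \<psi> = 0" by (rule repr_zlim_zero[OF FG(2) gL \<psi>])
   finally have "cmod (?G (cx (f' f)) \<psi>) = M * cmod (?G (cx r) \<psi>)" using M0 by (simp add: norm_mult)
   also have "... <= M * (C0 * e * D * CC)" using norm_zlim_le[OF t(2) rg \<psi>] M0 by (intro mult_left_mono) auto
   finally show ?thesis by (simp add: mult_ac)
  qed
  \<comment> \<open>The factor of proportionality, read off on \<open>u\<close> and
    \<open>v\<close>; it is real because both forms are real on real functions.\<close>
  define c where "c = ?G (cx u) (cx v) / ?F (cx u) (cx v)"
  have real: "Im c = 0"
   using zlim_cx_real[OF t(1) T(1)[OF uvT(1)] T(1)[OF uvT(2)]] zlim_cx_real[OF t(2) T(1)[OF uvT(1)] T(1)[OF uvT(2)]]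
   by (simp add: c_def Im_divide)
  have expand: "zlim H (cx f) (cx g) = zlim H (cx (f' f)) (cx g) + of_real (X f) * zlim H (cx u) (cx g) + of_real (Y f) * zlim H (cx v) (cx g)"
   if H: "tgerm H" and fg: "f \<in> T" "g \<in> trigL 8" for H f g
  proof -
   obtain D1 D2 where D: "good UNIV D1 (cx (f' f))" "good UNIV D2 (cx g)" using trigL_good f'L[OF fg(1)] fg(2) by metis
   have eq: "cx f = (%s. 1 * (1 * cx (f' f) s + of_real (X f) * cx u s) + of_real (Y f) * cx v s)"
    by (auto simp: cx_def f'_def corr_def algebra_simps)
   obtain D3 where D3: "good UNIV D3 (%s. 1 * cx (f' f) s + of_real (X f) * cx u s)"
    using good_add[OF good_mult[OF good_const[of UNIV 1] D(1)] good_mult[OF good_const[of UNIV "of_real (X f)"] gT[OF uvT(1)]]] by blast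
   note tH = H
   show ?thesis by (subst eq, subst zlim_bilinear(1)[OF tH D3 gT[OF uvT(2)] D(2)], subst zlim_bilinear(1)[OF tH D(1) gT[OF uvT(1)] D(2)]) simp
  qed
  have diff: "cmod (?G (cx f) (cx g) - c * ?F (cx f) (cx g)) <= k * e" if fg: "f \<in> T" "g \<in> T" for f g
  proof -
   note fgL = T(1)[OF fg(1)] T(1)[OF fg(2)]
   have s: "zlim H (cx g) (cx w) = - zlim H (cx w) (cx g)" if "tgerm H" "w \<in> T" for H w
    by (rule zlim_swap[OF that(1) gT[OF that(2)] gT[OF fg(2)]])
   have uu: "zlim H (cx w) (cx w) = 0" if "tgerm H" "w \<in> T" for H w
    using zlim_swap[OF that(1) gT[OF that(2)] gT[OF that(2)]] by simp
   have vu: "zlim H (cx v) (cx u) = - zlim H (cx u) (cx v)" if "tgerm H" for H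
    by (rule zlim_swap[OF that gT[OF uvT(1)] gT[OF uvT(2)]])
   have ex: "zlim H (cx f) (cx g) = zlim H (cx (f' f)) (cx g)
    - of_real (X f) * zlim H (cx (f' g)) (cx u) - of_real (Y f) * zlim H (cx (f' g)) (cx v)
    + (of_real (X f) * of_real (Y g) - of_real (Y f) * of_real (X g)) * zlim H (cx u) (cx v)" if H: "tgerm H" for H
   proof -
    have u: "zlim H (cx u) (cx g) = - zlim H (cx g) (cx u)" "zlim H (cx v) (cx g) = - zlim H (cx g) (cx v)"
     using s[OF H uvT(1)] s[OF H uvT(2)] by simp_all
    show ?thesis
     unfolding expand[OF H fg(1) fgL(2)] u expand[OF H fg(2) T(1)[OF uvT(1)]] expand[OF H fg(2) T(1)[OF uvT(2)]] uu[OF H uvT(1)] uu[OF H uvT(2)] vu[OF H]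
     by (simp add: algebra_simps)
   qed
   have exF: "?F (cx f) (cx g) = (of_real (X f) * of_real (Y g) - of_real (Y f) * of_real (X g)) * ?F (cx u) (cx v)"
    using ex[OF t(1)] f'z[OF fg(1) gT[OF fg(2)]] f'z[OF fg(2) gT[OF uvT(1)]] f'z[OF fg(2) gT[OF uvT(2)]] by simp
   have "c * ?F (cx f) (cx g) = (of_real (X f) * of_real (Y g) - of_real (Y f) * of_real (X g)) * ?G (cx u) (cx v)"
    using nz unfolding exF c_def by simp
   hence "?G (cx f) (cx g) - c * ?F (cx f) (cx g) = ?G (cx (f' f)) (cx g) - of_real (X f) * ?G (cx (f' g)) (cx u) - of_real (Y f) * ?G (cx (f' g)) (cx v)"
    using ex[OF t(2)] by simp
   also have "cmod ... <= C0 * M * C0 * CC * e + b * (C0 * M * C0 * CC * e) + b * (C0 * M * C0 * CC * e)"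
    using small[OF fg(1) gT[OF fg(2)]] small[OF fg(2) gT[OF uvT(1)]] small[OF fg(2) gT[OF uvT(2)]] XY[OF fg(1)] b0
    by (intro order_trans[OF norm_triangle_ineq4] add_mono; simp only: norm_mult norm_of_real; (intro mult_mono)?; auto)
   also have "... = k * e" by (simp add: k_def k1_def algebra_simps)
   finally show ?thesis .
  qed
  have diffE: "cmod (zdat nu' i j - c * zdat nu i j) <= 4 * k * e" if ij: "i <= 7" "j <= 7" for i j
  proof -
   let ?c = "%k x. cos (real k * x)" and ?s = "%k x. sin (real k * x)"
   have in4: "?c i \<in> T" "?s i \<in> T" "?c j \<in> T" "?s j \<in> T" using ij by (auto simp: T_def)
   note g4 = in4[THEN gT]
   have exE: "zlim H (E i) (E j) = (zlim H (cx (?c i)) (cx (?c j)) + \<i> * zlim H (cx (?c i)) (cx (?s j)))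
     + \<i> * (zlim H (cx (?s i)) (cx (?c j)) + \<i> * zlim H (cx (?s i)) (cx (?s j)))" if "tgerm H" for H
   proof -
    note tH = that
    obtain D where D: "good UNIV D (E j)" using good_E by blast
    have "zlim H (E i) (E j) = 1 * zlim H (cx (?c i)) (E j) + \<i> * zlim H (cx (?s i)) (E j)"
     by (subst E_eq[of i]) (rule zlim_bilinear(1)[OF tH g4(1,2) D])
    moreover have "zlim H \<phi> (E j) = 1 * zlim H \<phi> (cx (?c j)) + \<i> * zlim H \<phi> (cx (?s j))"
     if "good UNIV D' \<phi>" for D' \<phi> by (subst E_eq[of j]) (rule zlim_bilinear(2)[OF tH g4(3,4) that])
    ultimately show ?thesis using g4 by simp
   qed
   have "zdat nu' i j - c * zdat nu i j = ((?G (cx (?c i)) (cx (?c j)) - c * ?F (cx (?c i)) (cx (?c j))) + \<i> * (?G (cx (?c i)) (cx (?s j)) - c * ?F (cx (?c i)) (cx (?s j))))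
    + (\<i> * (?G (cx (?s i)) (cx (?c j)) - c * ?F (cx (?s i)) (cx (?c j))) + - (?G (cx (?s i)) (cx (?s j)) - c * ?F (cx (?s i)) (cx (?s j))))"
    unfolding zdat_def exE[OF t(1)] exE[OF t(2)] by (simp add: algebra_simps)
   also have "cmod ... <= (k * e + k * e) + (k * e + k * e)"
    using diff in4 by (intro order_trans[OF norm_triangle_ineq] add_mono; simp only: norm_mult norm_ii mult_1 norm_minus_cancel)
   finally show ?thesis by (simp add: mult_ac)
  qed
  have n1: "norm (zdat H 1 2, zdat H 1 3) = 1" if "tgerm H" for H
   using zlim_normalized[OF that] by (simp add: norm_prod_def zdat_def)
  define \<sigma> :: complex where "\<sigma> = (if Re c \<ge> 0 then 1 else -1)"
  have c\<sigma>: "cmod (c - \<sigma>) = \<bar>cmod c - 1\<bar>"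
   using real by (auto simp: \<sigma>_def cmod_def)
  have "\<bar>cmod c - 1\<bar> <= 8 * k * e"
  proof -
   have "\<bar>norm (zdat nu' 1 2, zdat nu' 1 3) - norm (c * zdat nu 1 2, c * zdat nu 1 3)\<bar> <= norm ((zdat nu' 1 2, zdat nu' 1 3) - (c * zdat nu 1 2, c * zdat nu 1 3))"
    by (rule norm_triangle_ineq3)
   also have "... <= cmod (zdat nu' 1 2 - c * zdat nu 1 2) + cmod (zdat nu' 1 3 - c * zdat nu 1 3)"
    using norm_Pair_le by simp
   also have "... <= 4 * k * e + 4 * k * e" by (intro add_mono diffE) auto
   finally show ?thesis
    using n1[OF t(1)] n1[OF t(2)]
    by (simp add: norm_prod_def norm_mult power_mult_distrib distrib_left[symmetric] real_sqrt_mult abs_minus_commute)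
  qed
  hence c\<sigma>': "cmod (c - \<sigma>) <= 8 * k * e" using c\<sigma> by simp
  have "cmod (zdat nu' i j - \<sigma> * zdat nu i j) <= C * e" if ij: "i <= 7" "j <= 7" for i j
  proof -
   have bz: "cmod (zdat nu i j) <= CC"
   proof -
    obtain B B' where "good UNIV B (E i)" "good UNIV B' (E j)" using good_E by metis
    from tendsto_norm[OF tendsto_zlim_UNIV[OF t(1) this]] show ?thesis unfolding zdat_def
     by (rule tendsto_upperbound) (use norm_zform_E_le[OF ij] in \<open>auto simp: trivial_limit_at_right_real\<close>)
   qed
   have "zdat nu' i j - \<sigma> * zdat nu i j = (zdat nu' i j - c * zdat nu i j) + (c - \<sigma>) * zdat nu i j" by (simp add: algebra_simps)
   also have "cmod ... <= 4 * k * e + (8 * k * e) * CC"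
    using diffE[OF ij] c\<sigma>' bz M0 e
    by (intro order_trans[OF norm_triangle_ineq] add_mono; simp only: norm_mult; (intro mult_mono)?; auto)
   also have "... <= C * e" using e by (simp add: C_def algebra_simps)
   finally show ?thesis .
  qed
  hence "close (C * e) (zdat nu') (zdat nu)" unfolding close_iff by (intro bexI[of _ \<sigma>]) (auto simp: sclose_def \<sigma>_def)
  thus ?thesis by (rule close_sym)
 qed
 moreover have "C > 0" using M0 CC_pos by (auto simp: C_def intro!: add_nonneg_pos)
 ultimately show ?thesis using that by blast
qed

text \<open>The distance of an algebra to itself is bounded by every positive number, so the
  comparison in the other direction applies to two germs of the same algebra.\<close>

lemma repr_close:
 assumes "repr F nu" "repr F nu'" "e > 0" shows "close e (zdat nu) (zdat nu')"
proof -
 obtain C where C: "C > 0" "!!F G e. F \<in> CDbar 2 ==> G \<in> CDbar 2 ==> e > 0 ==> close e (zd F) (zd G) ==> grass_dist 8 F G <= C * e"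
  using grass_dist_le_close by blast
 obtain D where D: "D > 0" "!!F G e nu nu'. repr F nu ==> repr G nu' ==> e > 0 ==> grass_dist 8 F G < e ==> close (D * e) (zdat nu) (zdat nu')"
  using close_le_grass_dist by blast
 define d where "d = e / (2 * C * D)"
 have d: "d > 0" using assms C D by (simp add: d_def)
 have "grass_dist 8 F F <= C * d" using C(2)[OF repr_CDbar repr_CDbar d close_refl, OF assms(1) assms(1)] d by simp
 also have "... < e / D" using C D assms(3) by (simp add: d_def field_simps)
 finally show ?thesis using D(2)[OF assms(1,2), of "e / D"] D(1) assms(3) by simp
qed

text \<open>Both comparison lemmas are linear in \<open>e\<close>, so the distance of unit balls and
  the closeness of tables generate the same open sets.\<close>

lemma openin_CD_top:
 "openin (CD_top 2) U \<longleftrightarrow> U \<subseteq> CDbar 2 & (\<forall>F\<in>U. \<exists>e>0. \<forall>G\<in>CDbar 2. close e (zd F) (zd G) --> G \<in> U)"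
proof -
 have ist: "istopology (%U. U \<subseteq> CDbar 2 & (\<forall>F\<in>U. \<exists>e>0. \<forall>G\<in>CDbar 2. grass_dist (2 * 2^2) F G < e --> G \<in> U))"
  unfolding istopology_def
 proof (intro conjI allI impI)
  fix S T :: "alg set"
  assume S: "S \<subseteq> CDbar 2 & (\<forall>F\<in>S. \<exists>e>0. \<forall>G\<in>CDbar 2. grass_dist (2 * 2^2) F G < e --> G \<in> S)"
   and T: "T \<subseteq> CDbar 2 & (\<forall>F\<in>T. \<exists>e>0. \<forall>G\<in>CDbar 2. grass_dist (2 * 2^2) F G < e --> G \<in> T)"
  thus "S \<inter> T \<subseteq> CDbar 2" by blast
  show "\<forall>F\<in>S \<inter> T. \<exists>e>0. \<forall>G\<in>CDbar 2. grass_dist (2 * 2^2) F G < e --> G \<in> S \<inter> T"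
  proof
   fix F assume F: "F \<in> S \<inter> T"
   obtain e1 where "e1 > 0" "\<forall>G\<in>CDbar 2. grass_dist (2 * 2^2) F G < e1 --> G \<in> S" using S F by blast
   moreover obtain e2 where "e2 > 0" "\<forall>G\<in>CDbar 2. grass_dist (2 * 2^2) F G < e2 --> G \<in> T" using T F by blast
   ultimately show "\<exists>e>0. \<forall>G\<in>CDbar 2. grass_dist (2 * 2^2) F G < e --> G \<in> S \<inter> T"
    by (intro exI[of _ "min e1 e2"]) auto
  qed
 next
  fix K :: "alg set set"
  assume K: "\<forall>S\<in>K. S \<subseteq> CDbar 2 & (\<forall>F\<in>S. \<exists>e>0. \<forall>G\<in>CDbar 2. grass_dist (2 * 2^2) F G < e --> G \<in> S)"
  thus "\<Union>K \<subseteq> CDbar 2" by blast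
  show "\<forall>F\<in>\<Union>K. \<exists>e>0. \<forall>G\<in>CDbar 2. grass_dist (2 * 2^2) F G < e --> G \<in> \<Union>K"
  proof
   fix F assume "F \<in> \<Union>K"
   then obtain S where S: "S \<in> K" "F \<in> S" by blast
   then obtain e where "e > 0" "\<forall>G\<in>CDbar 2. grass_dist (2 * 2^2) F G < e --> G \<in> S" using K by blast
   thus "\<exists>e>0. \<forall>G\<in>CDbar 2. grass_dist (2 * 2^2) F G < e --> G \<in> \<Union>K" using S(1) by blast
  qed
 qed
 have o: "openin (CD_top 2) U \<longleftrightarrow> U \<subseteq> CDbar 2 & (\<forall>F\<in>U. \<exists>e>0. \<forall>G\<in>CDbar 2. grass_dist 8 F G < e --> G \<in> U)"
  unfolding CD_top_def topology_inverse'[OF ist] by simp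
 obtain C where C: "C > 0" "!!F G e. F \<in> CDbar 2 ==> G \<in> CDbar 2 ==> e > 0 ==> close e (zd F) (zd G) ==> grass_dist 8 F G <= C * e"
  using grass_dist_le_close by blast
 obtain D where D: "D > 0" "!!F G e nu nu'. repr F nu ==> repr G nu' ==> e > 0 ==> grass_dist 8 F G < e ==> close (D * e) (zdat nu) (zdat nu')"
  using close_le_grass_dist by blast
 show ?thesis unfolding o
 proof (intro conj_cong refl ball_cong iffI)
  fix F assume U: "U \<subseteq> CDbar 2" and F: "F \<in> U" and "\<exists>e>0. \<forall>G\<in>CDbar 2. grass_dist 8 F G < e --> G \<in> U"
  then obtain e where e: "e > 0" "\<forall>G\<in>CDbar 2. grass_dist 8 F G < e --> G \<in> U" by blast
  have "G \<in> U" if "G \<in> CDbar 2" "close (e / (2 * C)) (zd F) (zd G)" for G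
  proof -
   have "grass_dist 8 F G <= C * (e / (2 * C))" using C(2)[of F G "e / (2 * C)"] that U F e C(1) by auto
   also have "... < e" using e C(1) by simp
   finally show ?thesis using e(2) that(1) by blast
  qed
  thus "\<exists>e>0. \<forall>G\<in>CDbar 2. close e (zd F) (zd G) --> G \<in> U"
   using e(1) C(1) by (intro exI[of _ "e / (2 * C)"]) auto
 next
  fix F assume U: "U \<subseteq> CDbar 2" and F: "F \<in> U" and "\<exists>e>0. \<forall>G\<in>CDbar 2. close e (zd F) (zd G) --> G \<in> U"
  then obtain e where e: "e > 0" "\<forall>G\<in>CDbar 2. close e (zd F) (zd G) --> G \<in> U" by blast
  have "G \<in> U" if "G \<in> CDbar 2" "grass_dist 8 F G < e / D" for G
   using D(2)[OF repr_germ_of repr_germ_of, of F G "e / D"] that U F e D(1) by (auto simp: zd_def)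
  thus "\<exists>e>0. \<forall>G\<in>CDbar 2. grass_dist 8 F G < e --> G \<in> U"
   using e(1) D(1) by (intro exI[of _ "e / D"]) auto
 qed
qed

lemma topspace_CD_top: "topspace (CD_top 2) = CDbar 2"
proof
 show "topspace (CD_top 2) \<subseteq> CDbar 2" using openin_CD_top[of "topspace (CD_top 2)"] by simp
 have "openin (CD_top 2) (CDbar 2)" unfolding openin_CD_top by (auto intro: exI[of _ 1])
 thus "CDbar 2 \<subseteq> topspace (CD_top 2)" by (rule openin_subset)
qed

lemma continuous_map_CD_top:
 fixes S :: "'a::topological_space set"
 assumes "!!x. x \<in> S ==> f x \<in> CDbar 2"
  and "!!x e. x \<in> S ==> e > 0 ==> \<forall>\<^sub>F y in at x within S. close e (zd (f x)) (zd (f y))"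
 shows "CD_cont S f"
 unfolding continuous_map_def topspace_CD_top
proof (intro conjI allI impI)
 show "f \<in> topspace (top_of_set S) \<rightarrow> CDbar 2" using assms(1) by auto
 fix U assume U: "openin (CD_top 2) U"
 show "openin (top_of_set S) {x \<in> topspace (top_of_set S). f x \<in> U}"
  unfolding openin_subopen[of _ "{x \<in> topspace (top_of_set S). f x \<in> U}"]
 proof safe
  fix x assume x: "x \<in> topspace (top_of_set S)" "f x \<in> U"
  then obtain e where e: "e > 0" "\<forall>G\<in>CDbar 2. close e (zd (f x)) (zd G) --> G \<in> U"
   using U unfolding openin_CD_top by blast
  have xS: "x \<in> S" using x by simp
  obtain T where T: "open T" "x \<in> T" "!!y. y \<in> T ==> y ~= x ==> y \<in> S ==> close e (zd (f x)) (zd (f y))"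
   using assms(2)[OF xS e(1)] unfolding eventually_at_topological by blast
  have "f y \<in> U" if "y \<in> S \<inter> T" for y
   using that T(3)[of y] e(2) assms(1)[of y] x(2) by (cases "y = x") auto
  thus "\<exists>T. openin (top_of_set S) T & x \<in> T & T \<subseteq> {x \<in> topspace (top_of_set S). f x \<in> U}"
   using T xS by (intro exI[of _ "S \<inter> T"]) (auto simp: openin_open)
 qed
qed

subsection \<open>Realization of algebraic families of configurations\<close>

lemma ctame_of_real: "tame f ==> ctame (%t. of_real (f t))" by (simp add: ctame_def tame_const)

lemma ctame_inverse:
 assumes "ctame f" "EV t. f t ~= 0" shows "ctame (%t. inverse (f t))"
proof -
 define D where "D t = (Re (f t))\<^sup>2 + (Im (f t))\<^sup>2" for t
 have "EV t. D t ~= 0"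
  using assms(2) by eventually_elim (simp add: D_def complex_eq_iff sum_power2_eq_zero_iff)
 hence "tame (%t. inverse (D t))"
  using assms(1) unfolding D_def ctame_def by (intro tame_inverse tame_add tame_power) auto
 hence "tame (%t. Re (f t) * inverse (D t))" "tame (%t. - Im (f t) * inverse (D t))"
  using assms(1) unfolding ctame_def by (auto intro!: tame_mult tame_uminus)
 thus ?thesis unfolding ctame_def D_def by (simp add: divide_inverse)
qed

lemma ctame_tendsto:
 assumes "ctame f" "EV t. cmod (f t) <= B" shows "\<exists>L. (f ~~> L)"
proof -
 have "EV t. \<bar>Re (f t)\<bar> <= B" "EV t. \<bar>Im (f t)\<bar> <= B"
  using assms(2) by (eventually_elim, meson abs_Re_le_cmod abs_Im_le_cmod order_trans)+
 then obtain a b where "((%t. Re (f t)) ~~> a)" "((%t. Im (f t)) ~~> b)"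
  using tame_tendsto assms(1) unfolding ctame_def by metis
 from tendsto_Complex[OF this] have "(f ~~> Complex a b)" by simp
 thus ?thesis by blast
qed

lemma tame_cong: assumes "tame f" "!!t. t > 0 ==> g t = f t" shows "tame g"
proof -
 obtain P where P: "P ~= 0" "EV t. eval2 P t (f t) = 0" using assms(1) by (auto simp: tame_def alg_fun_def)
 obtain e where e: "e > 0" "continuous_on {0<..<e} f" using assms(1) by (auto simp: tame_def)
 have "EV t. eval2 P t (g t) = 0"
  using P(2) eventually_at_right_less[of 0] by eventually_elim (simp add: assms(2))
 moreover have "continuous_on {0<..<e} g" using e(2) assms(2) by (simp cong: continuous_on_cong_simp)
 ultimately show ?thesis using P(1) e(1) unfolding tame_def alg_fun_def by blast
qed

text \<open>The limit at 0 exists by algebraicity, so the germ extends to the closed end, and a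
  continuous logarithm on the contractible interval provides the angle.\<close>

lemma circle_germ_lift:
 assumes z: "ctame z" "EV t. cmod (z t) = 1"
 obtains a e where "e > 0" "continuous_on {0..<e} a" "!!t. 0 < t ==> t < e ==> cis (a t) = z t"
  "!!e'. e' <= e ==> alg_germ e' (%t. cos (a t)) & alg_germ e' (%t. sin (a t))"
proof -
 have "EV t. cmod (z t) <= 1" using z(2) by eventually_elim simp
 then obtain L where L: "(z ~~> L)" using ctame_tendsto[OF z(1)] by blast
 obtain e1 where e1: "e1 > 0" "continuous_on {0<..<e1} (%t. Re (z t))" using z(1) by (auto simp: ctame_def tame_def)
 obtain e2 where e2: "e2 > 0" "continuous_on {0<..<e2} (%t. Im (z t))" using z(1) by (auto simp: ctame_def tame_def)
 obtain e3 where e3: "e3 > 0" "!!t. 0 < t ==> t < e3 ==> cmod (z t) = 1"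
  using z(2) by (auto simp: eventually_at_right_field)
 define w where "w t = (if t <= 0 then L else z t)" for t
 have tw: "tame (%t. Re (w t))" "tame (%t. Im (w t))"
  using z(1) by (auto simp: ctame_def w_def intro: tame_cong[of "%t. Re (z t)"] tame_cong[of "%t. Im (z t)"])
 obtain e4 where e4: "e4 > 0" "!!e'. e' <= e4 ==> alg_germ e' (%t. Re (w t))" using tame_imp_alg_germ[OF tw(1)] by blast
 obtain e5 where e5: "e5 > 0" "!!e'. e' <= e5 ==> alg_germ e' (%t. Im (w t))" using tame_imp_alg_germ[OF tw(2)] by blast
 define e where "e = Min {e1, e2, e3, e4, e5}"
 have e: "e > 0" "e <= e1" "e <= e2" "e <= e3" "e <= e4" "e <= e5" using e1 e2 e3 e4 e5 by (auto simp: e_def)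
 have cz: "continuous_on {0<..<e} z"
 proof -
  have "continuous_on {0<..<e} (%t. Complex (Re (z t)) (Im (z t)))"
   by (intro continuous_on_Complex continuous_on_subset[OF e1(2)] continuous_on_subset[OF e2(2)]) (use e in auto)
  thus ?thesis by simp
 qed
 have cw: "continuous_on {0..<e} w"
  unfolding continuous_on_eq_continuous_within
 proof
  fix t assume t: "t \<in> {0..<e}"
  show "continuous (at t within {0..<e}) w"
  proof (cases "t = 0")
   case True
   have "(w ~~> L)" by (rule Lim_transform_eventually[OF L]) (auto simp: w_def eventually_at_right_field intro!: exI[of _ 1])
   hence "(w \<longlongrightarrow> w 0) (at 0 within {0<..})" by (simp add: w_def)
   hence "(w \<longlongrightarrow> w 0) (at 0 within {0..})" by (simp add: at_within_Ici_at_right)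
   hence "(w \<longlongrightarrow> w 0) (at 0 within {0..<e})" by (rule tendsto_within_subset) auto
   thus ?thesis using True by (simp add: continuous_within)
  next
   case False
   hence t': "t \<in> {0<..<e}" using t by auto
   have "continuous_on {0<..<e} w" using cz by (simp add: w_def cong: continuous_on_cong_simp)
   hence "isCont w t" using t' continuous_on_eq_continuous_at[of "{0<..<e}" w] by auto
   thus ?thesis by (rule continuous_at_imp_continuous_at_within)
  qed
 qed
 have L1: "cmod L = 1"
 proof -
  have "EV t. 1 = cmod (z t)" using z(2) by eventually_elim simp
  hence "((%t. cmod (z t)) ~~> 1)" by (rule Lim_transform_eventually[OF tendsto_const])
  from tendsto_unique[OF _ tendsto_norm[OF L] this] show ?thesis by (simp add: trivial_limit_at_right_real)
 qed
 have w1: "cmod (w t) = 1" if "t \<in> {0..<e}" for t using that e3(2)[of t] e L1 by (auto simp: w_def)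
 hence "w t ~= 0" if "t \<in> {0..<e}" for t using that by force
 then obtain g where g: "continuous_on {0..<e} g" "!!t. t \<in> {0..<e} ==> w t = exp (g t)"
  using continuous_logarithm_on_contractible[OF cw] convex_imp_contractible[of "{0..<e}"] by auto
 have ca: "cis (Im (g t)) = w t" if "t \<in> {0..<e}" for t
 proof -
  have "exp (Re (g t)) = 1" using w1[OF that] g(2)[OF that] by simp
  thus ?thesis using g(2)[OF that] by (simp add: exp_eq_polar)
 qed
 have cs: "cos (Im (g t)) = Re (w t)" "sin (Im (g t)) = Im (w t)" if "t \<in> {0..<e}" for t
  using ca[OF that] by (auto simp: complex_eq_iff)
 have congr: "alg_germ e' u" if "alg_germ e' v" "e' <= e" "!!t. t \<in> {0..<e} ==> u t = v t" for e' u v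
  using that unfolding alg_germ_def by (metis atLeastLessThan_iff less_le_trans)
 show ?thesis
 proof (rule that[of e "%t. Im (g t)"])
  show "continuous_on {0..<e} (%t. Im (g t))" using g(1) by (intro continuous_intros)
  show "cis (Im (g t)) = z t" if "0 < t" "t < e" for t using ca[of t] that by (simp add: w_def)
  fix e' assume e': "e' <= e"
  show "alg_germ e' (%t. cos (Im (g t))) & alg_germ e' (%t. sin (Im (g t)))"
   using congr[OF e4(2) e' cs(1)] congr[OF e5(2) e' cs(2)] e' e by auto
 qed (use e in auto)
qed

text \<open>All algebras constructed from tables come from here: it suffices to give four algebraic
  points of the circle that are distinct for small positive times.\<close>

lemma realization:
 fixes z :: "nat => real => complex"
 assumes z: "!!i. i < 4 ==> ctame (z i)" "!!i. i < 4 ==> EV t. cmod (z i t) = 1"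
  and d: "!!i j. i < 4 ==> j < 4 ==> i ~= j ==> EV t. z i t ~= z j t"
 obtains F nu where "repr F nu" "EV t. \<forall>i<4. cis (nu t i) = z i t"
proof -
 have "\<exists>a e. i < 4 --> e > 0 & continuous_on {0..<e} a & (\<forall>t. 0 < t --> t < e --> cis (a t) = z i t) \<and>
  (\<forall>e'\<le>e. alg_germ e' (%t. cos (a t)) & alg_germ e' (%t. sin (a t)))" for i
 proof (cases "i < 4")
  case True
  show ?thesis by (rule circle_germ_lift[OF z(1)[OF True] z(2)[OF True]]) blast
 qed auto
 then obtain a e where ae: "!!i. i < 4 ==> e i > 0 & continuous_on {0..<e i} (a i) & (\<forall>t. 0 < t --> t < e i --> cis (a i t) = z i t) \<and>
  (\<forall>e'\<le>e i. alg_germ e' (%t. cos (a i t)) & alg_germ e' (%t. sin (a i t)))" by metis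
 have "EV t. \<forall>i\<in>{..<4}. \<forall>j\<in>{..<4}-{i}. z i t ~= z j t"
 proof (intro eventually_ball_finite ballI)
  fix i j :: nat assume "i \<in> {..<4}" "j \<in> {..<4} - {i}"
  thus "EV t. z i t ~= z j t" using d[of i j] by auto
 qed auto
 then obtain e0 where e0: "e0 > 0" "\<forall>t>0. t < e0 --> (\<forall>i\<in>{..<4}. \<forall>j\<in>{..<4}-{i}. z i t ~= z j t)"
   unfolding eventually_at_right_field by blast
 define \<epsilon> where "\<epsilon> = Min (insert e0 (e ` {..<4}))"
 have \<epsilon>: "\<epsilon> > 0" "\<epsilon> <= e0" "!!i. i < 4 ==> \<epsilon> <= e i" using ae e0(1) by (auto simp: \<epsilon>_def)
 define nu where "nu t i = a i t" for t i
 have c: "cis (nu t i) = z i t" if "0 < t" "t < \<epsilon>" "i < 4" for t i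
  using ae[OF that(3)] \<epsilon>(3)[OF that(3)] that(1,2) by (auto simp: nu_def)
 have "curve_germ 2 \<epsilon> nu" unfolding curve_germ_def
 proof (intro conjI allI impI ballI)
  fix i :: nat assume "i < 2 * 2"
  hence i: "i < 4" by simp
  have ai: "continuous_on {0..<e i} (a i)" using ae[OF i] by blast
  show "continuous_on {0..<\<epsilon>} (%t. nu t i)" unfolding nu_def
   by (rule continuous_on_subset[OF ai]) (use \<epsilon>(3)[OF i] in force)
  have "alg_germ \<epsilon> (%t. cos (a i t)) & alg_germ \<epsilon> (%t. sin (a i t))"
   using conjunct2[OF conjunct2[OF conjunct2[OF ae[OF i]]]] \<epsilon>(3)[OF i] by blast
  thus "alg_germ \<epsilon> (%t. cos (nu t i))" "alg_germ \<epsilon> (%t. sin (nu t i))" unfolding nu_def by simp_all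
 next
  fix t assume t: "t \<in> {0<..<\<epsilon>}"
  have "cis (nu t i) ~= cis (nu t j)" if "i < 4" "j < 4" "i ~= j" for i j
   using c[of t i] c[of t j] e0(2) t \<epsilon>(2) that by force
  thus "config 2 (nu t)" unfolding config_def cis_eq_iff by auto
 qed (use \<epsilon> in auto)
 hence "repr (limit_alg 2 \<epsilon> nu) nu" unfolding repr_def by blast
 moreover have "EV t. \<forall>i<4. cis (nu t i) = z i t"
  using c \<epsilon>(1) by (auto simp: eventually_at_right_field)
 ultimately show ?thesis using that by blast
qed

section \<open>Algebras with a prescribed table, and the algebra of a quadruple\<close>

lemma tendsto_zform:
 assumes "!!i. i < 4 ==> ((%t. cis (nu t i)) \<longlongrightarrow> cis (\<tau> i)) F" "nrm \<tau> > 0"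
 shows "((%t. zform (nu t) (E i) (E j)) \<longlongrightarrow> zform \<tau> (E i) (E j)) F"
proof -
 have "((%t. nform (nu t) (E i) (E j)) \<longlongrightarrow> nform \<tau> (E i) (E j)) F" for i j
  unfolding nform_def E_def by (intro tendsto_diff tendsto_mult tendsto_power assms(1)) auto
 thus ?thesis unfolding zform_def nrm_def using assms(2) by (intro tendsto_intros) (auto simp: nrm_def)
qed

text \<open>The sign might depend on \<open>e\<close>; but if the two signs failed at
  \<open>e1\<close> and at \<open>e2\<close>, closeness at the smaller of these would be
  contradicted.\<close>

lemma close_zero:
 assumes "!!e. e > 0 ==> close e A B" shows "close 0 A B"
proof (rule ccontr)
 assume *: "\<not> close 0 A B"
 have "\<exists>e>0. \<not> sclose \<sigma> e A B" if "\<not> sclose \<sigma> 0 A B" for \<sigma>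
 proof -
  have "\<exists>i\<le>7. \<exists>j\<le>7. cmod (A i j - \<sigma> * B i j) > 0" using that unfolding sclose_def by (meson not_le)
  then obtain i j where "i <= 7" "j <= 7" "cmod (A i j - \<sigma> * B i j) > 0" by blast
  hence "\<not> sclose \<sigma> (cmod (A i j - \<sigma> * B i j) / 2) A B" "cmod (A i j - \<sigma> * B i j) / 2 > 0"
   unfolding sclose_def by (simp_all only: not_all not_imp not_le, intro exI[of _ i] conjI exI[of _ j], simp_all)
  thus ?thesis by blast
 qed
 then obtain e1 e2 where e: "e1 > 0" "\<not> sclose 1 e1 A B" "e2 > 0" "\<not> sclose (-1) e2 A B" using * unfolding close_def by blast
 have "close (min e1 e2) A B" using assms[of "min e1 e2"] e by simp
 hence "sclose 1 e1 A B \<or> sclose (-1) e2 A B" unfolding close_def sclose_def by force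
 thus False using e by blast
qed

text \<open>Tables are easier to vary continuously than algebras. Some algebra with the given table
  is chosen, and tables equal up to sign give the same choice, so that identities between
  configurations become equalities of algebras.\<close>

definition dalg :: "(nat => nat => complex) => alg" where
 "dalg Y = (SOME F. F \<in> CDbar 2 & close 0 (zd F) Y)"

definition realizable :: "(nat => nat => complex) => bool" where
 "realizable Y \<longleftrightarrow> (\<exists>F\<in>CDbar 2. close 0 (zd F) Y)"

lemma dalg: "realizable Y ==> dalg Y \<in> CDbar 2" "realizable Y ==> close 0 (zd (dalg Y)) Y"
 using someI_ex[of "%F. F \<in> CDbar 2 & close 0 (zd F) Y"] unfolding dalg_def realizable_def by blast+

lemma dalg_cong: assumes "close 0 Y Y'" shows "dalg Y = dalg Y'"
proof -
 have "close 0 (zd F) Y \<longleftrightarrow> close 0 (zd F) Y'" for F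
  using close_trans[of 0 "zd F" Y 0 Y'] close_trans[of 0 "zd F" Y' 0 Y] assms close_sym[OF assms] by auto
 thus ?thesis by (simp add: dalg_def)
qed

lemma repr_realizable:
 assumes "repr F nu" "close 0 (zdat nu) Y" shows "realizable Y"
proof -
 have "close 0 (zd F) (zdat nu)" unfolding zd_def
  by (rule close_zero) (rule repr_close[OF repr_germ_of[OF repr_CDbar[OF assms(1)]] assms(1)])
 from close_trans[OF this assms(2)] show ?thesis using repr_CDbar[OF assms(1)] unfolding realizable_def by auto
qed

definition tdat :: "conf => nat => nat => complex" where
 "tdat \<tau> i j = zform \<tau> (E i) (E j)"

lemma zdat_eqI: "(!!i j. ((%t. zform (nu t) (E i) (E j)) ~~> Y i j)) ==> zdat nu = Y"
 unfolding zdat_def by (intro ext zlimI)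

lemma cayley_circle:
 fixes x y :: real
 shows "cmod ((1 + \<i> * of_real x) / (1 - \<i> * of_real x)) = 1"
  and "(1 + \<i> * of_real x) / (1 - \<i> * of_real x) = (1 + \<i> * of_real y) / (1 - \<i> * of_real y) \<longleftrightarrow> x = y"
proof -
 have nz: "1 - \<i> * of_real u ~= 0" for u :: real by (auto simp: complex_eq_iff)
 have "cmod (1 + \<i> * of_real x) = cmod (1 - \<i> * of_real x)" by (simp add: cmod_def)
 thus "cmod ((1 + \<i> * of_real x) / (1 - \<i> * of_real x)) = 1" using nz[of x] by (simp add: norm_divide)
 have "(1 + \<i> * of_real x) / (1 - \<i> * of_real x) = (1 + \<i> * of_real y) / (1 - \<i> * of_real y) \<longleftrightarrow>
  (1 + \<i> * of_real x) * (1 - \<i> * of_real y) = (1 + \<i> * of_real y) * (1 - \<i> * of_real x)"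
  by (rule frac_eq_eq[OF nz nz])
 also have "... \<longleftrightarrow> x = y" by (auto simp: complex_eq_iff)
 finally show "(1 + \<i> * of_real x) / (1 - \<i> * of_real x) = (1 + \<i> * of_real y) / (1 - \<i> * of_real y) \<longleftrightarrow> x = y" .
qed

text \<open>Coinciding points are separated by rotating the i-th point with the Cayley transform of
  \<open>i * t\<close>: the speeds differ, and the rotation is rational in \<open>t\<close>, hence
  algebraic.\<close>

lemma tuple_realizable:
 assumes "nrm \<tau> > 0" shows "realizable (tdat \<tau>)"
proof -
 define \<rho> where "\<rho> i t = (1 + \<i> * of_real (real i * t)) / (1 - \<i> * of_real (real i * t))" for i :: nat and t :: real
 define z where "z i t = cis (\<tau> i) * \<rho> i t" for i t
 have nz: "1 - \<i> * of_real u ~= 0" for u :: real by (auto simp: complex_eq_iff)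
 have r: "ctame (\<rho> i)" for i
  unfolding \<rho>_def[abs_def] divide_inverse using nz
  by (intro ctame_mult ctame_add ctame_inverse ctame_diff ctame_const ctame_of_real tame_mult tame_const tame_ident) auto
 have lim\<rho>: "(\<rho> i ~~> 1)" for i
 proof -
  have "(\<rho> i ~~> (1 + \<i> * of_real (real i * 0)) / (1 - \<i> * of_real (real i * 0)))"
   unfolding \<rho>_def by (intro tendsto_intros) auto
  thus ?thesis by simp
 qed
 have lim: "(z i ~~> cis (\<tau> i))" for i
  using tendsto_mult[OF tendsto_const lim\<rho>, of "cis (\<tau> i)"] by (simp add: z_def[abs_def])
 have dist: "EV t. z i t ~= z j t" if "i ~= j" for i j
 proof (cases "cis (\<tau> i) = cis (\<tau> j)")
  case True
  have "z i t ~= z j t" if "t > 0" for t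
  proof -
   have "real i * t ~= real j * t" using \<open>i ~= j\<close> that by simp
   hence "\<rho> i t ~= \<rho> j t" unfolding \<rho>_def cayley_circle(2) .
   thus ?thesis using True unfolding z_def by simp
  qed
  thus ?thesis by (auto simp: eventually_at_right_field intro!: exI[of _ 1])
 next
  case False
  have "((%t. z i t - z j t) ~~> cis (\<tau> i) - cis (\<tau> j))" by (intro tendsto_intros lim)
  from tendsto_imp_eventually_ne[OF this, of 0] False show ?thesis by simp
 qed
 obtain F nu where F: "repr F nu" "EV t. \<forall>i<4. cis (nu t i) = z i t"
 proof (rule realization[of z])
  show "ctame (z i)" for i unfolding z_def[abs_def] by (intro ctame_mult ctame_const r)
  show "EV t. cmod (z i t) = 1" for i
   unfolding z_def \<rho>_def norm_mult cayley_circle(1) by simp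
 qed (use dist in blast)+
 have "zdat nu = tdat \<tau>"
 proof (rule zdat_eqI, unfold tdat_def, rule tendsto_zform[OF _ assms])
  fix i :: nat assume i: "i < 4"
  have "EV t. z i t = cis (nu t i)" using F(2) by eventually_elim (use i in auto)
  thus "((%t. cis (nu t i)) ~~> cis (\<tau> i))" by (rule Lim_transform_eventually[OF lim])
 qed
 thus ?thesis using repr_realizable[OF F(1)] close_refl by simp
qed

lemma continuous_map_dalg:
 fixes S :: "'a::topological_space set"
 assumes r: "!!x. x \<in> S ==> realizable (Y x)"
  and c: "!!i j. i <= 7 ==> j <= 7 ==> continuous_on S (%x. Y x i j)"
  and f: "!!x. x \<in> S ==> f x \<in> CDbar 2 & close 0 (zd (f x)) (Y x)"
 shows "CD_cont S f"
proof (rule continuous_map_CD_top)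
 show "f x \<in> CDbar 2" if "x \<in> S" for x using f[OF that] by blast
 fix x e assume x: "x \<in> S" and e: "(e::real) > 0"
 have "\<forall>\<^sub>F y in at x within S. dist (Y y i j) (Y x i j) < e" if "i <= 7" "j <= 7" for i j
  using c[OF that] x e unfolding continuous_on_def by (auto intro: tendstoD)
 hence "\<forall>\<^sub>F y in at x within S. \<forall>i\<in>{..7}. \<forall>j\<in>{..7}. dist (Y y i j) (Y x i j) < e"
  by (intro eventually_ball_finite ballI) auto
 moreover have "\<forall>\<^sub>F y in at x within S. y \<in> S" by (simp add: eventually_at_filter)
 ultimately show "\<forall>\<^sub>F y in at x within S. close e (zd (f x)) (zd (f y))"
 proof eventually_elim
  fix y assume "\<forall>i\<in>{..7}. \<forall>j\<in>{..7}. dist (Y y i j) (Y x i j) < e" "y \<in> S"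
  hence "sclose 1 e (Y x) (Y y)" by (auto simp: sclose_def dist_norm norm_minus_commute intro: less_imp_le)
  hence "close e (Y x) (Y y)" by (simp add: close_def)
  from close_trans[OF conjunct2[OF f[OF x]] this] have "close e (zd (f x)) (Y y)" by simp
  from close_trans[OF this close_sym[OF conjunct2[OF f[OF \<open>y \<in> S\<close>]]]] show "close e (zd (f x)) (zd (f y))" by simp
 qed
qed

definition A :: "conf => alg" where "A \<tau> = dalg (tdat \<tau>)"

lemma A_props: "nrm \<tau> > 0 ==> A \<tau> \<in> CDbar 2" "nrm \<tau> > 0 ==> close 0 (zd (A \<tau>)) (tdat \<tau>)"
 using dalg[OF tuple_realizable] by (simp_all add: A_def)

lemma tgerm_const: "nrm \<tau> > 0 ==> tgerm (%t. \<tau>)" by (simp add: tgerm_def ctame_const)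

lemma zlim_const: "zlim (%t. \<tau>) \<phi> \<psi> = zform \<tau> \<phi> \<psi>" "zdat (%t. \<tau>) = tdat \<tau>"
proof -
 show "zlim (%t. \<tau>) \<phi> \<psi> = zform \<tau> \<phi> \<psi>" for \<phi> \<psi> by (rule zlimI) (rule tendsto_const)
 thus "zdat (%t. \<tau>) = tdat \<tau>" by (intro ext) (simp add: zdat_def tdat_def)
qed

lemma continuous_map_A:
 fixes S :: "'a::topological_space set"
 assumes "!!x. x \<in> S ==> nrm (\<tau> x) > 0" "!!i. i < 4 ==> continuous_on S (%x. \<tau> x i)"
 shows "CD_cont S (%x. A (\<tau> x))"
proof (rule continuous_map_dalg[of S "%x. tdat (\<tau> x)"])
 show "continuous_on S (%x. tdat (\<tau> x) i j)" for i j
  unfolding continuous_on_def tdat_def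
 proof
  fix x assume x: "x \<in> S"
  show "((%x. zform (\<tau> x) (E i) (E j)) \<longlongrightarrow> zform (\<tau> x) (E i) (E j)) (at x within S)"
  proof (rule tendsto_zform[OF _ assms(1)[OF x]])
   fix i :: nat assume "i < 4"
   hence "continuous_on S (%x. cis (\<tau> x i))" using assms(2) by (intro continuous_intros) auto
   thus "((%x. cis (\<tau> x i)) \<longlongrightarrow> cis (\<tau> x i)) (at x within S)" using x by (simp add: continuous_on_def)
  qed
 qed
qed (use assms(1) tuple_realizable A_props in auto)

subsection \<open>Semicontinuity of supports and the open sets of algebras seen from a point\<close>

definition tup :: "real => real => real => real => nat => real" where
 "tup a b c d i = (if i = 0 then a else if i = 1 then b else if i = 2 then c else d)"

lemma tup_simps [simp]: "tup a b c d 0 = a" "tup a b c d 1 = b" "tup a b c d 2 = c" "tup a b c d 3 = d" by (simp_all add: tup_def)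

lemma less_4_cases: "i < (4::nat) \<longleftrightarrow> i = 0 \<or> i = 1 \<or> i = 2 \<or> i = 3" by (auto simp: One_nat_def)

lemma zform_neg:
 assumes "!!\<phi> \<psi>. nform xs \<phi> \<psi> = - nform ys \<phi> \<psi>"
 shows "nrm xs = nrm ys" "zform xs \<phi> \<psi> = - zform ys \<phi> \<psi>"
proof -
 show *: "nrm xs = nrm ys" by (simp add: nrm_def assms)
 show "zform xs \<phi> \<psi> = - zform ys \<phi> \<psi>" by (simp add: zform_def * assms)
qed

lemma nform_tup_swaps:
 "nform (tup b a c d) \<phi> \<psi> = - nform (tup a b c d) \<phi> \<psi>"
 "nform (tup a b d c) \<phi> \<psi> = - nform (tup a b c d) \<phi> \<psi>"
 "nform (tup c d a b) \<phi> \<psi> = - nform (tup a b c d) \<phi> \<psi>" by (simp_all add: nform_def algebra_simps)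

lemma nform_tup: "nform (tup (xs 0) (xs 1) (xs 2) (xs 3)) \<phi> \<psi> = nform xs \<phi> \<psi>" by (simp add: nform_def)

lemma zform_tup: "zform (tup (xs 0) (xs 1) (xs 2) (xs 3)) \<phi> \<psi> = zform xs \<phi> \<psi>"
 by (simp add: zform_def nform_tup nrm_def)

lemma nrm_le_mdist: "nrm xs <= 20736 * mdist xs"
proof -
 have m: "mdist xs \<ge> 0" by (simp add: mdist_def)
 have "nrm xs <= cmod (nform xs (E 1) (E 2)) + cmod (nform xs (E 1) (E 3))"
  unfolding nrm_def by (rule sqrt_sum_squares_le_sum) auto
 also have "... <= 2 * 6 ^ (1 + 2) * mdist xs + 2 * 6 ^ (1 + 3) * mdist xs" by (intro add_mono norm_nform_E_le)
 also have "... <= 20736 * mdist xs" using m by simp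
 finally show ?thesis .
qed

lemma good_poly: "degree r <= 7 ==> good K (pnorm r) (%x. poly r (cis x))"
 unfolding good_def by blast

lemma pnorm_linear: "cmod z = 1 ==> pnorm [:-z, 1:] = 2" by (simp add: pnorm_pCons) (simp add: pnorm_def)

text \<open>The form of \<open>ys\<close> vanishes on every function divisible by
  \<open>\<Omega>\<close>, so the form of \<open>xs\<close> is small there. With a further zero of
  \<open>f\<close> at \<open>xs 1\<close> and test functions that vanish at both ends of the first
  chord, the value of \<open>\<Omega>\<close> at \<open>xs 0\<close> is isolated, multiplied by the
  quantities that make up \<open>mdist xs\<close>.\<close>

lemma supp_bound0:
 assumes n: "nrm xs > 0"
  and c: "!!i j. i <= 7 ==> j <= 7 ==> cmod (zform xs (E i) (E j) - \<sigma> * zform ys (E i) (E j)) <= e"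
 shows "(\<Prod>i<4. cmod (cis (xs 0) - cis (ys i))) <= 10616832 * e"
proof -
 define a b where "a = cis (xs 0)" "b = cis (xs 1)"
 define z where "z i = cis (ys i)" for i
 have u: "cmod a = 1" "cmod b = 1" "cmod (z i) = 1" for i by (simp_all add: a_b_def z_def)
 define \<Omega> where "\<Omega> = [:- z 0, 1:] * ([:- z 1, 1:] * ([:- z 2, 1:] * [:- z 3, 1:]))"
 define f where "f = \<Omega> * [:-b, 1:]"
 \<comment> \<open>Two test functions, because the differences of the sums and of the products of
   the chord ends have to be seen separately.\<close>
 define \<psi>1 where "\<psi>1 = [:-a, 1:] * [:-b, 1:]"
 define \<psi>2 where "\<psi>2 = [:0, 1:] * \<psi>1"
 note [simp del] = mult_pCons_left mult_pCons_right
 have po: "poly \<Omega> x = (x - z 0) * ((x - z 1) * ((x - z 2) * (x - z 3)))" for x unfolding \<Omega>_def poly_mult by simp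
 have d1: "degree (p * [:-c, 1:]) <= Suc (degree p)" "degree ([:-c, 1:] * p) <= Suc (degree p)" for p :: "complex poly" and c
  using degree_mult_le[of p "[:-c, 1:]"] degree_mult_le[of "[:-c, 1:]" p] by auto
 have deg: "degree f <= 7" "degree \<psi>1 <= 7" "degree \<psi>2 <= 7"
 proof -
  have "degree \<Omega> <= 4" unfolding \<Omega>_def by (simp add: degree_mult_eq del: mult_pCons_left mult_pCons_right)
  thus "degree f <= 7" unfolding f_def using d1(1)[of \<Omega> b] by linarith
  have *: "degree \<psi>1 <= 2" unfolding \<psi>1_def by (rule order_trans[OF d1(2)]) simp
  thus "degree \<psi>1 <= 7" by simp
  show "degree \<psi>2 <= 7" unfolding \<psi>2_def using degree_mult_le[of "[:0, 1:]" \<psi>1] * by simp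
 qed
 have pn: "pnorm f <= 32" "pnorm \<psi>1 <= 4" "pnorm \<psi>2 <= 4"
 proof -
  have m: "pnorm (p * q) <= x * y" if "pnorm p <= x" "pnorm q <= y" for p q x y
   using pnorm_mult[of p q] mult_mono[OF that] pnorm_nonneg[of q] pnorm_nonneg[of p] that by (meson order_trans)
  have l: "pnorm [:-c, 1:] <= 2" if "cmod c = 1" for c using pnorm_linear[OF that] by simp
  have "pnorm f <= (2 * (2 * (2 * 2))) * 2" unfolding f_def \<Omega>_def by (intro m l u)
  thus "pnorm f <= 32" by simp
  have "pnorm \<psi>1 <= 2 * 2" unfolding \<psi>1_def by (intro m l u)
  thus *: "pnorm \<psi>1 <= 4" by simp
  have "pnorm \<psi>2 <= 1 * 4" unfolding \<psi>2_def by (intro m *) (simp add: pnorm_pCons, simp add: pnorm_def)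
  thus "pnorm \<psi>2 <= 4" by simp
 qed
 have e0: "e \<ge> 0" using order_trans[OF norm_ge_zero c[of 0 0]] by simp
 let ?P = "%p x. poly p (cis x)"
 have small: "cmod (zform xs (?P f) (?P \<psi>)) <= 128 * e" if "degree \<psi> <= 7" "pnorm \<psi> <= 4" for \<psi>
 proof -
  have "poly f (z i) = 0" if "i < 4" for i using that unfolding f_def poly_mult po less_4_cases by auto
  hence "zform ys (?P f) (?P \<psi>) = 0" unfolding zform_def nform_def using less_4_cases by (simp add: z_def)
  hence "cmod (zform xs (?P f) (?P \<psi>)) <= pnorm f * pnorm \<psi> * e"
   using zform_transfer[OF good_poly[OF deg(1)] good_poly[OF that(1)], of xs UNIV ys \<sigma> e] c by simp
  also have "... <= 32 * 4 * e" using pn(1) that(2) e0 pnorm_nonneg by (intro mult_mono mult_right_mono) auto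
  finally show ?thesis by simp
 qed
 define S P S' P' where "S = chord_sum (xs 0) (xs 1)" "P = chord_prod (xs 0) (xs 1)"
  "S' = chord_sum (xs 2) (xs 3)" "P' = chord_prod (xs 2) (xs 3)"
 define w where "w = poly \<Omega> a * (a - b) * (cis (xs 2) - cis (xs 3))"
 have pf: "poly f a = poly \<Omega> a * (a - b)" "poly f b = 0" "poly \<psi>1 a = 0" "poly \<psi>1 b = 0" "poly \<psi>2 a = 0" "poly \<psi>2 b = 0"
  by (simp_all add: f_def \<psi>1_def \<psi>2_def algebra_simps)
 have pd: "poly \<psi>1 x - poly \<psi>1 y = (x - y) * (x + y - (a + b))"
  "poly \<psi>2 x - poly \<psi>2 y = (x - y) * ((x + y) * (x + y - (a + b)) + (a * b - x * y))" for x y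
  by (simp_all add: \<psi>1_def \<psi>2_def algebra_simps)
 have N1: "nform xs (?P f) (?P \<psi>1) = w * (S' - S)" and N2: "nform xs (?P f) (?P \<psi>2) = w * (S' * (S' - S) + (P - P'))"
  unfolding nform_def using pf pd[of "cis (xs 2)" "cis (xs 3)"]
  by (simp_all add: a_b_def[symmetric] w_def S_P_S'_P'_def chord_sum_def chord_prod_def)
 have b1: "cmod w * cmod (S' - S) <= 128 * e * nrm xs"
  using small[OF deg(2) pn(2)] n unfolding zform_def N1 norm_divide norm_mult by (simp add: pos_divide_le_eq)
 have b2: "cmod w * cmod (S' * (S' - S) + (P - P')) <= 128 * e * nrm xs"
  using small[OF deg(3) pn(3)] n unfolding zform_def N2 norm_divide norm_mult by (simp add: pos_divide_le_eq)
 have "cmod (P - P') <= cmod (S' * (S' - S) + (P - P')) + cmod (S' * (S' - S))"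
  using norm_triangle_ineq4[of "S' * (S' - S) + (P - P')" "S' * (S' - S)"] by simp
 also have "cmod (S' * (S' - S)) <= 2 * cmod (S' - S)"
  unfolding norm_mult S_P_S'_P'_def using chord_bounds(1) by (intro mult_right_mono) auto
 finally have "cmod w * cmod (P - P') <= cmod w * (cmod (S' * (S' - S) + (P - P')) + 2 * cmod (S' - S))"
  by (intro mult_left_mono) auto
 also have "... <= 128 * e * nrm xs + 2 * (128 * e * nrm xs)" using b1 b2 by (simp add: distrib_left)
 finally have "cmod w * (cmod (S - S') + cmod (P - P')) <= 512 * e * nrm xs"
  using b1 by (simp add: distrib_left norm_minus_commute)
 moreover have "cmod w * (cmod (S - S') + cmod (P - P')) = cmod (poly \<Omega> a) * mdist xs"
  by (simp add: w_def mdist_def a_b_def S_P_S'_P'_def norm_mult)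
 ultimately have "cmod (poly \<Omega> a) * mdist xs <= 512 * e * nrm xs" by simp
 \<comment> \<open>Return from \<open>nrm\<close> to \<open>mdist\<close>, which then cancels; 512 *
   20736 = 10616832.\<close>
 also have "... <= 512 * e * (20736 * mdist xs)" using nrm_le_mdist[of xs] e0 by (intro mult_left_mono) auto
 finally have "cmod (poly \<Omega> a) * mdist xs <= (10616832 * e) * mdist xs" by (simp add: mult_ac)
 moreover have "mdist xs > 0" using nrm_le_mdist[of xs] n by linarith
 ultimately have "cmod (poly \<Omega> a) <= 10616832 * e" by simp
 moreover have "cmod (poly \<Omega> a) = (\<Prod>i<4. cmod (a - z i))"
  by (simp add: po norm_mult numeral_eq_Suc One_nat_def mult_ac)
 ultimately show ?thesis by (simp add: a_b_def z_def)
qed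

lemma supp_bound:
 assumes n: "nrm xs > 0" "m < 4"
  and c: "!!i j. i <= 7 ==> j <= 7 ==> cmod (zform xs (E i) (E j) - \<sigma> * zform ys (E i) (E j)) <= e"
 shows "(\<Prod>i<4. cmod (cis (xs m) - cis (ys i))) <= 10616832 * e"
proof -
 let ?t = "tup (xs 0) (xs 1) (xs 2) (xs 3)"
 have n0: "nrm ?t = nrm xs" by (simp add: nrm_def nform_tup)
 have neg: ?thesis if "!!\<phi> \<psi>. nform us \<phi> \<psi> = - nform ?t \<phi> \<psi>" "us 0 = xs m" for us
 proof -
  have "cmod (zform us (E i) (E j) - (- \<sigma>) * zform ys (E i) (E j)) <= e" if "i <= 7" "j <= 7" for i j
  proof -
   have "zform us (E i) (E j) = - zform xs (E i) (E j)" using zform_neg(2)[OF \<open>!!\<phi> \<psi>. nform us \<phi> \<psi> = _\<close>] by (simp add: zform_tup)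
   hence "zform us (E i) (E j) - (- \<sigma>) * zform ys (E i) (E j) = - (zform xs (E i) (E j) - \<sigma> * zform ys (E i) (E j))" by simp
   thus ?thesis using c[OF that] by (metis norm_minus_cancel)
  qed
  moreover have "nrm us > 0" using zform_neg(1)[OF that(1)] n0 n(1) by simp
  ultimately show ?thesis using supp_bound0[of us "- \<sigma>" ys e] that(2) by simp
 qed
 have pos: ?thesis if "!!\<phi> \<psi>. nform us \<phi> \<psi> = nform ?t \<phi> \<psi>" "us 0 = xs m" for us
 proof -
  have "nrm us = nrm xs" using that(1) n0 by (simp add: nrm_def)
  moreover from this have "zform us (E i) (E j) = zform xs (E i) (E j)" for i j using that(1) by (simp add: zform_def nform_tup)
  ultimately show ?thesis using supp_bound0[of us \<sigma> ys e] that(2) n(1) c by simp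
 qed
 consider "m = 0" | "m = 1" | "m = 2" | "m = 3" using n(2)[unfolded less_4_cases] by argo
 thus ?thesis
 proof cases
  case 1 thus ?thesis by (intro pos[of ?t]) simp_all
 next
  case 2 thus ?thesis by (intro neg[of "tup (xs 1) (xs 0) (xs 2) (xs 3)"] nform_tup_swaps) simp
 next
  case 3 thus ?thesis by (intro neg[of "tup (xs 2) (xs 3) (xs 0) (xs 1)"] nform_tup_swaps) simp
 next
  case 4 thus ?thesis
   by (intro pos[of "tup (xs 3) (xs 2) (xs 0) (xs 1)"]) (simp_all add: nform_tup_swaps(1)[of "xs 3"] nform_tup_swaps(3)[of "xs 2"])
 qed
qed

section \<open>Germs that stay away from a point, and the sets \<open>U th\<close>\<close>

definition away :: "real => real => real set" where "away th k = {x. cmod (cis x - cis th) \<ge> k}"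

definition avoids :: "germ => real => real => bool" where
 "avoids nu th k \<longleftrightarrow> (EV t. nodes (nu t) \<subseteq> away th k)"

lemma avoids_open:
 assumes "k > 0"
 obtains d where "d > 0" "!!nu nu'. tgerm nu ==> tgerm nu' ==> close d (zdat nu) (zdat nu') ==> avoids nu th k ==> avoids nu' th (k / 2)"
proof -
 \<comment> \<open>If a node of \<open>nu'\<close> came within \<open>k / 2\<close> of
   \<open>th\<close>, its four distances to the nodes of \<open>nu\<close> would be at least
   \<open>k / 2\<close>. With error \<open>2 * d\<close> the bound of \<open>supp_bound\<close> is
   only half of the fourth power of \<open>k / 2\<close>.\<close>
 define d where "d = (k / 2) ^ 4 / (10616832 * 4)"
 have d: "d > 0" using assms by (simp add: d_def)
 have "avoids nu' th (k / 2)" if t: "tgerm nu" "tgerm nu'" and c: "close d (zdat nu) (zdat nu')" and a: "avoids nu th k" for nu nu'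
 proof -
  obtain \<sigma> where s: "sclose \<sigma> d (zdat nu') (zdat nu)" using close_sym[OF c] by (auto simp: close_iff)
  have dd: "d < 2 * d" using d by simp
  have "EV s. nrm (nu' s) > 0" using t(2) by (simp add: tgerm_def)
  thus ?thesis using eventually_sclose[OF t(2,1) s dd] a unfolding avoids_def
  proof eventually_elim
   fix s assume n: "nrm (nu' s) > 0" and nd: "nodes (nu s) \<subseteq> away th k"
    and cl: "\<forall>i\<le>7. \<forall>j\<le>7. cmod (zform (nu' s) (E i) (E j) - \<sigma> * zform (nu s) (E i) (E j)) <= 2 * d"
   have "cmod (cis (nu' s m) - cis th) \<ge> k / 2" if m: "m < 4" for m
   proof (rule ccontr)
    assume *: "\<not> ?thesis"
    have "cmod (cis (nu' s m) - cis (nu s i)) \<ge> k / 2" if "i < 4" for i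
    proof -
     have "cmod (cis (nu s i) - cis th) \<ge> k" using nd that by (auto simp: away_def nodes_def)
     thus ?thesis using * norm_triangle_ineq[of "cis (nu s i) - cis (nu' s m)" "cis (nu' s m) - cis th"]
      by (simp add: norm_minus_commute)
    qed
    hence "(\<Prod>i<4::nat. k / 2) <= (\<Prod>i<4. cmod (cis (nu' s m) - cis (nu s i)))" using assms by (intro prod_mono) auto
    also have "... <= 10616832 * (2 * d)" by (rule supp_bound[OF n m]) (use cl in blast)
    also have "... = (k / 2) ^ 4 / 2" by (simp add: d_def)
    finally have "(k / 2) ^ 4 <= (k / 2) ^ 4 / 2" by simp
    moreover have "(k / 2) ^ 4 > 0" using assms by simp
    ultimately show False by linarith
   qed
   thus "nodes (nu' s) \<subseteq> away th (k / 2)" by (auto simp: nodes_def away_def)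
  qed
 qed
 thus ?thesis using that d by blast
qed

lemma good_cong: "good K B \<phi> ==> (!!x. x \<in> K ==> \<phi> x = \<psi> x) ==> good K B \<psi>"
 unfolding good_def by (metis subset_iff)

text \<open>Stereographic coordinate of the circle with centre \<open>th\<close>: an affine
  coordinate on the complement of that point, in which the dilations are multiplications.\<close>

definition ct :: "real => real => real" where "ct th x = cot ((x - th) / 2)"

lemma ct_eq:
 assumes "cis x ~= cis th"
 shows "cx (ct th) x = \<i> * (cis x + cis th) * inverse (- cis th + cis x)"
proof -
 define u where "u = (x - th) / 2"
 have x: "cis x = cis (th + u) * cis u" "cis th = cis (th + u) * cis (- u)" by (simp_all add: cis_mult u_def field_simps)
 have s: "cis u + cis (- u) = 2 * of_real (cos u)" "cis u - cis (- u) = 2 * \<i> * of_real (sin u)" by (auto simp: complex_eq_iff)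
 have p: "cis x + cis th = cis (th + u) * (2 * of_real (cos u))" "- cis th + cis x = cis (th + u) * (2 * \<i> * of_real (sin u))"
  unfolding x s[symmetric] by (simp_all add: algebra_simps)
 have "sin u ~= 0" using assms p(2) by auto
 thus ?thesis unfolding p cx_def ct_def u_def[symmetric] cot_def by (simp add: field_simps)
qed

lemma good_ct:
 assumes "k > 0" shows "\<exists>B. good (away th k) B (cx (ct th))" "\<exists>B. good (away th k) B (%x. cx (ct th) x ^ 2)"
proof -
 have i: "good (away th k) (inv_bound 1 k 8) (%x. inverse (- cis th + 1 * cis x))"
  by (rule good_inverse) (use assms in \<open>auto simp: away_def norm_minus_commute\<close>)
 from good_mult[OF good_mult[OF good_const[of _ \<i>] good_add[OF good_cis good_const[of _ "cis th"]]] i]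
 have "\<exists>B. good (away th k) B (%x. \<i> * (cis x + cis th) * inverse (- cis th + cis x))" by auto
 then obtain B where "good (away th k) B (%x. \<i> * (cis x + cis th) * inverse (- cis th + cis x))" by blast
 hence "good (away th k) B (cx (ct th))"
 proof (rule good_cong)
  fix x assume "x \<in> away th k"
  hence "cis x ~= cis th" using assms by (auto simp: away_def)
  thus "\<i> * (cis x + cis th) * inverse (- cis th + cis x) = cx (ct th) x" by (rule ct_eq[symmetric])
 qed
 thus "\<exists>B. good (away th k) B (cx (ct th))" "\<exists>B. good (away th k) B (%x. cx (ct th) x ^ 2)"
  using good_power_ex[of _ B "cx (ct th)" 2] by - (rule exI[of _ B], assumption, assumption)
qed

text \<open>For a quadruple the value is, up to \<open>nrm\<close>, the product of the
  \<open>ct\<close> differences of both chords and of the difference of their \<open>ct\<close>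
  sums. Its sign trivializes the double cover over \<open>U th\<close>.\<close>

definition cform :: "real => germ => complex" where
 "cform th nu = zlim nu (cx (ct th)) (%x. cx (ct th) x ^ 2)"

definition inU :: "real => germ => bool" where
 "inU th nu \<longleftrightarrow> (\<exists>k>0. avoids nu th k) & cform th nu ~= 0"

lemma away_mono: "k' <= k ==> away th k \<subseteq> away th k'" by (auto simp: away_def)

lemma avoids_mono: "avoids nu th k ==> k' <= k ==> avoids nu th k'"
 unfolding avoids_def by (elim eventually_mono) (use away_mono in blast)

lemma cform_transfer:
 assumes "k > 0"
 obtains B where "B > 0" "!!nu nu' \<sigma> e e'. tgerm nu ==> tgerm nu' ==> avoids nu th k ==> avoids nu' th k ==>
   sclose \<sigma> e (zdat nu) (zdat nu') ==> e < e' ==> cmod (cform th nu - \<sigma> * cform th nu') <= B * e'"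
proof -
 obtain B1 B2 where B: "good (away th k) B1 (cx (ct th))" "good (away th k) B2 (%x. cx (ct th) x ^ 2)" using good_ct[OF assms] by blast
 have *: "cmod (cform th nu - \<sigma> * cform th nu') <= (B1 * B2 + 1) * e'" if "tgerm nu" "tgerm nu'" "avoids nu th k" "avoids nu' th k"
   "sclose \<sigma> e (zdat nu) (zdat nu')" "e < e'" for nu nu' \<sigma> e e'
 proof -
  have "0 <= e" using that(5) order_trans[OF norm_ge_zero] unfolding sclose_def by blast
  thus ?thesis unfolding cform_def
   using zlim_transfer[OF that(1,2) B that(3,4)[unfolded avoids_def] that(5,6)] that(6) by (simp add: distrib_right)
 qed
 show ?thesis by (rule that[of "B1 * B2 + 1"]) (use good_nonneg[OF B(1)] good_nonneg[OF B(2)] * in \<open>auto intro!: add_nonneg_pos\<close>)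
qed

lemma inU_open:
 assumes "tgerm nu" "inU th nu"
 obtains d k where "d > 0" "k > 0" "avoids nu th k" "!!nu'. tgerm nu' ==> close d (zdat nu) (zdat nu') ==> inU th nu' & avoids nu' th k"
proof -
 obtain k where k: "k > 0" "avoids nu th k" and c: "cform th nu ~= 0" using assms(2) unfolding inU_def by blast
 have k2: "k / 2 > 0" "k / 2 <= k" using k(1) by auto
 obtain d where d: "d > 0" "!!nu nu'. tgerm nu ==> tgerm nu' ==> close d (zdat nu) (zdat nu') ==> avoids nu th k ==> avoids nu' th (k / 2)"
  using avoids_open[OF k(1), of th] by blast
 obtain B where B: "B > 0" "!!nu nu' \<sigma> e e'. tgerm nu ==> tgerm nu' ==> avoids nu th (k/2) ==> avoids nu' th (k/2) ==>
   sclose \<sigma> e (zdat nu) (zdat nu') ==> e < e' ==> cmod (cform th nu - \<sigma> * cform th nu') <= B * e'"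
  using cform_transfer[OF k2(1), of th] by blast
 define d' where "d' = min d (cmod (cform th nu) / (4 * B))"
 have d': "d' > 0" using d(1) B(1) c by (simp add: d'_def)
 have "inU th nu' & avoids nu' th (k / 2)" if t: "tgerm nu'" and cl: "close d' (zdat nu) (zdat nu')" for nu'
 proof -
  have a: "avoids nu' th (k / 2)" using d(2)[OF assms(1) t close_mono[OF cl] k(2)] by (simp add: d'_def)
  obtain \<sigma> where \<sigma>: "sclose \<sigma> d' (zdat nu) (zdat nu')" using cl by (auto simp: close_iff)
  have "cmod (cform th nu - \<sigma> * cform th nu') <= B * (2 * d')"
   using B(2)[OF assms(1) t avoids_mono[OF k(2) k2(2)] a \<sigma>, of "2 * d'"] d' by simp
  also have "... <= B * (2 * (cmod (cform th nu) / (4 * B)))" using B(1) by (intro mult_left_mono) (auto simp: d'_def)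
  also have "... = cmod (cform th nu) / 2" using B(1) by simp
  also have "... < cmod (cform th nu)" using c by simp
  finally have "cform th nu' ~= 0" by auto
  thus ?thesis using a k2 unfolding inU_def by blast
 qed
 thus ?thesis using that[OF d' k2(1) avoids_mono[OF k(2) k2(2)]] by blast
qed

lemma cform_real: assumes "tgerm nu" "k > 0" "avoids nu th k" shows "Im (cform th nu) = 0"
proof -
 obtain B1 B2 where B: "good (away th k) B1 (cx (ct th))" "good (away th k) B2 (%x. cx (ct th) x ^ 2)" using good_ct[OF assms(2)] by blast
 have eq: "(%x. cx (ct th) x ^ 2) = cx (%x. ct th x ^ 2)" by (auto simp: cx_def)
 from tendsto_Im[OF tendsto_zlim[OF assms(1) B assms(3)[unfolded avoids_def]]]
 have "((%t::real. 0::real) ~~> Im (cform th nu))" unfolding cform_def eq zform_def nform_cx by (simp flip: of_real_divide)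
 thus ?thesis using tendsto_unique[OF _ tendsto_const] by (metis trivial_limit_at_right_real)
qed

definition U :: "real => alg set" where "U th = {F \<in> CDbar 2. inU th (germ_of F)}"

lemma openin_U: "openin (CD_top 2) (U th)"
 unfolding openin_CD_top
proof (intro conjI ballI)
 fix F assume F: "F \<in> U th"
 hence F': "F \<in> CDbar 2" "inU th (germ_of F)" by (auto simp: U_def)
 obtain d k where d: "d > 0" "!!nu'. tgerm nu' ==> close d (zdat (germ_of F)) (zdat nu') ==> inU th nu' & avoids nu' th k"
  by (rule inU_open[OF tgerm_germ_of[OF F'(1)] F'(2)]) blast
 have "G \<in> U th" if "G \<in> CDbar 2" "close d (zd F) (zd G)" for G
  using that d(2)[OF tgerm_germ_of[OF that(1)]] by (simp add: U_def zd_def)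
 thus "\<exists>e>0. \<forall>G\<in>CDbar 2. close e (zd F) (zd G) --> G \<in> U th" using d(1) by blast
qed (auto simp: U_def)

lemma inU_close0: "tgerm nu ==> inU th nu ==> tgerm nu' ==> close 0 (zdat nu) (zdat nu') ==> inU th nu'"
 using inU_open close_mono by (metis less_imp_le)

lemma cis_ne_infinite:
 assumes "finite S" obtains th where "cis th \<notin> S"
proof -
 have "inj_on cis {0<..<1}"
 proof (rule inj_onI)
  fix x y :: real assume xy: "x \<in> {0<..<1}" "y \<in> {0<..<1}" "cis x = cis y"
  then obtain m :: int where m: "x - y = 2 * pi * m" using cis_eq_iff by blast
  have "\<bar>x - y\<bar> < 2 * pi * 1" using xy pi_gt3 by auto
  hence "\<bar>m\<bar> < 1" unfolding m abs_mult by (simp add: abs_mult flip: of_int_abs)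
  thus "x = y" using m by simp
 qed
 hence "infinite (cis ` {0<..<1::real})"
  using infinite_Ioo[of 0 "1::real"] finite_image_iff[of cis "{0<..<1::real}"] by auto
 hence "\<not> cis ` {0<..<1::real} \<subseteq> S" using assms finite_subset by blast
 thus ?thesis using that by blast
qed

text \<open>With denominators cleared, the value becomes, up to a power of \<open>cis th\<close>, a
  quadratic polynomial in \<open>cis th\<close> with coefficients built from the two normalizing
  values. In this shape the limit along a germ can be taken although points collide.\<close>

lemma nform_ct:
 assumes "!!i. i < 4 ==> cis (xs i) ~= cis th"
 shows "nform xs (cx (ct th)) (%x. cx (ct th) x ^ 2) *
   ((cis th - cis (xs 0)) * (cis th - cis (xs 1)) * (cis th - cis (xs 2)) * (cis th - cis (xs 3))) ^ 2
  = 8 * \<i> * cis th ^ 3 * (nform xs (E 1) (E 2) * (cis th ^ 2 - chord_prod (xs 0) (xs 1)) +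
   (nform xs (E 1) (E 3) - (chord_sum (xs 0) (xs 1) + chord_sum (xs 2) (xs 3)) * nform xs (E 1) (E 2)) * (2 * cis th - chord_sum (xs 0) (xs 1)))"
proof -
 define p a b c d where "p = cis th" "a = cis (xs 0)" "b = cis (xs 1)" "c = cis (xs 2)" "d = cis (xs 3)"
 define u where "u z = 1 / (p - z)" for z
 have nz: "p - a ~= 0" "p - b ~= 0" "p - c ~= 0" "p - d ~= 0" using assms[of 0] assms[of 1] assms[of 2] assms[of 3] by (auto simp: p_a_b_c_d_def)
 have ctu: "cx (ct th) x = \<i> - 2 * \<i> * p * u (cis x)" if "cis x ~= cis th" for x
 proof -
  have "p - cis x ~= 0" "- p + cis x ~= 0" using that by (auto simp: p_a_b_c_d_def)
  thus ?thesis unfolding ct_eq[OF that] u_def p_a_b_c_d_def(1)[symmetric] by (simp add: field_simps)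
 qed
 have ct4: "cx (ct th) (xs 0) = \<i> - 2 * \<i> * p * u a" "cx (ct th) (xs 1) = \<i> - 2 * \<i> * p * u b"
  "cx (ct th) (xs 2) = \<i> - 2 * \<i> * p * u c" "cx (ct th) (xs 3) = \<i> - 2 * \<i> * p * u d"
  using ctu[OF assms[of 0]] ctu[OF assms[of 1]] ctu[OF assms[of 2]] ctu[OF assms[of 3]] by (simp_all add: p_a_b_c_d_def)
 have i3: "\<i> ^ 3 = - \<i>" by (simp add: power3_eq_cube)
 have N: "nform xs (cx (ct th)) (%x. cx (ct th) x ^ 2) = 8 * \<i> * p ^ 3 * ((u a - u b) * (u c - u d) * (u c + u d - u a - u b))"
  unfolding nform_def ct4 by (simp add: algebra_simps power2_eq_square power3_eq_cube)
 have inv: "(1 / x - 1 / y) * (x * y) = y - x" if "x ~= 0" "y ~= 0" for x y :: complex using that by (simp add: field_simps)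
 have inv4: "(1 / z + 1 / w - 1 / x - 1 / y) * (x * y * (z * w)) = (z + w) * (x * y) - (x + y) * (z * w)"
  if "x ~= 0" "y ~= 0" "z ~= 0" "w ~= 0" for x y z w :: complex using that by (simp add: field_simps)
 have du: "(u a - u b) * ((p - a) * (p - b)) = a - b" "(u c - u d) * ((p - c) * (p - d)) = c - d"
  unfolding u_def using inv[OF nz(1,2)] inv[OF nz(3,4)] by simp_all
 have su: "(u c + u d - u a - u b) * ((p - a) * (p - b) * ((p - c) * (p - d))) =
  (2 * p - (c + d)) * ((p - a) * (p - b)) - (2 * p - (a + b)) * ((p - c) * (p - d))"
  unfolding u_def using inv4[OF nz] by (simp add: algebra_simps)
 have "nform xs (cx (ct th)) (%x. cx (ct th) x ^ 2) * ((p - a) * (p - b) * (p - c) * (p - d)) ^ 2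
  = 8 * \<i> * p ^ 3 * (((u a - u b) * ((p - a) * (p - b))) * ((u c - u d) * ((p - c) * (p - d))) *
    ((u c + u d - u a - u b) * ((p - a) * (p - b) * ((p - c) * (p - d)))))"
  unfolding N by (simp add: power2_eq_square mult_ac)
 also have "... = 8 * \<i> * p ^ 3 * ((a - b) * (c - d) * ((2 * p - (c + d)) * ((p - a) * (p - b)) - (2 * p - (a + b)) * ((p - c) * (p - d))))"
  unfolding du su by (simp add: mult_ac)
 also have "(2 * p - (c + d)) * ((p - a) * (p - b)) - (2 * p - (a + b)) * ((p - c) * (p - d)) =
  (c + d - (a + b)) * (p ^ 2 - a * b) + (a * b - c * d) * (2 * p - (a + b))" by (simp add: algebra_simps power2_eq_square)
 also have "(a - b) * (c - d) * ((c + d - (a + b)) * (p ^ 2 - a * b) + (a * b - c * d) * (2 * p - (a + b))) =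
  nform xs (E 1) (E 2) * (p ^ 2 - a * b) + (nform xs (E 1) (E 3) - (a + b + (c + d)) * nform xs (E 1) (E 2)) * (2 * p - (a + b))"
  unfolding nform_E12 nform_E13 chord_sum_def chord_prod_def p_a_b_c_d_def(2-5)[symmetric]
  by (simp add: algebra_simps power2_eq_square)
 finally show ?thesis unfolding chord_sum_def chord_prod_def p_a_b_c_d_def .
qed

text \<open>The limit polynomial \<open>Q\<close> is nonzero, since the two normalizing values do
  not both vanish. Any point of the circle off its roots and off the limits of the four points will
  do.\<close>

lemma U_cover:
 assumes t: "tgerm nu" obtains th where "inU th nu"
proof -
 have "\<exists>L. ((%t. cis (nu t i)) ~~> L)" if "i < 4" for i
  by (rule ctame_tendsto[of _ 1]) (use t that in \<open>auto simp: tgerm_def\<close>)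
 then obtain L where L: "!!i. i < 4 ==> ((%t. cis (nu t i)) ~~> L i)" by metis
 have L4: "((%t. cis (nu t 0)) ~~> L 0)" "((%t. cis (nu t 1)) ~~> L 1)"
  "((%t. cis (nu t 2)) ~~> L 2)" "((%t. cis (nu t 3)) ~~> L 3)" using L by simp_all
 define z2 z3 where "z2 = zlim nu (E 1) (E 2)" "z3 = zlim nu (E 1) (E 3)"
 define S S' P where "S = L 0 + L 1" "S' = L 2 + L 3" "P = L 0 * L 1"
 define \<beta> where "\<beta> = z3 - (S + S') * z2"
 define Q where "Q = [: - (z2 * P + \<beta> * S), 2 * \<beta>, z2 :]"
 have "(cmod z2)\<^sup>2 + (cmod z3)\<^sup>2 = 1" using zlim_normalized[OF t] by (simp add: z2_z3_def)
 hence "Q ~= 0" by (auto simp: Q_def \<beta>_def)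
 hence "finite ({p. poly Q p = 0} \<union> L ` {..<4})" by (simp add: poly_roots_finite)
 from cis_ne_infinite[OF this] obtain th where th: "cis th \<notin> {p. poly Q p = 0} \<union> L ` {..<4}" .
 define p where "p = cis th"
 have pQ: "poly Q p ~= 0" "!!i. i < 4 ==> p ~= L i" using th by (auto simp: p_def)
 define k where "k = Min ((%i. cmod (L i - p)) ` {..<4}) / 2"
 have kk: "Min ((%i. cmod (L i - p)) ` {..<4::nat}) > 0"
  using pQ(2) by (subst Min_gr_iff) (auto simp: lessThan_empty_iff)
 have k: "k > 0" "k < cmod (L i - p)" if "i < 4" for i
 proof -
  have "Min ((%i. cmod (L i - p)) ` {..<4}) <= cmod (L i - p)" using that by (intro Min_le) auto
  thus "k > 0" "k < cmod (L i - p)" using kk by (auto simp: k_def)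
 qed
 have "EV t. \<forall>i\<in>{..<4}. cmod (cis (nu t i) - p) > k"
 proof (intro eventually_ball_finite ballI)
  fix i :: nat assume "i \<in> {..<4}"
  hence i: "i < 4" by simp
  have "((%t. cmod (cis (nu t i) - p)) ~~> cmod (L i - p))" by (intro tendsto_intros L i)
  from order_tendstoD(1)[OF this k(2)[OF i]] show "EV t. cmod (cis (nu t i) - p) > k" .
 qed auto
 hence ev: "EV t. nodes (nu t) \<subseteq> away th k" by eventually_elim (auto simp: nodes_def away_def p_def intro: less_imp_le)
 have k0: "k > 0" using k(1)[of 0] by simp
 obtain B1 B2 where B: "good (away th k) B1 (cx (ct th))" "good (away th k) B2 (%x. cx (ct th) x ^ 2)" using good_ct[OF k0] by blast
 have lc: "((%t. zform (nu t) (cx (ct th)) (%x. cx (ct th) x ^ 2)) ~~> cform th nu)"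
  unfolding cform_def by (rule tendsto_zlim[OF t B ev])
 obtain D1 D2 D3 where D: "good UNIV D1 (E 1)" "good UNIV D2 (E 2)" "good UNIV D3 (E 3)" using good_E by metis
 have z: "((%t. zform (nu t) (E 1) (E 2)) ~~> z2)" "((%t. zform (nu t) (E 1) (E 3)) ~~> z3)"
  unfolding z2_z3_def by (rule tendsto_zlim_UNIV[OF t D(1,2)], rule tendsto_zlim_UNIV[OF t D(1,3)])
 define W where "W t = 8 * \<i> * p ^ 3 * (zform (nu t) (E 1) (E 2) * (p ^ 2 - chord_prod (nu t 0) (nu t 1)) +
   (zform (nu t) (E 1) (E 3) - (chord_sum (nu t 0) (nu t 1) + chord_sum (nu t 2) (nu t 3)) * zform (nu t) (E 1) (E 2)) * (2 * p - chord_sum (nu t 0) (nu t 1)))" for t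
 have W: "(W ~~> 8 * \<i> * p ^ 3 * (z2 * (p ^ 2 - P) + (z3 - (S + S') * z2) * (2 * p - S)))"
  unfolding W_def[abs_def] chord_sum_def chord_prod_def S_S'_P_def by (intro tendsto_intros z L4)
 have "EV t. zform (nu t) (cx (ct th)) (%x. cx (ct th) x ^ 2) *
  ((p - cis (nu t 0)) * (p - cis (nu t 1)) * (p - cis (nu t 2)) * (p - cis (nu t 3))) ^ 2 = W t"
  using ev
 proof eventually_elim
  fix t assume "nodes (nu t) \<subseteq> away th k"
  hence "cis (nu t i) ~= cis th" if "i < 4" for i using that k0 by (auto simp: nodes_def away_def)
  note eq = nform_ct[of "nu t" th, OF this]
  have gen: "a / n * D = k * (b / n * u + (c / n - s * (b / n)) * v)" if "a * D = k * (b * u + (c - s * b) * v)" for a D k b u c s v n :: complex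
  proof -
   have "a / n * D = (a * D) / n" by simp
   also have "... = k * (b / n * u + (c / n - s * (b / n)) * v)" unfolding that by (simp add: divide_inverse algebra_simps)
   finally show ?thesis .
  qed
  show "zform (nu t) (cx (ct th)) (%x. cx (ct th) x ^ 2) *
  ((p - cis (nu t 0)) * (p - cis (nu t 1)) * (p - cis (nu t 2)) * (p - cis (nu t 3))) ^ 2 = W t"
   unfolding zform_def W_def p_def by (rule gen[OF eq])
 qed
 from tendsto_cong[OF this] W
 have l1: "((%t. zform (nu t) (cx (ct th)) (%x. cx (ct th) x ^ 2) *
  ((p - cis (nu t 0)) * (p - cis (nu t 1)) * (p - cis (nu t 2)) * (p - cis (nu t 3))) ^ 2) ~~>
    8 * \<i> * p ^ 3 * (z2 * (p ^ 2 - P) + (z3 - (S + S') * z2) * (2 * p - S)))" by (simp only:)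
 have l2: "((%t. zform (nu t) (cx (ct th)) (%x. cx (ct th) x ^ 2) *
  ((p - cis (nu t 0)) * (p - cis (nu t 1)) * (p - cis (nu t 2)) * (p - cis (nu t 3))) ^ 2) ~~>
   cform th nu * ((p - L 0) * (p - L 1) * (p - L 2) * (p - L 3)) ^ 2)" by (intro tendsto_intros lc L4)
 have "cform th nu * ((p - L 0) * (p - L 1) * (p - L 2) * (p - L 3)) ^ 2 =
   8 * \<i> * p ^ 3 * (z2 * (p ^ 2 - P) + (z3 - (S + S') * z2) * (2 * p - S))"
  by (rule tendsto_unique[OF _ l2 l1]) (simp add: trivial_limit_at_right_real)
 also have "z2 * (p ^ 2 - P) + (z3 - (S + S') * z2) * (2 * p - S) = poly Q p"
  by (simp add: Q_def \<beta>_def algebra_simps power2_eq_square)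
 finally have "cform th nu ~= 0" using pQ(1) by (auto simp: p_def)
 thus ?thesis using that k0 ev unfolding inU_def avoids_def by blast
qed

subsection \<open>Contraction by hyperbolic dilations\<close>

text \<open>Uniformly good and Lipschitz in the dilation factor, which gives joint continuity of the
  limit form in the algebra and the factor.\<close>

definition Lgood :: "real set => (real => real => complex) => bool" where
 "Lgood K \<phi> \<longleftrightarrow> (\<exists>B\<ge>0. (\<forall>l\<in>{0..1}. good K B (\<phi> l)) \<and>
  (\<forall>l\<in>{0..1}. \<forall>m\<in>{0..1}. good K (B * \<bar>l - m\<bar>) (%x. \<phi> l x - \<phi> m x)))"

lemma LgoodI:
 assumes "!!l. l \<in> {0..1} ==> good K B (\<phi> l)"
  "!!l m. l \<in> {0..1} ==> m \<in> {0..1} ==> good K (C * \<bar>l - m\<bar>) (%x. \<phi> l x - \<phi> m x)"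
 shows "Lgood K \<phi>"
 unfolding Lgood_def
proof (intro exI[of _ "max 0 (max B C)"] conjI ballI)
 show "good K (max 0 (max B C)) (\<phi> l)" if "l \<in> {0..1}" for l by (rule good_mono[OF assms(1)[OF that]]) auto
 show "good K (max 0 (max B C) * \<bar>l - m\<bar>) (%x. \<phi> l x - \<phi> m x)" if "l \<in> {0..1}" "m \<in> {0..1}" for l m
  by (rule good_mono[OF assms(2)[OF that]]) (auto intro!: mult_right_mono)
qed simp

lemma LgoodE:
 assumes "Lgood K \<phi>"
 obtains B where "B \<ge> 0" "!!l. l \<in> {0..1} ==> good K B (\<phi> l)"
  "!!l m. l \<in> {0..1} ==> m \<in> {0..1} ==> good K (B * \<bar>l - m\<bar>) (%x. \<phi> l x - \<phi> m x)"
 using assms unfolding Lgood_def by blast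

lemma Lgood_good: "good K B \<phi> ==> Lgood K (%l. \<phi>)"
 using good_const[of K 0] by (intro LgoodI[of K B _ 0]) simp_all

lemma Lgood_const: "Lgood K (%l x. c)" by (rule Lgood_good[OF good_const])

lemma Lgood_cis: "Lgood K (%l. cis)" by (rule Lgood_good[OF good_cis])

lemma Lgood_param: "Lgood K (%l x. of_real l)"
proof (rule LgoodI[of K 1 _ 1])
 show "good K 1 (%x. of_real l)" if "l \<in> {0..1}" for l by (rule good_mono[OF good_const]) (use that in auto)
 show "good K (1 * \<bar>l - m\<bar>) (%x. of_real l - of_real m)" for l m
  by (rule good_mono[OF good_const]) (auto simp flip: of_real_diff)
qed

lemma Lgood_add: assumes "Lgood K \<phi>" "Lgood K \<psi>" shows "Lgood K (%l x. \<phi> l x + \<psi> l x)"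
proof -
 obtain B where "B \<ge> 0" and B: "!!l. l \<in> {0..1} ==> good K B (\<phi> l)" "!!l m. l \<in> {0..1} ==> m \<in> {0..1} ==> good K (B * \<bar>l - m\<bar>) (%x. \<phi> l x - \<phi> m x)"
  by (rule LgoodE[OF assms(1)]) (rule that)
 obtain C where "C \<ge> 0" and C: "!!l. l \<in> {0..1} ==> good K C (\<psi> l)" "!!l m. l \<in> {0..1} ==> m \<in> {0..1} ==> good K (C * \<bar>l - m\<bar>) (%x. \<psi> l x - \<psi> m x)"
  by (rule LgoodE[OF assms(2)]) (rule that)
 show ?thesis
 proof (rule LgoodI[of K "B + C" _ "B + C"])
  show "good K (B + C) (%x. \<phi> l x + \<psi> l x)" if "l \<in> {0..1}" for l by (intro good_add B C that)
  show "good K ((B + C) * \<bar>l - m\<bar>) (%x. \<phi> l x + \<psi> l x - (\<phi> m x + \<psi> m x))" if "l \<in> {0..1}" "m \<in> {0..1}" for l m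
   using good_add[OF B(2)[OF that] C(2)[OF that]] by (simp add: algebra_simps)
 qed
qed

lemma Lgood_mult: assumes "Lgood K \<phi>" "Lgood K \<psi>" shows "Lgood K (%l x. \<phi> l x * \<psi> l x)"
proof -
 obtain B where "B \<ge> 0" and B: "!!l. l \<in> {0..1} ==> good K B (\<phi> l)" "!!l m. l \<in> {0..1} ==> m \<in> {0..1} ==> good K (B * \<bar>l - m\<bar>) (%x. \<phi> l x - \<phi> m x)"
  by (rule LgoodE[OF assms(1)]) (rule that)
 obtain C where "C \<ge> 0" and C: "!!l. l \<in> {0..1} ==> good K C (\<psi> l)" "!!l m. l \<in> {0..1} ==> m \<in> {0..1} ==> good K (C * \<bar>l - m\<bar>) (%x. \<psi> l x - \<psi> m x)"
  by (rule LgoodE[OF assms(2)]) (rule that)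
 let ?k = "257 ^ 7 * (B * C)"
 show ?thesis
 proof (rule LgoodI[of K ?k _ "2 * ?k"])
  show "good K ?k (%x. \<phi> l x * \<psi> l x)" if "l \<in> {0..1}" for l by (intro good_mult B C that)
  show "good K (2 * ?k * \<bar>l - m\<bar>) (%x. \<phi> l x * \<psi> l x - \<phi> m x * \<psi> m x)" if "l \<in> {0..1}" "m \<in> {0..1}" for l m
   using good_add[OF good_mult[OF B(2)[OF that] C(1)[OF that(1)]] good_mult[OF B(1)[OF that(2)] C(2)[OF that]]]
   by (simp add: algebra_simps)
 qed
qed

definition dl :: "real => real => real => complex" where
 "dl th l x = (cis th - cis x) + of_real l * (cis th + cis x)"

definition gl :: "real => real => real => complex" where
 "gl th l x = 2 * cis th * (cis x + cis th) * inverse (dl th l x)"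

text \<open>The Moebius map of the circle that multiplies \<open>ct th\<close> by \<open>l\<close>;
  at \<open>l = 0\<close> every point other than \<open>cis th\<close> goes to the antipode
  \<open>- cis th\<close>. The part \<open>gl\<close>, the displacement from the antipode divided by
  \<open>l\<close>, still makes sense at \<open>l = 0\<close>.\<close>

definition fl :: "real => real => real => complex" where
 "fl th l x = - cis th + of_real l * gl th l x"

text \<open>Sum and difference of two unit vectors are orthogonal.\<close>

lemma dl_norm: "(cmod (dl th l x))\<^sup>2 = (cmod (cis th - cis x))\<^sup>2 + l\<^sup>2 * (cmod (cis th + cis x))\<^sup>2"
proof -
 have "sin th * sin th + cos th * cos th = 1" "sin x * sin x + cos x * cos x = 1"
  using sin_cos_squared_add[of th] sin_cos_squared_add[of x] by (simp_all add: power2_eq_square)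
 hence "(cos th - cos x) * (cos th + cos x) + (sin th - sin x) * (sin th + sin x) = 0" by (simp add: algebra_simps)
 moreover have "((a - c) + l * (a + c))\<^sup>2 + ((b - d) + l * (b + d))\<^sup>2 = ((a - c)\<^sup>2 + (b - d)\<^sup>2) + l\<^sup>2 * ((a + c)\<^sup>2 + (b + d)\<^sup>2)
  + 2 * l * ((a - c) * (a + c) + (b - d) * (b + d))" for a b c d :: real by (simp add: power2_eq_square algebra_simps)
 ultimately show ?thesis unfolding dl_def cmod_power2 by simp
qed

lemma dl_away: "x \<in> away th k ==> k \<ge> 0 ==> cmod (dl th l x) \<ge> k"
proof -
 assume x: "x \<in> away th k" "k \<ge> 0"
 have "k\<^sup>2 <= (cmod (cis th - cis x))\<^sup>2" using x by (intro power_mono) (auto simp: away_def norm_minus_commute)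
 also have "... <= (cmod (dl th l x))\<^sup>2" unfolding dl_norm by simp
 finally show ?thesis by (rule power2_le_imp_le) simp
qed

lemma dl_nonzero: assumes "l ~= 0 \<or> cis x ~= cis th" shows "dl th l x ~= 0"
proof
 assume "dl th l x = 0"
 hence "(cmod (cis th - cis x))\<^sup>2 + l\<^sup>2 * (cmod (cis th + cis x))\<^sup>2 = 0" using dl_norm[of th l x] by simp
 hence "cis th = cis x" "l * cmod (cis th + cis x) = 0" by (auto simp: add_nonneg_eq_0_iff)
 thus False using assms by (auto simp flip: mult_2)
qed

lemma fl_eq:
 assumes "dl th l x ~= 0" shows "fl th l x = cis th * ((cis x - cis th) + of_real l * (cis th + cis x)) / dl th l x"
 using assms unfolding fl_def gl_def by (simp add: field_simps) (simp add: dl_def algebra_simps)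

lemma fl_unit: assumes "dl th l x ~= 0" shows "cmod (fl th l x) = 1"
proof -
 have "(cmod ((cis x - cis th) + of_real l * (cis th + cis x)))\<^sup>2 = (cmod (dl x l th))\<^sup>2" by (simp add: dl_def add.commute)
 also have "... = (cmod (dl th l x))\<^sup>2" unfolding dl_norm by (simp add: norm_minus_commute add.commute)
 finally have "cmod ((cis x - cis th) + of_real l * (cis th + cis x)) = cmod (dl th l x)" by (simp add: power2_eq_iff_nonneg)
 thus ?thesis using assms by (simp add: fl_eq[OF assms] norm_mult norm_divide)
qed

lemma fl_inverse:
 assumes l: "l > 0"
 shows "cis x * (cis th * (1 + of_real l) + of_real (1 - l) * fl th l x) = cis th * (of_real (1 - l) * cis th + (1 + of_real l) * fl th l x)"
proof -
 have nz: "dl th l x ~= 0" using l dl_nonzero by simp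
 define a where "a = (cis x - cis th) + of_real l * (cis th + cis x)"
 have f: "fl th l x * dl th l x = cis th * a" using nz unfolding fl_eq[OF nz] a_def by simp
 have "cis x * (cis th * (1 + of_real l) * dl th l x + of_real (1 - l) * (fl th l x * dl th l x)) =
  cis th * (of_real (1 - l) * cis th * dl th l x + (1 + of_real l) * (fl th l x * dl th l x))"
  unfolding f unfolding a_def dl_def by (simp add: algebra_simps)
 hence "(cis x * (cis th * (1 + of_real l) + of_real (1 - l) * fl th l x)) * dl th l x =
  (cis th * (of_real (1 - l) * cis th + (1 + of_real l) * fl th l x)) * dl th l x" by (simp add: algebra_simps)
 thus ?thesis using nz by simp
qed

lemma fl_inj: assumes "l > 0" "l <= 1" "fl th l x = fl th l y" shows "cis x = cis y"
proof -
 let ?w = "cis th * (1 + of_real l) + of_real (1 - l) * fl th l x"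
 have "cmod (cis th * (1 + of_real l)) = 1 + l" using assms by (simp add: norm_mult) (metis abs_of_pos norm_of_real of_real_1 of_real_add add_pos_pos zero_less_one)
 moreover have "cmod (of_real (1 - l) * fl th l x) = 1 - l"
  using assms fl_unit[of th l x] dl_nonzero[of l x th] by (simp add: norm_mult del: of_real_diff)
 ultimately have "?w ~= 0" using assms norm_triangle_ineq4[of ?w "of_real (1 - l) * fl th l x"] by auto
 moreover have "cis x * ?w = cis y * ?w" using fl_inverse[OF assms(1), of x th] fl_inverse[OF assms(1), of y th] assms(3) by simp
 ultimately show ?thesis by simp
qed

lemma Lgood_gl: assumes "k > 0" shows "Lgood (away th k) (gl th)"
proof -
 let ?K = "away th k"
 have i: "good ?K (inv_bound 2 k 8) (%x. inverse (dl th l x))" if l: "l \<in> {0..1}" for l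
 proof -
  have eq: "dl th l x = (cis th * of_real (1 + l)) + of_real (l - 1) * cis x" for x by (simp add: dl_def algebra_simps)
  have "cmod (cis th * of_real (1 + l)) <= 2" "cmod (of_real (l - 1)) <= 2"
   using l by (auto simp: norm_mult simp del: of_real_add of_real_diff)
  thus ?thesis unfolding eq using assms dl_away[of _ th k l, unfolded eq] by (intro good_inverse) auto
 qed
 have s: "good ?K 2 (%x. cis th + cis x)" using good_add[OF good_const[of ?K "cis th"] good_cis] by simp
 have "Lgood ?K (%l x. inverse (dl th l x))"
 proof (rule LgoodI[OF i])
  fix l m :: real assume lm: "l \<in> {0..1}" "m \<in> {0..1}"
  have eq: "inverse (dl th l x) - inverse (dl th m x) = of_real (m - l) * (cis th + cis x) * inverse (dl th l x) * inverse (dl th m x)"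
   if "x \<in> ?K" for x
  proof -
   have nz: "dl th l x ~= 0" "dl th m x ~= 0" using dl_away[OF that, of l] dl_away[OF that, of m] assms by auto
   have "dl th m x - dl th l x = of_real (m - l) * (cis th + cis x)" by (simp add: dl_def algebra_simps)
   thus ?thesis using nz by (simp add: inverse_eq_divide diff_frac_eq)
  qed
  let ?C = "257 ^ 7 * (257 ^ 7 * (257 ^ 7 * 2 * inv_bound 2 k 8) * inv_bound 2 k 8)"
  have "good ?K (257 ^ 7 * (257 ^ 7 * (257 ^ 7 * (cmod (of_real (m - l)) * 2) * inv_bound 2 k 8) * inv_bound 2 k 8))
   (%x. of_real (m - l) * (cis th + cis x) * inverse (dl th l x) * inverse (dl th m x))" by (intro good_mult good_const s i lm)
  hence "good ?K (?C * \<bar>l - m\<bar>) (%x. of_real (m - l) * (cis th + cis x) * inverse (dl th l x) * inverse (dl th m x))"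
   by (rule good_mono) (simp_all add: mult_ac abs_minus_commute del: of_real_diff)
  thus "good ?K (?C * \<bar>l - m\<bar>) (%x. inverse (dl th l x) - inverse (dl th m x))" by (rule good_cong) (use eq in simp)
 qed
 thus ?thesis unfolding gl_def[abs_def] by (intro Lgood_mult Lgood_add Lgood_const Lgood_cis)
qed

text \<open>The linear coefficient, and in \<open>qq\<close> the part of second and higher order
  divided by the square, of the expansion of the i-th power at \<open>- p\<close>.\<close>

fun bq :: "complex => nat => complex" where "bq p 0 = 0" | "bq p (Suc i) = - p * bq p i + (- p) ^ i"
fun qq :: "complex => nat => complex => complex" where "qq p 0 w = 0" | "qq p (Suc i) w = bq p i + (w - p) * qq p i w"

lemma shifted_power: "(- p + w) ^ i = (- p) ^ i + bq p i * w + w\<^sup>2 * qq p i w"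
proof (induction i)
 case (Suc i)
 have "(- p + w) ^ Suc i = (- p + w) * ((- p) ^ i + bq p i * w + w\<^sup>2 * qq p i w)" by (simp only: power_Suc Suc)
 also have "... = (- p) ^ Suc i + bq p (Suc i) * w + w\<^sup>2 * qq p (Suc i) w" by (simp add: algebra_simps power2_eq_square)
 finally show ?case .
qed simp

definition Gl :: "real => nat => real => real => complex" where
 "Gl th i l x = gl th l x * gl th l x * qq (cis th) i (of_real l * gl th l x)"

lemma Lgood_Gl: assumes "k > 0" shows "Lgood (away th k) (Gl th i)"
proof -
 note g = Lgood_gl[OF assms, of th]
 have "Lgood (away th k) (%l x. qq (cis th) i (of_real l * gl th l x))"
 proof (induction i)
  case (Suc i)
  have "Lgood (away th k) (%l x. bq (cis th) i + (of_real l * gl th l x + (- cis th)) * qq (cis th) i (of_real l * gl th l x))"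
   by (intro Lgood_add Lgood_mult Lgood_const Lgood_param g Suc)
  thus ?case by simp
 qed (simp add: Lgood_const)
 thus ?thesis unfolding Gl_def[abs_def] by (intro Lgood_mult g)
qed

text \<open>The form of the dilated quadruple divided by \<open>l ^ 3\<close>. Constants drop out of
  the form and the product of the two linear terms cancels by antisymmetry, so the third order is
  the leading one and the quotient extends to \<open>l = 0\<close>.\<close>

definition Yt :: "real => conf => real => nat => nat => complex" where
 "Yt th \<tau> l i j = bq (cis th) i * zform \<tau> (gl th l) (Gl th j l) + bq (cis th) j * zform \<tau> (Gl th i l) (gl th l) + of_real l * zform \<tau> (Gl th i l) (Gl th j l)"

definition Y :: "real => germ => real => nat => nat => complex" where
 "Y th nu l i j = bq (cis th) i * zlim nu (gl th l) (Gl th j l) + bq (cis th) j * zlim nu (Gl th i l) (gl th l) + of_real l * zlim nu (Gl th i l) (Gl th j l)"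

lemma zform_fl: "zform \<tau> (%x. fl th l x ^ i) (%x. fl th l x ^ j) = of_real (l ^ 3) * Yt th \<tau> l i j"
proof -
 define u where "u = complex_of_real l"
 have f: "fl th l x ^ i = (- cis th) ^ i + (bq (cis th) i * u * gl th l x + u\<^sup>2 * Gl th i l x)" for i x
  unfolding fl_def shifted_power Gl_def u_def by (simp add: power2_eq_square)
 have "nform \<tau> (%x. fl th l x ^ i) (%x. fl th l x ^ j) =
  nform \<tau> (%x. bq (cis th) i * u * gl th l x + u\<^sup>2 * Gl th i l x) (%x. bq (cis th) j * u * gl th l x + u\<^sup>2 * Gl th j l x)"
  unfolding f nform_def by simp
 also have "... = u ^ 3 * (bq (cis th) i * nform \<tau> (gl th l) (Gl th j l) + bq (cis th) j * nform \<tau> (Gl th i l) (gl th l) + u * nform \<tau> (Gl th i l) (Gl th j l))"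
  unfolding nform_def by (simp add: algebra_simps power2_eq_square power3_eq_cube)
 finally show ?thesis unfolding zform_def Yt_def u_def by (simp add: divide_inverse algebra_simps)
qed

lemma tendsto_Yt:
 assumes "tgerm nu" "k > 0" "avoids nu th k" "l \<in> {0..1}"
 shows "((%t. Yt th (nu t) l i j) ~~> Y th nu l i j)"
proof -
 obtain B where B: "good (away th k) B (gl th l)" using Lgood_gl[OF assms(2), of th] assms(4) unfolding Lgood_def by blast
 have "\<exists>C. good (away th k) C (Gl th i l)" for i using Lgood_Gl[OF assms(2), of th i] assms(4) unfolding Lgood_def by blast
 then obtain C where C: "!!i. good (away th k) (C i) (Gl th i l)" by metis
 note a = assms(3)[unfolded avoids_def]
 show ?thesis unfolding Yt_def Y_def
  by (intro tendsto_add tendsto_mult tendsto_const tendsto_zlim[OF assms(1) B C a] tendsto_zlim[OF assms(1) C B a] tendsto_zlim[OF assms(1) C C a])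
qed

section \<open>Normalized tables of dilated algebras and their realization\<close>

definition nsq :: "(nat => nat => complex) => real" where "nsq Z = (cmod (Z 1 2))\<^sup>2 + (cmod (Z 1 3))\<^sup>2"
text \<open>Restores the normalization of a table, which a dilation does not preserve.\<close>

definition nz :: "(nat => nat => complex) => nat => nat => complex" where "nz Z i j = Z i j / of_real (sqrt (nsq Z))"

lemma nsq_nonneg: "nsq Z \<ge> 0" by (simp add: nsq_def)

lemma nz_scale: assumes "c > 0" shows "nz (%i j. of_real c * Z i j) = nz Z"
proof -
 have "nsq (%i j. of_real c * Z i j) = c\<^sup>2 * nsq Z" by (simp add: nsq_def norm_mult power_mult_distrib distrib_left)
 thus ?thesis using assms by (simp add: nz_def real_sqrt_mult fun_eq_iff)
qed

lemma nz_sign: assumes "\<sigma> \<in> {1, -1}" shows "nz (%i j. \<sigma> * Z i j) = (%i j. \<sigma> * nz Z i j)"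
proof -
 have "nsq (%i j. \<sigma> * Z i j) = nsq Z" using assms by (auto simp: nsq_def norm_mult)
 thus ?thesis by (simp add: nz_def fun_eq_iff)
qed

lemma tendsto_nz:
 assumes "!!i j. i <= 7 ==> j <= 7 ==> ((%x. Z x i j) \<longlongrightarrow> Z0 i j) F" "nsq Z0 ~= 0" "i <= 7" "j <= 7"
 shows "((%x. nz (Z x) i j) \<longlongrightarrow> nz Z0 i j) F"
 unfolding nz_def nsq_def using assms(2) by (intro tendsto_intros assms(1,3,4)) (auto simp: nsq_def)

lemma tdat_nz: "tdat \<tau> = nz (%i j. nform \<tau> (E i) (E j))"
 by (intro ext) (simp add: tdat_def nz_def zform_def nrm_def nsq_def)

text \<open>A dilation with \<^term>\<open>l > 0\<close> distorts the norming factor by a bounded amount only, because its inverse is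
 again a good function on the whole circle.\<close>

lemma nsq_Y_pos:
 assumes t: "tgerm nu" and k: "k > 0" "avoids nu th k" and l: "0 < l" "l <= 1"
 shows "nsq (Y th nu l) > 0"
proof -
 define \<psi> where "\<psi> y = cis th * (of_real (1 - l) * cis th + of_real (1 + l) * cis y) * inverse (cis th * of_real (1 + l) + of_real (1 - l) * cis y)" for y
 have low: "cmod (cis th * of_real (1 + l) + of_real (1 - l) * cis y) \<ge> 2 * l" for y
 proof -
  have "cmod (cis th * of_real (1 + l)) = 1 + l" "cmod (of_real (1 - l) * cis y) = 1 - l"
   using l by (simp_all add: norm_mult del: of_real_add of_real_diff)
  thus ?thesis using norm_diff_ineq[of "cis th * of_real (1 + l)" "of_real (1 - l) * cis y"] by simp
 qed
 have i: "good UNIV (inv_bound 2 (2 * l) 8) (%y. inverse (cis th * of_real (1 + l) + of_real (1 - l) * cis y))"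
  using l low by (intro good_inverse) (auto simp: norm_mult simp del: of_real_add of_real_diff)
 have "\<exists>B. good UNIV B \<psi>"
  unfolding \<psi>_def[abs_def]
  by (rule exI) (rule good_mult[OF good_mult[OF good_const good_add[OF good_const good_mult[OF good_const good_cis]]] i])
 then obtain B where B: "good UNIV B \<psi>" by blast
 have "\<exists>C. good UNIV C (%y. \<psi> y ^ n)" for n using good_power_ex[OF B] by blast
 then obtain C where C: "!!n. good UNIV (C n) (%y. \<psi> y ^ n)" by metis
 define M where "M = C 1 * C 2 * CC + C 1 * C 3 * CC"
 have nb: "nrm (nu t) <= M * sqrt (nsq (%i j. nform (nu t) (%x. fl th l x ^ i) (%x. fl th l x ^ j)))" for t
 proof -
  define \<mu> where "\<mu> i = Arg (fl th l (nu t i))" for i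
  have u: "cmod (fl th l x) = 1" for x using fl_unit[of th l x] dl_nonzero[of l x th] l by simp
  have cm: "cis (\<mu> i) = fl th l (nu t i)" for i
   unfolding \<mu>_def using u[of "nu t i"] cis_Arg[of "fl th l (nu t i)"] by (force simp: sgn_eq)
  have ps: "\<psi> (\<mu> i) = cis (nu t i)" for i
  proof -
   have "cis th * of_real (1 + l) + of_real (1 - l) * cis (\<mu> i) ~= 0" using low[of "\<mu> i"] l by auto
   thus ?thesis unfolding \<psi>_def
    using fl_inverse[OF l(1), of "nu t i" th] unfolding cm[symmetric] by (simp add: field_simps)
  qed
  have e: "nform (nu t) (E i) (E j) = nform \<mu> (%y. \<psi> y ^ i) (%y. \<psi> y ^ j)" for i j
   unfolding nform_def E_def ps by simp
  have f: "nform (nu t) (%x. fl th l x ^ i) (%x. fl th l x ^ j) = nform \<mu> (E i) (E j)" for i j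
   unfolding nform_def E_def cm by simp
  have n: "sqrt (nsq (%i j. nform (nu t) (%x. fl th l x ^ i) (%x. fl th l x ^ j))) = nrm \<mu>" unfolding f by (simp add: nsq_def nrm_def)
  show ?thesis
  proof (cases "nrm \<mu> = 0")
   case True
   hence "mdist \<mu> = 0" by (simp add: nrm_eq_0_iff)
   have "cis (nu t i) = cis (nu t j)" if "cis (\<mu> i) = cis (\<mu> j)" for i j
    using that unfolding cm using fl_inj[OF l] by blast
   hence "mdist (nu t) = 0" using \<open>mdist \<mu> = 0\<close> unfolding mdist_eq_0_iff chord_eq_iff by blast
   hence "nrm (nu t) = 0" by (simp only: nrm_eq_0_iff)
   thus ?thesis using True n by simp
  next
   case False
   hence n0: "nrm \<mu> > 0" by (simp add: nrm_def less_le)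
   have "cmod (nform (nu t) (E i) (E j)) <= C i * C j * CC * nrm \<mu>" for i j
   proof -
    have "cmod (zform \<mu> (%y. \<psi> y ^ i) (%y. \<psi> y ^ j)) <= C i * C j * CC" by (rule norm_zform_le[OF C C]) simp
    thus ?thesis unfolding e zform_def using n0 by (simp add: norm_divide pos_divide_le_eq)
   qed
   hence "nrm (nu t) <= C 1 * C 2 * CC * nrm \<mu> + C 1 * C 3 * CC * nrm \<mu>"
    unfolding nrm_def by (intro order_trans[OF sqrt_sum_squares_le_sum] add_mono) auto
   thus ?thesis unfolding n M_def by (simp add: distrib_right)
  qed
 qed
 have "EV t. 1 <= M * sqrt (nsq (%i j. of_real (l ^ 3) * Yt th (nu t) l i j))"
 proof -
  have "EV t. nrm (nu t) > 0" using t by (simp add: tgerm_def)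
  thus ?thesis
  proof eventually_elim
   fix t assume n: "nrm (nu t) > 0"
   have "nsq (%i j. nform (nu t) (%x. fl th l x ^ i) (%x. fl th l x ^ j)) = (nrm (nu t))\<^sup>2 * nsq (%i j. of_real (l ^ 3) * Yt th (nu t) l i j)"
    unfolding zform_fl[symmetric] zform_def nsq_def using n by (simp add: norm_divide power_divide field_simps)
   hence "nrm (nu t) <= M * (nrm (nu t) * sqrt (nsq (%i j. of_real (l ^ 3) * Yt th (nu t) l i j)))"
    using nb[of t] n by (simp add: real_sqrt_mult)
   hence "nrm (nu t) * 1 <= nrm (nu t) * (M * sqrt (nsq (%i j. of_real (l ^ 3) * Yt th (nu t) l i j)))" by (simp add: mult_ac)
   thus "1 <= M * sqrt (nsq (%i j. of_real (l ^ 3) * Yt th (nu t) l i j))" using n by (simp only: mult_le_cancel_left_pos)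
  qed
 qed
 moreover have "((%t. M * sqrt (nsq (%i j. of_real (l ^ 3) * Yt th (nu t) l i j))) ~~> M * sqrt (nsq (%i j. of_real (l ^ 3) * Y th nu l i j)))"
  unfolding nsq_def by (intro tendsto_intros tendsto_Yt[OF t k]) (use l in auto)
 ultimately have "1 <= M * sqrt (nsq (%i j. of_real (l ^ 3) * Y th nu l i j))"
  using tendsto_lowerbound trivial_limit_at_right_real by blast
 hence "nsq (%i j. of_real (l ^ 3) * Y th nu l i j) ~= 0" by auto
 moreover have "nsq (%i j. of_real (l ^ 3) * Y th nu l i j) = (l ^ 3)\<^sup>2 * nsq (Y th nu l)"
  by (simp add: nsq_def norm_mult power_mult_distrib distrib_left norm_power)
 ultimately show ?thesis using nsq_nonneg[of "Y th nu l"] by (cases "nsq (Y th nu l) = 0") auto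
qed

lemma bq_qq_12: "bq p 1 = 1" "qq p 1 w = 0" "qq p 2 w = 1" by (simp_all add: numeral_2_eq_2 One_nat_def)

text \<open>First and half the second derivative at the antipode \<open>- cis th\<close>,
  antisymmetrized: up to a factor, the table of the algebra of functions whose first two derivatives
  vanish there. All algebras of \<open>U th\<close> are contracted to this table.\<close>

definition Y0 :: "real => nat => nat => complex" where
 "Y0 th i j = (bq (cis th) i * qq (cis th) j 0 - bq (cis th) j * qq (cis th) i 0) * (2 * \<i> * cis th) ^ 3"

lemma nsq_Y0: "nsq (Y0 th) > 0"
proof -
 have "Y0 th 1 2 = (2 * \<i> * cis th) ^ 3" by (simp only: Y0_def bq_qq_12) simp
 thus ?thesis by (simp add: nsq_def add_pos_nonneg)
qed

lemma Yt_zero: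
 assumes "!!i. i < 4 ==> cis (\<tau> i) ~= cis th"
 shows "Yt th \<tau> 0 i j = Y0 th i j * zform \<tau> (cx (ct th)) (%x. cx (ct th) x ^ 2)"
proof -
 have g: "gl th 0 x = (2 * \<i> * cis th) * cx (ct th) x" if "cis x ~= cis th" for x
 proof -
  have "dl th 0 x = - (- cis th + cis x)" by (simp add: dl_def)
  hence "inverse (dl th 0 x) = - inverse (- cis th + cis x)" by (simp only: inverse_minus_eq)
  thus ?thesis unfolding gl_def ct_eq[OF that] by (simp only:) (simp add: mult_ac)
 qed
 have G: "Gl th i 0 x = qq (cis th) i 0 * ((2 * \<i> * cis th)\<^sup>2 * cx (ct th) x ^ 2)" if "cis x ~= cis th" for i x
  unfolding Gl_def g[OF that] by (simp add: power2_eq_square mult_ac)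
 have z1: "zform \<tau> (gl th 0) (Gl th j 0) = (2 * \<i> * cis th) ^ 3 * qq (cis th) j 0 * zform \<tau> (cx (ct th)) (%x. cx (ct th) x ^ 2)" for j
 proof -
  have "nform \<tau> (gl th 0) (Gl th j 0) = nform \<tau> (%x. (2 * \<i> * cis th) * cx (ct th) x) (%x. qq (cis th) j 0 * ((2 * \<i> * cis th)\<^sup>2 * cx (ct th) x ^ 2))"
   by (rule nform_cong) (use g G assms in auto)
  thus ?thesis unfolding zform_def nform_bilinear by (simp add: power2_eq_square power3_eq_cube)
 qed
 have "zform \<tau> (Gl th i 0) (gl th 0) = - zform \<tau> (gl th 0) (Gl th i 0)"
  using nform_swap[of \<tau> "Gl th i 0" "gl th 0"] by (simp add: zform_def)
 thus ?thesis unfolding Yt_def Y0_def z1 by (simp add: algebra_simps)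
qed

lemma Y_zero:
 assumes "tgerm nu" "k > 0" "avoids nu th k" shows "Y th nu 0 i j = Y0 th i j * cform th nu"
proof -
 obtain B1 B2 where B: "good (away th k) B1 (cx (ct th))" "good (away th k) B2 (%x. cx (ct th) x ^ 2)" using good_ct[OF assms(2)] by blast
 have "EV t. Yt th (nu t) 0 i j = Y0 th i j * zform (nu t) (cx (ct th)) (%x. cx (ct th) x ^ 2)"
  using assms(3) unfolding avoids_def
 proof eventually_elim
  fix t assume "nodes (nu t) \<subseteq> away th k"
  thus "Yt th (nu t) 0 i j = Y0 th i j * zform (nu t) (cx (ct th)) (%x. cx (ct th) x ^ 2)"
   using assms(2) by (intro Yt_zero) (auto simp: nodes_def away_def)
 qed
 from tendsto_cong[OF this] tendsto_Yt[OF assms, of 0 i j]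
 have l: "((%t. Y0 th i j * zform (nu t) (cx (ct th)) (%x. cx (ct th) x ^ 2)) ~~> Y th nu 0 i j)" by simp
 have "((%t. Y0 th i j * zform (nu t) (cx (ct th)) (%x. cx (ct th) x ^ 2)) ~~> Y0 th i j * cform th nu)"
  unfolding cform_def by (intro tendsto_intros tendsto_zlim[OF assms(1) B assms(3)[unfolded avoids_def]])
 from tendsto_unique[OF _ l this] show ?thesis by (simp add: trivial_limit_at_right_real)
qed

lemma Y_one:
 assumes "tgerm nu" "k > 0" "avoids nu th k" shows "Y th nu 1 = zdat nu"
proof (intro ext)
 fix i j
 have "fl th 1 x = cis x" for x
  using fl_eq[of th 1 x] dl_nonzero[of 1 x th] by (simp add: dl_def)
 hence "Yt th \<tau> 1 i j = zform \<tau> (E i) (E j)" for \<tau>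
  using zform_fl[of \<tau> th 1 i j] by (simp add: E_def[abs_def])
 hence l: "((%t. zform (nu t) (E i) (E j)) ~~> Y th nu 1 i j)" using tendsto_Yt[OF assms, of 1 i j] by simp
 thus "Y th nu 1 i j = zdat nu i j" unfolding zdat_def by (rule zlimI[symmetric])
qed

lemma nsq_zdat: "tgerm nu ==> nsq (zdat nu) = 1"
 using zlim_normalized by (simp add: nsq_def zdat_def)

lemma nz_real_mult: assumes "r ~= 0" shows "\<exists>\<sigma>\<in>{1,-1}. nz (%i j. Z i j * of_real r) = (%i j. \<sigma> * nz Z i j)"
proof -
 define \<sigma> :: complex where "\<sigma> = of_real (sgn r)"
 have s: "\<sigma> \<in> {1, -1}" using assms by (auto simp: \<sigma>_def sgn_real_def)
 have "complex_of_real r = of_real (sgn r * \<bar>r\<bar>)" by (simp only: sgn_mult_abs)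
 hence "of_real r = \<sigma> * of_real \<bar>r\<bar>" by (simp add: \<sigma>_def)
 hence "(%i j. Z i j * of_real r) = (%i j. \<sigma> * (of_real \<bar>r\<bar> * Z i j))" by (auto simp: fun_eq_iff)
 thus ?thesis using nz_sign[OF s] nz_scale[of "\<bar>r\<bar>" Z] assms s by auto
qed

lemma close0_sign: "\<sigma> \<in> {1, -1} ==> close 0 (%i j. \<sigma> * Z i j) Z"
 unfolding close_def sclose_def by auto

lemma realizable_cong: assumes "realizable Z" "close 0 Z Z'" shows "realizable Z'"
 using close_trans[of 0 _ Z 0 Z'] assms unfolding realizable_def by auto

lemma nz_Y_zero:
 assumes "tgerm nu" "inU th nu" shows "close 0 (nz (Y th nu 0)) (nz (Y0 th))"
proof -
 obtain k where k: "k > 0" "avoids nu th k" "cform th nu ~= 0" using assms(2) by (auto simp: inU_def)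
 have r: "cform th nu = of_real (Re (cform th nu))" using cform_real[OF assms(1) k(1,2)] by (simp add: complex_eq_iff)
 hence "Re (cform th nu) ~= 0" using k(3) by auto
 moreover have "Y th nu 0 = (%i j. Y0 th i j * of_real (Re (cform th nu)))" using Y_zero[OF assms(1) k(1,2)] r by (intro ext) metis
 ultimately show ?thesis using nz_real_mult[of "Re (cform th nu)" "Y0 th"] close0_sign by metis
qed

text \<open>The dilation factor may vary along the germ. It is used with a constant factor on the
  germ of an algebra, and with the factor \<open>t\<close> on a fixed quadruple in order to reach
  \<open>l = 0\<close>.\<close>

lemma dilation_realizable:
 assumes r: "!!i. i < 4 ==> ctame (%t. cis (nu t i))" and l: "tame l" "EV t. 0 < l t & l t <= 1"
  and c: "EV t. config 2 (nu t)"
  and lim: "!!i j. ((%t. Yt th (nu t) (l t) i j) ~~> Z i j)" and n: "nsq Z ~= 0"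
 shows "realizable (nz Z)"
proof -
 define z where "z i t = fl th (l t) (nu t i)" for i t
 obtain F \<mu> where F: "repr F \<mu>" "EV t. \<forall>i<4. cis (\<mu> t i) = z i t"
 proof (rule realization[of z])
  fix i :: nat assume i: "i < 4"
  have "ctame (%t. dl th (l t) (nu t i))" unfolding dl_def
   by (intro ctame_add ctame_diff ctame_mult ctame_const r[OF i] ctame_of_real l)
  moreover have "EV t. dl th (l t) (nu t i) ~= 0" using l(2) by eventually_elim (simp add: dl_nonzero)
  ultimately have "ctame (%t. inverse (dl th (l t) (nu t i)))" by (rule ctame_inverse)
  thus "ctame (z i)" unfolding z_def[abs_def] fl_def gl_def by (intro ctame_add ctame_mult ctame_const r[OF i] ctame_of_real l)
  show "EV t. cmod (z i t) = 1" using l(2) by eventually_elim (simp add: z_def fl_unit dl_nonzero)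
  fix j :: nat assume j: "j < 4" "i ~= j"
  show "EV t. z i t ~= z j t" using l(2) c
  proof eventually_elim
   fix t assume "0 < l t & l t <= 1" "config 2 (nu t)"
   thus "z i t ~= z j t" using fl_inj[of "l t" th "nu t i" "nu t j"] config_cis[of "nu t" i j] i j by (auto simp: z_def)
  qed
 qed
 have "EV t. tdat (\<mu> t) = nz (Yt th (nu t) (l t))" using F(2) c l(2)
 proof eventually_elim
  fix t assume m: "\<forall>i<4. cis (\<mu> t i) = z i t" and c: "config 2 (nu t)" and lt: "0 < l t & l t <= 1"
  have n: "nrm (nu t) > 0" by (rule config_nrm_pos[OF c])
  have m4: "cis (\<mu> t 0) = z 0 t" "cis (\<mu> t 1) = z 1 t" "cis (\<mu> t 2) = z 2 t" "cis (\<mu> t 3) = z 3 t" using m by simp_all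
  have "nform (\<mu> t) (E i) (E j) = of_real (nrm (nu t)) * (of_real (l t ^ 3) * Yt th (nu t) (l t) i j)" for i j
  proof -
   have "nform (\<mu> t) (E i) (E j) = nform (nu t) (%x. fl th (l t) x ^ i) (%x. fl th (l t) x ^ j)"
    unfolding nform_def E_def m4 z_def ..
   also have "... = of_real (nrm (nu t)) * zform (nu t) (%x. fl th (l t) x ^ i) (%x. fl th (l t) x ^ j)" using n by (simp add: zform_def)
   finally show ?thesis unfolding zform_fl .
  qed
  hence "tdat (\<mu> t) = nz (%i j. of_real (nrm (nu t)) * (of_real (l t ^ 3) * Yt th (nu t) (l t) i j))" unfolding tdat_nz by simp
  also have "... = nz (Yt th (nu t) (l t))" using nz_scale[OF n] nz_scale[of "l t ^ 3"] lt by simp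
  finally show "tdat (\<mu> t) = nz (Yt th (nu t) (l t))" .
 qed
 hence ev: "EV t. zform (\<mu> t) (E i) (E j) = nz (Yt th (nu t) (l t)) i j" for i j
  by eventually_elim (simp add: tdat_def fun_eq_iff)
 have "zdat \<mu> i j = nz Z i j" if "i <= 7" "j <= 7" for i j
  unfolding zdat_def by (rule zlimI, subst tendsto_cong[OF ev], rule tendsto_nz[OF lim n that])
 hence "close 0 (zdat \<mu>) (nz Z)" by (simp add: close_def sclose_def)
 thus ?thesis by (rule repr_realizable[OF F(1)])
qed

lemma repr_config: "repr F nu ==> EV t. config 2 (nu t)"
 unfolding repr_def curve_germ_def eventually_at_right_field by force

lemma tendsto_Yt_param:
 assumes "!!i. i < 4 ==> cis (\<tau> i) ~= cis th"
 shows "((%l. Yt th \<tau> l i j) ~~> Yt th \<tau> 0 i j)"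
proof -
 have g: "((%l. gl th l (\<tau> i)) ~~> gl th 0 (\<tau> i))" if "i < 4" for i
  unfolding gl_def using dl_nonzero[of 0 "\<tau> i" th] assms[OF that] unfolding dl_def by (intro tendsto_intros) auto
 have q: "((%l. qq p i (w l)) ~~> qq p i w0)" if "(w ~~> w0)" for p i w w0 by (induction i) (auto intro!: tendsto_intros that)
 have G: "((%l. Gl th j l (\<tau> i)) ~~> Gl th j 0 (\<tau> i))" if "i < 4" for i j
  unfolding Gl_def by (intro tendsto_mult g that q tendsto_of_real tendsto_ident_at)
 have z: "((%l. zform \<tau> (\<phi> l) (\<psi> l)) ~~> zform \<tau> (\<phi> 0) (\<psi> 0))"
  if "!!i. i < 4 ==> ((%l. \<phi> l (\<tau> i)) ~~> \<phi> 0 (\<tau> i))" "!!i. i < 4 ==> ((%l. \<psi> l (\<tau> i)) ~~> \<psi> 0 (\<tau> i))"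
  for \<phi> \<psi> :: "real => real => complex"
  unfolding zform_def nform_def divide_inverse by (intro tendsto_mult tendsto_diff that tendsto_const) auto
 show ?thesis unfolding Yt_def by (intro tendsto_add tendsto_mult tendsto_const z g G tendsto_of_real tendsto_ident_at)
qed

lemma realizable_Y:
 assumes F: "repr F nu" "inU th nu" and l: "0 <= l" "l <= 1"
 shows "realizable (nz (Y th nu l))"
proof -
 note t = repr_tgerm[OF F(1)]
 obtain k where k: "k > 0" "avoids nu th k" "cform th nu ~= 0" using F(2) by (auto simp: inU_def)
 show ?thesis
 proof (cases "l = 0")
  case False
  hence l0: "0 < l" using l by simp
  show ?thesis
  proof (rule dilation_realizable[of nu "%t. l"])
   show "((%t. Yt th (nu t) l i j) ~~> Y th nu l i j)" for i j by (rule tendsto_Yt[OF t k(1,2)]) (use l in auto)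
   show "nsq (Y th nu l) ~= 0" using nsq_Y_pos[OF t k(1,2) l0 l(2)] by simp
  qed (use t l0 l tame_const repr_config[OF F(1)] in \<open>auto simp: tgerm_def\<close>)
 next
  case True
  obtain B1 B2 where B: "good (away th k) B1 (cx (ct th))" "good (away th k) B2 (%x. cx (ct th) x ^ 2)" using good_ct[OF k(1)] by blast
  note a = k(2)[unfolded avoids_def]
  \<comment> \<open>In place of a diagonal argument, one quadruple of the germ with nonzero value is
    shrunk by \<open>l = t\<close>; its limit table is \<open>Y0\<close> up to a real factor, as is
    that of the germ itself.\<close>
  have "EV t. zform (nu t) (cx (ct th)) (%x. cx (ct th) x ^ 2) ~= 0"
   using tendsto_imp_eventually_ne[OF tendsto_zlim[OF t B a]] k(3) by (simp add: cform_def)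
  hence "EV t. zform (nu t) (cx (ct th)) (%x. cx (ct th) x ^ 2) ~= 0 & nodes (nu t) \<subseteq> away th k & config 2 (nu t)"
   using a repr_config[OF F(1)] by eventually_elim blast
  from eventually_happens[OF this] obtain t0 where t0: "zform (nu t0) (cx (ct th)) (%x. cx (ct th) x ^ 2) ~= 0" "nodes (nu t0) \<subseteq> away th k" "config 2 (nu t0)"
   by (auto simp: trivial_limit_at_right_real)
  define \<tau> where "\<tau> = nu t0"
  have nd: "cis (\<tau> i) ~= cis th" if "i < 4" for i using t0(2) that k(1) by (auto simp: nodes_def away_def \<tau>_def)
  define r where "r = Re (zform \<tau> (cx (ct th)) (%x. cx (ct th) x ^ 2))"
  have eq: "(%x. cx (ct th) x ^ 2) = cx (%x. ct th x ^ 2)" by (auto simp: cx_def)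
  have r: "zform \<tau> (cx (ct th)) (%x. cx (ct th) x ^ 2) = of_real r" "r ~= 0"
   using t0(1) unfolding r_def \<tau>_def eq zform_def nform_cx by (simp_all flip: of_real_divide)
  have Yz: "Yt th \<tau> 0 = (%i j. Y0 th i j * of_real r)" by (intro ext) (simp add: Yt_zero[OF nd] r)
  have "realizable (nz (Yt th \<tau> 0))"
  proof (rule dilation_realizable[of "%t. \<tau>" "%t. t"])
   show "nsq (Yt th \<tau> 0) ~= 0"
   proof -
    have "nsq (Yt th \<tau> 0) = nsq (Y0 th) * r\<^sup>2" unfolding Yz by (simp add: nsq_def norm_mult power_mult_distrib distrib_right)
    thus ?thesis using nsq_Y0[of th] r(2) by simp
   qed
   show "((%t. Yt th \<tau> t i j) ~~> Yt th \<tau> 0 i j)" for i j by (rule tendsto_Yt_param[OF nd])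
  qed (use t0(3) in \<open>auto simp: ctame_const tame_ident \<tau>_def eventually_at_right_field intro!: exI[of _ 1]\<close>)
  moreover have "close 0 (nz (Yt th \<tau> 0)) (nz (Y0 th))" unfolding Yz using nz_real_mult[OF r(2), of "Y0 th"] close0_sign by metis
  ultimately have "realizable (nz (Y0 th))" by (rule realizable_cong)
  thus ?thesis unfolding True by (rule realizable_cong) (rule close_sym[OF nz_Y_zero[OF t F(2)]])
 qed
qed

text \<open>At \<open>l = 1\<close> the algebra itself is returned, since \<open>dalg\<close> only
  picks some algebra with the given table.\<close>

definition H :: "real => alg => real => alg" where
 "H th F l = (if l = 1 then F else dalg (nz (Y th (germ_of F) l)))"

lemma H_props:
 assumes "F \<in> U th" "0 <= l" "l <= 1"
 shows "H th F l \<in> CDbar 2 & close 0 (zd (H th F l)) (nz (Y th (germ_of F) l))"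
proof (cases "l = 1")
 case True
 have F: "F \<in> CDbar 2" "inU th (germ_of F)" using assms(1) by (auto simp: U_def)
 note t = tgerm_germ_of[OF F(1)]
 obtain k where k: "k > 0" "avoids (germ_of F) th k" using F(2) by (auto simp: inU_def)
 have "nz (Y th (germ_of F) 1) = zd F" unfolding Y_one[OF t k] by (simp add: nz_def nsq_zdat[OF t] zd_def fun_eq_iff)
 thus ?thesis using True F close_refl by (simp add: H_def)
next
 case False
 thus ?thesis using dalg realizable_Y[OF repr_germ_of _ assms(2,3)] assms(1) by (simp add: H_def U_def)
qed

lemma H_one: "H th F 1 = F" by (simp add: H_def)

lemma H_zero: assumes "F \<in> U th" "G \<in> U th" shows "H th F 0 = H th G 0"
proof -
 have c: "close 0 (nz (Y th (germ_of F) 0)) (nz (Y0 th))" if "F \<in> U th" for F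
  using that by (intro nz_Y_zero[OF tgerm_germ_of]) (simp_all add: U_def)
 have "close 0 (nz (Y th (germ_of F) 0)) (nz (Y th (germ_of G) 0))"
  using close_trans[OF c[OF assms(1)] close_sym[OF c[OF assms(2)]]] by simp
 from dalg_cong[OF this] show ?thesis by (simp add: H_def)
qed

text \<open>The sign with the smaller total deviation serves for all \<open>e\<close>
  simultaneously; summation over the 64 entries of the table costs a factor 64.\<close>

lemma sign_choice:
 assumes "!!e. e > 0 ==> \<forall>\<^sub>F x in F. close e A0 (B x)"
 obtains s where "!!x. s x \<in> {1, -1}" "!!e. e > 0 ==> \<forall>\<^sub>F x in F. sclose (s x) e A0 (B x)"
proof -
 define m where "m \<sigma> x = (\<Sum>i\<le>7. \<Sum>j\<le>7. cmod (A0 i j - \<sigma> * B x i j))" for \<sigma> x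
 define s :: "_ => complex" where "s x = (if m 1 x <= m (-1) x then 1 else -1)" for x
 have up: "m \<sigma> x <= 64 * e" if "sclose \<sigma> e A0 (B x)" for \<sigma> x e
 proof -
  have "m \<sigma> x <= (\<Sum>i\<le>7::nat. \<Sum>j\<le>7::nat. e)" unfolding m_def using that by (intro sum_mono) (auto simp: sclose_def)
  thus ?thesis by simp
 qed
 have lo: "sclose \<sigma> (m \<sigma> x) A0 (B x)" for \<sigma> x
  unfolding sclose_def m_def
 proof (intro allI impI)
  fix i j :: nat assume ij: "i <= 7" "j <= 7"
  have "cmod (A0 i j - \<sigma> * B x i j) <= (\<Sum>j\<le>7. cmod (A0 i j - \<sigma> * B x i j))"
   using ij by (intro member_le_sum[of j "{..7}" "%j. cmod (A0 i j - \<sigma> * B x i j)"]) auto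
  also have "... <= (\<Sum>i\<le>7. \<Sum>j\<le>7. cmod (A0 i j - \<sigma> * B x i j))"
   using ij by (intro member_le_sum[of i "{..7}" "%i. \<Sum>j\<le>7. cmod (A0 i j - \<sigma> * B x i j)"]) (auto intro: sum_nonneg)
  finally show "cmod (A0 i j - \<sigma> * B x i j) <= (\<Sum>i\<le>7. \<Sum>j\<le>7. cmod (A0 i j - \<sigma> * B x i j))" .
 qed
 have "\<forall>\<^sub>F x in F. sclose (s x) e A0 (B x)" if "e > 0" for e
 proof -
  have "e / 64 > 0" using that by simp
  from assms[OF this] show ?thesis
  proof eventually_elim
   fix x assume "close (e / 64) A0 (B x)"
   hence "m (s x) x <= 64 * (e / 64)" using up[of 1 "e / 64" x] up[of "-1" "e / 64" x] by (auto simp: close_def s_def)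
   thus "sclose (s x) e A0 (B x)" using lo[of "s x" x] unfolding sclose_def by force
  qed
 qed
 thus ?thesis using that[of s] by (auto simp: s_def)
qed

text \<open>Two variations are separated: that of the parameter, controlled uniformly by the
  Lipschitz property, and that of the germ, controlled by \<open>zlim_transfer\<close> up to the
  sign \<open>s\<close>.\<close>

lemma tendsto_zlim_family:
 assumes \<phi>: "Lgood (away th k) \<phi>" and \<psi>: "Lgood (away th k) \<psi>"
  and t: "tgerm nu" "avoids nu th k" "l0 \<in> {0..1}"
  and ev: "\<forall>\<^sub>F x in F. tgerm (\<mu> x) & avoids (\<mu> x) th k & l x \<in> {0..1}" and lim: "(l \<longlongrightarrow> l0) F"
  and s: "!!x. s x \<in> {1, -1}" "!!e. e > 0 ==> \<forall>\<^sub>F x in F. sclose (s x) e (zdat nu) (zdat (\<mu> x))"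
 shows "((%x. s x * zlim (\<mu> x) (\<phi> (l x)) (\<psi> (l x))) \<longlongrightarrow> zlim nu (\<phi> l0) (\<psi> l0)) F"
proof -
 obtain B where B0: "B \<ge> 0" and B: "!!l. l \<in> {0..1} ==> good (away th k) B (\<phi> l)" "!!l m. l \<in> {0..1} ==> m \<in> {0..1} ==> good (away th k) (B * \<bar>l - m\<bar>) (%x. \<phi> l x - \<phi> m x)"
  by (rule LgoodE[OF \<phi>]) (rule that)
 obtain C where C0: "C \<ge> 0" and C: "!!l. l \<in> {0..1} ==> good (away th k) C (\<psi> l)" "!!l m. l \<in> {0..1} ==> m \<in> {0..1} ==> good (away th k) (C * \<bar>l - m\<bar>) (%x. \<psi> l x - \<psi> m x)"
  by (rule LgoodE[OF \<psi>]) (rule that)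
 define D where "D = B * C * 2 * CC"
 have D0: "D \<ge> 0" using B0 C0 CC_pos by (simp add: D_def)
 have vary: "cmod (zlim \<mu> (\<phi> m) (\<psi> m) - zlim \<mu> (\<phi> l0) (\<psi> l0)) <= D * \<bar>m - l0\<bar>"
  if \<mu>: "tgerm \<mu>" "avoids \<mu> th k" "m \<in> {0..1}" for \<mu> m
 proof -
  note a = \<mu>(2)[unfolded avoids_def]
  have "((%t. cmod (zform (\<mu> t) (\<phi> m) (\<psi> m) - zform (\<mu> t) (\<phi> l0) (\<psi> l0))) ~~> cmod (zlim \<mu> (\<phi> m) (\<psi> m) - zlim \<mu> (\<phi> l0) (\<psi> l0)))"
   by (intro tendsto_norm tendsto_diff tendsto_zlim[OF \<mu>(1) B(1) C(1) a] \<mu>(3) t(3))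
  moreover have "EV t. cmod (zform (\<mu> t) (\<phi> m) (\<psi> m) - zform (\<mu> t) (\<phi> l0) (\<psi> l0)) <= D * \<bar>m - l0\<bar>"
   using a
  proof eventually_elim
   fix t assume n: "nodes (\<mu> t) \<subseteq> away th k"
   have "zform (\<mu> t) (\<phi> m) (\<psi> m) - zform (\<mu> t) (\<phi> l0) (\<psi> l0) =
    zform (\<mu> t) (%x. \<phi> m x - \<phi> l0 x) (\<psi> m) + zform (\<mu> t) (\<phi> l0) (%x. \<psi> m x - \<psi> l0 x)"
    unfolding zform_def nform_bilinear by (simp add: diff_divide_distrib)
   also have "cmod ... <= (B * \<bar>m - l0\<bar>) * C * CC + B * (C * \<bar>m - l0\<bar>) * CC"
    by (intro order_trans[OF norm_triangle_ineq] add_mono norm_zform_le[OF B(2) C(1) n] norm_zform_le[OF B(1) C(2) n] \<mu>(3) t(3))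
   also have "... = D * \<bar>m - l0\<bar>" by (simp add: D_def)
   finally show "cmod (zform (\<mu> t) (\<phi> m) (\<psi> m) - zform (\<mu> t) (\<phi> l0) (\<psi> l0)) <= D * \<bar>m - l0\<bar>" .
  qed
  ultimately show ?thesis using tendsto_upperbound trivial_limit_at_right_real by blast
 qed
 show ?thesis
 proof (rule tendstoI)
  fix e :: real assume e: "e > 0"
  define e1 where "e1 = e / (4 * (B * C + 1))"
  define e2 where "e2 = e / (4 * (D + 1))"
  have BC: "B * C + 1 > 0" "D + 1 > 0" using B0 C0 D0 by (simp_all add: add_nonneg_pos)
  have e12: "e1 > 0" "e2 > 0" using e BC by (simp_all add: e1_def e2_def)
  have "\<forall>\<^sub>F x in F. dist (l x) l0 < e2" by (rule tendstoD[OF lim e12(2)])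
  thus "\<forall>\<^sub>F x in F. dist (s x * zlim (\<mu> x) (\<phi> (l x)) (\<psi> (l x))) (zlim nu (\<phi> l0) (\<psi> l0)) < e"
   using ev s(2)[OF e12(1)]
  proof eventually_elim
   fix x assume 1: "dist (l x) l0 < e2" and 2: "tgerm (\<mu> x) & avoids (\<mu> x) th k & l x \<in> {0..1}" and 3: "sclose (s x) e1 (zdat nu) (zdat (\<mu> x))"
   have sx: "cmod (s x) = 1" using s(1)[of x] by auto
   let ?a = "zlim (\<mu> x) (\<phi> (l x)) (\<psi> (l x))" and ?b = "zlim (\<mu> x) (\<phi> l0) (\<psi> l0)" and ?c = "zlim nu (\<phi> l0) (\<psi> l0)"
   have "cmod (?a - ?b) <= D * \<bar>l x - l0\<bar>" using vary 2 by blast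
   also have "... <= (D + 1) * e2" using 1 D0 by (intro mult_mono) (auto simp: dist_real_def)
   also have "... = e / 4" unfolding e2_def using BC(2) by (simp only: times_divide_eq_right mult_ac) (simp add: field_simps)
   finally have A1: "cmod (s x * ?a - s x * ?b) <= e / 4" by (simp add: norm_mult sx flip: right_diff_distrib)
   have "cmod (?c - s x * ?b) <= B * C * (2 * e1)"
    using zlim_transfer[OF t(1) _ B(1)[OF t(3)] C(1)[OF t(3)] t(2)[unfolded avoids_def] _ 3, of "2 * e1"] 2 e12 by (simp add: avoids_def)
   also have "... <= (B * C + 1) * (2 * e1)" using e12 by (intro mult_right_mono) auto
   also have "... = e / 2"
   proof -
    have "x * (2 * (e / (4 * x))) = e / 2" if "x > 0" for x :: real using that by simp
    from this[OF BC(1)] show ?thesis unfolding e1_def .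
   qed
   finally have A2: "cmod (?c - s x * ?b) <= e / 2" .
   have "s x * ?a - ?c = (s x * ?a - s x * ?b) - (?c - s x * ?b)" by simp
   hence "cmod (s x * ?a - ?c) <= e / 4 + e / 2" using norm_triangle_ineq4[of "s x * ?a - s x * ?b" "?c - s x * ?b"] A1 A2 by simp
   thus "dist (s x * ?a) ?c < e" using e by (simp add: dist_norm)
  qed
 qed
qed

lemma continuous_map_CD_topD:
 fixes S :: "'a::topological_space set"
 assumes f: "CD_cont S f" and x: "x \<in> S" and e: "e > 0"
 shows "\<forall>\<^sub>F y in at x within S. close e (zd (f x)) (zd (f y))"
proof -
 have fC: "f y \<in> CDbar 2" if "y \<in> S" for y using continuous_map_image_subset_topspace[OF f] that by (auto simp: topspace_CD_top)
 define V where "V = {G \<in> CDbar 2. \<exists>d<e. close d (zd (f x)) (zd G)}"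
 have "openin (CD_top 2) V" unfolding openin_CD_top
 proof (intro conjI ballI)
  fix G assume "G \<in> V"
  then obtain d where d: "G \<in> CDbar 2" "d < e" "close d (zd (f x)) (zd G)" by (auto simp: V_def)
  have "G' \<in> V" if "G' \<in> CDbar 2" "close ((e - d) / 2) (zd G) (zd G')" for G'
   proof -
   have "d + (e - d) / 2 < e" using d(2) by (simp add: field_simps)
   thus ?thesis unfolding V_def using that(1) close_trans[OF d(3) that(2)] by blast
  qed
  thus "\<exists>e>0. \<forall>G'\<in>CDbar 2. close e (zd G) (zd G') --> G' \<in> V" using d(2) by (intro exI[of _ "(e - d) / 2"]) auto
 qed (auto simp: V_def)
 hence "openin (top_of_set S) {y \<in> topspace (top_of_set S). f y \<in> V}" by (rule openin_continuous_map_preimage[OF f])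
 then obtain T where T: "open T" "{y \<in> S. f y \<in> V} = S \<inter> T" by (auto simp: openin_open)
 have "f x \<in> V" unfolding V_def using fC[OF x] e close_refl[of 0] by auto
 hence "x \<in> T" using T(2) x by auto
 have "\<forall>y\<in>T. y ~= x --> y \<in> S --> close e (zd (f x)) (zd (f y))"
 proof (intro ballI impI)
  fix y assume "y \<in> T" "y \<in> S"
  hence "f y \<in> V" using T(2) by auto
  thus "close e (zd (f x)) (zd (f y))" unfolding V_def using close_mono less_imp_le by blast
 qed
 thus ?thesis unfolding eventually_at_topological using T(1) \<open>x \<in> T\<close> by blast
qed

text \<open>All three terms of \<open>Y\<close> change by the same sign \<open>s\<close>, so the
  sign passes through the normalization and is absorbed by \<open>close\<close>.\<close>

lemma continuous_map_H:
 fixes S :: "'a::topological_space set"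
 assumes f: "CD_cont S f" and fU: "!!x. x \<in> S ==> f x \<in> U th"
  and l: "continuous_on S l" "!!x. x \<in> S ==> l x \<in> {0..1}"
 shows "CD_cont S (%x. H th (f x) (l x))"
proof (rule continuous_map_CD_top)
 show "H th (f x) (l x) \<in> CDbar 2" if "x \<in> S" for x using H_props[OF fU[OF that]] l(2)[OF that] by auto
 fix x e assume x: "x \<in> S" and e: "(e::real) > 0"
 let ?F = "at x within S"
 define nu where "nu = germ_of (f x)"
 have fx: "f x \<in> CDbar 2" "inU th nu" using fU[OF x] by (auto simp: U_def nu_def)
 have t: "tgerm nu" unfolding nu_def by (rule tgerm_germ_of[OF fx(1)])
 obtain d k where d: "d > 0" "k > 0" "avoids nu th k" "!!nu'. tgerm nu' ==> close d (zdat nu) (zdat nu') ==> inU th nu' & avoids nu' th k"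
  using inU_open[OF t fx(2)] by metis
 have S: "\<forall>\<^sub>F y in ?F. y \<in> S" by (simp add: eventually_at_filter)
 have cl: "\<forall>\<^sub>F y in ?F. close e (zdat nu) (zdat (germ_of (f y)))" if "e > 0" for e
  using continuous_map_CD_topD[OF f x that] by (simp add: zd_def nu_def)
 obtain s where s: "!!y. s y \<in> {1, -1}" "!!e. e > 0 ==> \<forall>\<^sub>F y in ?F. sclose (s y) e (zdat nu) (zdat (germ_of (f y)))"
  using sign_choice[OF cl] by blast
 have ev: "\<forall>\<^sub>F y in ?F. tgerm (germ_of (f y)) & avoids (germ_of (f y)) th k & l y \<in> {0..1}"
  using S cl[OF d(1)]
 proof eventually_elim
  fix y assume y: "y \<in> S" "close d (zdat nu) (zdat (germ_of (f y)))"
  have "f y \<in> CDbar 2" using fU[OF y(1)] by (simp add: U_def)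
  hence "tgerm (germ_of (f y))" by (rule tgerm_germ_of)
  thus "tgerm (germ_of (f y)) & avoids (germ_of (f y)) th k & l y \<in> {0..1}" using d(4) y l(2) by blast
 qed
 have ll: "(l \<longlongrightarrow> l x) ?F" using l(1) x by (simp add: continuous_on_def)
 note fam = tendsto_zlim_family[OF _ _ t d(3) l(2)[OF x] ev ll s]
 note L = Lgood_gl[OF d(2), of th] Lgood_Gl[OF d(2), of th]
 have limY: "((%y. s y * Y th (germ_of (f y)) (l y) i j) \<longlongrightarrow> Y th nu (l x) i j) ?F" for i j
 proof -
  have "((%y. bq (cis th) i * (s y * zlim (germ_of (f y)) (gl th (l y)) (Gl th j (l y))) + bq (cis th) j * (s y * zlim (germ_of (f y)) (Gl th i (l y)) (gl th (l y)))
   + of_real (l y) * (s y * zlim (germ_of (f y)) (Gl th i (l y)) (Gl th j (l y)))) \<longlongrightarrow> Y th nu (l x) i j) ?F"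
   unfolding Y_def by (intro tendsto_add tendsto_mult[OF tendsto_const] tendsto_mult[OF tendsto_of_real[OF ll]] fam L)
  thus ?thesis by (simp add: Y_def algebra_simps)
 qed
 have n0: "nsq (Y th nu (l x)) ~= 0"
 proof (cases "l x = 0")
  case True
  have "nsq (Y th nu 0) = (cmod (cform th nu))\<^sup>2 * nsq (Y0 th)"
   using Y_zero[OF t d(2,3)] by (simp add: nsq_def norm_mult power_mult_distrib distrib_left mult.commute)
  thus ?thesis using True fx(2) nsq_Y0[of th] by (simp add: inU_def)
 next
  case False
  thus ?thesis using nsq_Y_pos[OF t d(2,3), of "l x"] l(2)[OF x] by simp
 qed
 have "((%y. s y * nz (Y th (germ_of (f y)) (l y)) i j) \<longlongrightarrow> nz (Y th nu (l x)) i j) ?F" if "i <= 7" "j <= 7" for i j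
  using tendsto_nz[OF limY n0 that] by (simp add: nz_sign[OF s(1)])
 from tendstoD[OF this e] have "\<forall>\<^sub>F y in ?F. \<forall>i\<in>{..7}. \<forall>j\<in>{..7}. dist (s y * nz (Y th (germ_of (f y)) (l y)) i j) (nz (Y th nu (l x)) i j) < e"
  by (intro eventually_ball_finite ballI) auto
 thus "\<forall>\<^sub>F y in ?F. close e (zd (H th (f x) (l x))) (zd (H th (f y) (l y)))"
  using S
 proof eventually_elim
  fix y assume "\<forall>i\<in>{..7}. \<forall>j\<in>{..7}. dist (s y * nz (Y th (germ_of (f y)) (l y)) i j) (nz (Y th nu (l x)) i j) < e" and y: "y \<in> S"
  hence "sclose (s y) e (nz (Y th nu (l x))) (nz (Y th (germ_of (f y)) (l y)))"
   by (auto simp: sclose_def dist_norm norm_minus_commute intro: less_imp_le)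
  hence c: "close e (nz (Y th nu (l x))) (nz (Y th (germ_of (f y)) (l y)))" using s(1)[of y] by (auto simp: close_iff)
  have hx: "close 0 (zd (H th (f x) (l x))) (nz (Y th nu (l x)))" using H_props[OF fU[OF x]] l(2)[OF x] by (auto simp: nu_def)
  have hy: "close 0 (nz (Y th (germ_of (f y)) (l y))) (zd (H th (f y) (l y)))" using H_props[OF fU[OF y]] l(2)[OF y] close_sym by auto
  from close_trans[OF close_trans[OF hx c] hy] show "close e (zd (H th (f x) (l x))) (zd (H th (f y) (l y)))" by simp
 qed
qed

subsection \<open>Integration of cocycles along segments\<close>

definition seg :: "('v::real_vector => 'a) => 'v => 'v => conf => 'a" where
 "seg q P Q = restrict (%x. q (x 0 *\<^sub>R P + x 1 *\<^sub>R Q)) (standard_simplex 1)"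

definition tri :: "('v::real_vector => 'a) => 'v => 'v => 'v => conf => 'a" where
 "tri q P Q R = restrict (%x. q (x 0 *\<^sub>R P + x 1 *\<^sub>R Q + x 2 *\<^sub>R R)) (standard_simplex 2)"

lemma simplex_1: "x \<in> standard_simplex 1 ==> x 0 = 1 - x 1 & 0 <= x 1 & x 1 <= 1"
 by (auto simp: standard_simplex_def One_nat_def)

lemma simplex_2: "x \<in> standard_simplex 2 ==> x 0 + x 1 + x 2 = 1 & 0 <= x 0 & 0 <= x 1 & 0 <= x 2"
 by (auto simp: standard_simplex_def numeral_2_eq_2 One_nat_def)

lemma singular_simplex_top_of_set:
 "singular_simplex p X f \<longleftrightarrow> continuous_map (top_of_set (standard_simplex p)) X f & f \<in> extensional (standard_simplex p)"
 by (simp add: singular_simplex_def euclidean_product_topology)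

lemma singular_simplex_comp:
 fixes q :: "'v::topological_space => 'a"
 assumes q: "continuous_map (top_of_set C) X q" and h: "continuous_on (standard_simplex p) h" "!!x. x \<in> standard_simplex p ==> h x \<in> C"
 shows "singular_simplex p X (restrict (%x. q (h x)) (standard_simplex p))"
proof -
 have "continuous_map (top_of_set (standard_simplex p)) (top_of_set C) h"
  using h by (auto simp: continuous_map_in_subtopology image_subset_iff)
 from continuous_map_compose[OF this q] have "continuous_map (top_of_set (standard_simplex p)) X (restrict (%x. q (h x)) (standard_simplex p))"
  by (rule continuous_map_eq) simp
 thus ?thesis by (simp add: singular_simplex_top_of_set)
qed

lemma cont_coord: "continuous_on S (%x::nat => real. x i)"
 by (rule continuous_on_subset[OF continuous_on_product_coordinates]) simp

lemma singular_simplex_tri: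
 fixes q :: "'v::real_normed_vector => 'a"
 assumes "continuous_map (top_of_set C) X q" "convex C" "P \<in> C" "Q \<in> C" "R \<in> C"
 shows "singular_simplex 2 X (tri q P Q R)"
 unfolding tri_def
proof (rule singular_simplex_comp[OF assms(1)])
 show "continuous_on (standard_simplex 2) (%x::nat=>real. x 0 *\<^sub>R P + x 1 *\<^sub>R Q + x 2 *\<^sub>R R)"
  by (intro continuous_intros cont_coord)
 show "x 0 *\<^sub>R P + x 1 *\<^sub>R Q + x 2 *\<^sub>R R \<in> C" if "x \<in> standard_simplex 2" for x
 proof -
  have "(\<Sum>i\<in>{0,1,2::nat}. x i *\<^sub>R (if i = 0 then P else if i = 1 then Q else R)) \<in> C"
   using simplex_2[OF that] assms by (intro convex_sum) (auto simp: One_nat_def numeral_2_eq_2)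
  thus ?thesis by (simp add: add.assoc)
 qed
qed

lemma edge_tri:
 "edge (tri q P Q R) 0 1 = seg q P Q" "edge (tri q P Q R) 1 2 = seg q Q R" "edge (tri q P Q R) 0 2 = seg q P R"
proof -
 have e: "edge \<sigma> i j = restrict (%x. \<sigma> (%l. (if i = l then x 0 else 0) + (if j = l then x 1 else 0))) (standard_simplex 1)" for \<sigma> :: "conf => 'a" and i j
  unfolding edge_def sub_simplex_def One_nat_def sum.atMost_Suc atMost_0 by (intro restrict_ext) simp
 have m: "(%l. (if i = l then x 0 else 0) + (if j = l then x 1 else 0)) \<in> standard_simplex 2" if "x \<in> standard_simplex 1" "i <= 2" "j <= 2" for x :: "nat => real" and i j
  using sub_simplex_point[of 1 "%k. if k = 0 then i else j" 2 x] that unfolding One_nat_def sum.atMost_Suc atMost_0 by simp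
 show "edge (tri q P Q R) 0 1 = seg q P Q" "edge (tri q P Q R) 1 2 = seg q Q R" "edge (tri q P Q R) 0 2 = seg q P R"
  unfolding e seg_def using m[of _ 0 1] m[of _ 1 2] m[of _ 0 2] by (auto simp: tri_def intro!: restrict_ext)
qed

lemma seg_triangle:
 fixes q :: "'v::real_normed_vector => 'a"
 assumes "is_cocycle 1 X W" "continuous_map (top_of_set C) X q" "convex C" "P \<in> C" "Q \<in> C" "R \<in> C"
 shows "W (seg q P R) \<longleftrightarrow> W (seg q P Q) ~= W (seg q Q R)"
 using cocycle_triangle[OF assms(1) singular_simplex_tri[OF assms(2-6)], of 0 1 2] by (simp add: edge_tri)

lemma seg_const:
 fixes q :: "'v::real_normed_vector => 'a"
 assumes "is_cocycle 1 X W" "continuous_map (top_of_set C) X q" "convex C" "P \<in> C"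
 shows "\<not> W (seg q P P)"
 using seg_triangle[OF assms(1-4) assms(4) assms(4)] by simp

lemma seg_cong:
 assumes "!!t. 0 <= t ==> t <= 1 ==> q ((1 - t) *\<^sub>R P + t *\<^sub>R Q) = q' ((1 - t) *\<^sub>R P' + t *\<^sub>R Q')"
 shows "seg q P Q = seg q' P' Q'"
 unfolding seg_def
proof (rule restrict_ext)
 fix x :: "nat => real" assume "x \<in> standard_simplex 1"
 hence x: "x 0 = 1 - x 1" "0 <= x 1" "x 1 <= 1" using simplex_1 by auto
 show "q (x 0 *\<^sub>R P + x 1 *\<^sub>R Q) = q' (x 0 *\<^sub>R P' + x 1 *\<^sub>R Q')" unfolding x(1) by (rule assms[OF x(2,3)])
qed

definition path_of :: "(conf => 'a) => real => 'a" where
 "path_of \<sigma> t = \<sigma> (%j. if j = 0 then 1 - t else if j = 1 then t else 0)"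

lemma simplex_path:
 assumes "singular_simplex 1 X \<sigma>"
 shows "continuous_map (top_of_set {0..1}) X (path_of \<sigma>)" "\<sigma> = seg (path_of \<sigma>) 0 1"
  "path_of \<sigma> 0 = vertex \<sigma> 0" "path_of \<sigma> 1 = vertex \<sigma> 1"
  "t \<in> {0..1} ==> path_of \<sigma> t \<in> \<sigma> ` standard_simplex 1"
proof -
 let ?h = "%t j::nat. if j = 0 then 1 - t else if j = 1 then t else (0::real)"
 have h: "?h t \<in> standard_simplex 1" if "t \<in> {0..1}" for t using that by (auto simp: standard_simplex_def One_nat_def)
 have "continuous_on {0..1} ?h"
 proof (rule continuous_on_coordinatewise_then_product)
  show "continuous_on {0..1} (%t. ?h t i)" for i by (cases "i = 0"; cases "i = 1") (auto intro!: continuous_intros)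
 qed
 hence "continuous_map (top_of_set {0..1}) (top_of_set (standard_simplex 1)) ?h"
  using h by (auto simp: continuous_map_in_subtopology)
 moreover have "continuous_map (top_of_set (standard_simplex 1)) X \<sigma>" using assms by (simp add: singular_simplex_top_of_set)
 ultimately have "continuous_map (top_of_set {0..1}) X (\<sigma> \<circ> ?h)" by (rule continuous_map_compose)
 thus "continuous_map (top_of_set {0..1}) X (path_of \<sigma>)" by (simp add: o_def path_of_def[abs_def])
 show "\<sigma> = seg (path_of \<sigma>) 0 1"
 proof
  fix x
  show "\<sigma> x = seg (path_of \<sigma>) 0 1 x"
  proof (cases "x \<in> standard_simplex 1")
   case True
   have "x = ?h (x 1)" using simplex_1[OF True] True by (auto simp: fun_eq_iff standard_simplex_def One_nat_def)
   thus ?thesis using True by (simp add: seg_def path_of_def)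
  next
   case False
   thus ?thesis using assms by (simp add: seg_def singular_simplex_top_of_set extensional_def)
  qed
 qed
 show "path_of \<sigma> 0 = vertex \<sigma> 0" "path_of \<sigma> 1 = vertex \<sigma> 1"
  unfolding path_of_def vertex_def by (rule arg_cong[of _ _ \<sigma>], auto)+
 show "t \<in> {0..1} ==> path_of \<sigma> t \<in> \<sigma> ` standard_simplex 1" using h by (auto simp: path_of_def)
qed

text \<open>The integral of the cocycle along the contraction path, from the common end of all these
  paths to \<open>F\<close>.\<close>

definition prim :: "((conf => alg) => bool) => real => alg => bool" where
 "prim W th F = W (seg (H th F) 0 (1::real))"

text \<open>Stokes on the square swept out by the contraction of \<open>\<gamma>\<close>: the side
  \<open>l = 0\<close> is constant by \<open>H_zero\<close> and contributes nothing, the side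
  \<open>l = 1\<close> is \<open>\<gamma>\<close>.\<close>

lemma cocycle_in_U:
 assumes W: "is_cocycle 1 (CD_top 2) W" and g: "CD_cont {0..1::real} \<gamma>"
  and U: "!!t. t \<in> {0..1} ==> \<gamma> t \<in> U th"
 shows "W (seg \<gamma> 0 1) \<longleftrightarrow> prim W th (\<gamma> 0) ~= prim W th (\<gamma> 1)"
proof -
 let ?S = "{0..1::real} \<times> {0..1::real}"
 define q where "q = (%x. H th (\<gamma> (fst x)) (snd x))"
 have c: "continuous_map (top_of_set ?S) (CD_top 2) q" unfolding q_def
 proof (rule continuous_map_H)
  have "continuous_map (top_of_set ?S) (top_of_set {0..1}) fst"
   by (auto simp: continuous_map_in_subtopology intro!: continuous_intros)
  from continuous_map_compose[OF this g] show "continuous_map (top_of_set ?S) (CD_top 2) (%x. \<gamma> (fst x))" by (simp add: o_def)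
 qed (auto intro!: continuous_intros U)
 have cv: "convex ?S" by (intro convex_Times) auto
 note tr = seg_triangle[OF W c cv]
 have 1: "W (seg q (0,0) (1,1)) \<longleftrightarrow> W (seg q (0,0) (0,1)) ~= W (seg q (0,1) (1,1))" by (rule tr) auto
 have 2: "W (seg q (0,0) (1,1)) \<longleftrightarrow> W (seg q (0,0) (1,0)) ~= W (seg q (1,0) (1,1))" by (rule tr) auto
 have 3: "seg q (0,0) (1,0) = seg q (0,0) (0,0)" by (rule seg_cong) (simp add: q_def, rule H_zero, auto intro!: U)
 have 4: "seg q (0,1) (1,1) = seg \<gamma> 0 1" by (rule seg_cong) (simp add: q_def H_one)
 have 5: "seg q (0,0) (0,1) = seg (H th (\<gamma> 0)) 0 1" "seg q (1,0) (1,1) = seg (H th (\<gamma> 1)) 0 1"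
  by (rule seg_cong, simp add: q_def)+
 have "\<not> W (seg q (0,0) (0,0))" by (rule seg_const[OF W c cv]) auto
 thus ?thesis using 1 2 unfolding 3 4 5 prim_def by blast
qed

subsection \<open>Sections of the double cover given by the sign of the limit form\<close>

text \<open>A continuous section of the real line bundle of the double cover: \<open>R\<close> is
  computed from the chosen germ and changes sign with the form, so continuity holds only after
  multiplication by the sign \<open>\<sigma>\<close>.\<close>

definition evensec :: "(germ => real) => alg set => bool" where
 "evensec R V \<longleftrightarrow> (\<forall>F\<in>V. \<forall>e>0. \<exists>d>0. \<forall>G\<in>V. \<forall>\<sigma>\<in>{1,-1}. sclose \<sigma> d (zd F) (zd G) --> \<bar>R (germ_of F) - Re \<sigma> * R (germ_of G)\<bar> < e)"

lemma evensec_mono: "evensec R V ==> V' \<subseteq> V ==> evensec R V'"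
 unfolding evensec_def by (meson subsetD)

lemma evensec_cform: "evensec (%nu. Re (cform th nu)) (U th)"
 unfolding evensec_def
proof (intro ballI allI impI)
 fix F e assume F: "F \<in> U th" and e: "(e::real) > 0"
 have F': "F \<in> CDbar 2" "inU th (germ_of F)" using F by (auto simp: U_def)
 obtain d k where d: "d > 0" "k > 0" "avoids (germ_of F) th k" "!!nu'. tgerm nu' ==> close d (zdat (germ_of F)) (zdat nu') ==> inU th nu' & avoids nu' th k"
  using inU_open[OF tgerm_germ_of[OF F'(1)] F'(2)] by metis
 obtain B where B: "B > 0" "!!nu nu' \<sigma> e e'. tgerm nu ==> tgerm nu' ==> avoids nu th k ==> avoids nu' th k ==>
   sclose \<sigma> e (zdat nu) (zdat nu') ==> e < e' ==> cmod (cform th nu - \<sigma> * cform th nu') <= B * e'"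
  using cform_transfer[OF d(2), of th] by metis
 define d' where "d' = min d (e / (4 * B))"
 have d': "d' > 0" using d(1) B(1) e by (simp add: d'_def)
 show "\<exists>d>0. \<forall>G\<in>U th. \<forall>\<sigma>\<in>{1,-1}. sclose \<sigma> d (zd F) (zd G) --> \<bar>Re (cform th (germ_of F)) - Re \<sigma> * Re (cform th (germ_of G))\<bar> < e"
 proof (intro exI[of _ d'] conjI ballI impI d')
  fix G and \<sigma> :: complex assume G: "G \<in> U th" and \<sigma>: "\<sigma> \<in> {1,-1}" and c: "sclose \<sigma> d' (zd F) (zd G)"
  have tG: "tgerm (germ_of G)" using G tgerm_germ_of by (simp add: U_def)
  have "close d (zdat (germ_of F)) (zdat (germ_of G))" using c \<sigma> close_mono[of d' _ _ d] unfolding close_iff zd_def d'_def by (metis min.cobounded1)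
  hence "avoids (germ_of G) th k" using d(4)[OF tG] by blast
  from B(2)[OF tgerm_germ_of[OF F'(1)] tG d(3) this c[unfolded zd_def], of "2 * d'"] d'
  have "cmod (cform th (germ_of F) - \<sigma> * cform th (germ_of G)) <= B * (2 * d')" by simp
  also have "... <= B * (2 * (e / (4 * B)))" using B(1) by (intro mult_left_mono) (auto simp: d'_def)
  also have "... = e / 2" using B(1) by simp
  finally have 1: "\<bar>Re (cform th (germ_of F) - \<sigma> * cform th (germ_of G))\<bar> <= e / 2" using abs_Re_le_cmod order_trans by blast
  have "Re (x - \<sigma> * z) = Re x - Re \<sigma> * Re z" for x z using \<sigma> by auto
  from 1[unfolded this] show "\<bar>Re (cform th (germ_of F)) - Re \<sigma> * Re (cform th (germ_of G))\<bar> < e" using e by simp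
 qed
qed

lemma evensec_zlim:
 assumes "good UNIV B1 \<phi>" "good UNIV B2 \<psi>" shows "evensec (%nu. Re (c * zlim nu \<phi> \<psi>)) (CDbar 2)"
 unfolding evensec_def
proof (intro ballI allI impI)
 fix F e assume F: "F \<in> CDbar 2" and e: "(e::real) > 0"
 define B where "B = cmod c * (B1 * B2) + 1"
 have B: "B > 0" "cmod c * (B1 * B2) <= B" using good_nonneg[OF assms(1)] good_nonneg[OF assms(2)] by (auto simp: B_def intro!: add_nonneg_pos)
 define d where "d = e / (4 * B)"
 have d: "d > 0" using e B by (simp add: d_def)
 show "\<exists>d>0. \<forall>G\<in>CDbar 2. \<forall>\<sigma>\<in>{1,-1}. sclose \<sigma> d (zd F) (zd G) --> \<bar>Re (c * zlim (germ_of F) \<phi> \<psi>) - Re \<sigma> * Re (c * zlim (germ_of G) \<phi> \<psi>)\<bar> < e"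
 proof (intro exI[of _ d] conjI ballI impI d)
  fix G and \<sigma> :: complex assume G: "G \<in> CDbar 2" and \<sigma>: "\<sigma> \<in> {1,-1}" and cl: "sclose \<sigma> d (zd F) (zd G)"
  have "cmod (zlim (germ_of F) \<phi> \<psi> - \<sigma> * zlim (germ_of G) \<phi> \<psi>) <= B1 * B2 * (2 * d)"
   using zlim_transfer_UNIV[OF tgerm_germ_of[OF F] tgerm_germ_of[OF G] assms cl[unfolded zd_def], of "2 * d"] d by simp
  hence "cmod c * cmod (zlim (germ_of F) \<phi> \<psi> - \<sigma> * zlim (germ_of G) \<phi> \<psi>) <= cmod c * (B1 * B2 * (2 * d))" by (intro mult_left_mono) auto
  also have "... <= B * (2 * d)" using mult_right_mono[OF B(2), of "2 * d"] d by (simp add: mult_ac)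
  also have "... = e / 2" using B(1) by (simp add: d_def)
  finally have "cmod (c * (zlim (germ_of F) \<phi> \<psi> - \<sigma> * zlim (germ_of G) \<phi> \<psi>)) <= e / 2" by (simp add: norm_mult)
  hence "\<bar>Re (c * (zlim (germ_of F) \<phi> \<psi> - \<sigma> * zlim (germ_of G) \<phi> \<psi>))\<bar> <= e / 2" using abs_Re_le_cmod order_trans by blast
  moreover have "Re (c * (x - \<sigma> * y)) = Re (c * x) - Re \<sigma> * Re (c * y)" for x y using \<sigma> by (auto simp: algebra_simps)
  ultimately show "\<bar>Re (c * zlim (germ_of F) \<phi> \<psi>) - Re \<sigma> * Re (c * zlim (germ_of G) \<phi> \<psi>)\<bar> < e" using e by simp
 qed
qed

lemma evensec_open: assumes "evensec R (CDbar 2)" shows "openin (CD_top 2) {F \<in> CDbar 2. R (germ_of F) ~= 0}"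
 unfolding openin_CD_top
proof (intro conjI ballI)
 fix F assume "F \<in> {F \<in> CDbar 2. R (germ_of F) ~= 0}"
 hence F: "F \<in> CDbar 2" "\<bar>R (germ_of F)\<bar> > 0" by auto
 obtain d where d: "d > 0" "!!G \<sigma>. G \<in> CDbar 2 ==> \<sigma> \<in> {1,-1} ==> sclose \<sigma> d (zd F) (zd G) ==> \<bar>R (germ_of F) - Re \<sigma> * R (germ_of G)\<bar> < \<bar>R (germ_of F)\<bar>"
  using assms F unfolding evensec_def by meson
 have "R (germ_of G) ~= 0" if G: "G \<in> CDbar 2" "close d (zd F) (zd G)" for G
 proof -
  obtain \<sigma> where "\<sigma> \<in> {1,-1}" "sclose \<sigma> d (zd F) (zd G)" using G(2) by (auto simp: close_iff)
  from d(2)[OF G(1) this] show ?thesis by auto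
 qed
 thus "\<exists>e>0. \<forall>G\<in>CDbar 2. close e (zd F) (zd G) --> G \<in> {F \<in> CDbar 2. R (germ_of F) ~= 0}" using d(1) by blast
qed auto

lemma continuous_sign_const:
 fixes f :: "real => real"
 assumes "x <= y" "continuous_on {x..y} f" "!!t. t \<in> {x..y} ==> f t ~= 0" shows "(f x > 0) = (f y > 0)"
proof (rule ccontr)
 assume *: "\<not> ?thesis"
 have "\<exists>t. x <= t & t <= y & f t = 0"
 proof (cases "f x > 0")
  case True thus ?thesis using * IVT2'[of f y 0 x] assms by auto
 next
  case False thus ?thesis using * IVT'[of f x 0 y] assms by auto
 qed
 thus False using assms(3) by auto
qed

text \<open>Both functions change sign together, so their product is a genuine continuous function
  along the path, and it has no zero.\<close>

lemma evensec_sign_const: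
 assumes R: "evensec R1 V" "evensec R2 V" and g: "CD_cont {0..1::real} \<gamma>"
  and V: "!!t. t \<in> {0..1} ==> \<gamma> t \<in> V & R1 (germ_of (\<gamma> t)) ~= 0 & R2 (germ_of (\<gamma> t)) ~= 0"
 shows "((R1 (germ_of (\<gamma> 0)) > 0) ~= (R2 (germ_of (\<gamma> 0)) > 0)) \<longleftrightarrow> ((R1 (germ_of (\<gamma> 1)) > 0) ~= (R2 (germ_of (\<gamma> 1)) > 0))"
proof -
 define p where "p t = R1 (germ_of (\<gamma> t)) * R2 (germ_of (\<gamma> t))" for t
 have "continuous_on {0..1} p"
  unfolding continuous_on_def
 proof
  fix x :: real assume x: "x \<in> {0..1}"
  let ?F = "at x within {0..1}"
  obtain s where s: "!!y. s y \<in> {1, -1}" "!!e. e > 0 ==> \<forall>\<^sub>F y in ?F. sclose (s y) e (zd (\<gamma> x)) (zd (\<gamma> y))"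
   using sign_choice[OF continuous_map_CD_topD[OF g x]] by blast
  have ev: "\<forall>\<^sub>F y in ?F. y \<in> {0..1}" by (simp add: eventually_at_filter)
  have lim: "((%y. Re (s y) * R (germ_of (\<gamma> y))) \<longlongrightarrow> R (germ_of (\<gamma> x))) ?F" if R: "evensec R V" for R
  proof (rule tendstoI)
   fix e :: real assume e: "e > 0"
   obtain d where d: "d > 0" "!!G \<sigma>. G \<in> V ==> \<sigma> \<in> {1,-1} ==> sclose \<sigma> d (zd (\<gamma> x)) (zd G) ==> \<bar>R (germ_of (\<gamma> x)) - Re \<sigma> * R (germ_of G)\<bar> < e"
    using R V[OF x] e unfolding evensec_def by meson
   show "\<forall>\<^sub>F y in ?F. dist (Re (s y) * R (germ_of (\<gamma> y))) (R (germ_of (\<gamma> x))) < e"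
    using s(2)[OF d(1)] ev
   proof eventually_elim
    fix y assume "sclose (s y) d (zd (\<gamma> x)) (zd (\<gamma> y))" "y \<in> {0..1}"
    hence "\<bar>R (germ_of (\<gamma> x)) - Re (s y) * R (germ_of (\<gamma> y))\<bar> < e" using d(2)[OF _ s(1)] V by blast
    thus "dist (Re (s y) * R (germ_of (\<gamma> y))) (R (germ_of (\<gamma> x))) < e" by (simp add: dist_real_def abs_minus_commute)
   qed
  qed
  have "Re (s y) * a * (Re (s y) * b) = a * b" for y a b using s(1)[of y] by auto
  with tendsto_mult[OF lim[OF R(1)] lim[OF R(2)]] show "(p \<longlongrightarrow> p x) ?F" unfolding p_def[abs_def] by (simp only:)
 qed
 note pc = this
 have nz: "p t ~= 0" if "0 <= t" "t <= 1" for t using V[of t] that by (simp add: p_def)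
 have "(p 0 > 0) = (p 1 > 0)" by (rule continuous_sign_const[OF _ pc]) (use nz in auto)
 thus ?thesis using V[of 0] V[of 1] by (auto simp: p_def zero_less_mult_iff)
qed

definition sgU :: "real => alg => bool" where "sgU th F \<longleftrightarrow> Re (cform th (germ_of F)) > 0"

lemma U_cform_nonzero: assumes "F \<in> U th" shows "Re (cform th (germ_of F)) ~= 0"
proof -
 have F: "F \<in> CDbar 2" "inU th (germ_of F)" using assms by (auto simp: U_def)
 then obtain k where "k > 0" "avoids (germ_of F) th k" "cform th (germ_of F) ~= 0" by (auto simp: inU_def)
 thus ?thesis using cform_real[OF tgerm_germ_of[OF F(1)]] by (auto simp: complex_eq_iff)
qed

lemma sgU_path:
 assumes g: "CD_cont {0..1::real} \<gamma>" and U: "!!t. t \<in> {0..1} ==> \<gamma> t \<in> U th \<inter> U \<phi>"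
 shows "(sgU th (\<gamma> 0) ~= sgU \<phi> (\<gamma> 0)) \<longleftrightarrow> (sgU th (\<gamma> 1) ~= sgU \<phi> (\<gamma> 1))"
 unfolding sgU_def
 by (rule evensec_sign_const[OF evensec_mono[OF evensec_cform] evensec_mono[OF evensec_cform] g, of "U th \<inter> U \<phi>"])
  (use U U_cform_nonzero in auto)

subsection \<open>Configurations of two chords\<close>

definition AA :: "real => real => real => real => alg" where "AA a b c d = A (tup a b c d)"

lemma A_cong:
 assumes "!!i j. tdat \<tau> i j = \<sigma> * tdat \<tau>' i j" "\<sigma> \<in> {1, -1}" shows "A \<tau> = A \<tau>'"
proof -
 have "close 0 (tdat \<tau>) (tdat \<tau>')" using assms unfolding close_def sclose_def by auto
 thus ?thesis unfolding A_def by (rule dalg_cong)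
qed

lemma A_neg: assumes "!!i j. nform \<tau> (E i) (E j) = - nform \<tau>' (E i) (E j)" shows "A \<tau> = A \<tau>'"
proof (rule A_cong[of _ "-1"])
 have "nrm \<tau> = nrm \<tau>'" by (simp add: nrm_def assms)
 thus "tdat \<tau> i j = - 1 * tdat \<tau>' i j" for i j by (simp add: tdat_def zform_def assms)
qed simp

lemma A_eq: assumes "!!i j. nform \<tau> (E i) (E j) = nform \<tau>' (E i) (E j)" shows "A \<tau> = A \<tau>'"
proof (rule A_cong[of _ 1])
 have "nrm \<tau> = nrm \<tau>'" by (simp add: nrm_def assms)
 thus "tdat \<tau> i j = 1 * tdat \<tau>' i j" for i j by (simp add: tdat_def zform_def assms)
qed simp

lemma AA_swap: "AA b a c d = AA a b c d" "AA a b d c = AA a b c d" "AA c d a b = AA a b c d"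
 unfolding AA_def by (rule A_neg, rule nform_tup_swaps)+

lemma AA_cis: "cis a = cis a' ==> cis b = cis b' ==> cis c = cis c' ==> cis d = cis d' ==> AA a b c d = AA a' b' c' d'"
 unfolding AA_def by (rule A_eq) (simp add: nform_def E_def)

text \<open>Two chords with a common end impose equal values at three points, so any two sides of
  the triangle give the same algebra.\<close>

lemma AA_V: "AA x z y z = AA x y x z" "AA y z y x = AA x y x z"
 unfolding AA_def by (rule A_eq, simp add: nform_def algebra_simps)+

lemma cis_shift [simp]: "cis (x + 2 * pi) = cis x" "cis (x - 2 * pi) = cis x"
 unfolding cis_eq_iff by (intro exI[of _ 1], simp, intro exI[of _ "-1"], simp)

lemma ct_cis: assumes "cis x = cis y" shows "ct th x = ct th y"
proof -
 obtain m :: int where m: "x - y = 2 * pi * m" using assms cis_eq_iff by blast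
 have "(x - th) / 2 = (y - th) / 2 + of_int m * pi" using m by (simp add: field_simps)
 moreover have "cot (u + of_int m * pi) = cot u" for u
 proof -
  have s: "sin (of_int m * pi) = 0" using sin_zero_iff_int2 by blast
  hence "cos (of_int m * pi) ~= 0" using sin_cos_squared_add[of "of_int m * pi"] by auto
  thus ?thesis by (simp add: cot_def sin_add cos_add s)
 qed
 ultimately show ?thesis unfolding ct_def by (simp only:)
qed

lemma ct_shift [simp]: "ct th (x + 2 * pi) = ct th x" "ct th (x - 2 * pi) = ct th x" by (rule ct_cis, simp)+

text \<open>Among nondegenerate quadruples exactly those whose algebra lies in \<open>U th\<close>,
  by \<open>AA_U\<close> and \<open>U_G\<close>.\<close>

definition G :: "real => real => real => real => real => bool" where
 "G th a b c d \<longleftrightarrow> cis a ~= cis th & cis b ~= cis th & cis c ~= cis th & cis d ~= cis th \<and>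
  ct th a ~= ct th b & ct th c ~= ct th d & ct th a + ct th b ~= ct th c + ct th d"

lemma G_swap: "G th b a c d = G th a b c d" "G th a b d c = G th a b c d" "G th c d a b = G th a b c d"
 by (auto simp: G_def add.commute)

lemma G_shift [simp]: "G th (a + 2 * pi) b c d = G th a b c d" "G th a (b + 2 * pi) c d = G th a b c d"
 "G th a b (c + 2 * pi) d = G th a b c d" "G th a b c (d + 2 * pi) = G th a b c d" by (simp_all add: G_def)

definition gv :: "real => real => real => real => real => real" where
 "gv th a b c d = (ct th a - ct th b) * (ct th c - ct th d) * (ct th c + ct th d - (ct th a + ct th b))"

lemma G_nrm_pos: assumes "G th a b c d" shows "nrm (tup a b c d) > 0"
proof -
 have *: "ct th a ~= ct th b" "ct th c ~= ct th d" "ct th a + ct th b ~= ct th c + ct th d" using assms by (auto simp: G_def)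
 have "cis a ~= cis b" "cis c ~= cis d" using *(1,2) ct_cis by blast+
 moreover have "\<not> (cis a = cis c & cis b = cis d)" using *(3) ct_cis[of a c th] ct_cis[of b d th] by auto
 moreover have "\<not> (cis a = cis d & cis b = cis c)" using *(3) ct_cis[of a d th] ct_cis[of b c th] by auto
 ultimately show ?thesis unfolding nrm_pos_iff by simp
qed

lemma cform_tup: "zform (tup a b c d) (cx (ct th)) (%x. cx (ct th) x ^ 2) = of_real (gv th a b c d / nrm (tup a b c d))"
 by (simp add: zform_def nform_def gv_def cx_def) (simp add: algebra_simps power2_eq_square)

lemma inU_tup:
 assumes "G th a b c d" shows "inU th (%t. tup a b c d)"
proof -
 define k where "k = Min {cmod (cis a - cis th), cmod (cis b - cis th), cmod (cis c - cis th), cmod (cis d - cis th)}"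
 have "k > 0" using assms by (simp add: k_def G_def)
 moreover have "nodes (tup a b c d) \<subseteq> away th k" by (auto simp: nodes_def away_def k_def less_4_cases)
 moreover have "gv th a b c d / nrm (tup a b c d) ~= 0" using assms G_nrm_pos[OF assms] by (auto simp: gv_def G_def)
 ultimately show ?thesis unfolding inU_def avoids_def cform_def zlim_const cform_tup by auto
qed

lemma AA_U: assumes "G th a b c d" shows "AA a b c d \<in> U th"
proof -
 note n = G_nrm_pos[OF assms]
 have c: "close 0 (zdat (%t. tup a b c d)) (zdat (germ_of (AA a b c d)))"
  unfolding zlim_const AA_def using close_sym[OF A_props(2)[OF n]] by (simp add: zd_def)
 have "AA a b c d \<in> CDbar 2" using A_props(1)[OF n] by (simp add: AA_def)
 thus ?thesis
  using inU_close0[OF tgerm_const[OF n] inU_tup[OF assms] tgerm_germ_of c] by (simp add: U_def)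
qed

text \<open>The germ chosen for the algebra may carry the opposite sign, but one \<open>s\<close>
  works for all \<open>th\<close>, so the signs for different \<open>th\<close> can be
  compared.\<close>

lemma sgU_AA:
 assumes n: "nrm (tup a b c d) > 0"
 obtains s :: real where "s \<in> {1, -1}" "!!th. G th a b c d ==> sgU th (AA a b c d) \<longleftrightarrow> s * gv th a b c d > 0"
proof -
 let ?\<tau> = "%t::real. tup a b c d" and ?nu = "germ_of (AA a b c d)"
 have C: "AA a b c d \<in> CDbar 2" using A_props(1)[OF n] by (simp add: AA_def)
 obtain \<sigma> where \<sigma>: "\<sigma> \<in> {1, -1}" "sclose \<sigma> 0 (zdat ?nu) (zdat ?\<tau>)"
  using A_props(2)[OF n] unfolding close_iff zd_def AA_def zlim_const by blast
 have "sgU th (AA a b c d) \<longleftrightarrow> Re \<sigma> * gv th a b c d > 0" if g: "G th a b c d" for th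
 proof -
  note t = tgerm_germ_of[OF C] tgerm_const[OF n]
  have "inU th ?nu" using AA_U[OF g] by (simp add: U_def)
  then obtain k1 where k1: "k1 > 0" "avoids ?nu th k1" by (auto simp: inU_def)
  obtain k2 where k2: "k2 > 0" "avoids ?\<tau> th k2" using inU_tup[OF g] by (auto simp: inU_def)
  define k where "k = min k1 k2"
  have k: "k > 0" "avoids ?nu th k" "avoids ?\<tau> th k"
   using k1 k2 avoids_mono[OF k1(2), of k] avoids_mono[OF k2(2), of k] by (auto simp: k_def)
  obtain B where B: "B > 0" "!!nu nu' \<sigma> e e'. tgerm nu ==> tgerm nu' ==> avoids nu th k ==> avoids nu' th k ==>
   sclose \<sigma> e (zdat nu) (zdat nu') ==> e < e' ==> cmod (cform th nu - \<sigma> * cform th nu') <= B * e'"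
   using cform_transfer[OF k(1), of th] by metis
  have "cmod (cform th ?nu - \<sigma> * cform th ?\<tau>) <= e" if "e > 0" for e
   using B(2)[OF t k(2,3) \<sigma>(2), of "e / B"] B(1) that by simp
  hence "cform th ?nu = \<sigma> * cform th ?\<tau>" using field_le_epsilon[of "cmod (cform th ?nu - \<sigma> * cform th ?\<tau>)" 0] by auto
  also have "cform th ?\<tau> = of_real (gv th a b c d / nrm (tup a b c d))" unfolding cform_def zlim_const cform_tup ..
  finally have "Re (cform th ?nu) = (Re \<sigma> * gv th a b c d) / nrm (tup a b c d)" using \<sigma>(1) by auto
  thus ?thesis using n by (simp add: sgU_def zero_less_divide_iff)
 qed
 moreover have "Re \<sigma> \<in> {1, -1}" using \<sigma>(1) by auto
 ultimately show ?thesis using that by blast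
qed

lemma ct_mono: assumes "th < x" "x < y" "y < th + 2 * pi" shows "ct th y < ct th x"
proof -
 define u v where "u = (x - th) / 2" "v = (y - th) / 2"
 have uv: "0 < u" "u < v" "v < pi" using assms by (auto simp: u_v_def field_simps)
 have s: "sin u > 0" "sin v > 0" "sin (v - u) > 0" using uv by (auto intro!: sin_gt_zero)
 have "cot u - cot v = sin (v - u) / (sin u * sin v)"
  using s by (simp add: cot_def sin_diff field_simps)
 also have "... > 0" using s by simp
 finally show ?thesis by (simp add: ct_def u_v_def)
qed

lemma cis_ne: assumes "th < x" "x < th + 2 * pi" shows "cis x ~= cis th"
proof
 assume "cis x = cis th"
 then obtain m :: int where m: "x - th = 2 * pi * m" using cis_eq_iff by blast
 have "0 < 2 * pi * real_of_int m" "2 * pi * real_of_int m < 2 * pi * 1" unfolding m[symmetric] using assms by auto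
 moreover have "2 * pi > 0" by simp
 ultimately have "0 < real_of_int m" "real_of_int m < 1" by (simp_all only: zero_less_mult_pos mult_less_cancel_left_pos)
 hence "0 < m" "m < 1" by simp_all
 thus False by linarith
qed

text \<open>Linear inequalities between angles, so the set is convex (\<open>ordG_ip\<close>); by
  monotonicity of the cotangent they fix the sign of \<open>gv\<close>.\<close>

definition ordG :: "real => real => real => real => real => bool" where
 "ordG th a b c d \<longleftrightarrow> th < a & a < b & c < d & a <= c & b <= d & a + b < c + d & d < th + 2 * pi"

lemma ordG_G: assumes "ordG th a b c d" shows "G th a b c d" "gv th a b c d < 0"
proof -
 have o: "th < a" "a < b" "c < d" "a <= c" "b <= d" "a < c \<or> b < d" "d < th + 2 * pi" using assms by (auto simp: ordG_def)
 have l: "ct th y <= ct th x" if "th < x" "x <= y" "y < th + 2 * pi" for x y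
  using ct_mono[of th x y] that by (cases "x = y") auto
 have 1: "ct th b < ct th a" "ct th d < ct th c" using o ct_mono[of th a b] ct_mono[of th c d] by auto
 have 2: "ct th c <= ct th a" "ct th d <= ct th b" using o l[of a c] l[of b d] by auto
 have "ct th c < ct th a \<or> ct th d < ct th b" using o ct_mono[of th a c] ct_mono[of th b d] by auto
 hence 3: "ct th c + ct th d < ct th a + ct th b" using 2 by auto
 show "G th a b c d" unfolding G_def using 1 3 o by (auto dest!: cis_ne[THEN notE, rotated 2])
 show "gv th a b c d < 0" unfolding gv_def using 1 3 by (intro mult_pos_neg mult_pos_pos) auto
qed

definition ip :: "real => real => real => real" where "ip t a b = (1 - t) * a + t * b"

lemma ip_simps [simp]: "ip 0 a b = a" "ip 1 a b = b" "ip t a a = a" by (simp_all add: ip_def algebra_simps)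

lemma ip_shift: "ip t (a + 2 * pi) (b + 2 * pi) = ip t a b + 2 * pi" by (simp add: ip_def algebra_simps)

lemma ip_le: "t \<in> {0..1} ==> a <= b ==> a' <= b' ==> ip t a a' <= ip t b b'"
 unfolding ip_def by (intro add_mono mult_left_mono) auto

lemma ip_less: assumes "t \<in> {0..1}" "a < b" "a' < b'" shows "ip t a a' < ip t b b'"
proof (cases "t = 1")
 case False
 hence "(1 - t) * a < (1 - t) * b" "t * a' <= t * b'" using assms by (auto intro: mult_strict_left_mono mult_left_mono)
 thus ?thesis by (simp add: ip_def)
qed (use assms in simp)

lemma ip_const_less: "t \<in> {0..1} ==> a < b ==> a < b' ==> a < ip t b b'" "t \<in> {0..1} ==> a < b ==> a' < b ==> ip t a a' < b"
 using ip_less[of t a b a b'] ip_less[of t a b a' b] by simp_all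

lemma ip_add: "ip t a a' + ip t b b' = ip t (a + b) (a' + b')" by (simp add: ip_def algebra_simps)

lemma ordG_ip: assumes "ordG th a b c d" "ordG th a' b' c' d'" "t \<in> {0..1}"
 shows "ordG th (ip t a a') (ip t b b') (ip t c c') (ip t d d')"
 using assms(1,2) unfolding ordG_def ip_add
 by (elim conjE, intro conjI) (assumption | rule ip_const_less[OF assms(3)] ip_less[OF assms(3)] ip_le[OF assms(3)])+

lemma rep_interval: obtains th' where "cis th' = cis th" "p <= th'" "th' < p + 2 * pi"
proof -
 define m where "m = \<lfloor>(th - p) / (2 * pi)\<rfloor>"
 have "of_int m <= (th - p) / (2 * pi)" "(th - p) / (2 * pi) < of_int m + 1" by (simp_all add: m_def)
 hence "2 * pi * of_int m <= th - p" "th - p < 2 * pi * (of_int m + 1)" by (simp_all add: field_simps)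
 moreover have "cis (th - 2 * pi * of_int m) = cis th" unfolding cis_eq_iff by (intro exI[of _ "-m"]) simp
 ultimately show ?thesis using that[of "th - 2 * pi * of_int m"] by (simp add: algebra_simps)
qed

subsection \<open>Coherent families of local potentials\<close>

text \<open>The behaviour of the potentials of one cocycle on the sets \<open>U th\<close>: on an
  intersection the difference of two of them is constant along paths.\<close>

locale coherent =
 fixes e :: "real => alg => bool"
 assumes per: "cis th = cis \<phi> ==> e th F = e \<phi> F"
  and path: "!!\<gamma> th \<phi>. CD_cont {0..1::real} \<gamma> ==> (!!t. t \<in> {0..1} ==> \<gamma> t \<in> U th \<inter> U \<phi>) ==>
   (e th (\<gamma> 0) = e \<phi> (\<gamma> 0)) = (e th (\<gamma> 1) = e \<phi> (\<gamma> 1))"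
begin

lemma interp:
 assumes "!!t. t \<in> {0..1} ==> G th (ip t a a') (ip t b b') (ip t c c') (ip t d d')"
  "!!t. t \<in> {0..1} ==> G \<phi> (ip t a a') (ip t b b') (ip t c c') (ip t d d')"
 shows "(e th (AA a b c d) = e \<phi> (AA a b c d)) = (e th (AA a' b' c' d') = e \<phi> (AA a' b' c' d'))"
proof -
 let ?\<tau> = "%t. tup (ip t a a') (ip t b b') (ip t c c') (ip t d d')"
 have "CD_cont {0..1::real} (%t. A (?\<tau> t))"
 proof (rule continuous_map_A)
  show "nrm (?\<tau> t) > 0" if "t \<in> {0..1}" for t using G_nrm_pos[OF assms(1)[OF that]] .
  show "continuous_on {0..1} (%t. ?\<tau> t i)" if "i < 4" for i
   using that unfolding less_4_cases ip_def by (elim disjE) (simp_all, (intro continuous_intros)+)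
 qed
 moreover have "A (?\<tau> t) \<in> U th \<inter> U \<phi>" if "t \<in> {0..1}" for t
  using AA_U[OF assms(1)[OF that]] AA_U[OF assms(2)[OF that]] by (simp add: AA_def)
 ultimately show ?thesis using path[of "%t. A (?\<tau> t)" th \<phi>] by (simp add: AA_def)
qed

end

text \<open>Pairs of crossing chords, or of chords with a common end, that both join the arc between
  \<open>th\<close> and \<open>\<phi>\<close> to the complementary arc. The set is convex, so the
  difference of the two potentials is constant on it.\<close>

definition Q :: "real => real => real => real => real => real => bool" where
 "Q th \<phi> x y z w \<longleftrightarrow> th < x & x <= y & y < \<phi> & \<phi> < z & z <= w & w < th + 2 * pi & x + z < y + w"

lemma Q_ord: assumes "Q th \<phi> x y z w" shows "ordG th x z y w" "ordG \<phi> z (x + 2 * pi) w (y + 2 * pi)"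
 using assms by (auto simp: Q_def ordG_def)

lemma (in coherent) Q_const:
 assumes "Q th \<phi> x y z w" "Q th \<phi> x' y' z' w'"
 shows "(e th (AA x z y w) = e \<phi> (AA x z y w)) = (e th (AA x' z' y' w') = e \<phi> (AA x' z' y' w'))"
proof (rule interp)
 fix t :: real assume t: "t \<in> {0..1}"
 show "G th (ip t x x') (ip t z z') (ip t y y') (ip t w w')"
  by (rule ordG_G(1)[OF ordG_ip[OF Q_ord(1)[OF assms(1)] Q_ord(1)[OF assms(2)] t]])
 have "G \<phi> (ip t z z') (ip t x x' + 2 * pi) (ip t w w') (ip t y y' + 2 * pi)"
  using ordG_G(1)[OF ordG_ip[OF Q_ord(2)[OF assms(1)] Q_ord(2)[OF assms(2)] t]] unfolding ip_shift .
 thus "G \<phi> (ip t x x') (ip t z z') (ip t y y') (ip t w w')" by (simp add: G_swap)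
qed

text \<open>Potentials without discrepancy on the configurations \<open>Q\<close>; adding a constant
  to each one achieves this.\<close>

locale normalized = coherent +
 assumes Q0: "Q th \<phi> x y z w ==> e th (AA x z y w) = e \<phi> (AA x z y w)"
begin

lemma triple_adj: "r - 2 * pi < th ==> th < p ==> p < \<phi> ==> \<phi> < q ==> q < r ==> e th (AA p q p r) = e \<phi> (AA p q p r)"
 by (rule Q0) (auto simp: Q_def)

text \<open>The three ends cut the circle into three arcs. Neighbouring arcs are compared by
  \<open>triple_adj\<close> across the point between them, where the triangle is rewritten from that
  point by \<open>AA_V\<close>.\<close>

lemma triple_mid:
 assumes pqr: "p < q" "q < r" "r < p + 2 * pi" and th: "cis th \<notin> {cis p, cis q, cis r}"
 shows "e th (AA p q p r) = e ((p + q) / 2) (AA p q p r)"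
proof -
 obtain th' where t: "cis th' = cis th" "p <= th'" "th' < p + 2 * pi" by (rule rep_interval)
 have ne: "th' ~= p" "th' ~= q" "th' ~= r" using th t(1) by auto
 let ?F = "AA p q p r" and ?m = "(p + q) / 2" and ?o = "(r - 2 * pi + p) / 2"
 have om: "e ?o ?F = e ?m ?F" by (rule triple_adj) (use pqr in \<open>auto simp: field_simps\<close>)
 consider "th' < q" | "q < th'" "th' < r" | "r < th'" using ne by linarith
 hence "e th' ?F = e ?m ?F"
 proof cases
  case 1
  have "e ?o ?F = e th' ?F" by (rule triple_adj) (use pqr 1 t ne in \<open>auto simp: field_simps\<close>)
  thus ?thesis using om by simp
 next
  case 2
  have "e ?m (AA q r q (p + 2 * pi)) = e th' (AA q r q (p + 2 * pi))" by (rule triple_adj) (use pqr 2 in \<open>auto simp: field_simps\<close>)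
  moreover have "AA q r q (p + 2 * pi) = ?F" using AA_V(2)[of q r p] AA_cis[of q q r r q q "p + 2 * pi" p] by simp
  ultimately show ?thesis by simp
 next
  case 3
  have "e (th' - 2 * pi) ?F = e ?m ?F" by (rule triple_adj) (use pqr 3 t in \<open>auto simp: field_simps\<close>)
  thus ?thesis using per[of "th' - 2 * pi" th'] by simp
 qed
 thus ?thesis using per[OF t(1)] by simp
qed

lemma triple:
 assumes "p < q" "q < r" "r < p + 2 * pi" "cis th \<notin> {cis p, cis q, cis r}" "cis \<phi> \<notin> {cis p, cis q, cis r}"
 shows "e th (AA p q p r) = e \<phi> (AA p q p r)"
 using triple_mid[OF assms(1-4)] triple_mid[OF assms(1-3,5)] by simp

text \<open>Sliding \<open>z\<close> into \<open>w\<close> turns crossing chords into a triangle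
  without leaving the two sets, and triangles are settled.\<close>

lemma linked_adj:
 assumes "w - 2 * pi < th" "th < x" "x < \<phi>" "\<phi> < y" "y < z" "z < w"
 shows "e th (AA x z y w) = e \<phi> (AA x z y w)"
proof -
 have "(e th (AA x z y w) = e \<phi> (AA x z y w)) = (e th (AA x w y w) = e \<phi> (AA x w y w))"
 proof (rule interp)
  fix t :: real assume t: "t \<in> {0..1}"
  have "ordG th x z y w" "ordG th x w y w" "ordG \<phi> y w z (x + 2 * pi)" "ordG \<phi> y w w (x + 2 * pi)" using assms by (auto simp: ordG_def)
  hence "ordG th (ip t x x) (ip t z w) (ip t y y) (ip t w w)" "ordG \<phi> (ip t y y) (ip t w w) (ip t z w) (ip t (x + 2 * pi) (x + 2 * pi))"
   using t by (blast intro: ordG_ip)+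
  from this[THEN ordG_G(1)] show "G th (ip t x x) (ip t z w) (ip t y y) (ip t w w)" "G \<phi> (ip t x x) (ip t z w) (ip t y y) (ip t w w)"
   by (simp_all add: G_swap)
 qed
 moreover have "e th (AA x w y w) = e \<phi> (AA x w y w)"
  using triple_adj[of w th x \<phi> y] assms unfolding AA_V(1)[of x w y] by simp
 ultimately show ?thesis by simp
qed

lemma linked_mid:
 assumes xyzw: "x < y" "y < z" "z < w" "w < x + 2 * pi" and th: "cis th \<notin> {cis x, cis y, cis z, cis w}"
 shows "e th (AA x z y w) = e ((x + y) / 2) (AA x z y w)"
proof -
 obtain th' where t: "cis th' = cis th" "x <= th'" "th' < x + 2 * pi" by (rule rep_interval)
 have ne: "th' ~= x" "th' ~= y" "th' ~= z" "th' ~= w" using th t(1) by auto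
 let ?F = "AA x z y w" and ?m = "(x + y) / 2" and ?n = "(y + z) / 2" and ?o = "(w - 2 * pi + x) / 2"
 have rot: "AA y w z (x + 2 * pi) = ?F"
  unfolding AA_swap(3)[of y w z "x + 2 * pi"] using AA_cis[of z z "x + 2 * pi" x y y w w] AA_swap(1)[of z x y w] by simp
 have rot2: "AA z (x + 2 * pi) w (y + 2 * pi) = ?F"
  using AA_cis[of z z "x + 2 * pi" x w w "y + 2 * pi" y] AA_swap[of z x w y] AA_swap[of x z y w] by simp
 have om: "e ?o ?F = e ?m ?F" by (rule linked_adj) (use xyzw in \<open>auto simp: field_simps\<close>)
 have mn: "e ?m ?F = e \<psi> ?F" if "y < \<psi>" "\<psi> < z" for \<psi>
  using linked_adj[of "x + 2 * pi" ?m y \<psi> z w] xyzw that unfolding rot by (auto simp: field_simps)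
 consider "th' < y" | "y < th'" "th' < z" | "z < th'" "th' < w" | "w < th'" using ne by linarith
 hence "e th' ?F = e ?m ?F"
 proof cases
  case 1
  have "e ?o ?F = e th' ?F" by (rule linked_adj) (use xyzw 1 t ne in \<open>auto simp: field_simps\<close>)
  thus ?thesis using om by simp
 next
  case 2 thus ?thesis using mn by simp
 next
  case 3
  have "e ?n ?F = e th' ?F"
   using linked_adj[of "y + 2 * pi" ?n z th' w "x + 2 * pi"] xyzw 3 unfolding rot2 by (auto simp: field_simps)
  thus ?thesis using mn[of ?n] xyzw by (simp add: field_simps)
 next
  case 4
  have "e (th' - 2 * pi) ?F = e ?m ?F" by (rule linked_adj) (use xyzw 4 t in \<open>auto simp: field_simps\<close>)
  thus ?thesis using per[of "th' - 2 * pi" th'] by simp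
 qed
 thus ?thesis using per[OF t(1)] by simp
qed

text \<open>The end \<open>w\<close> can be slid to \<open>x\<close> inside \<open>U th\<close>,
  which merges the two chords into a triangle.\<close>

definition DM :: "real => real => real => real => real => bool" where
 "DM th x y z w \<longleftrightarrow> (\<forall>t\<in>{0..1}. G th x y z (ip t w (x + 2 * pi)))"

lemma DM_G: "DM th x y z w ==> G th x y z w"
 unfolding DM_def by (drule bspec[of _ _ 0]) simp_all

lemma DM_equal:
 assumes "x < y" "y < z" "z < x + 2 * pi" "DM th x y z w" "DM \<phi> x y z w"
 shows "e th (AA x y z w) = e \<phi> (AA x y z w)"
proof -
 have "(e th (AA x y z w) = e \<phi> (AA x y z w)) = (e th (AA x y z (x + 2 * pi)) = e \<phi> (AA x y z (x + 2 * pi)))"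
  by (rule interp) (use assms(4,5) in \<open>simp_all add: DM_def\<close>)
 moreover have "AA x y z (x + 2 * pi) = AA x y x z" using AA_swap(2)[of x y x z] AA_cis[of x x y y z z "x + 2 * pi" x] by simp
 moreover have "cis th \<notin> {cis x, cis y, cis z}" "cis \<phi> \<notin> {cis x, cis y, cis z}"
  using assms(4,5)[THEN DM_G] by (auto simp: G_def)
 ultimately show ?thesis using triple[OF assms(1-3), of th \<phi>] by simp
qed

lemma DM_B: assumes "x < y" "y < \<beta>" "\<beta> < z" "z < w" "w < x + 2 * pi" shows "DM \<beta> x y z w"
 unfolding DM_def
proof
 fix t :: real assume t: "t \<in> {0..1}"
 have "ordG \<beta> z w (x + 2 * pi) (y + 2 * pi)" "ordG \<beta> z (x + 2 * pi) (x + 2 * pi) (y + 2 * pi)" using assms by (auto simp: ordG_def)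
 from ordG_G(1)[OF ordG_ip[OF this t]] show "G \<beta> x y z (ip t w (x + 2 * pi))" by (simp add: G_swap(3))
qed

text \<open>With \<open>th\<close> in the arc from \<open>x\<close> to \<open>y\<close> the sums of
  cotangents of the two chords may come in either order. In each order one sliding of an end does
  not bring the sums closer, so one of the two mergers stays in the set.\<close>

lemma DM_A:
 assumes o: "x < th" "th < y" "y < z" "z < w" "w < x + 2 * pi"
 shows "ct th z + ct th w < ct th x + ct th y ==> DM th x y z w"
  and "ct th x + ct th y < ct th z + ct th w ==> DM th z w (x + 2 * pi) (y + 2 * pi)"
proof -
 have lt: "ct th z < ct th y" "ct th w < ct th z" "ct th x < ct th w"
  using ct_mono[of th y z] ct_mono[of th z w] ct_mono[of th w "x + 2 * pi"] o by auto
 have ne: "cis x ~= cis th" "cis y ~= cis th" "cis z ~= cis th" "cis w ~= cis th"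
  using cis_ne[of th "x + 2 * pi"] cis_ne[of th y] cis_ne[of th z] cis_ne[of th w] o by auto
 assume *: "ct th z + ct th w < ct th x + ct th y"
 show "DM th x y z w" unfolding DM_def
 proof
  fix t :: real assume t: "t \<in> {0..1}"
  define v where "v = ip t w (x + 2 * pi)"
  have v: "w <= v" "v <= x + 2 * pi" using ip_le[OF t, of w w w "x + 2 * pi"] ip_le[OF t, of w "x + 2 * pi" "x + 2 * pi" "x + 2 * pi"] o by (auto simp: v_def)
  have "ct th v <= ct th w" using ct_mono[of th w v] v o by (cases "v = w") auto
  moreover have "cis v ~= cis th" using cis_ne[of th v] v o by auto
  ultimately show "G th x y z (ip t w (x + 2 * pi))" unfolding v_def[symmetric] G_def using ne lt * by simp
 qed
next
 have lt: "ct th z < ct th y" "ct th w < ct th z" "ct th x < ct th w"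
  using ct_mono[of th y z] ct_mono[of th z w] ct_mono[of th w "x + 2 * pi"] o by auto
 have ne: "cis x ~= cis th" "cis y ~= cis th" "cis z ~= cis th" "cis w ~= cis th"
  using cis_ne[of th "x + 2 * pi"] cis_ne[of th y] cis_ne[of th z] cis_ne[of th w] o by auto
 assume *: "ct th x + ct th y < ct th z + ct th w"
 show "DM th z w (x + 2 * pi) (y + 2 * pi)" unfolding DM_def ip_shift G_shift
 proof
  fix t :: real assume t: "t \<in> {0..1}"
  define v where "v = ip t y z"
  have v: "y <= v" "v <= z" using ip_le[OF t, of y y y z] ip_le[OF t, of y z z z] o by (auto simp: v_def)
  have "ct th v <= ct th y" using ct_mono[of th y v] v o by (cases "v = y") auto
  moreover have "ct th z <= ct th v" using ct_mono[of th v z] v o by (cases "v = z") auto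
  ultimately have cv: "ct th v <= ct th y" "ct th z <= ct th v" by auto
  have "cis v ~= cis th" using cis_ne[of th v] v o by auto
  thus "G th z w x (ip t y z)" unfolding v_def[symmetric] G_def using ne lt * cv by simp
 qed
qed

lemma DM_shift: "DM th (x + 2 * pi) (y + 2 * pi) (z + 2 * pi) (w + 2 * pi) = DM th x y z w"
 by (simp only: DM_def ip_shift G_shift)

lemma DM_cases:
 assumes o: "x < y" "y < z" "z < w" "w < x + 2 * pi" and g: "G th x y z w"
 shows "DM th x y z w \<or> DM th z w (x + 2 * pi) (y + 2 * pi)"
proof -
 obtain th' where t: "cis th' = cis th" "x <= th'" "th' < x + 2 * pi" by (rule rep_interval)
 have cc: "ct th' u = ct th u" if "cis u ~= cis th" for u
 proof -
  have "cx (ct th') u = cx (ct th) u" unfolding ct_eq[OF that] using ct_eq[of u th'] that t(1) by simp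
  thus ?thesis by (simp add: cx_def)
 qed
 have Gc: "G th' a b c d = G th a b c d" for a b c d unfolding G_def t(1) using cc by metis
 hence DMc: "DM th' a b c d = DM th a b c d" for a b c d unfolding DM_def by simp
 have g': "G th' x y z w" using g Gc by simp
 hence ne: "th' ~= x" "th' ~= y" "th' ~= z" "th' ~= w" and s: "ct th' x + ct th' y ~= ct th' z + ct th' w" by (auto simp: G_def)
 consider "th' < y" | "y < th'" "th' < z" | "z < th'" "th' < w" | "w < th'" using ne by linarith
 hence "DM th' x y z w \<or> DM th' z w (x + 2 * pi) (y + 2 * pi)"
 proof cases
  case 1 thus ?thesis using DM_A[of x th' y z w] o t ne s
   by (cases rule: linorder_cases[of "ct th' x + ct th' y" "ct th' z + ct th' w"]) auto
 next
  case 2 thus ?thesis using DM_B[of x y th' z w] o by auto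
 next
  case 3
  thus ?thesis using DM_A[of z th' w "x + 2 * pi" "y + 2 * pi"] o s DM_shift
   by (cases rule: linorder_cases[of "ct th' x + ct th' y" "ct th' z + ct th' w"]) auto
 next
  case 4 thus ?thesis using DM_B[of z w th' "x + 2 * pi" "y + 2 * pi"] o t by auto
 qed
 thus ?thesis unfolding DMc .
qed

lemma AA_rot: "AA z w (x + 2 * pi) (y + 2 * pi) = AA x y z w"
 using AA_cis[of z z w w "x + 2 * pi" x "y + 2 * pi" y] AA_swap(3)[of x y z w] by simp

text \<open>Disjoint chords with \<open>\<beta>\<close> and \<open>\<delta>\<close> in the two gaps
  between them. This is the comparison that merging into triangles does not reach, and it carries
  the single invariant in Z_2.\<close>

definition PP :: "real => real => bool" where
 "PP \<beta> \<delta> \<longleftrightarrow> (\<forall>x y z w. \<delta> < x & x < y & y < \<beta> & \<beta> < z & z < w & w < \<delta> + 2 * pi --> e \<beta> (AA x y z w) = e \<delta> (AA x y z w))"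

lemma PP_one:
 assumes o: "\<delta> < x" "x < y" "y < \<beta>" "\<beta> < z" "z < w" "w < \<delta> + 2 * pi" and eq: "e \<beta> (AA x y z w) = e \<delta> (AA x y z w)"
 shows "PP \<beta> \<delta>"
 unfolding PP_def
proof (intro allI impI)
 fix x' y' z' w' assume o': "\<delta> < x' & x' < y' & y' < \<beta> & \<beta> < z' & z' < w' & w' < \<delta> + 2 * pi"
 have "(e \<beta> (AA x y z w) = e \<delta> (AA x y z w)) = (e \<beta> (AA x' y' z' w') = e \<delta> (AA x' y' z' w'))"
 proof (rule interp)
  fix t :: real assume t: "t \<in> {0..1}"
  have "ordG \<delta> x y z w" "ordG \<delta> x' y' z' w'" "ordG \<beta> z w (x + 2 * pi) (y + 2 * pi)" "ordG \<beta> z' w' (x' + 2 * pi) (y' + 2 * pi)"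
   using o o' by (auto simp: ordG_def)
  hence "ordG \<delta> (ip t x x') (ip t y y') (ip t z z') (ip t w w')" "ordG \<beta> (ip t z z') (ip t w w') (ip t x x' + 2 * pi) (ip t y y' + 2 * pi)"
   unfolding ip_shift[symmetric] using t by (blast intro: ordG_ip)+
  from this[THEN ordG_G(1)] show "G \<delta> (ip t x x') (ip t y y') (ip t z z') (ip t w w')" "G \<beta> (ip t x x') (ip t y y') (ip t z z') (ip t w w')"
   by (simp_all add: G_swap(3))
 qed
 thus "e \<beta> (AA x' y' z' w') = e \<delta> (AA x' y' z' w')" using eq by simp
qed

text \<open>One test pair of chords close enough to \<open>\<delta>\<close> has
  \<open>\<beta>\<close> and \<open>\<beta>'\<close> in the same gap, where both potentials agree by
  merging.\<close>

lemma PP_left: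
 assumes "PP \<beta> \<delta>" "\<delta> < \<beta>" "\<beta> < \<delta> + 2 * pi" "\<delta> < \<beta>'" "\<beta>' < \<delta> + 2 * pi" shows "PP \<beta>' \<delta>"
proof -
 define m M where "m = min \<beta> \<beta>'" "M = max \<beta> \<beta>'"
 have mM: "\<delta> < m" "m <= \<beta>" "m <= \<beta>'" "\<beta> <= M" "\<beta>' <= M" "M < \<delta> + 2 * pi" using assms by (auto simp: m_M_def)
 define x y z w where "x = \<delta> + (m - \<delta>) / 3" "y = \<delta> + 2 * (m - \<delta>) / 3" "z = M + (\<delta> + 2 * pi - M) / 3" "w = M + 2 * (\<delta> + 2 * pi - M) / 3"
 have o: "\<delta> < x" "x < y" "y < m" "M < z" "z < w" "w < \<delta> + 2 * pi" using mM by (auto simp: x_y_z_w_def field_simps)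
 have "e \<beta> (AA x y z w) = e \<delta> (AA x y z w)" using assms(1) o mM unfolding PP_def by auto
 moreover have "e \<beta> (AA x y z w) = e \<beta>' (AA x y z w)" by (rule DM_equal) (use o mM in \<open>auto intro!: DM_B\<close>)
 ultimately show ?thesis using o mM by (intro PP_one[of \<delta> x y \<beta>' z w]) auto
qed

lemma PP_right:
 assumes "PP \<beta> \<delta>" "\<beta> - 2 * pi < \<delta>" "\<delta> < \<beta>" "\<beta> - 2 * pi < \<delta>'" "\<delta>' < \<beta>" shows "PP \<beta> \<delta>'"
proof -
 define m M where "m = min \<delta> \<delta>'" "M = max \<delta> \<delta>'"
 have mM: "\<beta> - 2 * pi < m" "m <= \<delta>" "m <= \<delta>'" "\<delta> <= M" "\<delta>' <= M" "M < \<beta>" using assms by (auto simp: m_M_def)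
 define x y z w where "x = M + (\<beta> - M) / 3" "y = M + 2 * (\<beta> - M) / 3" "z = \<beta> + (m + 2 * pi - \<beta>) / 3" "w = \<beta> + 2 * (m + 2 * pi - \<beta>) / 3"
 have o: "M < x" "x < y" "y < \<beta>" "\<beta> < z" "z < w" "w < m + 2 * pi" using mM by (auto simp: x_y_z_w_def field_simps)
 have "e \<beta> (AA x y z w) = e \<delta> (AA x y z w)" using assms(1) o mM unfolding PP_def by auto
 moreover have "e (\<delta> + 2 * pi) (AA z w (x + 2 * pi) (y + 2 * pi)) = e (\<delta>' + 2 * pi) (AA z w (x + 2 * pi) (y + 2 * pi))"
  by (rule DM_equal) (use o mM in \<open>auto intro!: DM_B\<close>)
 hence "e \<delta> (AA x y z w) = e \<delta>' (AA x y z w)" unfolding AA_rot using per[of "\<delta> + 2 * pi" \<delta>] per[of "\<delta>' + 2 * pi" \<delta>'] by simp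
 ultimately show ?thesis using o mM by (intro PP_one[of \<delta>' x y \<beta> z w]) auto
qed

text \<open>The two base points are moved alternately, starting from 0 and \<open>pi\<close>; the
  intermediate position halfway between \<open>\<delta>'\<close> and \<open>2 * pi\<close> keeps
  them from meeting.\<close>

lemma PP_all:
 assumes "PP pi 0" "\<delta> < x" "x < y" "y < \<beta>" "\<beta> < z" "z < w" "w < \<delta> + 2 * pi"
 shows "e \<beta> (AA x y z w) = e \<delta> (AA x y z w)"
proof -
 obtain \<delta>' where t: "cis \<delta>' = cis \<delta>" "0 <= \<delta>'" "\<delta>' < 0 + 2 * pi" by (rule rep_interval)
 obtain m :: int where m: "\<delta>' - \<delta> = 2 * pi * m" using t(1) cis_eq_iff by blast
 define s where "s = 2 * pi * real_of_int m"
 have cs: "cis (u + s) = cis u" for u unfolding cis_eq_iff by (intro exI[of _ m]) (simp add: s_def)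
 have \<delta>': "\<delta>' = \<delta> + s" using m by (simp add: s_def)
 have "PP ((\<delta>' + 2 * pi) / 2) 0" by (rule PP_left[OF assms(1)]) (use t in \<open>auto simp: field_simps\<close>)
 hence "PP ((\<delta>' + 2 * pi) / 2) \<delta>'" by (rule PP_right) (use t in \<open>auto simp: field_simps\<close>)
 hence "PP (\<beta> + s) \<delta>'" by (rule PP_left) (use assms t \<delta>' in \<open>auto simp: field_simps\<close>)
 hence "e (\<beta> + s) (AA (x + s) (y + s) (z + s) (w + s)) = e \<delta>' (AA (x + s) (y + s) (z + s) (w + s))"
  using assms \<delta>' unfolding PP_def by auto
 moreover have "AA (x + s) (y + s) (z + s) (w + s) = AA x y z w" by (rule AA_cis) (rule cs)+
 ultimately show ?thesis using per[OF t(1)] per[OF cs] by simp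
qed

text \<open>For every admissible \<open>th\<close> one of the chords can be slid to form a triangle
  (\<open>DM_cases\<close>), so the potential equals that of one of the two gaps; the gaps agree by
  \<open>PP_all\<close>.\<close>

lemma unlinked:
 assumes P: "PP pi 0" and o: "x < y" "y < z" "z < w" "w < x + 2 * pi" and g: "G th x y z w" "G \<phi> x y z w"
 shows "e th (AA x y z w) = e \<phi> (AA x y z w)"
proof -
 define \<beta> \<delta> where "\<beta> = (y + z) / 2" "\<delta> = (w - 2 * pi + x) / 2"
 have bd: "y < \<beta>" "\<beta> < z" "w - 2 * pi < \<delta>" "\<delta> < x" using o by (auto simp: \<beta>_\<delta>_def field_simps)
 have B: "DM \<beta> x y z w" by (rule DM_B) (use o bd in auto)
 have D: "DM (\<delta> + 2 * pi) z w (x + 2 * pi) (y + 2 * pi)" by (rule DM_B) (use o bd in auto)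
 have bd_eq: "e \<beta> (AA x y z w) = e \<delta> (AA x y z w)" by (rule PP_all[OF P]) (use o bd in auto)
 have val: "e \<psi> (AA x y z w) = e \<beta> (AA x y z w)" if "G \<psi> x y z w" for \<psi>
  using DM_cases[OF o that]
 proof
  assume "DM \<psi> x y z w"
  thus ?thesis by (intro DM_equal[OF _ _ _ _ B]) (use o in auto)
 next
  assume "DM \<psi> z w (x + 2 * pi) (y + 2 * pi)"
  hence "e \<psi> (AA z w (x + 2 * pi) (y + 2 * pi)) = e (\<delta> + 2 * pi) (AA z w (x + 2 * pi) (y + 2 * pi))"
   by (intro DM_equal[OF _ _ _ _ D]) (use o in auto)
  thus ?thesis unfolding AA_rot using per[of "\<delta> + 2 * pi" \<delta>] bd_eq by simp
 qed
 show ?thesis using val[OF g(1)] val[OF g(2)] by simp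
qed

lemma G_cis: "cis a = cis a' ==> cis b = cis b' ==> cis c = cis c' ==> cis d = cis d' ==> G th a b c d = G th a' b' c' d'"
 unfolding G_def using ct_cis[of a a' th] ct_cis[of b b' th] ct_cis[of c c' th] ct_cis[of d d' th] by simp

lemma generic:
 assumes P: "PP pi 0" and dist: "cis a ~= cis b" "cis a ~= cis c" "cis a ~= cis d" "cis b ~= cis c" "cis b ~= cis d" "cis c ~= cis d"
  and g: "G th a b c d" "G \<phi> a b c d"
 shows "e th (AA a b c d) = e \<phi> (AA a b c d)"
proof -
 have lem: "e th (AA a b c d) = e \<phi> (AA a b c d)"
  if l: "a < b" "b < a + 2 * pi" "a < c" "c < d" "d < a + 2 * pi" "b ~= c" "b ~= d" and g: "G th a b c d" "G \<phi> a b c d" for b c d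
 proof -
  consider "b < c" | "c < b" "b < d" | "d < b" using l by linarith
  thus ?thesis
  proof cases
   case 1 thus ?thesis by (intro unlinked[OF P _ _ _ _ g]) (use l in auto)
  next
   case 2
   have "cis \<psi> \<notin> {cis a, cis c, cis b, cis d}" if "G \<psi> a b c d" for \<psi> using that by (auto simp: G_def)
   thus ?thesis using linked_mid[of a c b d th] linked_mid[of a c b d \<phi>] 2 l g by simp
  next
   case 3
   have G': "G \<psi> c d b (a + 2 * pi) = G \<psi> a b c d" for \<psi> using G_swap(2)[of \<psi> c d a b] G_swap(3)[of \<psi> a b c d] by simp
   have "AA c d b (a + 2 * pi) = AA a b c d" using AA_cis[of c c d d b b "a + 2 * pi" a] AA_swap(2)[of c d a b] AA_swap(3)[of a b c d] by simp
   moreover have "e th (AA c d b (a + 2 * pi)) = e \<phi> (AA c d b (a + 2 * pi))" by (rule unlinked[OF P]) (use 3 l g G' in auto)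
   ultimately show ?thesis by simp
  qed
 qed
 obtain b' where b: "cis b' = cis b" "a <= b'" "b' < a + 2 * pi" by (rule rep_interval)
 obtain c' where c: "cis c' = cis c" "a <= c'" "c' < a + 2 * pi" by (rule rep_interval)
 obtain d' where d: "cis d' = cis d" "a <= d'" "d' < a + 2 * pi" by (rule rep_interval)
 have ne: "a ~= b'" "a ~= c'" "a ~= d'" "b' ~= c'" "b' ~= d'" "c' ~= d'" using dist b(1) c(1) d(1) by auto
 have eq: "AA a b' c' d' = AA a b c d" by (rule AA_cis) (use b c d in auto)
 have Ge: "G \<psi> a b' c' d' = G \<psi> a b c d" for \<psi> by (rule G_cis) (use b c d in auto)
 show ?thesis
 proof (cases "c' < d'")
  case True
  thus ?thesis using lem[of b' c' d'] b c d ne g unfolding eq Ge by auto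
 next
  case False
  thus ?thesis using lem[of b' d' c'] b c d ne g AA_swap(2)[of a b' c' d'] G_swap(2)[of _ a b' d' c'] unfolding eq Ge by auto
 qed
qed

end

lemma real_mult_less_one: "\<bar>x\<bar> < 2 * pi ==> x = 2 * pi * of_int m ==> x = 0" for m :: int
proof -
 assume x: "\<bar>x\<bar> < 2 * pi" "x = 2 * pi * of_int m"
 have "2 * pi * real_of_int \<bar>m\<bar> < 2 * pi * 1" using x by (simp add: abs_mult)
 hence "real_of_int \<bar>m\<bar> < 1" by (subst (asm) mult_less_cancel_left_pos) auto
 hence "m = 0" by linarith
 thus "x = 0" using x by simp
qed

section \<open>Adjusting the potentials by constants, and agreement on all algebras\<close>

lemma cis_ne': "0 < \<bar>x - y\<bar> ==> \<bar>x - y\<bar> < 2 * pi ==> cis x ~= cis y"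
 unfolding cis_eq_iff using real_mult_less_one by force

definition rep :: "real => real" where "rep th = (SOME th'. cis th' = cis th & 0 <= th' & th' < 2 * pi)"

lemma rep: "cis (rep th) = cis th" "0 <= rep th" "rep th < 2 * pi"
proof -
 obtain th' where "cis th' = cis th" "0 <= th'" "th' < 0 + 2 * pi" by (rule rep_interval)
 hence "\<exists>th'. cis th' = cis th & 0 <= th' & th' < 2 * pi" by auto
 from someI_ex[OF this] show "cis (rep th) = cis th" "0 <= rep th" "rep th < 2 * pi" by (simp_all add: rep_def)
qed

lemma rep_cong: "cis th = cis \<phi> ==> rep th = rep \<phi>" by (simp add: rep_def)

lemma rep_id: "0 <= th ==> th < 2 * pi ==> rep th = th"
 using cis_ne'[of "rep th" th] rep[of th] by (cases "rep th = th") (auto simp: abs_less_iff)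

context coherent begin

text \<open>A pair of chords with a common end that satisfies \<open>Q 0 th\<close> for
  \<open>th\<close> strictly between 0 and \<open>2 * pi\<close>; by \<open>Q_const\<close> any
  other such pair measures the same difference.\<close>

definition Tb :: "real => alg" where
 "Tb th = AA (th / 2) (th + (2 * pi - th) / 3) (th / 2) (th + 2 * (2 * pi - th) / 3)"

text \<open>The constant that has to be added to the potential at \<open>th\<close> to match the one
  at 0.\<close>

definition eps :: "real => bool" where "eps th \<longleftrightarrow> rep th ~= 0 & e 0 (Tb (rep th)) ~= e (rep th) (Tb (rep th))"

lemma eps_Q: assumes "0 < th" "th < 2 * pi" "Q 0 th x y z w"
 shows "eps th \<longleftrightarrow> e 0 (AA x z y w) ~= e th (AA x z y w)"
proof -
 have "Q 0 th (th / 2) (th / 2) (th + (2 * pi - th) / 3) (th + 2 * (2 * pi - th) / 3)" using assms by (auto simp: Q_def field_simps)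
 from Q_const[OF assms(3) this] show ?thesis unfolding eps_def Tb_def using rep_id[of th] assms by auto
qed

text \<open>A triangle with one vertex in each of the three arcs cut out by 0, \<open>th\<close> and
  \<open>\<phi>\<close> takes part in all three comparisons when written from the proper vertex.
  This is the cocycle condition for the constants.\<close>

lemma eps_additive:
 assumes "0 <= th" "th < \<phi>" "\<phi> < 2 * pi" "Q th \<phi> x y z w"
 shows "(e th (AA x z y w) ~= eps th) \<longleftrightarrow> (e \<phi> (AA x z y w) ~= eps \<phi>)"
proof (cases "th = 0")
 case True
 have "\<not> eps 0" unfolding eps_def using rep_id[of 0] by simp
 thus ?thesis using eps_Q[of \<phi> x y z w] assms True by auto
next
 case False
 define p q r where "p = th / 2" "q = (th + \<phi>) / 2" "r = (\<phi> + 2 * pi) / 2"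
 have o: "0 < p" "p < th" "th < q" "q < \<phi>" "\<phi> < r" "r < 2 * pi" using assms False by (auto simp: p_q_r_def)
 have 1: "eps th \<longleftrightarrow> e 0 (AA p q p r) ~= e th (AA p q p r)" by (rule eps_Q) (use o assms in \<open>auto simp: Q_def\<close>)
 have 2: "eps \<phi> \<longleftrightarrow> e 0 (AA p r q r) ~= e \<phi> (AA p r q r)" by (rule eps_Q) (use o assms in \<open>auto simp: Q_def\<close>)
 have Q3: "Q th \<phi> q q r (p + 2 * pi)" using o by (auto simp: Q_def)
 have 3: "(e th (AA x z y w) = e \<phi> (AA x z y w)) = (e th (AA q r q (p + 2 * pi)) = e \<phi> (AA q r q (p + 2 * pi)))"
  by (rule Q_const[OF assms(4) Q3])
 have "AA q r q (p + 2 * pi) = AA p q p r" using AA_V(2)[of q r p] AA_cis[of q q r r q q "p + 2 * pi" p] by simp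
 moreover have "AA p r q r = AA p q p r" by (rule AA_V(1))
 ultimately show ?thesis using 1 2 3 by auto
qed

lemma normalized_eps: "normalized (%th F. e th F ~= eps th)"
proof
 show "(e th F ~= eps th) = (e \<phi> F ~= eps \<phi>)" if "cis th = cis \<phi>" for th \<phi> F
  using per[OF that] rep_cong[OF that] by (simp add: eps_def)
 show "((e th (\<gamma> 0) ~= eps th) = (e \<phi> (\<gamma> 0) ~= eps \<phi>)) = ((e th (\<gamma> 1) ~= eps th) = (e \<phi> (\<gamma> 1) ~= eps \<phi>))"
  if "CD_cont {0..1::real} \<gamma>" "!!t. t \<in> {0..1} ==> \<gamma> t \<in> U th \<inter> U \<phi>" for \<gamma> th \<phi>
  using path[OF that] by auto
 show "(e th (AA x z y w) ~= eps th) = (e \<phi> (AA x z y w) ~= eps \<phi>)" if q: "Q th \<phi> x y z w" for th \<phi> x y z w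
 proof -
  obtain m :: int where m: "rep th - th = 2 * pi * m" using rep(1) cis_eq_iff by blast
  define s where "s = 2 * pi * real_of_int m"
  have cs: "cis (u + s) = cis u" for u unfolding cis_eq_iff by (intro exI[of _ m]) (simp add: s_def)
  have rs: "rep th = th + s" using m by (simp add: s_def)
  let ?F = "AA x z y w"
  have F: "AA (x + s) (z + s) (y + s) (w + s) = ?F" by (rule AA_cis) (rule cs)+
  have q': "Q (rep th) (\<phi> + s) (x + s) (y + s) (z + s) (w + s)" using q rs by (auto simp: Q_def)
  have "(e (rep th) ?F ~= eps (rep th)) = (e (\<phi> + s) ?F ~= eps (\<phi> + s))"
  proof (cases "\<phi> + s < 2 * pi")
   case True
   from eps_additive[OF rep(2) _ True q'] q' show ?thesis unfolding F by (auto simp: Q_def)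
  next
   case False
   \<comment> \<open>When \<open>\<phi>\<close> passes the end of the period, subtracting
     \<open>2 * pi\<close> puts it before \<open>rep th\<close>; the two arcs, and with them the
     ends of the chords, exchange their roles.\<close>
   define \<phi>' where "\<phi>' = \<phi> + s - 2 * pi"
   have "Q \<phi>' (rep th) (z + s - 2 * pi) (w + s - 2 * pi) (x + s) (y + s)" using q' False by (auto simp: Q_def \<phi>'_def)
   moreover have "0 <= \<phi>'" "\<phi>' < rep th" using False q' by (auto simp: \<phi>'_def Q_def)
   ultimately have "(e \<phi>' (AA (z + s - 2 * pi) (x + s) (w + s - 2 * pi) (y + s)) ~= eps \<phi>') \<longleftrightarrow> (e (rep th) (AA (z + s - 2 * pi) (x + s) (w + s - 2 * pi) (y + s)) ~= eps (rep th))"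
    using eps_additive[OF _ _ rep(3)] by blast
   moreover have "AA (z + s - 2 * pi) (x + s) (w + s - 2 * pi) (y + s) = ?F"
   proof -
    have "AA (z + s - 2 * pi) (x + s) (w + s - 2 * pi) (y + s) = AA z x w y" by (rule AA_cis) (simp_all only: cis_shift cs)
    also have "... = AA x z w y" by (rule AA_swap(1))
    also have "... = ?F" by (rule AA_swap(2))
    finally show ?thesis .
   qed
   moreover have "cis \<phi>' = cis (\<phi> + s)" unfolding \<phi>'_def by (rule cis_shift(2))
   ultimately show ?thesis using per[of \<phi>' "\<phi> + s"] rep_cong[of \<phi>' "\<phi> + s"] by (auto simp: eps_def)
  qed
  thus ?thesis using per[OF rep(1)] per[OF cs] rep_cong[OF rep(1)] rep_cong[OF cs] by (simp add: eps_def)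
 qed
qed

end

lemma A_tup: "A \<tau> = AA (\<tau> 0) (\<tau> 1) (\<tau> 2) (\<tau> 3)"
 unfolding AA_def by (rule A_eq) (simp add: nform_tup)

lemma U_G: assumes n: "nrm (tup a b c d) > 0" and "AA a b c d \<in> U th" shows "G th a b c d"
proof -
 have C: "AA a b c d \<in> CDbar 2" "inU th (germ_of (AA a b c d))" using assms(2) by (auto simp: U_def)
 have "close 0 (zdat (germ_of (AA a b c d))) (zdat (%t. tup a b c d))"
  unfolding zlim_const AA_def using A_props(2)[OF n] by (simp add: zd_def)
 from inU_close0[OF tgerm_germ_of[OF C(1)] C(2) tgerm_const[OF n] this]
 obtain k where k: "k > 0" "avoids (%t. tup a b c d) th k" "cform th (%t. tup a b c d) ~= 0" by (auto simp: inU_def)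
 have "nodes (tup a b c d) \<subseteq> away th k" using k(2) by (simp add: avoids_def trivial_limit_at_right_real)
 hence "cis (tup a b c d i) ~= cis th" if "i < 4" for i using that k(1) by (auto simp: nodes_def away_def)
 from this[of 0] this[of 1] this[of 2] this[of 3] have "cis a ~= cis th" "cis b ~= cis th" "cis c ~= cis th" "cis d ~= cis th" by auto
 moreover have "gv th a b c d ~= 0" using k(3) unfolding cform_def zlim_const cform_tup by auto
 ultimately show ?thesis by (auto simp: G_def gv_def)
qed

text \<open>Following the representing germ for a short time leads to four distinct points inside
  the same open set. This reduces the comparison of potentials on arbitrary algebras to generic
  pairs of chords.\<close>

lemma germ_path:
 assumes V: "openin (CD_top 2) V" "F \<in> V"
 obtains \<gamma> \<tau> where "CD_cont {0..1::real} \<gamma>" "\<gamma> 0 = F" "!!t. t \<in> {0..1} ==> \<gamma> t \<in> V" "config 2 \<tau>" "\<gamma> 1 = A \<tau>"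
proof -
 have F: "F \<in> CDbar 2" using openin_subset[OF V(1)] V(2) by (auto simp: topspace_CD_top)
 define nu where "nu = germ_of F"
 obtain \<epsilon> where g: "curve_germ 2 \<epsilon> nu" using repr_germ_of[OF F] unfolding repr_def nu_def by blast
 have \<epsilon>: "\<epsilon> > 0" "!!t. 0 < t ==> t < \<epsilon> ==> config 2 (nu t)" "!!i. i < 4 ==> continuous_on {0..<\<epsilon>} (%t. nu t i)"
  using g by (auto simp: curve_germ_def)
 note tg = curve_germ_tgerm[OF g]
 define S where "S = {0..<\<epsilon>}"
 define f where "f t = (if t = 0 then F else A (nu t))" for t
 define Z where "Z t = (if t = 0 then zd F else tdat (nu t))" for t
 have n: "nrm (nu t) > 0" if "t \<in> S" "t ~= 0" for t using config_nrm_pos[OF \<epsilon>(2)] that by (auto simp: S_def)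
 have c: "CD_cont S f"
 proof (rule continuous_map_dalg[of S Z])
  show "realizable (Z t)" if "t \<in> S" for t
   using tuple_realizable[OF n[OF that]] F close_refl[of 0 "zd F"] by (auto simp: Z_def realizable_def)
  show "f t \<in> CDbar 2 & close 0 (zd (f t)) (Z t)" if "t \<in> S" for t
   using A_props[OF n[OF that]] F close_refl[of 0 "zd F"] by (auto simp: Z_def f_def)
  show "continuous_on S (%t. Z t i j)" if "i <= 7" "j <= 7" for i j
   unfolding continuous_on_def
  proof
   fix t assume t: "t \<in> S"
   show "((%t. Z t i j) \<longlongrightarrow> Z t i j) (at t within S)"
   proof (cases "t = 0")
    case True
    obtain C D where "good UNIV C (E i)" "good UNIV D (E j)" using good_E by metis
    from tendsto_zlim_UNIV[OF tg this] have l: "((%t. tdat (nu t) i j) ~~> zd F i j)"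
     by (simp add: tdat_def zd_def zdat_def nu_def)
    have "EV t. tdat (nu t) i j = Z t i j"
     using eventually_at_right_less[of 0] by eventually_elim (simp add: Z_def)
    hence "((%t. Z t i j) ~~> zd F i j)" by (rule Lim_transform_eventually[OF l])
    hence "((%t. Z t i j) \<longlongrightarrow> zd F i j) (at 0 within {0..})" by (simp add: at_within_Ici_at_right)
    hence "((%t. Z t i j) \<longlongrightarrow> zd F i j) (at 0 within S)" by (rule tendsto_within_subset) (auto simp: S_def)
    thus ?thesis using True by (simp add: Z_def)
   next
    case False
    have "((%t. tdat (nu t) i j) \<longlongrightarrow> tdat (nu t) i j) (at t within S)" unfolding tdat_def
    proof (rule tendsto_zform[OF _ n[OF t False]])
     fix i :: nat assume "i < 4"
     hence "continuous_on S (%t. cis (nu t i))" using \<epsilon>(3) unfolding S_def by (intro continuous_intros) auto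
     thus "((%t. cis (nu t i)) \<longlongrightarrow> cis (nu t i)) (at t within S)" using t by (simp add: continuous_on_def)
    qed
    moreover have "\<forall>\<^sub>F s in at t within S. tdat (nu s) i j = Z s i j"
    proof -
     have "((%s. s) \<longlongrightarrow> t) (at t within S)" by (rule tendsto_ident_at)
     from tendsto_imp_eventually_ne[OF this False] have "\<forall>\<^sub>F s in at t within S. s ~= 0" .
     thus ?thesis by eventually_elim (simp add: Z_def)
    qed
    ultimately have "((%t. Z t i j) \<longlongrightarrow> tdat (nu t) i j) (at t within S)" by (rule Lim_transform_eventually)
    thus ?thesis using False by (simp add: Z_def)
   qed
  qed
 qed
 have "openin (top_of_set S) {t \<in> topspace (top_of_set S). f t \<in> V}" by (rule openin_continuous_map_preimage[OF c V(1)])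
 then obtain T where T: "open T" "{t \<in> S. f t \<in> V} = S \<inter> T" by (auto simp: openin_open)
 have "0 \<in> {t \<in> S. f t \<in> V}" using V(2) \<epsilon>(1) by (simp add: S_def f_def)
 hence "0 \<in> T" unfolding T(2) by simp
 from openE[OF T(1) this] obtain d where d: "d > 0" "ball 0 d \<subseteq> T" .
 define t0 where "t0 = min d \<epsilon> / 2"
 have t0: "0 < t0" "t0 < d" "t0 < \<epsilon>" using d \<epsilon> by (auto simp: t0_def)
 have m: "t0 * s \<in> S \<inter> T" if "s \<in> {0..1}" for s
 proof -
  have ts: "0 <= t0 * s" "t0 * s <= t0" using that t0 by (auto simp: mult_le_cancel_left2)
  have ts': "t0 * s < \<epsilon>" using ts(2) t0(3) by linarith
  note ts
  moreover from this have "t0 * s < d" using t0(2) by linarith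
  ultimately have "t0 * s \<in> ball 0 d" by (simp only: mem_ball dist_real_def diff_0 abs_minus_cancel abs_of_nonneg)
  hence "t0 * s \<in> T" using d(2) by blast
  thus ?thesis using ts(1) ts' unfolding S_def by (simp only: Int_iff atLeastLessThan_iff)
 qed
 show ?thesis
 proof (rule that[of "%s. f (t0 * s)" "nu t0"])
  have "continuous_map (top_of_set {0..1}) (top_of_set S) (%s. t0 * s)"
   using m by (auto simp: continuous_map_in_subtopology intro!: continuous_intros)
  from continuous_map_compose[OF this c] show "CD_cont {0..1} (%s. f (t0 * s))" by (simp add: o_def)
  show "f (t0 * t) \<in> V" if "t \<in> {0..1}" for t using m[OF that] T(2) by blast
  show "config 2 (nu t0)" using \<epsilon>(2) t0 by blast
 qed (use t0 in \<open>simp_all add: f_def\<close>)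
qed

lemma (in normalized) agree:
 assumes P: "PP pi 0" and F: "F \<in> U th" "F \<in> U \<phi>" shows "e th F = e \<phi> F"
proof -
 have "openin (CD_top 2) (U th \<inter> U \<phi>)" by (intro openin_Int openin_U)
 then obtain \<gamma> \<tau> where g: "CD_cont {0..1::real} \<gamma>" "\<gamma> 0 = F" "!!t. t \<in> {0..1} ==> \<gamma> t \<in> U th \<inter> U \<phi>" "config 2 \<tau>" "\<gamma> 1 = A \<tau>"
  by (rule germ_path) (use F in auto)
 have n: "nrm (tup (\<tau> 0) (\<tau> 1) (\<tau> 2) (\<tau> 3)) > 0" using config_nrm_pos[OF g(4)] by (simp add: nrm_def nform_tup)
 have "A \<tau> \<in> U th" "A \<tau> \<in> U \<phi>" using g(3)[of 1] g(5) by auto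
 hence "G th (\<tau> 0) (\<tau> 1) (\<tau> 2) (\<tau> 3)" "G \<phi> (\<tau> 0) (\<tau> 1) (\<tau> 2) (\<tau> 3)" unfolding A_tup by (auto intro: U_G[OF n])
 hence "e th (A \<tau>) = e \<phi> (A \<tau>)" unfolding A_tup by (intro generic[OF P] config_cis[OF g(4)]) auto
 thus ?thesis using path[OF g(1) g(3)] g(2,5) by simp
qed

subsection \<open>The first cohomology group\<close>

lemma ct_cis_base: assumes "cis th = cis \<phi>" shows "ct th = ct \<phi>"
proof
 fix x
 obtain m :: int where m: "th - \<phi> = 2 * pi * m" using assms cis_eq_iff by blast
 have "cis (x - m * (2 * pi)) = cis x" unfolding cis_eq_iff by (intro exI[of _ "-m"]) simp
 moreover have "ct th x = ct \<phi> (x - m * (2 * pi))" unfolding ct_def using m by (simp add: algebra_simps)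
 ultimately show "ct th x = ct \<phi> x" using ct_cis by metis
qed

lemma H_cis: assumes "cis th = cis \<phi>" shows "H th = H \<phi>"
proof -
 have "gl th = gl \<phi>" using assms by (intro ext) (simp add: gl_def dl_def)
 hence "Gl th = Gl \<phi>" using assms by (intro ext) (simp add: Gl_def)
 hence "Y th = Y \<phi>" using assms \<open>gl th = gl \<phi>\<close> by (intro ext) (simp add: Y_def)
 thus ?thesis by (intro ext) (simp add: H_def)
qed

lemma sgU_Q: assumes "Q th \<phi> x y z w" shows "sgU th (AA x z y w) = sgU \<phi> (AA x z y w)"
proof -
 note o = Q_ord[OF assms]
 have G2: "G \<phi> x z y w" using ordG_G(1)[OF o(2)] by (simp add: G_swap)
 obtain s :: real where s: "s \<in> {1, -1}" "!!th. G th x z y w ==> sgU th (AA x z y w) \<longleftrightarrow> s * gv th x z y w > 0"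
  using sgU_AA[OF G_nrm_pos[OF G2]] by blast
 have "gv \<phi> z (x + 2 * pi) w (y + 2 * pi) = gv \<phi> x z y w" unfolding gv_def ct_shift by (simp add: algebra_simps)
 thus ?thesis using s(2)[OF ordG_G(1)[OF o(1)]] s(2)[OF G2] ordG_G(2)[OF o(1)] ordG_G(2)[OF o(2)] s(1) by auto
qed

text \<open>Seen from the other gap the two chords appear in exchanged order, which reverses the
  sign of \<open>gv\<close>. So the double cover realizes the invariant that \<open>PP\<close>
  leaves open.\<close>

lemma sgU_unlinked:
 assumes "\<delta> < x" "x < y" "y < \<beta>" "\<beta> < z" "z < w" "w < \<delta> + 2 * pi" shows "sgU \<beta> (AA x y z w) ~= sgU \<delta> (AA x y z w)"
proof -
 have o: "ordG \<delta> x y z w" "ordG \<beta> z w (x + 2 * pi) (y + 2 * pi)" using assms by (auto simp: ordG_def)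
 have G2: "G \<beta> x y z w" using ordG_G(1)[OF o(2)] by (simp add: G_swap(3))
 obtain s :: real where s: "s \<in> {1, -1}" "!!th. G th x y z w ==> sgU th (AA x y z w) \<longleftrightarrow> s * gv th x y z w > 0"
  using sgU_AA[OF G_nrm_pos[OF G2]] by blast
 have "gv \<beta> z w (x + 2 * pi) (y + 2 * pi) = - gv \<beta> x y z w" unfolding gv_def ct_shift by (simp add: algebra_simps)
 thus ?thesis using s(2)[OF ordG_G(1)[OF o(1)]] s(2)[OF G2] ordG_G(2)[OF o(1)] ordG_G(2)[OF o(2)] s(1) by auto
qed

text \<open>After adjustment by constants the potentials agree except possibly in the comparison
  \<open>PP\<close>. If this fails, adding the sign \<open>sgU\<close>, which fails it too and
  passes all others, repairs it; \<open>J\<close> records whether the sign is added.\<close>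

theorem cocycle_classification:
 assumes W: "is_cocycle 1 (CD_top 2) W"
 shows "\<exists>(e :: real => alg => bool) J.
  (\<forall>th \<gamma>. CD_cont {0..1::real} \<gamma> --> (\<forall>t\<in>{0..1}. \<gamma> t \<in> U th) --> W (seg \<gamma> 0 1) = (e th (\<gamma> 0) ~= e th (\<gamma> 1))) \<and>
  (\<forall>th \<phi> F. F \<in> U th --> F \<in> U \<phi> --> (e th F ~= (J & sgU th F)) = (e \<phi> F ~= (J & sgU \<phi> F)))"
proof -
 interpret coherent "prim W"
 proof
  show "prim W th F = prim W \<phi> F" if "cis th = cis \<phi>" for th \<phi> F unfolding prim_def H_cis[OF that] ..
  show "(prim W th (\<gamma> 0) = prim W \<phi> (\<gamma> 0)) = (prim W th (\<gamma> 1) = prim W \<phi> (\<gamma> 1))"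
   if "CD_cont {0..1::real} \<gamma>" "!!t. t \<in> {0..1} ==> \<gamma> t \<in> U th \<inter> U \<phi>" for \<gamma> th \<phi>
   using cocycle_in_U[OF W that(1), of th] cocycle_in_U[OF W that(1), of \<phi>] that(2) by auto
 qed
 define e1 where "e1 th F = (prim W th F ~= eps th)" for th F
 interpret n1: normalized e1 unfolding e1_def by (rule normalized_eps)
 \<comment> \<open>By \<open>PP_one\<close> a single pair of chords separated by 0 and
   \<open>pi\<close> decides; here 0 < 1 < 2 < pi < 4 < 5 < 2 pi.\<close>
 define J where "J = (e1 pi (AA 1 2 4 5) ~= e1 0 (AA 1 2 4 5))"
 define e2 where "e2 th F = (e1 th F ~= (J & sgU th F))" for th F
 interpret n2: normalized e2
 proof
  show "e2 th F = e2 \<phi> F" if "cis th = cis \<phi>" for th \<phi> F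
   using n1.per[OF that] by (simp add: e2_def sgU_def cform_def ct_cis_base[OF that])
  show "(e2 th (\<gamma> 0) = e2 \<phi> (\<gamma> 0)) = (e2 th (\<gamma> 1) = e2 \<phi> (\<gamma> 1))"
   if "CD_cont {0..1::real} \<gamma>" "!!t. t \<in> {0..1} ==> \<gamma> t \<in> U th \<inter> U \<phi>" for \<gamma> th \<phi>
  proof -
   have "(e1 th (\<gamma> 0) = e1 \<phi> (\<gamma> 0)) = (e1 th (\<gamma> 1) = e1 \<phi> (\<gamma> 1))" by (rule n1.path[OF that(1)]) (rule that(2))
   moreover have "(sgU th (\<gamma> 0) ~= sgU \<phi> (\<gamma> 0)) = (sgU th (\<gamma> 1) ~= sgU \<phi> (\<gamma> 1))" by (rule sgU_path[OF that(1)]) (rule that(2))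
   ultimately show ?thesis unfolding e2_def by argo
  qed
  show "e2 th (AA x z y w) = e2 \<phi> (AA x z y w)" if "Q th \<phi> x y z w" for th \<phi> x y z w
   using n1.Q0[OF that] sgU_Q[OF that] by (simp add: e2_def)
 qed
 have "n2.PP pi 0"
 proof (rule n2.PP_one[of 0 1 2 pi 4 5])
  have o: "(0::real) < 1" "(1::real) < 2" "2 < pi" "pi < 4" "(4::real) < 5" "5 < 0 + 2 * pi" using pi_gt3 pi_less_4 by auto
  from sgU_unlinked[OF this] show "e2 pi (AA 1 2 4 5) = e2 0 (AA 1 2 4 5)" unfolding e2_def J_def by argo
 qed (use pi_gt3 pi_less_4 in auto)
 from n2.agree[OF this] have 2: "(e1 th F ~= (J & sgU th F)) = (e1 \<phi> F ~= (J & sgU \<phi> F))" if "F \<in> U th" "F \<in> U \<phi>" for th \<phi> F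
  using that unfolding e2_def by blast
 have 1: "W (seg \<gamma> 0 1) \<longleftrightarrow> e1 th (\<gamma> 0) ~= e1 th (\<gamma> 1)"
  if "CD_cont {0..1::real} \<gamma>" "!!t. t \<in> {0..1} ==> \<gamma> t \<in> U th" for \<gamma> th
 proof -
  have "W (seg \<gamma> 0 1) \<longleftrightarrow> prim W th (\<gamma> 0) ~= prim W th (\<gamma> 1)" by (rule cocycle_in_U[OF W that(1)]) (rule that(2))
  thus ?thesis unfolding e1_def by argo
 qed
 show ?thesis
 proof (intro exI[of _ e1] exI[of _ J] conjI allI impI)
  show "W (seg \<gamma> 0 1) = (e1 th (\<gamma> 0) ~= e1 th (\<gamma> 1))"
   if "CD_cont {0..1::real} \<gamma>" "\<forall>t\<in>{0..1}. \<gamma> t \<in> U th" for \<gamma> th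
   by (rule 1[OF that(1)]) (use that(2) in blast)
  show "(e1 th F ~= (J & sgU th F)) = (e1 \<phi> F ~= (J & sgU \<phi> F))" if "F \<in> U th" "F \<in> U \<phi>" for th \<phi> F by (rule 2[OF that])
 qed
qed

text \<open>The difference between \<open>W\<close> and the coboundary of \<open>\<beta>\<close>
  vanishes on small simplices, so by subdivision it is itself a coboundary.\<close>

lemma local_coboundary:
 fixes \<beta> :: "'a => bool"
 assumes W: "is_cocycle 1 X W" and op: "!!V. V \<in> \<U> ==> openin X V" "topspace X \<subseteq> \<Union>\<U>"
  and s: "!!\<sigma> V. singular_simplex 1 X \<sigma> ==> V \<in> \<U> ==> \<sigma> \<in> standard_simplex 1 \<rightarrow> V ==> W \<sigma> = (\<beta> (vertex \<sigma> 0) ~= \<beta> (vertex \<sigma> 1))"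
 shows "\<exists>\<beta>' :: 'a => bool. \<forall>\<sigma>. singular_simplex 1 X \<sigma> --> W \<sigma> = (\<beta>' (vertex \<sigma> 0) ~= \<beta>' (vertex \<sigma> 1))"
proof -
 define C where "C \<sigma> = (W \<sigma> ~= (\<beta> (vertex \<sigma> 0) ~= \<beta> (vertex \<sigma> 1)))" for \<sigma>
 have "is_cocycle (Suc 0) X C"
  unfolding is_cocycle_def
 proof (intro allI impI)
  fix \<sigma> assume \<sigma>: "singular_simplex (Suc (Suc 0)) X \<sigma>"
  hence "\<not> cobdry 1 W \<sigma>" using W unfolding is_cocycle_def One_nat_def by blast
  hence "\<not> cobdry 1 C \<sigma>" unfolding cobdry_1 C_def vertex_edge by argo
  thus "\<not> cobdry (Suc 0) C \<sigma>" by (simp add: One_nat_def)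
 qed
 hence "is_coboundary 0 X C" by (rule small_cocycle_coboundary[OF _ op]) (use s in \<open>auto simp: C_def One_nat_def\<close>)
 then obtain b :: "'a => bool" where b: "!!\<sigma>. singular_simplex 1 X \<sigma> ==> C \<sigma> = (b (vertex \<sigma> 0) ~= b (vertex \<sigma> 1))"
  unfolding is_coboundary_0_iff by blast
 show ?thesis
 proof (intro exI[of _ "%x. b x ~= \<beta> x"] allI impI)
  fix \<sigma> assume "singular_simplex 1 X \<sigma>"
  from b[OF this] show "W \<sigma> = ((b (vertex \<sigma> 0) ~= \<beta> (vertex \<sigma> 0)) ~= (b (vertex \<sigma> 1) ~= \<beta> (vertex \<sigma> 1)))" unfolding C_def by argo
 qed
qed

section \<open>Base points, and three sections of the double cover without common zero\<close>

definition base :: "alg => real" where "base F = (SOME th. F \<in> U th)"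

lemma base: assumes "F \<in> CDbar 2" shows "F \<in> U (base F)"
proof -
 obtain th where "inU th (germ_of F)" by (rule U_cover[OF tgerm_germ_of[OF assms]])
 hence "\<exists>th. F \<in> U th" using assms by (auto simp: U_def)
 thus ?thesis unfolding base_def by (rule someI_ex)
qed

lemma simplex_in_U:
 assumes W: "!!th \<gamma>. CD_cont {0..1::real} \<gamma> ==> (!!t. t \<in> {0..1} ==> \<gamma> t \<in> U th) ==> W (seg \<gamma> 0 1) \<longleftrightarrow> e th (\<gamma> 0) ~= e th (\<gamma> 1)"
  and \<sigma>: "singular_simplex 1 (CD_top 2) \<sigma>" "\<sigma> \<in> standard_simplex 1 \<rightarrow> U th"
 shows "W \<sigma> = (e th (vertex \<sigma> 0) ~= e th (vertex \<sigma> 1))"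
proof -
 note p = simplex_path[OF \<sigma>(1)]
 have pU: "path_of \<sigma> t \<in> U th" if "t \<in> {0..1}" for t using p(5)[OF that] \<sigma>(2) by auto
 have "W (seg (path_of \<sigma>) 0 1) = (e th (path_of \<sigma> 0) ~= e th (path_of \<sigma> 1))" by (rule W[OF p(1)]) (rule pU)
 thus ?thesis unfolding p(2)[symmetric] p(3,4) .
qed

text \<open>Values of the form on 1/z with z and on 1/z with z^2. The first is purely imaginary, so
  one real section captures it; the second contributes its real and its imaginary part.\<close>

definition sec :: "nat => germ => real" where
 "sec i nu = (if i = 0 then Re (- \<i> * zlim nu (%x. inverse (cis x)) (E 1))
  else if i = 1 then Re (1 * zlim nu (%x. inverse (cis x)) (E 2)) else Re (- \<i> * zlim nu (%x. inverse (cis x)) (E 2)))"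

lemma evensec_sec: "evensec (sec i) (CDbar 2)"
proof -
 obtain B1 B2 where "good UNIV B1 (E 1)" "good UNIV B2 (E 2)" using good_E by metis
 note e = evensec_zlim[OF good_inverse_cis this(1)] evensec_zlim[OF good_inverse_cis this(2)]
 consider "i = 0" | "i ~= 0" "i = 1" | "i ~= 0" "i ~= 1" by blast
 thus ?thesis
 proof cases
  case 1 show ?thesis unfolding sec_def[abs_def] if_P[OF 1] by (rule e(1))
 next
  case 2 show ?thesis unfolding sec_def[abs_def] if_not_P[OF 2(1)] if_P[OF 2(2)] by (rule e(2))
 next
  case 3 show ?thesis unfolding sec_def[abs_def] if_not_P[OF 3(1)] if_not_P[OF 3(2)] by (rule e(2))
 qed
qed

definition Osec :: "nat => alg set" where "Osec i = {F \<in> CDbar 2. sec i (germ_of F) ~= 0}"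

text \<open>Up to the chord lengths, the two values are the differences of the products P and of the
  quantities S P. As P has modulus 1, the difference of the sums S is recovered, so
  \<open>nrm\<close> is at most a multiple of the two values and they cannot both vanish in the
  limit. The constant 62208 is 3 * 20736.\<close>

lemma sec_cover: assumes "F \<in> CDbar 2" shows "F \<in> Osec 0 \<union> Osec 1 \<union> Osec 2"
proof (rule ccontr)
 assume n: "\<not> ?thesis"
 define nu where "nu = germ_of F"
 let ?I = "%x. inverse (cis x)"
 note t = tgerm_germ_of[OF assms, folded nu_def]
 obtain B1 B2 where B: "good UNIV B1 (E 1)" "good UNIV B2 (E 2)" using good_E by metis
 have z: "((%t. zform (nu t) ?I (E 1)) ~~> zlim nu ?I (E 1))" "((%t. zform (nu t) ?I (E 2)) ~~> zlim nu ?I (E 2))"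
  by (rule tendsto_zlim_UNIV[OF t good_inverse_cis B(1)], rule tendsto_zlim_UNIV[OF t good_inverse_cis B(2)])
 have inv: "inverse (cis x) = cnj (cis x)" for x by (simp add: complex_eq_iff cis_inverse)
 have "Re (zform xs ?I (E 1)) = 0" for xs
 proof -
  have "Re (nform xs ?I (E 1)) = 0" unfolding nform_def E_def inv by (simp add: algebra_simps)
  thus ?thesis by (simp add: zform_def Re_divide_of_real)
 qed
 with tendsto_Re[OF z(1)] have "((%t::real. 0::real) ~~> Re (zlim nu ?I (E 1)))" by simp
 hence r: "Re (zlim nu ?I (E 1)) = 0" using tendsto_unique[OF _ tendsto_const] by (metis trivial_limit_at_right_real)
 have "sec 0 nu = 0" "sec 1 nu = 0" "sec 2 nu = 0" using n assms by (auto simp: Osec_def nu_def)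
 hence zero: "zlim nu ?I (E 1) = 0" "zlim nu ?I (E 2) = 0" using r by (auto simp: sec_def complex_eq_iff)
 have low: "nrm xs <= 62208 * (cmod (nform xs ?I (E 1)) + cmod (nform xs ?I (E 2)))" for xs
 proof -
  define a b c d where "a = cis (xs 0)" "b = cis (xs 1)" "c = cis (xs 2)" "d = cis (xs 3)"
  have u: "cmod a = 1" "cmod b = 1" "cmod c = 1" "cmod d = 1" by (simp_all add: a_b_c_d_def)
  hence nz: "a ~= 0" "b ~= 0" "c ~= 0" "d ~= 0" by auto
  have N1: "nform xs ?I (E 1) = (a - b) * (c - d) * ((a * b - c * d) * inverse (a * b * c * d))"
   unfolding nform_def E_def a_b_c_d_def[symmetric] using nz by (simp add: field_simps)
  have N2: "nform xs ?I (E 2) = (a - b) * (c - d) * (((a + b) * (a * b) - (c + d) * (c * d)) * inverse (a * b * c * d))"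
   unfolding nform_def E_def a_b_c_d_def[symmetric] using nz by (simp add: field_simps power2_eq_square)
  define k where "k = cmod ((a - b) * (c - d))"
  have n1: "cmod (nform xs ?I (E 1)) = k * cmod (a * b - c * d)" "cmod (nform xs ?I (E 2)) = k * cmod ((a + b) * (a * b) - (c + d) * (c * d))"
   unfolding N1 N2 by (simp_all add: norm_mult norm_inverse u k_def)
  define X Z where "X = (a + b) * (a * b) - (c + d) * (c * d)" "Z = (c + d) * (a * b - c * d)"
  have "(a * b) * (a + b - (c + d)) = X - Z" by (simp add: X_Z_def algebra_simps)
  hence "cmod (a + b - (c + d)) = cmod (X - Z)" using u by (metis mult_1 norm_mult)
  moreover have "cmod (X - Z) <= cmod X + cmod Z" by (rule norm_triangle_ineq4)
  moreover have "cmod Z <= 2 * cmod (a * b - c * d)"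
   unfolding X_Z_def norm_mult using norm_triangle_ineq[of c d] u by (intro mult_right_mono) auto
  moreover have "p + \<delta> <= 3 * (\<delta> + x)" if "p = q" "q <= x + z" "z <= 2 * \<delta>" "0 <= x" for p q x z \<delta> :: real
   using that by (simp add: distrib_left)
  ultimately have le: "cmod (a + b - (c + d)) + cmod (a * b - c * d) <= 3 * (cmod (a * b - c * d) + cmod ((a + b) * (a * b) - (c + d) * (c * d)))"
   using norm_ge_zero[of X] unfolding X_Z_def(1)[symmetric] by blast
  have "mdist xs = k * (cmod (a + b - (c + d)) + cmod (a * b - c * d))"
   by (simp add: mdist_def chord_sum_def chord_prod_def a_b_c_d_def k_def norm_mult)
  also have "... <= k * (3 * (cmod (a * b - c * d) + cmod ((a + b) * (a * b) - (c + d) * (c * d))))"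
   by (rule mult_left_mono[OF le]) (simp add: k_def)
  also have "... = 3 * (cmod (nform xs ?I (E 1)) + cmod (nform xs ?I (E 2)))" unfolding n1 by (simp add: algebra_simps)
  finally show ?thesis using nrm_le_mdist[of xs] by linarith
 qed
 have "EV t. 1 <= 62208 * (cmod (zform (nu t) ?I (E 1)) + cmod (zform (nu t) ?I (E 2)))"
 proof -
  have "EV t. nrm (nu t) > 0" using t by (simp add: tgerm_def)
  thus ?thesis
  proof eventually_elim
   fix s assume "nrm (nu s) > 0"
   thus "1 <= 62208 * (cmod (zform (nu s) ?I (E 1)) + cmod (zform (nu s) ?I (E 2)))"
    using low[of "nu s"] by (simp add: zform_def norm_divide flip: add_divide_distrib)
  qed
 qed
 moreover have "((%t. 62208 * (cmod (zform (nu t) ?I (E 1)) + cmod (zform (nu t) ?I (E 2)))) ~~> 62208 * (cmod (zlim nu ?I (E 1)) + cmod (zlim nu ?I (E 2))))"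
  by (intro tendsto_intros z)
 ultimately have "1 <= 62208 * (cmod (zlim nu ?I (E 1)) + cmod (zlim nu ?I (E 2)))"
  using tendsto_lowerbound trivial_limit_at_right_real by blast
 thus False using zero by simp
qed

subsection \<open>The loop exchanging the two chords and the Klein bottle\<close>

lemma continuous_on_ct:
 fixes f :: "real => real"
 assumes "continuous_on S f" "!!y. y \<in> S ==> cis (f y) ~= cis th" shows "continuous_on S (%y. ct th (f y))"
proof -
 have "sin ((f y - th) / 2) ~= 0" if "y \<in> S" for y
 proof
  assume "sin ((f y - th) / 2) = 0"
  then obtain m :: int where "(f y - th) / 2 = of_int m * pi" using sin_zero_iff_int2 by blast
  hence "cis (f y) = cis th" unfolding cis_eq_iff by (intro exI[of _ m]) (simp add: field_simps)
  thus False using assms(2)[OF that] by simp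
 qed
 moreover have "continuous_on S (%y. (f y - th) / 2)" by (intro continuous_intros assms(1)) auto
 note continuous_on_cos[OF this] continuous_on_sin[OF this]
 ultimately show ?thesis unfolding ct_def cot_def by (intro continuous_on_divide) auto
qed

text \<open>Along the loop the value \<open>gv\<close> is a continuous representative of the sign of
  the form. It is reversed when the chords are exchanged, while the algebra returns; the potential
  corrected by this sign is defined along the whole loop and takes different values at its
  ends.\<close>

lemma exchange_loop:
 fixes a b c d :: "real => real"
 assumes W: "is_cocycle 1 (CD_top 2) W"
  and e: "!!th \<gamma>. CD_cont {0..1::real} \<gamma> ==> (!!t. t \<in> {0..1} ==> \<gamma> t \<in> U th) ==> W (seg \<gamma> 0 1) \<longleftrightarrow> e th (\<gamma> 0) ~= e th (\<gamma> 1)"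
   "!!th \<phi> F. F \<in> U th ==> F \<in> U \<phi> ==> (e th F ~= sgU th F) = (e \<phi> F ~= sgU \<phi> F)"
  and cont: "continuous_on {0..1} a" "continuous_on {0..1} b" "continuous_on {0..1} c" "continuous_on {0..1} d"
  and n: "!!t. t \<in> {0..1} ==> nrm (tup (a t) (b t) (c t) (d t)) > 0"
  and ends: "a 1 = c 0" "b 1 = d 0" "c 1 = a 0" "d 1 = b 0"
 shows "W (seg (%t. AA (a t) (b t) (c t) (d t)) 0 1)"
proof -
 define q where "q t = AA (a t) (b t) (c t) (d t)" for t
 have qc: "CD_cont {0..1} q" unfolding q_def AA_def
 proof (rule continuous_map_A)
  show "continuous_on {0..1} (%t. tup (a t) (b t) (c t) (d t) i)" if "i < 4" for i
   using that cont unfolding less_4_cases by (elim disjE) simp_all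
 qed (rule n)
 have qC: "q t \<in> CDbar 2" if "t \<in> {0..1}" for t using A_props(1)[OF n[OF that]] by (simp add: q_def AA_def)
 define g where "g th t = gv th (a t) (b t) (c t) (d t)" for th t
 have qG: "G th (a t) (b t) (c t) (d t)" if "t \<in> {0..1}" "q t \<in> U th" for th t using U_G[OF n[OF that(1)]] that(2) by (simp add: q_def)
 \<comment> \<open>By \<open>Beq\<close> the choice of \<open>th\<close> does not matter: passing
   from one \<open>U th\<close> to another changes the potential and the sign by the same
   amount.\<close>
 define B where "B t = (e (base (q t)) (q t) ~= (g (base (q t)) t > 0))" for t
 have Beq: "B t = (e th (q t) ~= (g th t > 0))" if t: "t \<in> {0..1}" "q t \<in> U th" for t th
 proof -
  let ?b = "base (q t)"
  have b: "q t \<in> U ?b" by (rule base[OF qC[OF t(1)]])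
  obtain s :: real where s: "s \<in> {1, -1}" "!!th. G th (a t) (b t) (c t) (d t) ==> sgU th (q t) \<longleftrightarrow> s * g th t > 0"
   using sgU_AA[OF n[OF t(1)]] unfolding q_def g_def by blast
  have nz: "g \<psi> t ~= 0" if "G \<psi> (a t) (b t) (c t) (d t)" for \<psi> using that by (auto simp: G_def g_def gv_def)
  note g1 = qG[OF t(1) b] and g2 = qG[OF t]
  show ?thesis unfolding B_def
   using e(2)[OF b t(2)] s(1) s(2)[OF g1] s(2)[OF g2] nz[OF g1] nz[OF g2] by (auto simp: less_le)
 qed
 \<comment> \<open>The identity is known on short intervals, whose image lies in one
   \<open>U th\<close>, and it is additive; the Bolzano principle extends it to the whole
   loop.\<close>
 have "0 <= x & y <= 1 & x <= y --> W (seg q x y) = (B x ~= B y)" if "x <= y" for x y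
  using that
 proof (induction rule: Bolzano)
  case (trans x y z)
  show ?case
  proof (intro impI)
   assume xz: "0 <= x & z <= 1 & x <= z"
   have "W (seg q x z) \<longleftrightarrow> W (seg q x y) ~= W (seg q y z)"
    by (rule seg_triangle[OF W qc]) (use xz trans in auto)
   thus "W (seg q x z) = (B x ~= B z)" using trans xz by auto
  qed
 next
  case (local x0)
  show ?case
  proof (cases "x0 \<in> {0..1}")
   case False
   show ?thesis
   proof (intro exI[of _ 1] conjI allI impI)
    fix x y assume 1: "x <= x0 & x0 <= y & y - x < 1" and 2: "0 <= x & y <= 1 & x <= y"
    have False using 1 2 False by auto
    thus "W (seg q x y) = (B x ~= B y)" ..
   qed simp
  next
   case True
   define th where "th = base (q x0)"
   have "openin (top_of_set {0..1}) {t \<in> topspace (top_of_set {0..1}). q t \<in> U th}" by (rule openin_continuous_map_preimage[OF qc openin_U])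
   then obtain T where T: "open T" "{t \<in> {0..1}. q t \<in> U th} = {0..1} \<inter> T" by (auto simp: openin_open)
   have "x0 \<in> T" using base[OF qC[OF True]] T(2) True unfolding th_def by blast
   from openE[OF T(1) this] obtain r where r: "r > 0" "ball x0 r \<subseteq> T" .
   show ?thesis
   proof (intro exI[of _ r] conjI allI impI r(1))
    fix x y assume 1: "x <= x0 & x0 <= y & y - x < r" and 2: "0 <= x & y <= 1 & x <= y"
    have U: "t \<in> {0..1} & q t \<in> U th" if "x <= t" "t <= y" for t
    proof -
     have "t \<in> ball x0 r" using 1 that by (auto simp: dist_real_def)
     hence "t \<in> {0..1}" "t \<in> T" using 1 2 that r(2) by auto
     thus ?thesis using T(2) by blast
    qed
    have ipU: "x <= ip t x y & ip t x y <= y" if "t \<in> {0..1}" for t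
     using ip_le[OF that, of x x x y] ip_le[OF that, of x y y y] 2 by simp
    have "continuous_map (top_of_set {0..1}) (top_of_set {0..1}) (%t. ip t x y)"
     using ipU U by (auto simp: continuous_map_in_subtopology ip_def intro!: continuous_intros)
    from continuous_map_compose[OF this qc] have "CD_cont {0..1} (%t. q (ip t x y))" by (simp add: o_def)
    from e(1)[OF this, of th] U ipU have "W (seg (%t. q (ip t x y)) 0 1) \<longleftrightarrow> e th (q x) ~= e th (q y)" by simp
    moreover have "seg (%t. q (ip t x y)) 0 1 = seg q x y" by (rule seg_cong) (simp add: ip_def)
    moreover have "(g th x > 0) = (g th y > 0)"
    proof -
     have sub: "{x..y} \<subseteq> {0..1}" using 2 by auto
     have ne: "cis (a t) ~= cis th" "cis (b t) ~= cis th" "cis (c t) ~= cis th" "cis (d t) ~= cis th" "g th t ~= 0" if "t \<in> {x..y}" for t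
      using qG[of t th] U[of t] that by (auto simp: G_def g_def gv_def)
     have "continuous_on {x..y} (g th)" unfolding g_def gv_def
      by (intro continuous_intros continuous_on_ct cont[THEN continuous_on_subset[OF _ sub]] ne)
     thus ?thesis
      using continuous_sign_const[of x y "g th"] ne(5) 2 by blast
    qed
    moreover have "B x = (e th (q x) ~= (g th x > 0))" "B y = (e th (q y) ~= (g th y > 0))" using Beq U 2 by auto
    ultimately show "W (seg q x y) = (B x ~= B y)" by auto
   qed
  qed
 qed
 from this[of 0 1] have "W (seg q 0 1) = (B 0 ~= B 1)" by simp
 moreover have "q 1 = q 0" unfolding q_def ends by (rule AA_swap(3))
 moreover have "g th 1 = - g th 0" for th unfolding g_def ends by (simp add: gv_def algebra_simps)
 moreover have "g (base (q 0)) 0 ~= 0"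
  using qG[OF _ base[OF qC], of 0] by (auto simp: G_def g_def gv_def)
 ultimately show ?thesis unfolding q_def[symmetric, abs_def] B_def by auto
qed

text \<open>Two chords close to a diameter in direction \<open>th\<close>, displaced by
  \<open>u\<close> and \<open>v\<close> at its ends. As the second coordinate grows, the pair of
  displacements runs over half a circle and changes sign, which exchanges the chords. Turning the
  diameter by \<open>pi\<close> interchanges \<open>u\<close> and \<open>v\<close>; the offset of
  the half circle by 45 degrees makes this the reflection of \<open>y\<close> to
  \<open>1 - y\<close>. Division by 4 keeps the points near the two ends apart.\<close>

definition kl :: "real \<times> real => alg" where
 "kl p = (let th = pi * fst p; u = (cos (pi * snd p) + sin (pi * snd p)) / 4; v = (cos (pi * snd p) - sin (pi * snd p)) / 4
  in AA (th + u) (th + pi + v) (th - u) (th + pi - v))"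

lemma klein_nrm:
 assumes "\<phi> = pi * y" "u = (cos \<phi> + sin \<phi>) / 4" "v = (cos \<phi> - sin \<phi>) / 4"
 shows "nrm (tup (th + u) (th + pi + v) (th - u) (th + pi - v)) > 0"
proof -
 have "\<bar>cos \<phi> + sin \<phi>\<bar> <= 2" "\<bar>cos \<phi> - sin \<phi>\<bar> <= 2"
  using abs_cos_le_one[of \<phi>] abs_sin_le_one[of \<phi>] abs_triangle_ineq[of "cos \<phi>" "sin \<phi>"] abs_triangle_ineq4[of "cos \<phi>" "sin \<phi>"]
  by (linarith, linarith)
 hence b: "\<bar>u\<bar> <= 1 / 2" "\<bar>v\<bar> <= 1 / 2" unfolding assms(2,3) abs_divide abs_numeral by simp_all
 have ne: "u ~= 0 \<or> v ~= 0"
 proof (rule ccontr)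
  assume "\<not> ?thesis"
  hence "cos \<phi> = 0" "sin \<phi> = 0" using assms by auto
  thus False using sin_cos_squared_add[of \<phi>] by simp
 qed
 have 1: "cis (th + u) ~= cis (th + pi + v)" by (rule cis_ne') (use b pi_gt3 in auto)
 have 2: "cis (th - u) ~= cis (th + pi - v)" by (rule cis_ne') (use b pi_gt3 in auto)
 have 3: "cis (th + u) ~= cis (th + pi - v)" by (rule cis_ne') (use b pi_gt3 in auto)
 have 4: "u ~= 0 ==> cis (th + u) ~= cis (th - u)" by (rule cis_ne') (use b pi_gt3 in auto)
 have 5: "v ~= 0 ==> cis (th + pi + v) ~= cis (th + pi - v)" by (rule cis_ne') (use b pi_gt3 in auto)
 show ?thesis unfolding nrm_pos_iff using 1 2 3 4 5 ne by auto
qed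

lemma kl_continuous: "CD_cont S kl"
 unfolding kl_def[abs_def] Let_def AA_def
proof (rule continuous_map_A, rule klein_nrm[OF refl refl refl])
 fix i :: nat assume "i < 4"
 thus "continuous_on S (%p. tup (pi * fst p + (cos (pi * snd p) + sin (pi * snd p)) / 4) (pi * fst p + pi + (cos (pi * snd p) - sin (pi * snd p)) / 4)
  (pi * fst p - (cos (pi * snd p) + sin (pi * snd p)) / 4) (pi * fst p + pi - (cos (pi * snd p) - sin (pi * snd p)) / 4) i)"
  unfolding less_4_cases by (elim disjE) (simp_all, (intro continuous_intros; simp)+)
qed

lemma kl_glue: "kl (x, 1) = kl (x, 0)" "kl (1, y) = kl (0, 1 - y)"
proof -
 show "kl (x, 1) = kl (x, 0)" by (simp add: kl_def Let_def AA_swap(3)[of "pi * x - 1 / 4" "pi * x + pi - 1 / 4"])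
 define u v where "u = (cos (pi * y) + sin (pi * y)) / 4" "v = (cos (pi * y) - sin (pi * y)) / 4"
 have t: "cos (pi * (1 - y)) = - cos (pi * y)" "sin (pi * (1 - y)) = sin (pi * y)"
  by (simp_all add: right_diff_distrib cos_diff sin_diff)
 have "kl (0, 1 - y) = AA (- v) (pi - u) v (pi + u)"
  unfolding kl_def Let_def snd_conv fst_conv t u_v_def by (rule AA_cis; rule arg_cong[of _ _ cis]; simp add: field_simps)
 also have "... = AA v (pi + u) (- v) (pi - u)" by (rule AA_swap(3))
 also have "... = AA (pi + u) v (pi - u) (- v)" using AA_swap(1,2) by metis
 also have "... = AA (pi + u) (v + 2 * pi) (pi - u) (- v + 2 * pi)" by (rule AA_cis) (simp_all only: cis_shift)
 also have "... = kl (1, y)" unfolding kl_def Let_def snd_conv fst_conv u_v_def by (rule AA_cis; rule arg_cong[of _ _ cis]; simp add: field_simps)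
 finally show "kl (1, y) = kl (0, 1 - y)" ..
qed

section \<open>The square evaluated on the Klein bottle, and the vanishing cube\<close>

lemma cup_1_1: "cup 1 1 W W \<sigma> \<longleftrightarrow> W (edge \<sigma> 0 1) & W (edge \<sigma> 1 2)"
 unfolding cup_def front_face_eq_sub_simplex back_face_eq_sub_simplex sub_simplex_1 by (simp add: numeral_2_eq_2 One_nat_def)

theorem theorem2:
  fixes W :: "((nat \<Rightarrow> real) \<Rightarrow> (real \<Rightarrow> real) set) \<Rightarrow> bool"
  assumes "is_cocycle 1 (CD_top 2) W"
    and "\<not> is_coboundary 0 (CD_top 2) W"
  shows "\<not> is_coboundary 1 (CD_top 2) (cup 1 1 W W)
       \<and> is_coboundary 2 (CD_top 2) (cup 2 1 (cup 1 1 W W) W)"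
proof -
 note W = assms(1)
 let ?X = "CD_top 2"
 from cocycle_classification[OF W] obtain e :: "real => alg => bool" and J where
  E1: "\<forall>th \<gamma>. continuous_map (top_of_set {0..1::real}) ?X \<gamma> --> (\<forall>t\<in>{0..1}. \<gamma> t \<in> U th) --> W (seg \<gamma> 0 1) = (e th (\<gamma> 0) ~= e th (\<gamma> 1))"
  and E2: "\<forall>th \<phi> F. F \<in> U th --> F \<in> U \<phi> --> (e th F ~= (J & sgU th F)) = (e \<phi> F ~= (J & sgU \<phi> F))"
  by (elim exE conjE) (rule that)
 have e1: "W (seg \<gamma> 0 1) \<longleftrightarrow> e th (\<gamma> 0) ~= e th (\<gamma> 1)"
  if "continuous_map (top_of_set {0..1::real}) ?X \<gamma>" "!!t. t \<in> {0..1} ==> \<gamma> t \<in> U th" for th \<gamma>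
  by (rule E1[rule_format, OF that(1)]) (rule that(2))
 have e2: "(e th F ~= (J & sgU th F)) = (e \<phi> F ~= (J & sgU \<phi> F))" if "F \<in> U th" "F \<in> U \<phi>" for th \<phi> F
  using E2 that by blast
 have small: "W \<sigma> = (e th (vertex \<sigma> 0) ~= e th (vertex \<sigma> 1))"
  if "singular_simplex 1 ?X \<sigma>" "\<sigma> \<in> standard_simplex 1 \<rightarrow> U th" for \<sigma> th
  by (rule simplex_in_U[where W = W and e = e, OF e1 that])
 have vert: "vertex \<sigma> 0 \<in> V & vertex \<sigma> 1 \<in> V" if "\<sigma> \<in> standard_simplex 1 \<rightarrow> V" for \<sigma> :: "conf => alg" and V
  using that unfolding vertex_def by (auto simp: Pi_iff standard_simplex_def One_nat_def)
 \<comment> \<open>Without the sign the potentials agree on overlaps and form a global primitive of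
   \<open>W\<close> on small simplices.\<close>
 have J: J
 proof (rule ccontr)
  assume nJ: "\<not> J"
  define \<beta> where "\<beta> F = e (base F) F" for F
  have "\<exists>\<beta>' :: alg => bool. \<forall>\<sigma>. singular_simplex 1 ?X \<sigma> --> W \<sigma> = (\<beta>' (vertex \<sigma> 0) ~= \<beta>' (vertex \<sigma> 1))"
  proof (rule local_coboundary[OF W, of "range U" \<beta>])
   show "topspace ?X \<subseteq> \<Union> (range U)" using base by (auto simp: topspace_CD_top)
   fix \<sigma> V assume \<sigma>: "singular_simplex 1 ?X \<sigma>" "V \<in> range U" "\<sigma> \<in> standard_simplex 1 \<rightarrow> V"
   then obtain th where V: "V = U th" by blast
   have "\<beta> F = e th F" if "F \<in> U th" for F unfolding \<beta>_def using e2[OF base that] that nJ by (simp add: U_def)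
   thus "W \<sigma> = (\<beta> (vertex \<sigma> 0) ~= \<beta> (vertex \<sigma> 1))" using small[OF \<sigma>(1)] \<sigma>(3) vert[OF \<sigma>(3)] unfolding V by simp
  qed (use openin_U in auto)
  thus False using assms(2) unfolding is_coboundary_0_iff by blast
 qed
 have e2': "(e th F ~= sgU th F) = (e \<phi> F ~= sgU \<phi> F)" if "F \<in> U th" "F \<in> U \<phi>" for th \<phi> F using e2[OF that] J by simp
 have We: "W (seg kl (0, 0) (0, 1))"
 proof -
  let ?u = "%t. (cos (pi * t) + sin (pi * t)) / 4" and ?v = "%t. (cos (pi * t) - sin (pi * t)) / 4"
  have "W (seg (%t. AA (0 + ?u t) (0 + pi + ?v t) (0 - ?u t) (0 + pi - ?v t)) 0 1)"
   by (rule exchange_loop[where e = e, OF W e1 e2' _ _ _ _ klein_nrm[OF refl refl refl]]) (auto intro!: continuous_intros)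
  moreover have "seg (%t. AA (0 + ?u t) (0 + pi + ?v t) (0 - ?u t) (0 + pi - ?v t)) 0 1 = seg kl (0, 0) (0, 1)"
   by (rule seg_cong) (simp add: kl_def Let_def)
  ultimately show ?thesis by simp
 qed
 have "\<not> is_coboundary 1 ?X (cup 1 1 W W)"
 proof
  assume "is_coboundary 1 ?X (cup 1 1 W W)"
  then obtain b where b: "!!\<sigma>. singular_simplex 2 ?X \<sigma> ==> cup 1 1 W W \<sigma> = cobdry 1 b \<sigma>"
   unfolding is_coboundary_def by (auto simp: numeral_2_eq_2 One_nat_def)
  note c = kl_continuous[of UNIV]
  have b': "(W (seg kl P Q) & W (seg kl Q R)) = ((b (seg kl Q R) ~= b (seg kl P R)) ~= b (seg kl P Q))" for P Q R
   using b[OF singular_simplex_tri[OF c, of P Q R]] unfolding cup_1_1 cobdry_1 edge_tri by simp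
  \<comment> \<open>The square is cut along the diagonal from \<open>(0, 1)\<close> to
    \<open>(1, 0)\<close>. Under the gluing both triangles have the same values of \<open>b\<close>
    on their sides, so \<open>W\<close> agrees on the diagonal and on the horizontal side, whereas
    additivity makes the two differ by the value on the exchange loop.\<close>
  have top: "seg kl (0, 1) (1, 1) = seg kl (0, 0) (1, 0)" by (rule seg_cong) (simp add: kl_glue(1))
  have right: "seg kl (1, 1) (1, 0) = seg kl (0, 0) (0, 1)" by (rule seg_cong) (simp add: kl_glue(2))
  have "W (seg kl (0, 0) (1, 0)) \<longleftrightarrow> W (seg kl (0, 0) (0, 1)) ~= W (seg kl (0, 1) (1, 0))"
   by (rule seg_triangle[OF W c]) auto
  thus False using b'[of "(0, 0)" "(0, 1)" "(1, 0)"] b'[of "(0, 1)" "(1, 1)" "(1, 0)"] We unfolding top right by argo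
 qed
 moreover have "is_coboundary 2 ?X (cup 2 1 (cup 1 1 W W) W)"
 proof -
  have "\<exists>\<beta>' :: alg => bool. \<forall>\<sigma>. singular_simplex 1 (subtopology ?X (Osec i)) \<sigma> --> W \<sigma> = (\<beta>' (vertex \<sigma> 0) ~= \<beta>' (vertex \<sigma> 1))" for i
  proof -
   let ?Y = "subtopology ?X (Osec i)"
   \<comment> \<open>The section has no zero on \<open>Osec i\<close>; comparing its sign with that
     of \<open>cform\<close> removes the jumps of the potentials between different
     \<open>U th\<close>.\<close>
   define \<beta> where "\<beta> F = (e (base F) F ~= (sgU (base F) F ~= (sec i (germ_of F) > 0)))" for F
   have sub: "singular_simplex p ?Y \<sigma> \<longleftrightarrow> singular_simplex p ?X \<sigma> & \<sigma> \<in> standard_simplex p \<rightarrow> Osec i" for p \<sigma>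
    by (auto simp: singular_simplex_top_of_set continuous_map_in_subtopology)
   show ?thesis
   proof (rule local_coboundary[of ?Y W "range (%th. Osec i \<inter> U th)" \<beta>])
    show "is_cocycle 1 ?Y W" using W unfolding is_cocycle_def sub by blast
    show "openin ?Y V" if "V \<in> range (%th. Osec i \<inter> U th)" for V
     using that openin_subtopology_Int2[OF openin_U] by auto
    show "topspace ?Y \<subseteq> \<Union> (range (%th. Osec i \<inter> U th))" using base by (auto simp: topspace_CD_top)
    fix \<sigma> V assume \<sigma>: "singular_simplex 1 ?Y \<sigma>" "V \<in> range (%th. Osec i \<inter> U th)" "\<sigma> \<in> standard_simplex 1 \<rightarrow> V"
    then obtain th where V: "V = Osec i \<inter> U th" by blast
    have \<sigma>X: "singular_simplex 1 ?X \<sigma>" using \<sigma>(1) sub by blast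
    have \<beta>: "\<beta> F = (e th F ~= (sgU th F ~= (sec i (germ_of F) > 0)))" if "F \<in> U th" for F
     unfolding \<beta>_def using e2'[OF base that] that unfolding U_def by blast
    note p = simplex_path[OF \<sigma>X]
    have pV: "path_of \<sigma> t \<in> Osec i \<inter> U th" if "t \<in> {0..1}" for t using p(5)[OF that] \<sigma>(3) V by auto
    have "((Re (cform th (germ_of (path_of \<sigma> 0))) > 0) ~= (sec i (germ_of (path_of \<sigma> 0)) > 0)) \<longleftrightarrow>
     ((Re (cform th (germ_of (path_of \<sigma> 1))) > 0) ~= (sec i (germ_of (path_of \<sigma> 1)) > 0))"
    proof (rule evensec_sign_const[OF evensec_cform _ p(1)])
     show "evensec (sec i) (U th)" by (rule evensec_mono[OF evensec_sec]) (auto simp: U_def)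
    qed (use pV U_cform_nonzero in \<open>auto simp: Osec_def\<close>)
    hence "(sgU th (vertex \<sigma> 0) ~= (sec i (germ_of (vertex \<sigma> 0)) > 0)) \<longleftrightarrow> (sgU th (vertex \<sigma> 1) ~= (sec i (germ_of (vertex \<sigma> 1)) > 0))"
     unfolding p(3,4) sgU_def .
    moreover have "\<sigma> \<in> standard_simplex 1 \<rightarrow> U th" using \<sigma>(3) V by auto
    ultimately show "W \<sigma> = (\<beta> (vertex \<sigma> 0) ~= \<beta> (vertex \<sigma> 1))"
     using small[OF \<sigma>X, of th] vert[of \<sigma> "U th"] \<beta>[of "vertex \<sigma> 0"] \<beta>[of "vertex \<sigma> 1"] by argo
   qed
  qed
  then obtain \<beta> :: "nat => alg => bool" where
   \<beta>: "!!i \<sigma>. singular_simplex 1 (subtopology ?X (Osec i)) \<sigma> ==> W \<sigma> = (\<beta> i (vertex \<sigma> 0) ~= \<beta> i (vertex \<sigma> 1))"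
   by metis
  show ?thesis
  proof (rule cup_cube_coboundary[OF W, of Osec \<beta>])
   show "openin ?X (Osec i)" for i unfolding Osec_def by (rule evensec_open[OF evensec_sec])
   show "topspace ?X \<subseteq> Osec 0 \<union> Osec 1 \<union> Osec 2" using sec_cover by (auto simp: topspace_CD_top)
   show "W \<sigma> \<longleftrightarrow> \<beta> i (vertex \<sigma> 0) ~= \<beta> i (vertex \<sigma> 1)" if "singular_simplex 1 ?X \<sigma>" "\<sigma> \<in> standard_simplex 1 \<rightarrow> Osec i" for i \<sigma>
    by (rule \<beta>) (use that in \<open>auto simp: singular_simplex_top_of_set continuous_map_in_subtopology\<close>)
  qed
 qed
 ultimately show ?thesis by blast
qed

end
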